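(* As an additive group, the Grothendieck ring of $\mathcal T$ is $$K(\mathcal T)=\bigoplus_{x\in\hat{\mathcal A}}\mathcal R(A(x)),$$ the class of the simple object $[x]^0_\chi$ corresponding to $\chi\in\mathcal R(A(x))$. Moreover, for $x_1,x_2\in\hat{\mathcal A}$ the product of $f_1\in\mathcal R(A(x_1))$ and $f_2\in\mathcal R(A(x_2))$ is $$f_1\star f_2=\sum_x f_1\star_x f_2,$$ where $x\in\hat{\mathcal A}$ runs over all subquotients of $x_1\times x_2$ and $f_1\star_xf_2=\langle\chi_{T(x_1,x_2,x)}\mid f_1\otimes f_2\rangle_{A(x_1)\times A(x_2)}\in\mathcal R(A(x))$, i.e. $f_1\star_xf_2$ is the class function on $A(x)$ given by $$(f_1\star_xf_2)(h)=\frac1{|A(x_1)|\,|A(x_2)|}\sum_{g_1\in A(x_1),\,g_2\in A(x_2)}\chi_{T(x_1,x_2,x)}(g_1,g_2,h)\,f_1(g_1)f_2(g_2).$$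
   Context: Standing assumptions. $\mathbb K$ is an algebraically closed field of characteristic $0$. $\mathcal A$ is a finitely complete category with terminal object $\ast$. Monomorphisms are called injective ($\hookrightarrow$) and define subobjects of their target; the image of a morphism $y\to x$ is the smallest subobject of $x$ through which it factors; a morphism is surjective ($\twoheadrightarrow$) if its image is its whole target. $\mathcal A$ is assumed regular (every morphism has an image and surjectivity is preserved under pullback), subobject finite (each object has finitely many subobjects), exact (every equivalence relation $r\subseteq x\times x$ is effective, i.e. is the kernel pair of a surjective $x\twoheadrightarrow x/r$), Mal'cev (every reflexive relation $r\subseteq x\times x$ is an equivalence relation), and $\ast$ has no proper subobject. $\hat{\mathcal A}$ denotes a set of representatives of the isomorphism classes of objects of $\mathcal A$. A degree function $\delta$ assigns to each surjective morphism $e$ an element $\delta(e)\in\mathbb K$ with $\delta(\mathrm{id}_x)=1$, $\delta(e')=\delta(e)$ whenever $e'$ is a pullback of $e$, and $\delta(ef)=\delta(e)\delta(f)$ for composable surjective $e,f$. For surjective $e:x\twoheadrightarrow z$ put $\omega_e:=\sum_{y\subseteq x,\ e(y)=z}\mu_{\mathrm s}(y,x)\,\delta(e|_y)$, where $\mu_{\mathrm s}$ is the Möbius function of the finite poset $\mathrm s(x)$ of subobjects of $x$ ordered by inclusion. $\delta$ is assumed non-degenerate: $\omega_e\neq0$ for all surjective $e$. The category $\mathcal T=\mathcal T(\mathcal A,\delta)$. Let $\mathcal T^0$ have objects $[x]$, $x\in\mathcal A$, where $\mathrm{Hom}([x],[y])$ is the $\mathbb K$-vector space with basis $\langle r\rangle$,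 $r\subseteq x\times y$ a subobject; $\langle r\rangle:[x]\to[y]$ followed by $\langle s\rangle:[y]\to[z]$ is $\delta(r\times_ys\twoheadrightarrow r\circ s)\langle r\circ s\rangle$ with $r\circ s=\mathrm{image}(r\times_ys\to x\times z)$. $\mathcal T$ is the pseudo-abelian (idempotent) completion of the additive completion of $\mathcal T^0$. It is a semisimple rigid symmetric monoidal category with $[x]\otimes[y]=[x\times y]$, unit $I=[\ast]$, $\mathrm{End}(I)=\mathbb K$, $[x]^\vee=[x]$ and $\langle r\rangle^\vee=\langle r^\vee\rangle$ (factors swapped). A morphism $f:x\to y$ gives $[f]=\langle\Gamma_f\rangle:[x]\to[y]$ with $\Gamma_f$ its graph. The finite group $A(x):=\mathrm{Aut}_{\mathcal A}(x)$ acts on $[x]$ by $g\mapsto[g]$. Simple objects. $z$ is a subquotient of $x$ if there are a subobject $y\subseteq x$ and a surjection $y\twoheadrightarrow z$; it is proper if $z\not\cong x$. $[x]^1$ denotes the unique direct summand of $[x]$ which is isomorphic to a direct summand of a finite direct sum $\bigoplus[z_i]$ with all $z_i$ proper subquotients of $x$, and such that every morphism $[z]\to[x]$ with $z$ a proper subquotient of $x$ factors through $[x]^1$. It has a unique complement $[x]^0$ in $[x]$, and $\mathbb K[A(x)]\to\mathrm{End}_{\mathcal T}([x]^0)$ is an isomorphism. Hence $[x]^0=\bigoplus_\chi V_\chi\otimes_{\mathbb K}[x]^0_\chi$ ($\chi$ over the irreducible characters of $A(x)$, $V_\chi$ the irreducible module with character $\chi$) with $[x]^0_\chi$ simple; every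 simple object of $\mathcal T$ is isomorphic to $[x]^0_\chi$ for a pair $(x,\chi)$, $x\in\hat{\mathcal A}$, which is unique. The set $T$. For objects $x_1,x_2,x_3$ of $\mathcal A$, $T(x_1,x_2,x_3)$ is the set of subobjects $r\subseteq x_1\times x_2\times x_3$ such that the three projections $r\to x_i$ are surjective and the three projections $r\to x_j\times x_k$ ($j<k$) are injective. $A(x_1)\times A(x_2)\times A(x_3)$ permutes this finite set; $\chi_{T(x_1,x_2,x_3)}(g)=|T(x_1,x_2,x_3)^g|$ is its permutation character. $\mathcal R(G)$ is the representation ring (over $\mathbb K$) of a finite group $G$, viewed as a subring of the ring of $\mathbb K$-valued class functions on $G$. *)

theory Defs
  imports
    "HOL-Library.Function_Algebras"
    "HOL-Computational_Algebra.Polynomial"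
    "HOL-Algebra.Product_Groups"
    "HOL-Algebra.Free_Abelian_Groups"
    "HOL-Algebra.QuotRing"
    "Jordan_Normal_Form.Matrix"
begin

section \<open>Categories\<close>

record ('o, 'm) cat =
  obj :: "'o set"
  arr :: "'m set"
  src :: "'m \<Rightarrow> 'o"
  tgt :: "'m \<Rightarrow> 'o"
  idt :: "'o \<Rightarrow> 'm"
  cmp :: "'m \<Rightarrow> 'm \<Rightarrow> 'm" (infixl \<open>\<bullet>\<index>\<close> 70)

definition homs :: "('o, 'm) cat \<Rightarrow> 'o \<Rightarrow> 'o \<Rightarrow> 'm set" where
  "homs C x y = {f \<in> arr C. src C f = x \<and> tgt C f = y}"

definition iso_arr :: "('o, 'm) cat \<Rightarrow> 'm \<Rightarrow> bool" where
  "iso_arr C f \<longleftrightarrow> f \<in> arr C \<and>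
     (\<exists>g \<in> homs C (tgt C f) (src C f).
        g \<bullet>\<^bsub>C\<^esub> f = idt C (src C f) \<and> f \<bullet>\<^bsub>C\<^esub> g = idt C (tgt C f))"

definition iso_obj :: "('o, 'm) cat \<Rightarrow> 'o \<Rightarrow> 'o \<Rightarrow> bool" where
  "iso_obj C x y \<longleftrightarrow> (\<exists>f \<in> homs C x y. iso_arr C f)"

definition is_terminal :: "('o, 'm) cat \<Rightarrow> 'o \<Rightarrow> bool" where
  "is_terminal C t \<longleftrightarrow> t \<in> obj C \<and> (\<forall>x \<in> obj C. \<exists>!f. f \<in> homs C x t)"

definition terminal :: "('o, 'm) cat \<Rightarrow> 'o" where
  "terminal C = (SOME t. is_terminal C t)"

text \<open>
  A finite diagram is a finite list \<^term>\<open>xs\<close> of objects together with a finite set of triples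
  \<open>(i, j, f)\<close>, where \<open>f\<close> is an arrow from the \<open>i\<close>-th to the \<open>j\<close>-th object.
\<close>

definition finite_diagram :: "('o, 'm) cat \<Rightarrow> 'o list \<Rightarrow> (nat \<times> nat \<times> 'm) set \<Rightarrow> bool" where
  "finite_diagram C xs E \<longleftrightarrow> set xs \<subseteq> obj C \<and> finite E \<and>
     (\<forall>(i, j, f) \<in> E. i < length xs \<and> j < length xs \<and> f \<in> homs C (xs ! i) (xs ! j))"

definition is_cone ::
  "('o, 'm) cat \<Rightarrow> 'o list \<Rightarrow> (nat \<times> nat \<times> 'm) set \<Rightarrow> 'o \<Rightarrow> (nat \<Rightarrow> 'm) \<Rightarrow> bool" where
  "is_cone C xs E l p \<longleftrightarrow> l \<in> obj C \<and> (\<forall>i < length xs. p i \<in> homs C l (xs ! i)) \<and>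
     (\<forall>(i, j, f) \<in> E. f \<bullet>\<^bsub>C\<^esub> p i = p j)"

definition is_limit ::
  "('o, 'm) cat \<Rightarrow> 'o list \<Rightarrow> (nat \<times> nat \<times> 'm) set \<Rightarrow> 'o \<Rightarrow> (nat \<Rightarrow> 'm) \<Rightarrow> bool" where
  "is_limit C xs E l p \<longleftrightarrow> is_cone C xs E l p \<and>
     (\<forall>t q. is_cone C xs E t q \<longrightarrow>
        (\<exists>!u. u \<in> homs C t l \<and> (\<forall>i < length xs. p i \<bullet>\<^bsub>C\<^esub> u = q i)))"

definition is_product :: "('o, 'm) cat \<Rightarrow> 'o \<Rightarrow> 'o \<Rightarrow> 'm \<Rightarrow> 'm \<Rightarrow> bool" where
  "is_product C x y p q \<longleftrightarrow>
     p \<in> arr C \<and> q \<in> arr C \<and> src C p = src C q \<and> tgt C p = x \<and> tgt C q = y \<and>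
     (\<forall>t \<in> obj C. \<forall>f \<in> homs C t x. \<forall>g \<in> homs C t y.
        \<exists>!u. u \<in> homs C t (src C p) \<and> p \<bullet>\<^bsub>C\<^esub> u = f \<and> q \<bullet>\<^bsub>C\<^esub> u = g)"

definition prod_cone :: "('o, 'm) cat \<Rightarrow> 'o \<Rightarrow> 'o \<Rightarrow> 'm \<times> 'm" where
  "prod_cone C x y = (SOME (p, q). is_product C x y p q)"

definition pr1 :: "('o, 'm) cat \<Rightarrow> 'o \<Rightarrow> 'o \<Rightarrow> 'm" where
  "pr1 C x y = fst (prod_cone C x y)"

definition pr2 :: "('o, 'm) cat \<Rightarrow> 'o \<Rightarrow> 'o \<Rightarrow> 'm" where
  "pr2 C x y = snd (prod_cone C x y)"

definition prd :: "('o, 'm) cat \<Rightarrow> 'o \<Rightarrow> 'o \<Rightarrow> 'o" where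
  "prd C x y = src C (pr1 C x y)"

definition pairing :: "('o, 'm) cat \<Rightarrow> 'm \<Rightarrow> 'm \<Rightarrow> 'm" where
  "pairing C f g = (THE u. u \<in> homs C (src C f) (prd C (tgt C f) (tgt C g)) \<and>
     pr1 C (tgt C f) (tgt C g) \<bullet>\<^bsub>C\<^esub> u = f \<and> pr2 C (tgt C f) (tgt C g) \<bullet>\<^bsub>C\<^esub> u = g)"

text \<open>\<open>is_pullback C f g a b\<close>: the square \<open>f \<bullet> a = g \<bullet> b\<close> is cartesian, so \<open>b\<close> is a pullback of
  \<open>f\<close> (along \<open>g\<close>).\<close>

definition is_pullback :: "('o, 'm) cat \<Rightarrow> 'm \<Rightarrow> 'm \<Rightarrow> 'm \<Rightarrow> 'm \<Rightarrow> bool" where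
  "is_pullback C f g a b \<longleftrightarrow>
     f \<in> arr C \<and> g \<in> arr C \<and> tgt C f = tgt C g \<and>
     a \<in> arr C \<and> b \<in> arr C \<and> src C a = src C b \<and> tgt C a = src C f \<and> tgt C b = src C g \<and>
     f \<bullet>\<^bsub>C\<^esub> a = g \<bullet>\<^bsub>C\<^esub> b \<and>
     (\<forall>t \<in> obj C. \<forall>c \<in> homs C t (src C f). \<forall>d \<in> homs C t (src C g).
        f \<bullet>\<^bsub>C\<^esub> c = g \<bullet>\<^bsub>C\<^esub> d \<longrightarrow>
        (\<exists>!u. u \<in> homs C t (src C a) \<and> a \<bullet>\<^bsub>C\<^esub> u = c \<and> b \<bullet>\<^bsub>C\<^esub> u = d))"

subsection \<open>Subobjects and images\<close>

definition monic :: "('o, 'm) cat \<Rightarrow> 'm \<Rightarrow> bool" where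
  "monic C m \<longleftrightarrow> m \<in> arr C \<and>
     (\<forall>t \<in> obj C. \<forall>f \<in> homs C t (src C m). \<forall>g \<in> homs C t (src C m).
        m \<bullet>\<^bsub>C\<^esub> f = m \<bullet>\<^bsub>C\<^esub> g \<longrightarrow> f = g)"

definition factors_through :: "('o, 'm) cat \<Rightarrow> 'm \<Rightarrow> 'm \<Rightarrow> bool" where
  "factors_through C f m \<longleftrightarrow> (\<exists>k \<in> homs C (src C f) (src C m). f = m \<bullet>\<^bsub>C\<^esub> k)"

text \<open>A subobject of \<open>x\<close> is an equivalence class of monomorphisms into \<open>x\<close>, two of them being
  equivalent if each factors through the other.\<close>

definition sub_of :: "('o, 'm) cat \<Rightarrow> 'm \<Rightarrow> 'm set" where
  "sub_of C m = {n. monic C n \<and> tgt C n = tgt C m \<and> factors_through C n m \<and> factors_through C m n}"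

definition subobjs :: "('o, 'm) cat \<Rightarrow> 'o \<Rightarrow> 'm set set" where
  "subobjs C x = sub_of C ` {m. monic C m \<and> tgt C m = x}"

definition rep :: "'m set \<Rightarrow> 'm" where
  "rep s = (SOME m. m \<in> s)"

definition factors_sub :: "('o, 'm) cat \<Rightarrow> 'm \<Rightarrow> 'm set \<Rightarrow> bool" where
  "factors_sub C f s \<longleftrightarrow> (\<exists>m \<in> s. factors_through C f m)"

definition sub_le :: "('o, 'm) cat \<Rightarrow> 'm set \<Rightarrow> 'm set \<Rightarrow> bool" where
  "sub_le C s t \<longleftrightarrow> (\<exists>m \<in> s. factors_sub C m t)"

definition whole :: "('o, 'm) cat \<Rightarrow> 'o \<Rightarrow> 'm set" where
  "whole C x = sub_of C (idt C x)"

definition is_im :: "('o, 'm) cat \<Rightarrow> 'm \<Rightarrow> 'm set \<Rightarrow> bool" where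
  "is_im C f s \<longleftrightarrow> s \<in> subobjs C (tgt C f) \<and> factors_sub C f s \<and>
     (\<forall>t \<in> subobjs C (tgt C f). factors_sub C f t \<longrightarrow> sub_le C s t)"

definition im :: "('o, 'm) cat \<Rightarrow> 'm \<Rightarrow> 'm set" where
  "im C f = (THE s. is_im C f s)"

definition surjective :: "('o, 'm) cat \<Rightarrow> 'm \<Rightarrow> bool" where
  "surjective C f \<longleftrightarrow> f \<in> arr C \<and> is_im C f (whole C (tgt C f))"

text \<open>The surjective part of \<open>f\<close>, with target the domain of the chosen representative of its
  image.\<close>

definition surj_part :: "('o, 'm) cat \<Rightarrow> 'm \<Rightarrow> 'm" where
  "surj_part C f = (THE e. e \<in> homs C (src C f) (src C (rep (im C f))) \<and> f = rep (im C f) \<bullet>\<^bsub>C\<^esub> e)"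

definition subquotient :: "('o, 'm) cat \<Rightarrow> 'o \<Rightarrow> 'o \<Rightarrow> bool" where
  "subquotient C z x \<longleftrightarrow>
     (\<exists>m e. monic C m \<and> tgt C m = x \<and> surjective C e \<and> src C e = src C m \<and> tgt C e = z)"

definition proper_subquotient :: "('o, 'm) cat \<Rightarrow> 'o \<Rightarrow> 'o \<Rightarrow> bool" where
  "proper_subquotient C z x \<longleftrightarrow> subquotient C z x \<and> \<not> iso_obj C z x"

subsection \<open>Internal relations\<close>

text \<open>The relation induced by \<open>r \<subseteq> x \<times> x\<close> on the set of \<open>t\<close>-valued points of \<open>x\<close>.\<close>

definition points_rel :: "('o, 'm) cat \<Rightarrow> 'o \<Rightarrow> 'm set \<Rightarrow> 'o \<Rightarrow> ('m \<times> 'm) set" where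
  "points_rel C x r t =
     {(a, b). a \<in> homs C t x \<and> b \<in> homs C t x \<and> factors_sub C (pairing C a b) r}"

definition equiv_relation :: "('o, 'm) cat \<Rightarrow> 'o \<Rightarrow> 'm set \<Rightarrow> bool" where
  "equiv_relation C x r \<longleftrightarrow> r \<in> subobjs C (prd C x x) \<and>
     (\<forall>t \<in> obj C. equiv (homs C t x) (points_rel C x r t))"

definition reflexive_relation :: "('o, 'm) cat \<Rightarrow> 'o \<Rightarrow> 'm set \<Rightarrow> bool" where
  "reflexive_relation C x r \<longleftrightarrow> r \<in> subobjs C (prd C x x) \<and>
     factors_sub C (pairing C (idt C x) (idt C x)) r"

definition effective :: "('o, 'm) cat \<Rightarrow> 'o \<Rightarrow> 'm set \<Rightarrow> bool" where
  "effective C x r \<longleftrightarrow> (\<exists>e. surjective C e \<and> src C e = x \<and>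
     is_pullback C e e (pr1 C x x \<bullet>\<^bsub>C\<^esub> rep r) (pr2 C x x \<bullet>\<^bsub>C\<^esub> rep r))"

subsection \<open>The standing assumptions on the base category\<close>

locale category =
  fixes C :: "('o, 'm) cat" (structure)
  assumes src_tgt: "f \<in> arr C \<Longrightarrow> src C f \<in> obj C \<and> tgt C f \<in> obj C"
    and idt: "x \<in> obj C \<Longrightarrow> idt C x \<in> homs C x x"
    and cmp: "f \<in> homs C x y \<Longrightarrow> g \<in> homs C y z \<Longrightarrow> g \<bullet> f \<in> homs C x z"
    and cmp_idt: "f \<in> homs C x y \<Longrightarrow> f \<bullet> idt C x = f"
    and idt_cmp: "f \<in> homs C x y \<Longrightarrow> idt C y \<bullet> f = f"
    and cmp_assoc: "f \<in> homs C w x \<Longrightarrow> g \<in> homs C x y \<Longrightarrow> h \<in> homs C y z \<Longrightarrow>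
      (h \<bullet> g) \<bullet> f = h \<bullet> (g \<bullet> f)"

locale finitely_complete_category = category +
  assumes finite_limits: "finite_diagram C xs E \<Longrightarrow> \<exists>l p. is_limit C xs E l p"

locale regular_category = finitely_complete_category +
  assumes has_im: "f \<in> arr C \<Longrightarrow> \<exists>s. is_im C f s"
    and surjective_pullback: "surjective C f \<Longrightarrow> is_pullback C f g a b \<Longrightarrow> surjective C b"

locale exact_malcev_category = regular_category +
  assumes subobject_finite: "x \<in> obj C \<Longrightarrow> finite (subobjs C x)"
    and exact: "x \<in> obj C \<Longrightarrow> equiv_relation C x r \<Longrightarrow> effective C x r"
    and malcev: "x \<in> obj C \<Longrightarrow> reflexive_relation C x r \<Longrightarrow> equiv_relation C x r"
    and terminal_no_proper_sub: "is_terminal C t \<Longrightarrow> subobjs C t = {whole C t}"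

definition iso_representatives :: "('o, 'm) cat \<Rightarrow> 'o set \<Rightarrow> bool" where
  "iso_representatives C X \<longleftrightarrow> X \<subseteq> obj C \<and> (\<forall>x \<in> obj C. \<exists>!y. y \<in> X \<and> iso_obj C x y)"

definition aut_group :: "('o, 'm) cat \<Rightarrow> 'o \<Rightarrow> 'm monoid" where
  "aut_group C x =
     \<lparr>carrier = {g \<in> homs C x x. iso_arr C g}, monoid.mult = cmp C, one = idt C x\<rparr>"

section \<open>Degree functions\<close>

text \<open>The Moebius function of a finite poset \<open>(P, leq)\<close>, i.e. the inverse of the zeta function in the
  incidence algebra, extended by 0.\<close>

definition moebius :: "'a set \<Rightarrow> ('a \<Rightarrow> 'a \<Rightarrow> bool) \<Rightarrow> 'a \<Rightarrow> 'a \<Rightarrow> int" where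
  "moebius P leq = (THE \<mu>.
     (\<forall>a b. \<not> (a \<in> P \<and> b \<in> P \<and> leq a b) \<longrightarrow> \<mu> a b = 0) \<and>
     (\<forall>a \<in> P. \<forall>b \<in> P. leq a b \<longrightarrow>
        (\<Sum>c \<in> {c \<in> P. leq a c \<and> leq c b}. \<mu> a c) = (if a = b then 1 else 0)))"

definition omega :: "('o, 'm) cat \<Rightarrow> ('m \<Rightarrow> 'k::field) \<Rightarrow> 'm \<Rightarrow> 'k" where
  "omega C \<delta> e =
     (\<Sum>y \<in> {y \<in> subobjs C (src C e). im C (e \<bullet>\<^bsub>C\<^esub> rep y) = whole C (tgt C e)}.
        of_int (moebius (subobjs C (src C e)) (sub_le C) y (whole C (src C e))) *
        \<delta> (e \<bullet>\<^bsub>C\<^esub> rep y))"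

locale degree_function = exact_malcev_category C
  for C :: "('o, 'm) cat" (structure) +
  fixes \<delta> :: "'m \<Rightarrow> 'k::field"
  assumes degree_idt: "x \<in> obj C \<Longrightarrow> \<delta> (idt C x) = 1"
    and degree_pullback: "surjective C f \<Longrightarrow> is_pullback C f g a b \<Longrightarrow> \<delta> b = \<delta> f"
    and degree_cmp: "surjective C e \<Longrightarrow> surjective C f \<Longrightarrow> src C e = tgt C f \<Longrightarrow>
      \<delta> (e \<bullet> f) = \<delta> e * \<delta> f"

locale nondegenerate_degree_function = degree_function +
  assumes nondegenerate: "surjective C e \<Longrightarrow> omega C \<delta> e \<noteq> 0"

section \<open>Linear tensor categories\<close>

text \<open>
  \<open>Cmp X Y Z g f\<close> is the composite of \<open>f \<in> Hom X Y\<close> and \<open>g \<in> Hom Y Z\<close>, and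
  \<open>TenM X X' Y Y' f g\<close> is the tensor product of \<open>f \<in> Hom X X'\<close> and \<open>g \<in> Hom Y Y'\<close>.  The indices are
  needed because the sets \<open>Hom X Y\<close> need not be disjoint: all of them are subgroups of the additive
  group \<^typ>\<open>'h\<close>.
\<close>

record ('k, 'o, 'h) tcat =
  Obj :: "'o set"
  Hom :: "'o \<Rightarrow> 'o \<Rightarrow> 'h set"
  Idn :: "'o \<Rightarrow> 'h"
  Cmp :: "'o \<Rightarrow> 'o \<Rightarrow> 'o \<Rightarrow> 'h \<Rightarrow> 'h \<Rightarrow> 'h"
  Scl :: "'k \<Rightarrow> 'h \<Rightarrow> 'h"
  TenO :: "'o \<Rightarrow> 'o \<Rightarrow> 'o"
  TenM :: "'o \<Rightarrow> 'o \<Rightarrow> 'o \<Rightarrow> 'o \<Rightarrow> 'h \<Rightarrow> 'h \<Rightarrow> 'h"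
  UnitO :: "'o"

definition is_biproduct ::
  "('k, 'o, 'h::comm_monoid_add) tcat \<Rightarrow> 'o \<Rightarrow> 'i set \<Rightarrow> ('i \<Rightarrow> 'o) \<Rightarrow> ('i \<Rightarrow> 'h) \<Rightarrow> ('i \<Rightarrow> 'h) \<Rightarrow> bool"
where
  "is_biproduct D Z I X \<iota> \<pi> \<longleftrightarrow> finite I \<and> Z \<in> Obj D \<and>
     (\<forall>i \<in> I. X i \<in> Obj D \<and> \<iota> i \<in> Hom D (X i) Z \<and> \<pi> i \<in> Hom D Z (X i)) \<and>
     (\<forall>i \<in> I. \<forall>j \<in> I. Cmp D (X i) Z (X j) (\<pi> j) (\<iota> i) = (if i = j then Idn D (X i) else 0)) \<and>
     (\<Sum>i \<in> I. Cmp D Z (X i) Z (\<iota> i) (\<pi> i)) = Idn D Z"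

definition is_complement ::
  "('k, 'o, 'h::comm_monoid_add) tcat \<Rightarrow> 'o \<Rightarrow> 'o \<Rightarrow> 'h \<Rightarrow> 'o \<Rightarrow> 'h \<Rightarrow> bool" where
  "is_complement D X Y i Z j \<longleftrightarrow>
     (\<exists>p q. is_biproduct D X {0, 1::nat} (\<lambda>n. if n = 0 then Y else Z)
        (\<lambda>n. if n = 0 then i else j) (\<lambda>n. if n = 0 then p else q))"

definition is_summand :: "('k, 'o, 'h::comm_monoid_add) tcat \<Rightarrow> 'o \<Rightarrow> 'o \<Rightarrow> 'h \<Rightarrow> bool" where
  "is_summand D X Y i \<longleftrightarrow> (\<exists>Z j. is_complement D X Y i Z j)"

definition simple_object :: "('k, 'o, 'h::comm_monoid_add) tcat \<Rightarrow> 'o \<Rightarrow> bool" where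
  "simple_object D S \<longleftrightarrow> S \<in> Obj D \<and> Idn D S \<noteq> 0 \<and>
     (\<forall>X \<in> Obj D. \<forall>i \<in> Hom D X S.
        (\<forall>W \<in> Obj D. \<forall>f \<in> Hom D W X. \<forall>g \<in> Hom D W X.
           Cmp D W X S i f = Cmp D W X S i g \<longrightarrow> f = g) \<longrightarrow>
        i = 0 \<or> (\<exists>k \<in> Hom D S X. Cmp D X S X k i = Idn D X \<and> Cmp D S X S i k = Idn D S))"

text \<open>
  Objects of the additive completion are finite formal direct sums, given as lists; a morphism from
  \<open>xs\<close> to \<open>ys\<close> is a matrix whose entry \<open>(i, j)\<close> lies in \<open>Hom (xs ! j) (ys ! i)\<close>.
  In a tensor product \<open>xs \<otimes> ys\<close> the summand \<open>xs ! i \<otimes> ys ! j\<close> has position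
  \<open>i * length ys + j\<close>.
\<close>

definition additive_completion ::
  "('k, 'o, 'h::comm_monoid_add) tcat \<Rightarrow> ('k, 'o list, nat \<Rightarrow> nat \<Rightarrow> 'h) tcat" where
  "additive_completion D =
     \<lparr>Obj = lists (Obj D),
      Hom = (\<lambda>xs ys. {M. \<forall>i j. if i < length ys \<and> j < length xs
                then M i j \<in> Hom D (xs ! j) (ys ! i) else M i j = 0}),
      Idn = (\<lambda>xs i j. if i = j \<and> i < length xs then Idn D (xs ! i) else 0),
      Cmp = (\<lambda>xs ys zs N M i j. if i < length zs \<and> j < length xs
                then \<Sum>k<length ys. Cmp D (xs ! j) (ys ! k) (zs ! i) (N i k) (M k j) else 0),
      Scl = (\<lambda>c M i j. Scl D c (M i j)),
      TenO = (\<lambda>xs ys. concat (map (\<lambda>x. map (TenO D x) ys) xs)),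
      TenM = (\<lambda>xs xs' ys ys' M N i j.
                if i < length xs' * length ys' \<and> j < length xs * length ys
                then TenM D (xs ! (j div length ys)) (xs' ! (i div length ys'))
                       (ys ! (j mod length ys)) (ys' ! (i mod length ys'))
                       (M (i div length ys') (j div length ys))
                       (N (i mod length ys') (j mod length ys))
                else 0),
      UnitO = [UnitO D]\<rparr>"

definition idempotent_completion ::
  "('k, 'o, 'h) tcat \<Rightarrow> ('k, 'o \<times> 'h, 'h) tcat" where
  "idempotent_completion D =
     \<lparr>Obj = {(X, p). X \<in> Obj D \<and> p \<in> Hom D X X \<and> Cmp D X X X p p = p},
      Hom = (\<lambda>(X, p) (Y, q). {f \<in> Hom D X Y. Cmp D X X Y f p = f \<and> Cmp D X Y Y q f = f}),
      Idn = (\<lambda>(X, p). p),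
      Cmp = (\<lambda>(X, p) (Y, q) (Z, s). Cmp D X Y Z),
      Scl = Scl D,
      TenO = (\<lambda>(X, p) (Y, q). (TenO D X Y, TenM D X X Y Y p q)),
      TenM = (\<lambda>(X, p) (X', p') (Y, q) (Y', q'). TenM D X X' Y Y'),
      UnitO = (UnitO D, Idn D (UnitO D))\<rparr>"

subsection \<open>The Grothendieck ring\<close>

text \<open>
  The free abelian group on the objects, with the bilinear extension of the tensor product, modulo
  the relations \<open>[Z] = [X] + [Y]\<close> for \<open>Z \<cong> X \<oplus> Y\<close> (in a semisimple category
  every exact sequence splits).  \<open>object_ring\<close> itself satisfies the ring axioms only up to
  isomorphism of objects.
\<close>

definition object_ring :: "('k, 'o, 'h) tcat \<Rightarrow> ('o \<Rightarrow>\<^sub>0 int) ring" where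
  "object_ring D =
     \<lparr>carrier = carrier (free_Abelian_group (Obj D)),
      monoid.mult = (\<lambda>a b. frag_extend (\<lambda>X. frag_extend (\<lambda>Y. frag_of (TenO D X Y)) b) a),
      one = frag_of (UnitO D),
      zero = 0,
      add = (+)\<rparr>"

definition groth_relations :: "('k, 'o, 'h::comm_monoid_add) tcat \<Rightarrow> ('o \<Rightarrow>\<^sub>0 int) set" where
  "groth_relations D = generate (free_Abelian_group (Obj D))
     {frag_of Z - frag_of X - frag_of Y | X Y Z. \<exists>i j. is_complement D Z X i Y j}"

definition groth_ring :: "('k, 'o, 'h::comm_monoid_add) tcat \<Rightarrow> ('o \<Rightarrow>\<^sub>0 int) set ring" where
  "groth_ring D = object_ring D Quot groth_relations D"

definition groth_class :: "('k, 'o, 'h::comm_monoid_add) tcat \<Rightarrow> 'o \<Rightarrow> ('o \<Rightarrow>\<^sub>0 int) set" where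
  "groth_class D X = groth_relations D +>\<^bsub>object_ring D\<^esub> frag_of X"

section \<open>The tensor envelope\<close>

definition basis :: "'m set \<Rightarrow> 'm set \<Rightarrow> 'k::field" where
  "basis r = (\<lambda>s. if s = r then 1 else 0)"

definition graph :: "('o, 'm) cat \<Rightarrow> 'm \<Rightarrow> 'm set" where
  "graph C f = sub_of C (pairing C (idt C (src C f)) f)"

text \<open>For \<open>r \<subseteq> x \<times> y\<close> and \<open>s \<subseteq> y \<times> z\<close>, the canonical morphism
  from the fibre product of \<open>r\<close> and \<open>s\<close> over \<open>y\<close> to \<open>x \<times> z\<close>.\<close>

definition rel_span :: "('o, 'm) cat \<Rightarrow> 'o \<Rightarrow> 'o \<Rightarrow> 'o \<Rightarrow> 'm set \<Rightarrow> 'm set \<Rightarrow> 'm" where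
  "rel_span C x y z r s =
     (let (a, b) = (SOME (a, b). is_pullback C (pr2 C x y \<bullet>\<^bsub>C\<^esub> rep r) (pr1 C y z \<bullet>\<^bsub>C\<^esub> rep s) a b)
      in pairing C ((pr1 C x y \<bullet>\<^bsub>C\<^esub> rep r) \<bullet>\<^bsub>C\<^esub> a) ((pr2 C y z \<bullet>\<^bsub>C\<^esub> rep s) \<bullet>\<^bsub>C\<^esub> b))"

definition rel_cmp :: "('o, 'm) cat \<Rightarrow> 'o \<Rightarrow> 'o \<Rightarrow> 'o \<Rightarrow> 'm set \<Rightarrow> 'm set \<Rightarrow> 'm set" where
  "rel_cmp C x y z r s = im C (rel_span C x y z r s)"

text \<open>For \<open>r \<subseteq> x \<times> x'\<close> and \<open>s \<subseteq> y \<times> y'\<close>, the product of \<open>r\<close>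
  and \<open>s\<close> as a subobject of \<open>(x \<times> y) \<times> (x' \<times> y')\<close>.\<close>

definition rel_prod ::
  "('o, 'm) cat \<Rightarrow> 'o \<Rightarrow> 'o \<Rightarrow> 'o \<Rightarrow> 'o \<Rightarrow> 'm set \<Rightarrow> 'm set \<Rightarrow> 'm set" where
  "rel_prod C x x' y y' r s =
     (let a = rep r \<bullet>\<^bsub>C\<^esub> pr1 C (src C (rep r)) (src C (rep s));
          b = rep s \<bullet>\<^bsub>C\<^esub> pr2 C (src C (rep r)) (src C (rep s))
      in sub_of C (pairing C
           (pairing C (pr1 C x x' \<bullet>\<^bsub>C\<^esub> a) (pr1 C y y' \<bullet>\<^bsub>C\<^esub> b))
           (pairing C (pr2 C x x' \<bullet>\<^bsub>C\<^esub> a) (pr2 C y y' \<bullet>\<^bsub>C\<^esub> b))))"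

text \<open>
  \<open>Hom x y\<close> is the vector space with basis \<open>\<langle>r\<rangle> = basis r\<close>, for \<open>r\<close> a subobject of
  \<open>x \<times> y\<close>; \<open>\<langle>r\<rangle>\<close> followed by \<open>\<langle>s\<rangle>\<close> is
  \<open>\<delta>(r \<times>\<^sub>y s \<rightarrow> r \<circ> s) \<langle>r \<circ> s\<rangle>\<close> with \<open>r \<circ> s\<close> given by \<open>rel_cmp\<close>, extended bilinearly, and the tensor
  product is the bilinear extension of \<open>\<langle>r\<rangle> \<otimes> \<langle>s\<rangle> = \<langle>r \<times> s\<rangle>\<close>.
\<close>

definition T0 :: "('o, 'm) cat \<Rightarrow> ('m \<Rightarrow> 'k::field) \<Rightarrow> ('k, 'o, 'm set \<Rightarrow> 'k) tcat" where
  "T0 C \<delta> =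
     \<lparr>Obj = obj C,
      Hom = (\<lambda>x y. {v. \<forall>r. r \<notin> subobjs C (prd C x y) \<longrightarrow> v r = 0}),
      Idn = (\<lambda>x. basis (graph C (idt C x))),
      Cmp = (\<lambda>x y z w v t. \<Sum>r \<in> subobjs C (prd C x y). \<Sum>s \<in> subobjs C (prd C y z).
               v r * w s * (\<delta> (surj_part C (rel_span C x y z r s)) * basis (rel_cmp C x y z r s) t)),
      Scl = (\<lambda>c v r. c * v r),
      TenO = prd C,
      TenM = (\<lambda>x x' y y' v w t. \<Sum>r \<in> subobjs C (prd C x x'). \<Sum>s \<in> subobjs C (prd C y y').
               v r * w s * basis (rel_prod C x x' y y' r s) t),
      UnitO = terminal C\<rparr>"

definition tensor_envelope ::
  "('o, 'm) cat \<Rightarrow> ('m \<Rightarrow> 'k::field) \<Rightarrow>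
    ('k, 'o list \<times> (nat \<Rightarrow> nat \<Rightarrow> 'm set \<Rightarrow> 'k), nat \<Rightarrow> nat \<Rightarrow> 'm set \<Rightarrow> 'k) tcat" where
  "tensor_envelope C \<delta> = idempotent_completion (additive_completion (T0 C \<delta>))"

definition br ::
  "('o, 'm) cat \<Rightarrow> ('m \<Rightarrow> 'k::field) \<Rightarrow> 'o \<Rightarrow> 'o list \<times> (nat \<Rightarrow> nat \<Rightarrow> 'm set \<Rightarrow> 'k)" where
  "br C \<delta> x = ([x], Idn (additive_completion (T0 C \<delta>)) [x])"

definition br_arr :: "('o, 'm) cat \<Rightarrow> 'm \<Rightarrow> nat \<Rightarrow> nat \<Rightarrow> 'm set \<Rightarrow> 'k::field" where
  "br_arr C f = (\<lambda>i j. if i = 0 \<and> j = 0 then basis (graph C f) else 0)"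

section \<open>Representations and characters\<close>

definition is_rep :: "('g, 'a) monoid_scheme \<Rightarrow> nat \<Rightarrow> ('g \<Rightarrow> 'k::field mat) \<Rightarrow> bool" where
  "is_rep G n \<rho> \<longleftrightarrow> (\<forall>g \<in> carrier G. \<rho> g \<in> carrier_mat n n) \<and> \<rho> \<one>\<^bsub>G\<^esub> = 1\<^sub>m n \<and>
     (\<forall>g \<in> carrier G. \<forall>h \<in> carrier G. \<rho> (g \<otimes>\<^bsub>G\<^esub> h) = \<rho> g * \<rho> h)"

definition invariant_subspace ::
  "('g, 'a) monoid_scheme \<Rightarrow> nat \<Rightarrow> ('g \<Rightarrow> 'k::field mat) \<Rightarrow> 'k vec set \<Rightarrow> bool" where
  "invariant_subspace G n \<rho> W \<longleftrightarrow> W \<subseteq> carrier_vec n \<and> 0\<^sub>v n \<in> W \<and>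
     (\<forall>v \<in> W. \<forall>w \<in> W. v + w \<in> W) \<and> (\<forall>c. \<forall>v \<in> W. c \<cdot>\<^sub>v v \<in> W) \<and>
     (\<forall>g \<in> carrier G. \<forall>v \<in> W. \<rho> g *\<^sub>v v \<in> W)"

definition is_irr_rep :: "('g, 'a) monoid_scheme \<Rightarrow> nat \<Rightarrow> ('g \<Rightarrow> 'k::field mat) \<Rightarrow> bool" where
  "is_irr_rep G n \<rho> \<longleftrightarrow> is_rep G n \<rho> \<and> n > 0 \<and>
     (\<forall>W. invariant_subspace G n \<rho> W \<longrightarrow> W = {0\<^sub>v n} \<or> W = carrier_vec n)"

text \<open>Functions on \<open>G\<close> are extended by 0 outside the carrier.\<close>

definition rep_char :: "('g, 'a) monoid_scheme \<Rightarrow> nat \<Rightarrow> ('g \<Rightarrow> 'k::field mat) \<Rightarrow> 'g \<Rightarrow> 'k" where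
  "rep_char G n \<rho> g = (if g \<in> carrier G then \<Sum>i<n. \<rho> g $$ (i, i) else 0)"

definition irr_chars :: "('g, 'a) monoid_scheme \<Rightarrow> ('g \<Rightarrow> 'k::field) set" where
  "irr_chars G = {rep_char G n \<rho> | n \<rho>. is_irr_rep G n \<rho>}"

definition rep_ring :: "('g, 'a) monoid_scheme \<Rightarrow> ('g \<Rightarrow> 'k::field) ring" where
  "rep_ring G =
     \<lparr>carrier = {\<lambda>g. rep_char G n \<rho> g - rep_char G m \<sigma> g | n \<rho> m \<sigma>. is_rep G n \<rho> \<and> is_rep G m \<sigma>},
      monoid.mult = (\<lambda>f f' g. f g * f' g),
      one = (\<lambda>g. if g \<in> carrier G then 1 else 0),
      zero = (\<lambda>g. 0),
      add = (\<lambda>f f' g. f g + f' g)\<rparr>"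

section \<open>The simple objects of the tensor envelope\<close>

text \<open>\<open>is_top1 C \<delta> x Y i\<close>: the object \<open>Y\<close> with the inclusion \<open>i\<close> is the direct summand
  \<open>[x]\<^sup>1\<close> of \<open>[x]\<close>; similarly \<open>is_top0\<close> for its complement \<open>[x]\<^sup>0\<close>.\<close>

definition is_top1 :: "('o, 'm) cat \<Rightarrow> ('m \<Rightarrow> 'k::field) \<Rightarrow> 'o \<Rightarrow>
    'o list \<times> (nat \<Rightarrow> nat \<Rightarrow> 'm set \<Rightarrow> 'k) \<Rightarrow> (nat \<Rightarrow> nat \<Rightarrow> 'm set \<Rightarrow> 'k) \<Rightarrow> bool" where
  "is_top1 C \<delta> x Y i \<longleftrightarrow>
     is_summand (tensor_envelope C \<delta>) (br C \<delta> x) Y i \<and>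
     (\<exists>zs W \<iota> \<pi> k. (\<forall>z \<in> set zs. proper_subquotient C z x) \<and>
        is_biproduct (tensor_envelope C \<delta>) W {..<length zs} (\<lambda>n. br C \<delta> (zs ! n)) \<iota> \<pi> \<and>
        is_summand (tensor_envelope C \<delta>) W Y k) \<and>
     (\<forall>z f. proper_subquotient C z x \<and> f \<in> Hom (tensor_envelope C \<delta>) (br C \<delta> z) (br C \<delta> x) \<longrightarrow>
        (\<exists>u \<in> Hom (tensor_envelope C \<delta>) (br C \<delta> z) Y.
           f = Cmp (tensor_envelope C \<delta>) (br C \<delta> z) Y (br C \<delta> x) i u))"

definition is_top0 :: "('o, 'm) cat \<Rightarrow> ('m \<Rightarrow> 'k::field) \<Rightarrow> 'o \<Rightarrow>
    'o list \<times> (nat \<Rightarrow> nat \<Rightarrow> 'm set \<Rightarrow> 'k) \<Rightarrow> (nat \<Rightarrow> nat \<Rightarrow> 'm set \<Rightarrow> 'k) \<Rightarrow> bool" where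
  "is_top0 C \<delta> x Z j \<longleftrightarrow>
     (\<exists>Y i. is_top1 C \<delta> x Y i \<and> is_complement (tensor_envelope C \<delta>) (br C \<delta> x) Y i Z j)"

text \<open>The action of the automorphism group on \<open>[x]\<^sup>0\<close> induced by \<open>g \<mapsto> [g]\<close>.\<close>

definition is_top0_action :: "('o, 'm) cat \<Rightarrow> ('m \<Rightarrow> 'k::field) \<Rightarrow> 'o \<Rightarrow>
    'o list \<times> (nat \<Rightarrow> nat \<Rightarrow> 'm set \<Rightarrow> 'k) \<Rightarrow> (nat \<Rightarrow> nat \<Rightarrow> 'm set \<Rightarrow> 'k) \<Rightarrow>
    ('m \<Rightarrow> nat \<Rightarrow> nat \<Rightarrow> 'm set \<Rightarrow> 'k) \<Rightarrow> bool" where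
  "is_top0_action C \<delta> x Z j a \<longleftrightarrow>
     (\<forall>g \<in> carrier (aut_group C x). a g \<in> Hom (tensor_envelope C \<delta>) Z Z \<and>
        Cmp (tensor_envelope C \<delta>) Z (br C \<delta> x) (br C \<delta> x) (br_arr C g) j =
        Cmp (tensor_envelope C \<delta>) Z Z (br C \<delta> x) j (a g))"

text \<open>
  \<open>is_top0_chi C \<delta> x \<chi> S\<close>: the object \<open>S\<close> is \<open>[x]\<^sup>0\<^sub>\<chi>\<close>.  The tensor product
  \<open>V\<^sub>\<psi> \<otimes> S' \<psi>\<close> is a direct sum of copies of \<open>S' \<psi>\<close>, indexed by a basis of
  \<open>V\<^sub>\<psi>\<close>, on which the group acts through the matrices \<open>\<rho> \<psi> g\<close>.
\<close>

definition is_top0_chi :: "('o, 'm) cat \<Rightarrow> ('m \<Rightarrow> 'k::field) \<Rightarrow> 'o \<Rightarrow> ('m \<Rightarrow> 'k) \<Rightarrow>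
    'o list \<times> (nat \<Rightarrow> nat \<Rightarrow> 'm set \<Rightarrow> 'k) \<Rightarrow> bool" where
  "is_top0_chi C \<delta> x \<chi> S \<longleftrightarrow>
     (\<exists>Z j a S' n \<rho> \<iota> \<pi>.
        is_top0 C \<delta> x Z j \<and> is_top0_action C \<delta> x Z j a \<and>
        (\<forall>\<psi> \<in> irr_chars (aut_group C x).
           is_irr_rep (aut_group C x) (n \<psi>) (\<rho> \<psi>) \<and> rep_char (aut_group C x) (n \<psi>) (\<rho> \<psi>) = \<psi>) \<and>
        is_biproduct (tensor_envelope C \<delta>) Z (SIGMA \<psi>:irr_chars (aut_group C x). {..<n \<psi>})
          (\<lambda>(\<psi>, k). S' \<psi>) \<iota> \<pi> \<and>
        (\<forall>g \<in> carrier (aut_group C x). \<forall>\<psi> \<in> irr_chars (aut_group C x). \<forall>k < n \<psi>.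
           Cmp (tensor_envelope C \<delta>) (S' \<psi>) Z Z (a g) (\<iota> (\<psi>, k)) =
           (\<Sum>l<n \<psi>. Scl (tensor_envelope C \<delta>) (\<rho> \<psi> g $$ (l, k)) (\<iota> (\<psi>, l)))) \<and>
        \<chi> \<in> irr_chars (aut_group C x) \<and> S = S' \<chi>)"

section \<open>The structure constants\<close>

definition prd3 :: "('o, 'm) cat \<Rightarrow> 'o \<Rightarrow> 'o \<Rightarrow> 'o \<Rightarrow> 'o" where
  "prd3 C x1 x2 x3 = prd C (prd C x1 x2) x3"

definition proj1 :: "('o, 'm) cat \<Rightarrow> 'o \<Rightarrow> 'o \<Rightarrow> 'o \<Rightarrow> 'm" where
  "proj1 C x1 x2 x3 = pr1 C x1 x2 \<bullet>\<^bsub>C\<^esub> pr1 C (prd C x1 x2) x3"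

definition proj2 :: "('o, 'm) cat \<Rightarrow> 'o \<Rightarrow> 'o \<Rightarrow> 'o \<Rightarrow> 'm" where
  "proj2 C x1 x2 x3 = pr2 C x1 x2 \<bullet>\<^bsub>C\<^esub> pr1 C (prd C x1 x2) x3"

definition proj3 :: "('o, 'm) cat \<Rightarrow> 'o \<Rightarrow> 'o \<Rightarrow> 'o \<Rightarrow> 'm" where
  "proj3 C x1 x2 x3 = pr2 C (prd C x1 x2) x3"

definition Tset :: "('o, 'm) cat \<Rightarrow> 'o \<Rightarrow> 'o \<Rightarrow> 'o \<Rightarrow> 'm set set" where
  "Tset C x1 x2 x3 =
     {r \<in> subobjs C (prd3 C x1 x2 x3).
        let p1 = proj1 C x1 x2 x3 \<bullet>\<^bsub>C\<^esub> rep r;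
            p2 = proj2 C x1 x2 x3 \<bullet>\<^bsub>C\<^esub> rep r;
            p3 = proj3 C x1 x2 x3 \<bullet>\<^bsub>C\<^esub> rep r
        in surjective C p1 \<and> surjective C p2 \<and> surjective C p3 \<and>
           monic C (pairing C p1 p2) \<and> monic C (pairing C p1 p3) \<and> monic C (pairing C p2 p3)}"

definition act3 ::
  "('o, 'm) cat \<Rightarrow> 'o \<Rightarrow> 'o \<Rightarrow> 'o \<Rightarrow> 'm \<Rightarrow> 'm \<Rightarrow> 'm \<Rightarrow> 'm set \<Rightarrow> 'm set" where
  "act3 C x1 x2 x3 g1 g2 g3 r =
     sub_of C (pairing C
       (pairing C (g1 \<bullet>\<^bsub>C\<^esub> proj1 C x1 x2 x3) (g2 \<bullet>\<^bsub>C\<^esub> proj2 C x1 x2 x3))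
       (g3 \<bullet>\<^bsub>C\<^esub> proj3 C x1 x2 x3) \<bullet>\<^bsub>C\<^esub> rep r)"

definition chi_T :: "('o, 'm) cat \<Rightarrow> 'o \<Rightarrow> 'o \<Rightarrow> 'o \<Rightarrow> 'm \<Rightarrow> 'm \<Rightarrow> 'm \<Rightarrow> nat" where
  "chi_T C x1 x2 x3 g1 g2 g3 = card {r \<in> Tset C x1 x2 x3. act3 C x1 x2 x3 g1 g2 g3 r = r}"

definition star ::
  "('o, 'm) cat \<Rightarrow> 'o \<Rightarrow> 'o \<Rightarrow> 'o \<Rightarrow> ('m \<Rightarrow> 'k::field) \<Rightarrow> ('m \<Rightarrow> 'k) \<Rightarrow> 'm \<Rightarrow> 'k" where
  "star C x1 x2 x f1 f2 h =
     (if h \<in> carrier (aut_group C x) then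
        1 / (of_nat (order (aut_group C x1)) * of_nat (order (aut_group C x2))) *
        (\<Sum>g1 \<in> carrier (aut_group C x1). \<Sum>g2 \<in> carrier (aut_group C x2).
           of_nat (chi_T C x1 x2 x g1 g2 h) * f1 g1 * f2 g2)
      else 0)"

text \<open>The direct sum of the groups \<open>\<R>(A(x))\<close>, with \<open>x\<close> running over \<open>X\<close>, and the
  inclusion of its summand with index \<open>x\<close>.\<close>

definition rep_sum :: "('o, 'm) cat \<Rightarrow> 'o set \<Rightarrow> ('o \<Rightarrow> 'm \<Rightarrow> 'k::field) monoid" where
  "rep_sum C X = sum_group X (\<lambda>x. add_monoid (rep_ring (aut_group C x)))"

definition rep_incl :: "'o set \<Rightarrow> 'o \<Rightarrow> ('m \<Rightarrow> 'k::field) \<Rightarrow> 'o \<Rightarrow> 'm \<Rightarrow> 'k" where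
  "rep_incl X x f = (\<lambda>y\<in>X. if y = x then f else (\<lambda>g. 0))"

end

theory Submission
 imports Defs "Jordan_Normal_Form.Char_Poly"
begin

text \<open>
 Let \<open>J n\<close> be the ideal of morphisms of \<open>T0\<close> that factor through objects of size \<open>< n\<close>, where the
 size of an object is the dimension of its endomorphism ring; proper subquotients have smaller size.
 By Moebius inversion the trace form of \<open>T0\<close> has nonzero Gram determinant, and this provides, by
 induction on \<open>n\<close>, an identity element of \<open>J n\<close> at every object. For \<open>n = size x\<close> its complement
 \<open>\<epsilon> x\<close> cuts out \<open>[x]\<^sup>0\<close>. By Goursat's lemma only the partial surjections \<open>x \<rightharpoonup> z\<close> survive
 multiplication by \<open>\<epsilon> z\<close>, whence \<open>End [x]\<^sup>0 = K[A(x)]\<close>, and its matrix units give the simple objects.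

 The group \<open>A(z)\<close> acts on \<open>\<epsilon> z Hom(P, [z])\<close>. Its character is additive in \<open>P\<close>, invariant under
 isomorphism, and irreducible at the simple objects over \<open>z\<close>; together these characters identify
 \<open>K(T)\<close> with the sum of the \<open>R(A(z))\<close>. For \<open>P = [x]\<^sup>0 \<otimes> [y]\<^sup>0\<close> the relations
 \<open>r \<subseteq> x \<times> y \<times> z\<close> that survive multiplication by \<open>\<epsilon> x \<otimes> \<epsilon> y\<close> and \<open>\<epsilon> z\<close> are exactly the
 elements of \<open>T(x, y, z)\<close>, and averaging over \<open>A(x) \<times> A(y)\<close> gives the formula for the product.
\<close>

text \<open>Semisimplicity is a result here, not an input. Its substitute is the trace form: the
  trace of a relation on \<open>x\<close> is the degree of its intersection with the diagonal, and
  \<open>omega\<close> of a map to the terminal object is the Moebius transform of the degrees of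
  subobjects, so the numbers \<open>omega\<close> are the diagonal part of the factored Gram matrix.
  The form stays nondegenerate in both completions. Hence a nonzero morphism has a nonzero composite
  with some partner, and where endomorphisms are scalars this partner splits it. Sizes are compared
  with all degrees set to 1. Every subquotient is then a retract, so no value of
  \<open>\<delta>\<close> has to be inverted. The Mal'cev condition acts through Goursat's lemma: it
  makes relations difunctional. The character of A(z) on \<epsilon> z Hom(P, [z]) is read off from
  coefficients at partial surjections, which form a basis modulo the ideal. Cyclicity of this trace
  yields additivity and invariance under isomorphism at once.\<close>

hide_const (open) Missing_Polynomial.monic
no_notation scalar_prod (infix \<open>\<bullet>\<close> 70)

section \<open>Regular categories\<close>

notation cmp (infixl \<open>**\<index>\<close> 70)

context category
begin

abbreviation dom :: "'m => 'o" where "dom == src C"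
abbreviation "cod == tgt C"
abbreviation "ar f == f \<in> arr C"
abbreviation "ob x == x \<in> obj C"
abbreviation "pg == pairing C"
abbreviation "pbk == is_pullback C"
abbreviation "fth == factors_through C"
abbreviation "srj == surjective C"
abbreviation mon :: "'m => bool" where "mon == monic C"
abbreviation "AG == aut_group C"
abbreviation "pd == prd C"
abbreviation "cls == sub_of C"
abbreviation "Sub == subobjs C"

lemma in_homs: "f : homs C x y \<longleftrightarrow> ar f & dom f = x & cod f = y"
 by (auto simp: homs_def)

lemma src_obj [simp]: "ar f ==> dom f : obj C"
 and tgt_obj [simp]: "ar f ==> cod f : obj C"
 using src_tgt by auto

lemma idt_arr [simp]:
 "ob x ==> idt C x : arr C"
 "ob x ==> dom (idt C x) = x"
 "ob x ==> cod (idt C x) = x"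
 using idt[of x] by (auto simp: in_homs)

lemma cmp_arr [simp]:
 assumes "ar f" "ar g" "dom g = cod f"
 shows "g ** f : arr C" "dom (g ** f) = dom f" "cod (g ** f) = cod g"
 using cmp[of f "dom f" "cod f" g "cod g"] assms by (auto simp: in_homs)

lemma cmp_idt' [simp]: "ar f ==> dom f = x ==> f ** idt C x = f"
 and idt_cmp' [simp]: "ar f ==> cod f = x ==> idt C x ** f = f"
 using cmp_idt[of f "dom f" "cod f"] idt_cmp[of f "dom f" "cod f"] by (auto simp: in_homs)

lemma assoc [simp]:
 assumes "ar f" "ar g" "ar h" "dom g = cod f" "dom h = cod g"
 shows "(h ** g) ** f = h ** (g ** f)"
 using cmp_assoc[of f "dom f" "dom g" g "dom h" h "cod h"] assms by (auto simp: in_homs)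

lemma eq_cmp:
 assumes "f ** a = g ** b" "ar a" "ar b" "ar f" "ar g" "ar h"
  "dom f = cod a" "dom g = cod b" "cod h = dom a" "cod h = dom b"
 shows "f ** (a ** h) = g ** (b ** h)"
 using assms by (metis assoc)

lemma monicD:
 assumes "mon m" "ar u" "ar v" "dom u = dom v" "cod u = dom m"
  "cod v = dom m" "m ** u = m ** v"
 shows "u = v"
proof -
 have "u : homs C (dom u) (dom m)" "v : homs C (dom u) (dom m)" "dom u : obj C"
  using assms by (auto simp: in_homs)
 thus ?thesis using assms(1,7) unfolding monic_def by blast
qed

lemma monicI:
 assumes "ar m"
  and "!!u v. ar u ==> ar v ==> dom u = dom v ==> cod u = dom m ==>
   cod v = dom m ==> m ** u = m ** v ==> u = v"
 shows "mon m"
 using assms unfolding monic_def by (auto simp: in_homs)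

lemma monic_arr [simp]: "mon m ==> ar m"
 by (simp add: monic_def)

lemma monic_idt [simp]: "ob x ==> mon (idt C x)"
 by (rule monicI) auto

lemma monic_cmp:
 assumes "mon m" "mon n" "dom m = cod n"
 shows "mon (m ** n)"
proof (rule monicI)
 fix u v
 assume *: "ar u" "ar v" "dom u = dom v" "cod u = dom (m ** n)"
  "cod v = dom (m ** n)" "(m ** n) ** u = (m ** n) ** v"
 have "n ** u = n ** v"
  by (rule monicD[OF assms(1)]) (use * assms in auto)
 moreover have "cod u = dom n" "cod v = dom n"
  using * assms by auto
 ultimately show "u = v"
  using monicD[OF assms(2), of u v] * by simp
qed (use assms in auto)

lemma monic_cancel:
 assumes "mon (m ** n)" "ar m" "ar n" "dom m = cod n"
 shows "mon n"
proof (rule monicI)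
 fix u v
 assume *: "ar u" "ar v" "dom u = dom v" "cod u = dom n"
  "cod v = dom n" "n ** u = n ** v"
 thus "u = v"
  using monicD[OF assms(1), of u v] * assms by simp
qed (use assms in auto)

lemma iso_arrI:
 assumes "ar f" "ar g" "dom g = cod f" "cod g = dom f"
  "g ** f = idt C (dom f)" "f ** g = idt C (cod f)"
 shows "iso_arr C f"
 using assms unfolding iso_arr_def by (auto simp: in_homs)

lemma iso_arrE:
 assumes "iso_arr C f"
 obtains g where "ar f" "ar g" "dom g = cod f" "cod g = dom f"
  "g ** f = idt C (dom f)" "f ** g = idt C (cod f)" "iso_arr C g"
proof -
 obtain g where g: "ar f" "ar g" "dom g = cod f" "cod g = dom f"
  "g ** f = idt C (dom f)" "f ** g = idt C (cod f)"
  using assms unfolding iso_arr_def by (auto simp: in_homs)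
 thus ?thesis using that[of g] iso_arrI[of g f] by simp
qed

lemma iso_arr_arr [simp]: "iso_arr C f ==> ar f"
 by (simp add: iso_arr_def)

lemma iso_monic:
 assumes "iso_arr C f"
 shows "mon f"
proof -
 obtain g where g: "ar f" "ar g" "dom g = cod f" "cod g = dom f"
  "g ** f = idt C (dom f)"
  using iso_arrE[OF assms] by metis
 show ?thesis
 proof (rule monicI)
  fix u v
  assume *: "ar u" "ar v" "dom u = dom v" "cod u = dom f"
   "cod v = dom f" "f ** u = f ** v"
  have "(g ** f) ** u = (g ** f) ** v"
   using g * assoc[of u f g] assoc[of v f g] by simp
  thus "u = v" using g * by simp
 qed (use g in simp)
qed

lemma iso_idt [simp]: "ob x ==> iso_arr C (idt C x)"
 by (rule iso_arrI[where g = "idt C x"]) auto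

lemma iso_cmp:
 assumes "iso_arr C f" "iso_arr C g" "dom g = cod f"
 shows "iso_arr C (g ** f)"
proof -
 obtain f' where f: "ar f" "ar f'" "dom f' = cod f" "cod f' = dom f"
  "f' ** f = idt C (dom f)" "f ** f' = idt C (cod f)"
  using iso_arrE[OF assms(1)] by metis
 obtain g' where g: "ar g" "ar g'" "dom g' = cod g" "cod g' = dom g"
  "g' ** g = idt C (dom g)" "g ** g' = idt C (cod g)"
  using iso_arrE[OF assms(2)] by metis
 have 1: "g' ** (g ** f) = f" 
  using f g assms by (metis assoc idt_cmp')
 have 2: "f ** (f' ** g') = g'"
  using f g assms by (metis assoc idt_cmp')
 show ?thesis
  by (rule iso_arrI[where g = "f' ** g'"]) (use f g assms 1 2 in auto)
qed

lemma split_monic_iso: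
 assumes "mon m" "ar k" "dom k = cod m" "cod k = dom m" "m ** k = idt C (cod m)"
 shows "iso_arr C m"
proof (rule iso_arrI[where g = k])
 show "k ** m = idt C (dom m)"
  by (rule monicD[OF assms(1)]) (use assms assoc[of m k m] in auto)
qed (use assms in auto)

section \<open>Subobjects as classes of mutually factoring monomorphisms\<close>

lemma fth_iff:
 "fth f m \<longleftrightarrow> (EX k:arr C. dom k = dom f & cod k = dom m & m ** k = f)"
 by (auto simp: factors_through_def in_homs)

lemma factors_through_trans:
 assumes "fth f m" "fth m n" "ar m" "ar n"
 shows "fth f n"
proof -
 obtain k l where k: "ar k" "dom k = dom f" "cod k = dom m" "m ** k = f"
  and l: "ar l" "dom l = dom m" "cod l = dom n" "n ** l = m"
  using assms(1,2) unfolding fth_iff by blast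
 have "n ** (l ** k) = f" using k l assms assoc[of k l n] by simp
 thus ?thesis
  unfolding fth_iff using k l assms(3,4) by (intro bexI[of _ "l ** k"]) auto
qed

lemma factors_through_refl [simp]: "ar m ==> fth m m"
 unfolding fth_iff by (intro bexI[of _ "idt C (dom m)"]) auto

lemma factors_through_cmp:
 assumes "ar f" "ar g" "cod g = dom f"
 shows "fth (f ** g) f"
 unfolding fth_iff using assms by auto

lemma factors_through_cmp':
 assumes "fth f m" "ar f" "ar m" "ar g" "cod g = dom f"
 shows "fth (f ** g) m"
 using assms factors_through_cmp factors_through_trans by blast

lemma sub_of_self: "mon m ==> m : cls m"
 by (simp add: sub_of_def)

lemma sub_of_eq_iff:
 assumes "mon m" "mon n" "cod m = cod n"
 shows "cls m = cls n \<longleftrightarrow> fth m n & fth n m"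
proof
 assume "cls m = cls n"
 hence "m : cls n" using sub_of_self[OF assms(1)] by simp
 thus "fth m n & fth n m" by (simp add: sub_of_def)
next
 assume *: "fth m n & fth n m"
 have "fth k m \<longleftrightarrow> fth k n"
  "fth m k \<longleftrightarrow> fth n k" if "ar k" for k
  using * that assms factors_through_trans monic_arr by blast+
 thus "cls m = cls n"
  unfolding sub_of_def using assms(3) by auto
qed

lemma sub_of_subobjs: "mon m ==> cod m = x ==> cls m : Sub x"
 by (auto simp: subobjs_def)

lemma rep_in: "s : Sub x ==> rep s : s"
 unfolding rep_def by (rule someI_ex) (auto simp: subobjs_def intro: sub_of_self)

lemma in_sub_eq:
 assumes "s : Sub x" "m : s"
 shows "mon m" "cod m = x" "cls m = s"
proof -
 obtain n where n: "mon n" "cod n = x" "s = cls n"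
  using assms by (auto simp: subobjs_def)
 show 1: "mon m" "cod m = x" using assms n by (auto simp: sub_of_def)
 show "cls m = s"
  using assms n 1 sub_of_eq_iff[of m n] by (auto simp: sub_of_def)
qed

lemma rep_sub:
 assumes "s : Sub x"
 shows "mon (rep s)" "cod (rep s) = x" "cls (rep s) = s" "rep s : arr C"
  "dom (rep s) : obj C"
 using in_sub_eq[OF assms rep_in[OF assms]] by auto

lemma factors_sub_sub_of:
 assumes "mon m"
 shows "factors_sub C f (cls m) \<longleftrightarrow> fth f m"
 unfolding factors_sub_def using assms
 by (auto simp: sub_of_def intro: factors_through_trans sub_of_self)

lemma factors_sub_rep:
 assumes "s : Sub x"
 shows "factors_sub C f s \<longleftrightarrow> fth f (rep s)"
 using factors_sub_sub_of[OF rep_sub(1)[OF assms]] rep_sub(3)[OF assms] by simp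

text \<open>A chosen representative agrees with a given monomorphism only up to isomorphism;
  whatever is defined through \<open>rep\<close> is carried to arbitrary monomorphisms along this
  \<open>i\<close>.\<close>

lemma rep_sub_of:
 assumes "mon m"
 obtains i where "iso_arr C i" "dom i = dom m" "cod i = dom (rep (cls m))"
  "rep (cls m) ** i = m"
proof -
 let ?n = "rep (cls m)"
 have s: "cls m : Sub (cod m)" using assms by (auto simp: subobjs_def)
 have n: "mon ?n" "cod ?n = cod m" "cls ?n = cls m"
  using rep_sub[OF s] by auto
 hence f: "fth m ?n" "fth ?n m"
  using sub_of_eq_iff[OF assms n(1)] by auto
 obtain i where i: "ar i" "dom i = dom m" "cod i = dom ?n" "?n ** i = m"
  using f(1) unfolding fth_iff by blast
 obtain j where j: "ar j" "dom j = dom ?n" "cod j = dom m" "m ** j = ?n"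
  using f(2) unfolding fth_iff by blast
 have "mon i" using assms i n monic_cancel[of ?n i] by simp
 moreover have "i ** j = idt C (cod i)"
  by (rule monicD[OF n(1)]) (use i j n assoc[of j i ?n] in auto)
 ultimately have "iso_arr C i" using split_monic_iso i j by simp
 thus ?thesis using that i by blast
qed

lemma sub_le_iff:
 assumes "s : Sub x" "t : Sub x"
 shows "sub_le C s t \<longleftrightarrow> fth (rep s) (rep t)"
proof
 assume "sub_le C s t"
 then obtain m where m: "m : s" "fth m (rep t)"
  unfolding sub_le_def factors_sub_rep[OF assms(2)] by blast
 hence "fth (rep s) m"
  using in_sub_eq[OF assms(1) m(1)] rep_in[OF assms(1)] by (auto simp: sub_of_def)
 thus "fth (rep s) (rep t)"
  using m in_sub_eq[OF assms(1) m(1)] rep_sub(1)[OF assms(2)]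
  by (meson factors_through_trans monic_arr)
next
 assume "fth (rep s) (rep t)"
 thus "sub_le C s t"
  unfolding sub_le_def factors_sub_rep[OF assms(2)] using rep_in[OF assms(1)] by blast
qed

lemma sub_le_sub_of:
 assumes "mon m" "mon n" "cod m = cod n"
 shows "sub_le C (cls m) (cls n) \<longleftrightarrow> fth m n"
proof
 assume "sub_le C (cls m) (cls n)"
 then obtain k where k: "k : cls m" "fth k n"
  unfolding sub_le_def factors_sub_sub_of[OF assms(2)] by blast
 hence "fth m k" "ar k" by (auto simp: sub_of_def)
 thus "fth m n"
  using k assms by (meson factors_through_trans monic_arr)
next
 assume "fth m n"
 thus "sub_le C (cls m) (cls n)"
  unfolding sub_le_def factors_sub_sub_of[OF assms(2)] using sub_of_self[OF assms(1)] by blast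
qed

lemma sub_le_refl: "s : Sub x ==> sub_le C s s"
 using sub_le_iff rep_sub by simp

lemma sub_le_trans:
 "s : Sub x ==> t : Sub x ==> u : Sub x ==> sub_le C s t ==> sub_le C t u ==>
  sub_le C s u"
 using factors_through_trans[of "rep s" "rep t" "rep u"] by (simp add: sub_le_iff rep_sub)

lemma sub_le_antisym:
 "s : Sub x ==> t : Sub x ==> sub_le C s t ==> sub_le C t s ==> s = t"
 using sub_le_iff rep_sub sub_of_eq_iff by metis

lemma whole_subobjs [simp]: "ob x ==> whole C x : Sub x"
 unfolding whole_def by (rule sub_of_subobjs) auto

lemma factors_through_idt: "ar f ==> cod f = x ==> fth f (idt C x)"
 unfolding fth_iff by (intro bexI[of _ f]) auto

lemma sub_of_iso:
 assumes "iso_arr C m" "cod m = x"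
 shows "cls m = whole C x"
proof -
 obtain k where k: "ar k" "dom k = cod m" "cod k = dom m" "m ** k = idt C (cod m)"
  using iso_arrE[OF assms(1)] by metis
 have "ar m" using assms by simp
 moreover from this have "fth (idt C x) m"
  unfolding fth_iff using k assms by (intro bexI[of _ k]) auto
 ultimately show ?thesis
  unfolding whole_def using assms
  by (subst sub_of_eq_iff) (auto simp: iso_monic factors_through_idt)
qed

lemma sub_of_whole:
 assumes "cls m = whole C x" "mon m" "cod m = x"
 shows "iso_arr C m"
proof -
 have x: "ob x" using assms by auto
 hence "fth (idt C x) m"
  using assms sub_of_eq_iff[of m "idt C x"] by (simp add: whole_def)
 then obtain k where "ar k" "dom k = dom (idt C x)" "cod k = dom m" "m ** k = idt C x"
  unfolding fth_iff by blast
 thus ?thesis using assms x split_monic_iso[OF assms(2), of k] by simp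
qed

lemma is_im_unique:
 assumes "is_im C f s" "is_im C f t"
 shows "s = t"
 using assms sub_le_antisym unfolding is_im_def by metis

lemma im_eqI: "is_im C f s ==> im C f = s"
 unfolding im_def using is_im_unique by (intro the_equality)

text \<open>Surjective morphisms are the extremal epimorphisms.\<close>

lemma surjective_iff:
 "srj f \<longleftrightarrow> ar f &
  (ALL m. mon m --> cod m = cod f --> fth f m --> iso_arr C m)"
proof (intro iffI conjI allI impI)
 fix m
 assume f: "srj f" and m: "mon m" "cod m = cod f" "fth f m"
 have arr: "ar f" using f by (simp add: surjective_def)
 have "sub_le C (whole C (cod f)) (cls m)"
  using f m sub_of_subobjs[OF m(1,2)] factors_sub_sub_of[OF m(1)]
  unfolding surjective_def is_im_def by blast
 hence "fth (idt C (cod f)) m"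
  unfolding whole_def using sub_le_sub_of[of "idt C (cod f)" m] m arr by simp
 then obtain k where "ar k" "dom k = dom (idt C (cod f))" "cod k = dom m"
  "m ** k = idt C (cod f)"
  unfolding fth_iff by blast
 thus "iso_arr C m" using split_monic_iso[OF m(1), of k] arr m by simp
next
 assume *: "ar f &
  (ALL m. mon m --> cod m = cod f --> fth f m --> iso_arr C m)"
 show "srj f"
  unfolding surjective_def is_im_def
 proof (intro conjI ballI impI)
  show "factors_sub C f (whole C (cod f))"
   unfolding whole_def using * by (simp add: factors_sub_sub_of factors_through_idt)
  fix t
  assume t: "t : Sub (cod f)" "factors_sub C f t"
  hence "iso_arr C (rep t)"
   using * rep_sub[OF t(1)] factors_sub_rep[OF t(1)] by simp
  hence "t = whole C (cod f)" using sub_of_iso rep_sub[OF t(1)] by metis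
  thus "sub_le C (whole C (cod f)) t" using t sub_le_refl by simp
 qed (use * in auto)
qed (simp add: surjective_def)

lemma surjective_arr [simp]: "srj f ==> ar f"
 by (simp add: surjective_def)

lemma surjectiveD:
 assumes "srj f" "mon m" "cod m = cod f" "ar k" "dom k = dom f"
  "cod k = dom m" "m ** k = f"
 shows "iso_arr C m"
 using assms unfolding surjective_iff fth_iff by blast

lemma surj_monic_iso: "srj f ==> mon f ==> iso_arr C f"
 unfolding surjective_iff by auto

lemma iso_cancel_split:
 assumes "iso_arr C (m ** k)" "mon m" "ar k" "dom m = cod k"
 shows "iso_arr C m"
proof -
 obtain g where g: "ar g" "dom g = cod m" "cod g = dom k"
  "(m ** k) ** g = idt C (cod m)"
  using iso_arrE[OF assms(1)] assms by (metis cmp_arr monic_arr)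
 show ?thesis
  by (rule split_monic_iso[of _ "k ** g"]) (use g assms in auto)
qed

lemma iso_surjective: "iso_arr C f ==> srj f"
 unfolding surjective_iff fth_iff by (metis iso_arr_arr iso_cancel_split)

lemma surjective_cancel:
 assumes "srj (g ** f)" "ar f" "ar g" "dom g = cod f"
 shows "srj g"
 unfolding surjective_iff
proof (intro conjI allI impI)
 fix m assume m: "mon m" "cod m = cod g" "fth g m"
 hence "fth (g ** f) m"
  using factors_through_cmp' assms by simp
 thus "iso_arr C m" using m assms unfolding surjective_iff by simp
qed (use assms in auto)

section \<open>Pullback squares\<close>

lemma pullbackI:
 assumes "ar f" "ar g" "ar a" "ar b" "cod f = cod g" "dom a = dom b"
  "cod a = dom f" "cod b = dom g" "f ** a = g ** b"
  and ex: "!!c d. ar c ==> ar d ==> dom c = dom d ==> cod c = dom f ==>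
   cod d = dom g ==> f ** c = g ** d ==>
   EX u:arr C. dom u = dom d & cod u = dom b & a ** u = c & b ** u = d"
  and un: "!!u v. ar u ==> ar v ==> dom u = dom v ==> cod u = dom b ==>
   cod v = dom b ==> a ** u = a ** v ==> b ** u = b ** v ==> u = v"
 shows "pbk f g a b"
 unfolding is_pullback_def
proof (intro conjI ballI impI)
 fix t c d
 assume t: "ob t" "c : homs C t (dom f)" "d : homs C t (dom g)" "f ** c = g ** d"
 then obtain u where "u:arr C" "dom u = dom d" "cod u = dom b" "a ** u = c" "b ** u = d"
  using ex[of c d] by (auto simp: in_homs)
 thus "EX! u. u : homs C t (dom a) & a ** u = c & b ** u = d"
  using un t assms by (intro ex1I[of _ u]) (auto simp: in_homs)
qed (use assms in auto)

lemma pbkD: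
 assumes "pbk f g a b"
 shows "ar f" "ar g" "ar a" "ar b" "cod f = cod g" "dom a = dom b"
  "cod a = dom f" "cod b = dom g" "f ** a = g ** b"
 using assms unfolding is_pullback_def by auto

lemma pullback_ex:
 assumes "pbk f g a b" "ar c" "ar d" "dom c = dom d" "cod c = dom f"
   "cod d = dom g" "f ** c = g ** d"
 shows "EX u. ar u & dom u = dom d & cod u = dom b & a ** u = c & b ** u = d"
proof -
 have "EX u. u : homs C (dom d) (dom a) & a ** u = c & b ** u = d"
  using assms unfolding is_pullback_def by (metis in_homs src_obj)
 thus ?thesis using pbkD[OF assms(1)] by (auto simp: in_homs)
qed

lemma pullback_un:
 assumes "pbk f g a b" "ar u" "ar v" "dom u = dom v" "cod u = dom b"
   "cod v = dom b" "a ** u = a ** v" "b ** u = b ** v"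
 shows "u = v"
proof -
 note F = pbkD[OF assms(1)]
 have *: "f ** (a ** u) = g ** (b ** u)"
  using eq_cmp[OF F(9), of u] F assms by simp
 have "EX! w. w : homs C (dom u) (dom a) & a ** w = a ** u & b ** w = b ** u"
  using assms(1) unfolding is_pullback_def
 proof (elim conjE)
  assume H: "ALL t:obj C. ALL c:homs C t (dom f). ALL d:homs C t (dom g). f ** c = g ** d -->
   (EX! u. u : homs C t (dom a) & a ** u = c & b ** u = d)"
  have "dom u : obj C" "a ** u : homs C (dom u) (dom f)" "b ** u : homs C (dom u) (dom g)"
   using assms F by (auto simp: in_homs)
  thus ?thesis using H * by blast
 qed
 thus ?thesis using assms F by (auto simp: in_homs)
qed

lemma pullback_sym:
 assumes "pbk f g a b"
 shows "pbk g f b a"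
proof -
 note F = pbkD[OF assms]
 show ?thesis
 proof (rule pullbackI)
  fix c d
  assume "ar c" "ar d" "dom c = dom d" "cod c = dom g"
   "cod d = dom f" "g ** c = f ** d"
  then obtain u where "u:arr C" "dom u = dom c" "cod u = dom b" "a ** u = d" "b ** u = c"
   using pullback_ex[OF assms, of d c] by metis
  thus "EX u:arr C. dom u = dom d & cod u = dom a & b ** u = c & a ** u = d"
   using F \<open>dom c = dom d\<close> by auto
 next
  fix u v
  assume "ar u" "ar v" "dom u = dom v" "cod u = dom a" "cod v = dom a"
   "b ** u = b ** v" "a ** u = a ** v"
  thus "u = v" using pullback_un[OF assms] F by simp
 qed (use F in auto)
qed

lemma pullback_paste:
 assumes "pbk f g a b" "pbk b h a' b'"
 shows "pbk f (g ** h) (a ** a') b'"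
proof -
 note F = pbkD[OF assms(1)] and G = pbkD[OF assms(2)]
 show ?thesis
 proof (rule pullbackI)
  show "f ** (a ** a') = (g ** h) ** b'"
   using F G eq_cmp[OF F(9), of a'] by simp
 next
  fix c d
  assume *: "ar c" "ar d" "dom c = dom d" "cod c = dom f"
   "cod d = dom (g ** h)" "f ** c = (g ** h) ** d"
  obtain u where u: "u:arr C" "dom u = dom (h ** d)" "cod u = dom b" "a ** u = c" "b ** u = h ** d"
   using pullback_ex[OF assms(1), of c "h ** d"] * F G by auto
  obtain w where w: "w:arr C" "dom w = dom d" "cod w = dom b'" "a' ** w = u" "b' ** w = d"
   using pullback_ex[OF assms(2), of u d] u * F G by auto
  show "EX u:arr C. dom u = dom d & cod u = dom b' & (a ** a') ** u = c & b' ** u = d"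
   using u w F G by (intro bexI[of _ w]) auto
 next
  fix u v
  assume *: "ar u" "ar v" "dom u = dom v" "cod u = dom b'" "cod v = dom b'"
   "(a ** a') ** u = (a ** a') ** v" "b' ** u = b' ** v"
  have "b ** (a' ** u) = b ** (a' ** v)"
   using eq_cmp[OF G(9), of u] eq_cmp[OF G(9), of v] * F G by simp
  hence "a' ** u = a' ** v"
   using pullback_un[OF assms(1), of "a' ** u" "a' ** v"] * F G by simp
  thus "u = v" using pullback_un[OF assms(2), of u v] * G by simp
 qed (use F G in auto)
qed

lemma pullback_iso:
 assumes "pbk f g a b" "pbk f g a' b'"
 obtains i where "iso_arr C i" "dom i = dom b'" "cod i = dom b" "a' = a ** i" "b' = b ** i"
proof -
 note F = pbkD[OF assms(1)] and G = pbkD[OF assms(2)]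
 obtain i where i: "i:arr C" "dom i = dom b'" "cod i = dom b" "a ** i = a'" "b ** i = b'"
  using pullback_ex[OF assms(1), of a' b'] G F by metis
 obtain j where j: "j:arr C" "dom j = dom b" "cod j = dom b'" "a' ** j = a" "b' ** j = b"
  using pullback_ex[OF assms(2), of a b] G F by metis
 have *: "a ** (i ** j) = a" "b ** (i ** j) = b" "a' ** (j ** i) = a'" "b' ** (j ** i) = b'"
  using i j F G assoc[of j i a] assoc[of j i b] assoc[of i j a'] assoc[of i j b'] by simp_all
 have "i ** j = idt C (dom b)"
  using pullback_un[OF assms(1), of "i ** j" "idt C (dom b)"] i j F * by simp
 moreover have "j ** i = idt C (dom b')"
  using pullback_un[OF assms(2), of "j ** i" "idt C (dom b')"] i j G * by simp
 ultimately have "iso_arr C i" using i j by (intro iso_arrI[of i j]) auto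
 thus ?thesis using that i by metis
qed

lemma pullback_cmp_iso:
 assumes "pbk f g a b" "iso_arr C i" "cod i = dom b"
 shows "pbk f g (a ** i) (b ** i)"
proof -
 note F = pbkD[OF assms(1)]
 obtain j where j: "ar i" "j:arr C" "dom j = cod i" "cod j = dom i"
  "j ** i = idt C (dom i)" "i ** j = idt C (cod i)"
  using iso_arrE[OF assms(2)] by metis
 show ?thesis
 proof (rule pullbackI)
  show "f ** (a ** i) = g ** (b ** i)" using eq_cmp[OF F(9), of i] F assms by simp
 next
  fix c d
  assume *: "ar c" "ar d" "dom c = dom d" "cod c = dom f" "cod d = dom g"
   "f ** c = g ** d"
  then obtain u where u: "u:arr C" "dom u = dom d" "cod u = dom b" "a ** u = c" "b ** u = d"
   using pullback_ex[OF assms(1), of c d] by metis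
  have "i ** (j ** u) = u" using assoc[of u j i] j u assms by simp
  thus "EX u:arr C. dom u = dom d & cod u = dom (b ** i) & (a ** i) ** u = c & (b ** i) ** u = d"
   using j u F assms by (intro bexI[of _ "j ** u"]) auto
 next
  fix u v
  assume *: "ar u" "ar v" "dom u = dom v" "cod u = dom (b ** i)"
   "cod v = dom (b ** i)" "(a ** i) ** u = (a ** i) ** v" "(b ** i) ** u = (b ** i) ** v"
  hence "i ** u = i ** v"
   using pullback_un[OF assms(1), of "i ** u" "i ** v"] F assms by simp
  thus "u = v" using monicD[OF iso_monic[OF assms(2)]] * F assms by simp
 qed (use F assms in auto)
qed

lemma pullback_trivial:
 assumes "ar f" "cod f = x"
 shows "pbk f (idt C x) (idt C (dom f)) f"
proof (rule pullbackI)
 fix c d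
 assume *: "ar c" "ar d" "dom c = dom d" "cod c = dom f"
  "cod d = dom (idt C x)" "f ** c = idt C x ** d"
 show "EX u:arr C. dom u = dom d & cod u = dom f & idt C (dom f) ** u = c & f ** u = d"
  using * assms by (intro bexI[of _ c]) auto
qed (use assms in auto)

lemma pullback_monic:
 assumes "pbk m g a b" "mon m"
 shows "mon b"
proof (rule monicI)
 note F = pbkD[OF assms(1)]
 fix u v
 assume *: "ar u" "ar v" "dom u = dom v" "cod u = dom b"
  "cod v = dom b" "b ** u = b ** v"
 have "m ** (a ** u) = m ** (a ** v)"
  using eq_cmp[OF F(9), of u] eq_cmp[OF F(9), of v] * F by simp
 hence "a ** u = a ** v" using monicD[OF assms(2), of "a ** u" "a ** v"] * F by simp
 thus "u = v" using pullback_un[OF assms(1)] * by simp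
qed (use pbkD[OF assms(1)] in auto)

lemma iso_obj_sym: "iso_obj C x y ==> iso_obj C y x"
 unfolding iso_obj_def by (metis (no_types, lifting) in_homs iso_arrE)

lemma iso_obj_trans: "iso_obj C x y ==> iso_obj C y z ==> iso_obj C x z"
 unfolding iso_obj_def using iso_cmp by (metis cmp_arr in_homs)

lemma iso_obj_refl: "ob x ==> iso_obj C x x"
 unfolding iso_obj_def by (metis iso_idt in_homs idt_arr)

lemma iso_obj_arr: "iso_arr C f ==> dom f = x ==> cod f = y ==> iso_obj C x y"
 unfolding iso_obj_def by (auto simp: in_homs)

end

section \<open>Terminal object, products and pullbacks from finite limits\<close>

context finitely_complete_category
begin

lemma ex_terminal: "EX t. is_terminal C t"
proof -
 obtain l p where "is_limit C [] {} l p"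
  using finite_limits[of "[]" "{}"] by (auto simp: finite_diagram_def)
 hence "is_terminal C l"
  by (auto simp: is_limit_def is_cone_def is_terminal_def)
 thus ?thesis by blast
qed

lemma is_terminal_terminal: "is_terminal C (terminal C)"
 unfolding terminal_def using ex_terminal by (rule someI_ex)

lemma terminal_obj [simp]: "terminal C : obj C"
 using is_terminal_terminal by (simp add: is_terminal_def)

definition to_term :: "'a => 'b" where
 "to_term x = (THE f. f : homs C x (terminal C))"

lemma to_term_arr [simp]:
 assumes "ob x"
 shows "to_term x : arr C" "dom (to_term x) = x" "cod (to_term x) = terminal C"
proof -
 have "EX! f. f : homs C x (terminal C)"
  using is_terminal_terminal assms by (auto simp: is_terminal_def)
 from theI'[OF this] show "to_term x : arr C" "dom (to_term x) = x" "cod (to_term x) = terminal C"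
  by (auto simp: to_term_def in_homs)
qed

lemma to_term_unique:
 assumes "ar f" "cod f = terminal C"
 shows "f = to_term (dom f)"
proof -
 have "EX! g. g : homs C (dom f) (terminal C)"
  using is_terminal_terminal assms by (auto simp: is_terminal_def)
 moreover have "f : homs C (dom f) (terminal C)" "to_term (dom f) : homs C (dom f) (terminal C)"
  using assms by (auto simp: in_homs)
 ultimately show ?thesis by blast
qed

lemma ex_product:
 assumes "ob x" "ob y"
 shows "EX p q. is_product C x y p q"
proof -
 obtain l p where "is_limit C [x, y] {} l p"
  using finite_limits[of "[x, y]" "{}"] assms by (auto simp: finite_diagram_def)
 hence cone: "is_cone C [x, y] {} l p"
  and lim: "!!t q. is_cone C [x, y] {} t q ==>
   EX! u. u : homs C t l & (ALL i < length [x, y]. p i ** u = q i)"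
  by (auto simp: is_limit_def)
 have less2: "(ALL i<Suc (Suc 0). P i) \<longleftrightarrow> P 0 & P (Suc 0)" for P
  by (auto simp: less_Suc_eq)
 have "is_product C x y (p 0) (p (Suc 0))"
  unfolding is_product_def
 proof (intro conjI ballI)
  fix t f g assume "ob t" "f : homs C t x" "g : homs C t y"
  hence "is_cone C [x, y] {} t (%i. if i = 0 then f else g)"
   by (auto simp: is_cone_def less_Suc_eq)
  from lim[OF this] cone
  show "EX! u. u : homs C t (dom (p 0)) & p 0 ** u = f & p (Suc 0) ** u = g"
   by (simp add: less2 is_cone_def in_homs)
 qed (use cone in \<open>auto simp: is_cone_def less2 in_homs\<close>)
 thus ?thesis by blast
qed

lemma is_product_pr:
 assumes "ob x" "ob y"
 shows "is_product C x y (pr1 C x y) (pr2 C x y)"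
proof -
 have "EX z. (%(p, q). is_product C x y p q) z" using ex_product[OF assms] by auto
 hence "(%(p, q). is_product C x y p q) (prod_cone C x y)"
  unfolding prod_cone_def by (rule someI_ex)
 thus ?thesis by (simp add: pr1_def pr2_def case_prod_beta)
qed

lemma pr_arr [simp]:
 assumes "ob x" "ob y"
 shows "pr1 C x y : arr C" "dom (pr1 C x y) = pd x y" "cod (pr1 C x y) = x"
  "pr2 C x y : arr C" "dom (pr2 C x y) = pd x y" "cod (pr2 C x y) = y"
  "pd x y : obj C"
 using is_product_pr[OF assms] unfolding is_product_def prd_def by auto

lemma pairing_ex1:
 assumes "ar f" "ar g" "dom f = dom g"
 shows "EX! u. u : homs C (dom f) (pd (cod f) (cod g)) &
  pr1 C (cod f) (cod g) ** u = f & pr2 C (cod f) (cod g) ** u = g"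
proof -
 have "f : homs C (dom f) (cod f)" "g : homs C (dom f) (cod g)" "dom f : obj C"
  using assms by (auto simp: in_homs)
 thus ?thesis
  using is_product_pr[of "cod f" "cod g"] assms unfolding is_product_def prd_def by auto
qed

lemma pairing_arr [simp]:
 assumes "ar f" "ar g" "dom f = dom g"
 shows "pg f g : arr C" "dom (pg f g) = dom f"
  "cod (pg f g) = pd (cod f) (cod g)"
 using theI'[OF pairing_ex1[OF assms]] unfolding pairing_def[symmetric] by (auto simp: in_homs)

lemma pr_pairing [simp]:
 assumes "ar f" "ar g" "dom f = dom g" "cod f = x" "cod g = y"
 shows "pr1 C x y ** pg f g = f" "pr2 C x y ** pg f g = g"
 using theI'[OF pairing_ex1[OF assms(1-3)]] assms(4,5) unfolding pairing_def[symmetric] by auto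

lemma prd_eqI:
 assumes "ar u" "ar v" "dom u = dom v" "cod u = pd x y" "cod v = pd x y"
  "ob x" "ob y" "pr1 C x y ** u = pr1 C x y ** v" "pr2 C x y ** u = pr2 C x y ** v"
 shows "u = v"
proof -
 let ?f = "pr1 C x y ** u" and ?g = "pr2 C x y ** u"
 have "EX! w. w : homs C (dom ?f) (pd (cod ?f) (cod ?g)) &
  pr1 C (cod ?f) (cod ?g) ** w = ?f & pr2 C (cod ?f) (cod ?g) ** w = ?g"
  using assms by (intro pairing_ex1) auto
 hence "EX! w. w : homs C (dom u) (pd x y) & pr1 C x y ** w = ?f & pr2 C x y ** w = ?g"
  using assms(1-7) by simp
 thus ?thesis using assms by (auto simp: in_homs)
qed

lemma pairing_cmp [simp]:
 assumes "ar f" "ar g" "dom f = dom g" "ar h" "cod h = dom f"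
 shows "pg f g ** h = pg (f ** h) (g ** h)"
proof (rule prd_eqI[of _ _ "cod f" "cod g"])
 have "pr1 C (cod f) (cod g) ** (pg f g ** h) = (pr1 C (cod f) (cod g) ** pg f g) ** h"
  "pr2 C (cod f) (cod g) ** (pg f g ** h) = (pr2 C (cod f) (cod g) ** pg f g) ** h"
  using assms by (subst assoc; simp)+
 thus "pr1 C (cod f) (cod g) ** (pg f g ** h) =
   pr1 C (cod f) (cod g) ** pg (f ** h) (g ** h)"
  "pr2 C (cod f) (cod g) ** (pg f g ** h) =
   pr2 C (cod f) (cod g) ** pg (f ** h) (g ** h)"
  using assms by simp_all
qed (use assms in auto)

lemma pairing_eta:
 assumes "ar u" "cod u = pd x y" "ob x" "ob y"
 shows "pg (pr1 C x y ** u) (pr2 C x y ** u) = u"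
 by (rule prd_eqI[of _ _ x y]) (use assms in auto)

lemma pairing_eq_iff:
 assumes "ar f" "ar g" "dom f = dom g" "ar f'" "ar g'" "dom f' = dom g'"
  "cod f = cod f'" "cod g = cod g'"
 shows "pg f g = pg f' g' \<longleftrightarrow> f = f' & g = g'"
 using assms by (metis pr_pairing)

lemma pairing_pr [simp]:
 "ob x ==> ob y ==> pg (pr1 C x y) (pr2 C x y) = idt C (pd x y)"
 by (rule prd_eqI[of _ _ x y]) auto

lemma ex_pullback:
 assumes "ar f" "ar g" "cod f = cod g"
 obtains a b where "pbk f g a b"
proof -
 let ?xs = "[dom f, dom g, cod f]" and ?E = "{(0, 2, f), (1, 2, g)}"
 have less3: "(ALL i<length ?xs. P i) \<longleftrightarrow> P 0 & P 1 & P 2" for P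
  by (auto simp: less_Suc_eq numeral_2_eq_2)
 obtain l p where "is_limit C ?xs ?E l p"
  using finite_limits[of ?xs ?E] assms by (auto simp: finite_diagram_def in_homs)
 hence cone: "is_cone C ?xs ?E l p"
  and lim: "!!t q. is_cone C ?xs ?E t q ==>
   EX! u. u : homs C t l & (ALL i < length ?xs. p i ** u = q i)"
  by (auto simp: is_limit_def)
 have c: "ob l" "p 0 : homs C l (dom f)" "p 1 : homs C l (dom g)"
  "p 2 : homs C l (cod f)" "f ** p 0 = p 2" "g ** p 1 = p 2"
  using cone unfolding is_cone_def less3 by auto
 have "pbk f g (p 0) (p 1)"
 proof (rule pullbackI)
  fix u v assume *: "ar u" "ar v" "dom u = dom v" "cod u = dom (p 1)"
   "cod v = dom (p 1)" "p 0 ** u = p 0 ** v" "p 1 ** u = p 1 ** v"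
  let ?q = "%i. p i ** u"
  have cq: "f ** (p 0 ** u) = p 2 ** u" "g ** (p 1 ** u) = p 2 ** u" "f ** (p 0 ** v) = p 2 ** v"
   using c assms * assoc[of u "p 0" f] assoc[of u "p 1" g] assoc[of v "p 0" f]
   by (simp_all add: in_homs)
  have "is_cone C ?xs ?E (dom u) ?q"
   unfolding is_cone_def less3 using c * cq assms by (auto simp: in_homs)
  from lim[OF this] have "EX! w. w : homs C (dom u) l & (ALL i < length ?xs. p i ** w = ?q i)" .
  moreover have "p 2 ** u = p 2 ** v" using cq * by simp
  ultimately show "u = v"
   using * c unfolding less3 by (auto simp: in_homs)
 next
  fix s d assume *: "ar s" "ar d" "dom s = dom d" "cod s = dom f"
   "cod d = dom g" "f ** s = g ** d"
  let ?q = "%i. if i = 0 then s else if i = 1 then d else f ** s"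
  have "is_cone C ?xs ?E (dom s) ?q"
   unfolding is_cone_def less3 using c * assms by (auto simp: in_homs)
  from lim[OF this] obtain w where "w : homs C (dom s) l" "ALL i < length ?xs. p i ** w = ?q i"
   by auto
  thus "EX u:arr C. dom u = dom d & cod u = dom (p 1) & p 0 ** u = s & p 1 ** u = d"
   using * c unfolding less3 by (auto simp: in_homs)
 qed (use c assms in \<open>auto simp: in_homs\<close>)
 thus ?thesis using that by blast
qed

lemma monic_pairing_iff:
 assumes "ar f" "ar g" "dom f = dom g"
 shows "mon (pg f g) \<longleftrightarrow>
  (ALL u:arr C. ALL v:arr C. dom u = dom v --> cod u = dom f --> cod v = dom f -->
   f ** u = f ** v --> g ** u = g ** v --> u = v)"
proof
 assume m: "mon (pg f g)"
 show "ALL u:arr C. ALL v:arr C. dom u = dom v --> cod u = dom f --> cod v = dom f -->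
   f ** u = f ** v --> g ** u = g ** v --> u = v"
  using monicD[OF m] assms by simp
next
 assume *: "ALL u:arr C. ALL v:arr C. dom u = dom v --> cod u = dom f --> cod v = dom f -->
   f ** u = f ** v --> g ** u = g ** v --> u = v"
 show "mon (pg f g)"
 proof (rule monicI)
  fix u v assume "ar u" "ar v" "dom u = dom v" "cod u = dom (pg f g)"
   "cod v = dom (pg f g)" "pg f g ** u = pg f g ** v"
  thus "u = v"
   using * assms by (simp add: pairing_eq_iff)
 qed (use assms in simp)
qed

end

section \<open>Images and surjections in regular categories\<close>

context regular_category
begin

lemma im_fact:
 assumes "ar f"
 shows "im C f : Sub (cod f)"
  and "surj_part C f : arr C" "dom (surj_part C f) = dom f"
  "cod (surj_part C f) = dom (rep (im C f))"
  "rep (im C f) ** surj_part C f = f" "srj (surj_part C f)"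
proof -
 obtain s where "is_im C f s" using has_im[OF assms] by blast
 hence im: "is_im C f (im C f)" using im_eqI by simp
 thus s: "im C f : Sub (cod f)" by (simp add: is_im_def)
 note r = rep_sub[OF s]
 have "fth f (rep (im C f))"
  using im factors_sub_rep[OF s] by (simp add: is_im_def)
 then obtain e where e: "ar e" "dom e = dom f" "cod e = dom (rep (im C f))"
  "rep (im C f) ** e = f"
  unfolding fth_iff by blast
 have "surj_part C f = e"
  unfolding surj_part_def
 proof (rule the_equality)
  fix e' assume "e' : homs C (dom f) (dom (rep (im C f))) & f = rep (im C f) ** e'"
  thus "e' = e" using monicD[OF r(1), of e' e] e by (auto simp: in_homs)
 qed (use e in \<open>auto simp: in_homs\<close>)
 thus sp: "surj_part C f : arr C" "dom (surj_part C f) = dom f"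
  "cod (surj_part C f) = dom (rep (im C f))" "rep (im C f) ** surj_part C f = f"
  using e by auto
 \<comment> \<open>If the surjective part factors through a mono \<open>m\<close>, then
   \<open>f\<close> factors through \<open>rep (im C f) ** m\<close>; minimality of the image forces
   \<open>m\<close> to be split, hence invertible.\<close>
 show "srj (surj_part C f)"
  unfolding surjective_iff
 proof (intro conjI allI impI)
  fix m assume m: "mon m" "cod m = cod (surj_part C f)" "fth (surj_part C f) m"
  then obtain k where k: "ar k" "dom k = dom f" "cod k = dom m"
   "m ** k = surj_part C f"
   unfolding fth_iff using sp by auto
  let ?n = "rep (im C f) ** m"
  have n: "mon ?n" "cod ?n = cod f" "dom ?n = dom m"
   using monic_cmp r m sp by auto
  have "?n ** k = f" using k sp r m by simp
  hence "fth f ?n"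
   unfolding fth_iff using k n m sp r by (intro bexI[of _ k]) auto
  hence "sub_le C (im C f) (cls ?n)"
   using im sub_of_subobjs[OF n(1,2)] factors_sub_sub_of[OF n(1)] by (auto simp: is_im_def)
  hence "fth (rep (im C f)) ?n"
   using sub_le_sub_of[OF r(1) n(1)] r n by simp
  then obtain l where l: "ar l" "dom l = dom (rep (im C f))" "cod l = dom m"
   "?n ** l = rep (im C f)"
   unfolding fth_iff using n by auto
  have "m ** l = idt C (cod m)"
   using monicD[OF r(1), of "m ** l" "idt C (cod m)"] l m sp r by simp
  thus "iso_arr C m" using split_monic_iso[OF m(1), of l] l m sp by simp
 qed (use sp in simp)
qed

text \<open>A mono \<open>m\<close> through which \<open>e ** f\<close> factors is pulled back along
  \<open>e\<close>. The result is a mono through which \<open>f\<close> factors, hence invertible,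
  so \<open>e\<close> itself factors through \<open>m\<close>.\<close>

lemma surjective_cmp:
 assumes "srj e" "srj f" "dom e = cod f"
 shows "srj (e ** f)"
 unfolding surjective_iff
proof (intro conjI allI impI)
 fix m assume m: "mon m" "cod m = cod (e ** f)" "fth (e ** f) m"
 have [simp]: "ar e" "ar f" using assms by auto
 obtain k where k: "ar k" "dom k = dom f" "cod k = dom m" "m ** k = e ** f"
  using m(3) assms unfolding fth_iff by auto
 obtain a b where ab: "pbk m e a b"
  using ex_pullback[of m e] m assms by auto
 note F = pbkD[OF ab]
 obtain u where u: "ar u" "dom u = dom f" "cod u = dom b" "a ** u = k" "b ** u = f"
  using pullback_ex[OF ab, of k f] k assms by auto
 have "iso_arr C b"
  using surjectiveD[OF assms(2) pullback_monic[OF ab m(1)], of u] u F assms by simp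
 then obtain j where j: "ar j" "dom j = dom e" "cod j = dom b" "b ** j = idt C (dom e)"
  using iso_arrE F by metis
 have "m ** (a ** j) = e"
  using eq_cmp[OF F(9), of j] F j by simp
 thus "iso_arr C m"
  using surjectiveD[OF assms(1) m(1), of "a ** j"] m j F assms by simp
qed (use assms in auto)

text \<open>Surjections are left orthogonal to monomorphisms: \<open>e\<close> factors through the
  pullback of \<open>m\<close> along \<open>c\<close>, which is therefore invertible and yields the
  diagonal fill-in.\<close>

lemma surj_factor:
 assumes "srj e" "mon m" "ar c" "dom c = cod e" "cod c = cod m"
  "ar k" "dom k = dom e" "cod k = dom m" "m ** k = c ** e"
 shows "EX d. ar d & dom d = dom c & cod d = dom m & m ** d = c"
proof -
 have [simp]: "ar e" "ar m" using assms by auto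
 obtain a b where ab: "pbk m c a b"
  using ex_pullback[of m c] assms by auto
 note F = pbkD[OF ab]
 obtain u where u: "ar u" "dom u = dom e" "cod u = dom b" "a ** u = k" "b ** u = e"
  using pullback_ex[OF ab, of k e] assms by auto
 have "iso_arr C b"
  using surjectiveD[OF assms(1) pullback_monic[OF ab assms(2)], of u] u F assms by simp
 then obtain j where j: "ar j" "dom j = dom c" "cod j = dom b" "b ** j = idt C (dom c)"
  using iso_arrE F by metis
 have "m ** (a ** j) = c"
  using eq_cmp[OF F(9), of j] F j assms(3) by simp
 thus ?thesis using j F by (intro exI[of _ "a ** j"]) simp
qed

text \<open>Fill-in against the diagonal: since \<open>u ** e = v ** e\<close>, the pair of
  \<open>u\<close> and \<open>v\<close> factors through the diagonal after composing with
  \<open>e\<close>, hence already before.\<close>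

lemma surj_epi:
 assumes "srj e" "ar u" "ar v" "dom u = cod e" "dom v = cod e"
  "cod u = cod v" "u ** e = v ** e"
 shows "u = v"
proof -
 have [simp]: "ar e" using assms by auto
 let ?D = "pg (idt C (cod u)) (idt C (cod u))"
 have "mon ?D"
  using assms by (subst monic_pairing_iff) auto
 moreover have "?D ** (u ** e) = pg u v ** e"
  using assms by simp
 ultimately obtain d where d: "ar d" "dom d = dom u" "cod d = cod u"
  "?D ** d = pg u v"
  using surj_factor[OF assms(1), of ?D "pg u v" "u ** e"] assms by auto
 hence "pg d d = pg u v" using assms by simp
 thus ?thesis using d assms by (metis pr_pairing)
qed

text \<open>Uniqueness of the factorization into a surjection followed by a mono. The remaining
  isomorphism \<open>i\<close> has degree 1, so degrees may be computed from any such
  factorization.\<close>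

lemma surj_part_eq:
 assumes "mon m" "srj e" "dom m = cod e"
 shows "im C (m ** e) = cls m"
  and "EX i. iso_arr C i & dom i = cod e & surj_part C (m ** e) = i ** e"
proof -
 have [simp]: "ar m" "ar e" using assms by auto
 have "is_im C (m ** e) (cls m)"
  unfolding is_im_def
 proof (intro conjI ballI impI)
  show "factors_sub C (m ** e) (cls m)"
   using assms by (simp add: factors_sub_sub_of factors_through_cmp)
  fix t assume t: "t : Sub (cod (m ** e))" "factors_sub C (m ** e) t"
  note r = rep_sub[OF t(1)]
  obtain k where k: "ar k" "dom k = dom e" "cod k = dom (rep t)" "rep t ** k = m ** e"
   using t(2) assms unfolding factors_sub_rep[OF t(1)] fth_iff by auto
  obtain d where "ar d" "dom d = dom m" "cod d = dom (rep t)" "rep t ** d = m"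
   using surj_factor[OF assms(2) r(1), of m k] k r assms by auto
  hence "fth m (rep t)" unfolding fth_iff by blast
  thus "sub_le C (cls m) t"
   using sub_le_sub_of[OF assms(1) r(1)] r assms by simp
 qed (use assms in \<open>auto intro: sub_of_subobjs\<close>)
 thus im: "im C (m ** e) = cls m" by (rule im_eqI)
 obtain i where i: "iso_arr C i" "dom i = dom m" "cod i = dom (rep (cls m))"
  "rep (cls m) ** i = m"
  using rep_sub_of[OF assms(1)] by metis
 note S = im_fact[of "m ** e", unfolded im]
 have "rep (cls m) ** (i ** e) = m ** e"
  using i assms assoc[of e i "rep (cls m)"] rep_sub[OF sub_of_subobjs[OF assms(1) refl]] by simp
 hence "surj_part C (m ** e) = i ** e"
  using monicD[OF rep_sub(1)[OF sub_of_subobjs[OF assms(1) refl]], of "surj_part C (m ** e)" "i ** e"]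
   S i assms by simp
 thus "EX i. iso_arr C i & dom i = cod e & surj_part C (m ** e) = i ** e"
  using i assms by auto
qed

text \<open>Points of an image lift locally, i.e. after a surjective base change.\<close>

lemma im_lift:
 assumes "ar p" "ar c" "cod c = cod p" "fth c (rep (im C p))"
 shows "EX e k. srj e & cod e = dom c & ar k & dom k = dom e &
  cod k = dom p & p ** k = c ** e"
proof -
 note S = im_fact[OF assms(1)]
 note r = rep_sub[OF S(1)]
 obtain d where d: "ar d" "dom d = dom c" "cod d = dom (rep (im C p))" "rep (im C p) ** d = c"
  using assms(4) unfolding fth_iff by blast
 obtain a b where ab: "pbk (surj_part C p) d a b"
  using ex_pullback[of "surj_part C p" d] S d by auto
 note F = pbkD[OF ab]
 have "p ** a = rep (im C p) ** (surj_part C p ** a)"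
  using S F r assoc[of a "surj_part C p" "rep (im C p)"] by simp
 also have "... = c ** b"
  using F r d assoc[of b d "rep (im C p)"] by simp
 finally have "p ** a = c ** b" .
 thus ?thesis
  using surjective_pullback[OF S(6) ab] F d S by (intro exI[of _ b] exI[of _ a]) simp
qed

text \<open>Converse of \<open>im_lift\<close>: a point that lifts to the source of \<open>p\<close>
  after a surjective base change lies in the image, by fill-in against the mono part of
  \<open>p\<close>.\<close>

lemma im_factor:
 assumes "ar p" "ar c" "cod c = cod p" "srj e" "cod e = dom c" "ar k"
  "dom k = dom e" "cod k = dom p" "p ** k = c ** e"
 shows "fth c (rep (im C p))"
proof -
 note S = im_fact[OF assms(1)]
 note r = rep_sub[OF S(1)]
 have "rep (im C p) ** (surj_part C p ** k) = c ** e"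
  using S r assms assoc[of k "surj_part C p" "rep (im C p)"] by simp
 then obtain d where "ar d" "dom d = dom c" "cod d = dom (rep (im C p))" "rep (im C p) ** d = c"
  using surj_factor[OF assms(4) r(1) assms(2), of "surj_part C p ** k"] S r assms by auto
 thus ?thesis unfolding fth_iff by blast
qed

end

section \<open>Linear tensor categories\<close>

lemma sum_fun_apply: "(SUM i:I. f i) x = (SUM i:I. f i x)"
 by (induction I rule: infinite_finite_induct) (simp_all add: plus_fun_def zero_fun_def)

text \<open>Morphisms are functions in all the categories below. Pointwise evaluation of sums and
  zeros is therefore kept out of the simplifier, so that composites can be calculated with as
  vectors; it is invoked by name where coefficients are compared.\<close>

lemmas fun_simps = plus_fun_apply zero_fun_apply minus_apply uminus_apply sum_fun_apply

declare plus_fun_apply [simp del] zero_fun_apply [simp del] minus_apply [simp del] uminus_apply [simp del]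

text \<open>Additivity and homogeneity carry no \<open>Hom\<close> premises: composition and tensor
  product are given by bilinear formulas on the whole ambient group. The locale is stable under both
  completions, so its consequences are available at all three levels.\<close>

locale linear_tensor_category =
 fixes D :: "('k::field, 'o, 'h::ab_group_add) tcat"
 assumes vs: "vector_space (Scl D)"
  and Hom_subspace: "X : Obj D ==> Y : Obj D ==> module.subspace (Scl D) (Hom D X Y)"
  and Idn_Hom: "X : Obj D ==> Idn D X : Hom D X X"
  and Cmp_Hom: "X : Obj D ==> Y : Obj D ==> Z : Obj D ==> f : Hom D X Y ==> g : Hom D Y Z ==>
   Cmp D X Y Z g f : Hom D X Z"
  and Cmp_assoc: "W : Obj D ==> X : Obj D ==> Y : Obj D ==> Z : Obj D ==>
   f : Hom D W X ==> g : Hom D X Y ==> h : Hom D Y Z ==>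
   Cmp D W X Z (Cmp D X Y Z h g) f = Cmp D W Y Z h (Cmp D W X Y g f)"
  and Cmp_Idn: "X : Obj D ==> Y : Obj D ==> f : Hom D X Y ==> Cmp D X X Y f (Idn D X) = f"
  and Idn_Cmp: "X : Obj D ==> Y : Obj D ==> f : Hom D X Y ==> Cmp D X Y Y (Idn D Y) f = f"
  and Cmp_add_right: "Cmp D X Y Z g (f + f') = Cmp D X Y Z g f + Cmp D X Y Z g f'"
  and Cmp_add_left: "Cmp D X Y Z (g + g') f = Cmp D X Y Z g f + Cmp D X Y Z g' f"
  and Cmp_Scl_right: "Cmp D X Y Z g (Scl D c f) = Scl D c (Cmp D X Y Z g f)"
  and Cmp_Scl_left: "Cmp D X Y Z (Scl D c g) f = Scl D c (Cmp D X Y Z g f)"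
  and TenO_Obj: "X : Obj D ==> Y : Obj D ==> TenO D X Y : Obj D"
  and TenM_Hom: "X : Obj D ==> X' : Obj D ==> Y : Obj D ==> Y' : Obj D ==>
   f : Hom D X X' ==> g : Hom D Y Y' ==> TenM D X X' Y Y' f g : Hom D (TenO D X Y) (TenO D X' Y')"
  and TenM_Idn: "X : Obj D ==> Y : Obj D ==> TenM D X X Y Y (Idn D X) (Idn D Y) = Idn D (TenO D X Y)"
  and TenM_Cmp: "X : Obj D ==> X' : Obj D ==> X'' : Obj D ==> Y : Obj D ==> Y' : Obj D ==> Y'' : Obj D ==>
   f : Hom D X X' ==> f' : Hom D X' X'' ==> g : Hom D Y Y' ==> g' : Hom D Y' Y'' ==>
   TenM D X X'' Y Y'' (Cmp D X X' X'' f' f) (Cmp D Y Y' Y'' g' g) =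
   Cmp D (TenO D X Y) (TenO D X' Y') (TenO D X'' Y'') (TenM D X' X'' Y' Y'' f' g') (TenM D X X' Y Y' f g)"
  and TenM_add_right: "TenM D X X' Y Y' f (g + g') = TenM D X X' Y Y' f g + TenM D X X' Y Y' f g'"
  and TenM_add_left: "TenM D X X' Y Y' (f + f') g = TenM D X X' Y Y' f g + TenM D X X' Y Y' f' g"
  and TenM_Scl_right: "TenM D X X' Y Y' f (Scl D c g) = Scl D c (TenM D X X' Y Y' f g)"
  and TenM_Scl_left: "TenM D X X' Y Y' (Scl D c f) g = Scl D c (TenM D X X' Y Y' f g)"
begin

sublocale vector_space "Scl D"
 by (rule vs)

lemma Hom_zero [simp]: "X : Obj D ==> Y : Obj D ==> 0 : Hom D X Y"
 using Hom_subspace subspace_0 by blast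

lemma Hom_add: "X : Obj D ==> Y : Obj D ==> f : Hom D X Y ==> g : Hom D X Y ==> f + g : Hom D X Y"
 using Hom_subspace subspace_add by blast

lemma Hom_diff: "X : Obj D ==> Y : Obj D ==> f : Hom D X Y ==> g : Hom D X Y ==> f - g : Hom D X Y"
 using Hom_subspace subspace_diff by blast

lemma Hom_Scl: "X : Obj D ==> Y : Obj D ==> f : Hom D X Y ==> Scl D c f : Hom D X Y"
 using Hom_subspace subspace_scale by blast

lemma Hom_sum: "X : Obj D ==> Y : Obj D ==> (!!i. i : I ==> f i : Hom D X Y) ==> sum f I : Hom D X Y"
 using Hom_subspace subspace_sum by blast

lemma Cmp_zero_right [simp]: "Cmp D X Y Z g 0 = 0"
 using Cmp_add_right[of X Y Z g 0 0] by simp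

lemma Cmp_zero_left [simp]: "Cmp D X Y Z 0 f = 0"
 using Cmp_add_left[of X Y Z 0 0 f] by simp

lemma Cmp_diff_right: "Cmp D X Y Z g (f - f') = Cmp D X Y Z g f - Cmp D X Y Z g f'"
 using Cmp_add_right[of X Y Z g "f - f'" f'] by (simp add: algebra_simps)

lemma Cmp_diff_left: "Cmp D X Y Z (g - g') f = Cmp D X Y Z g f - Cmp D X Y Z g' f"
 using Cmp_add_left[of X Y Z "g - g'" g' f] by (simp add: algebra_simps)

lemma Cmp_sum_right: "Cmp D X Y Z g (sum f I) = (SUM i:I. Cmp D X Y Z g (f i))"
 by (induction I rule: infinite_finite_induct) (simp_all add: Cmp_add_right)

lemma Cmp_sum_left: "Cmp D X Y Z (sum g I) f = (SUM i:I. Cmp D X Y Z (g i) f)"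
 by (induction I rule: infinite_finite_induct) (simp_all add: Cmp_add_left)

lemma TenM_zero_right [simp]: "TenM D X X' Y Y' f 0 = 0"
 using TenM_add_right[of X X' Y Y' f 0 0] by simp

lemma TenM_zero_left [simp]: "TenM D X X' Y Y' 0 g = 0"
 using TenM_add_left[of X X' Y Y' 0 0 g] by simp

lemma TenM_sum_right: "TenM D X X' Y Y' f (sum g I) = (SUM i:I. TenM D X X' Y Y' f (g i))"
 by (induction I rule: infinite_finite_induct) (simp_all add: TenM_add_right)

lemma TenM_sum_left: "TenM D X X' Y Y' (sum f I) g = (SUM i:I. TenM D X X' Y Y' (f i) g)"
 by (induction I rule: infinite_finite_induct) (simp_all add: TenM_add_left)

end

section \<open>Weighted spans\<close>

context finitely_complete_category
begin

text \<open>The map \<open>f\<close> times the identity of \<open>w\<close> is a base change of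
  \<open>f\<close> along a projection, which is how surjectivity and degree pass to
  products.\<close>

lemma pullback_pr1:
 assumes "ar f" "ob w" "dom f = x" "cod f = y"
 shows "pbk f (pr1 C y w) (pr1 C x w) (pg (f ** pr1 C x w) (pr2 C x w))"
proof (rule pullbackI)
 have [simp]: "ob x" "ob y" using assms by auto
 {
  fix c d assume "ar c" "ar d" "dom c = dom d" "cod c = dom f"
   "cod d = dom (pr1 C y w)" "f ** c = pr1 C y w ** d"
  thus "EX u:arr C. dom u = dom d & cod u = dom (pg (f ** pr1 C x w) (pr2 C x w)) &
    pr1 C x w ** u = c & pg (f ** pr1 C x w) (pr2 C x w) ** u = d"
   using assms pairing_eta[of d y w]
   by (intro bexI[of _ "pg c (pr2 C y w ** d)"]) (auto simp: assms)
 next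
  fix u v assume *: "ar u" "ar v" "dom u = dom v"
   "cod u = dom (pg (f ** pr1 C x w) (pr2 C x w))"
   "cod v = dom (pg (f ** pr1 C x w) (pr2 C x w))" "pr1 C x w ** u = pr1 C x w ** v"
   "pg (f ** pr1 C x w) (pr2 C x w) ** u = pg (f ** pr1 C x w) (pr2 C x w) ** v"
  hence "pr2 C x w ** u = pr2 C x w ** v"
   using assms by (simp add: pairing_eq_iff)
  thus "u = v" using prd_eqI[of u v x w] * assms by simp
 }
qed (use assms in auto)

lemma pullback_pr2:
 assumes "ar f" "ob w" "dom f = x" "cod f = y"
 shows "pbk f (pr2 C w y) (pr2 C w x) (pg (pr1 C w x) (f ** pr2 C w x))"
proof (rule pullbackI)
 have [simp]: "ob x" "ob y" using assms by auto
 {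
  fix c d assume "ar c" "ar d" "dom c = dom d" "cod c = dom f"
   "cod d = dom (pr2 C w y)" "f ** c = pr2 C w y ** d"
  thus "EX u:arr C. dom u = dom d & cod u = dom (pg (pr1 C w x) (f ** pr2 C w x)) &
    pr2 C w x ** u = c & pg (pr1 C w x) (f ** pr2 C w x) ** u = d"
   using assms pairing_eta[of d w y]
   by (intro bexI[of _ "pg (pr1 C w y ** d) c"]) (auto simp: assms)
 next
  fix u v assume *: "ar u" "ar v" "dom u = dom v"
   "cod u = dom (pg (pr1 C w x) (f ** pr2 C w x))"
   "cod v = dom (pg (pr1 C w x) (f ** pr2 C w x))" "pr2 C w x ** u = pr2 C w x ** v"
   "pg (pr1 C w x) (f ** pr2 C w x) ** u = pg (pr1 C w x) (f ** pr2 C w x) ** v"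
  hence "pr1 C w x ** u = pr1 C w x ** v"
   using assms by (simp add: pairing_eq_iff)
  thus "u = v" using prd_eqI[of u v w x] * assms by simp
 }
qed (use assms in auto)

abbreviation prodm :: "'b => 'b => 'b" where
 "prodm f g == pg (f ** pr1 C (dom f) (dom g)) (g ** pr2 C (dom f) (dom g))"

text \<open>Fibre products commute with products. This is the geometric content of the interchange
  law between composition and tensor product.\<close>

lemma prodm_pullback:
 assumes "pbk f g a b" "pbk f' g' a' b'"
 shows "pbk (prodm f f') (prodm g g') (prodm a a') (prodm b b')"
proof (rule pullbackI)
 note F = pbkD[OF assms(1)] and F' = pbkD[OF assms(2)]
 have *: "f ** (a ** h) = g ** (b ** h)" "f' ** (a' ** h') = g' ** (b' ** h')"
  if "ar h" "cod h = dom b" "ar h'" "cod h' = dom b'" for h h'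
  using eq_cmp[OF F(9), of h] eq_cmp[OF F'(9), of h'] F F' that by simp_all
 show "prodm f f' ** prodm a a' = prodm g g' ** prodm b b'"
  using F F' *[of "pr1 C (dom b) (dom b')" "pr2 C (dom b) (dom b')"] by simp
 {
  fix c d assume H: "ar c" "ar d" "dom c = dom d" "cod c = dom (prodm f f')"
   "cod d = dom (prodm g g')" "prodm f f' ** c = prodm g g' ** d"
  let ?c = "pr1 C (dom f) (dom f') ** c" and ?c' = "pr2 C (dom f) (dom f') ** c"
  let ?d = "pr1 C (dom g) (dom g') ** d" and ?d' = "pr2 C (dom g) (dom g') ** d"
  have H': "cod c = pd (dom f) (dom f')" "cod d = pd (dom g) (dom g')"
   using H F F' by simp_all
  have E: "f ** ?c = g ** ?d" "f' ** ?c' = g' ** ?d'"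
   using H(1-3,6) H' F F' by (simp_all add: pairing_eq_iff)
  obtain u where u: "ar u" "dom u = dom d" "cod u = dom b" "a ** u = ?c" "b ** u = ?d"
   using pullback_ex[OF assms(1), of ?c ?d] E H(1-3) H' F F' by auto
  obtain u' where u': "ar u'" "dom u' = dom d" "cod u' = dom b'" "a' ** u' = ?c'" "b' ** u' = ?d'"
   using pullback_ex[OF assms(2), of ?c' ?d'] E H(1-3) H' F F' by auto
  show "EX u:arr C. dom u = dom d & cod u = dom (prodm b b') & prodm a a' ** u = c & prodm b b' ** u = d"
   using u u' F F' pairing_eta[of c "dom f" "dom f'"] pairing_eta[of d "dom g" "dom g'"] H(1,2) H'
   by (intro bexI[of _ "pg u u'"]) (auto simp: pairing_eq_iff)
 next
  fix u v assume H: "ar u" "ar v" "dom u = dom v" "cod u = dom (prodm b b')"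
   "cod v = dom (prodm b b')" "prodm a a' ** u = prodm a a' ** v" "prodm b b' ** u = prodm b b' ** v"
  let ?p = "pr1 C (dom b) (dom b')" and ?q = "pr2 C (dom b) (dom b')"
  have t: "cod u = pd (dom b) (dom b')" "cod v = pd (dom b) (dom b')"
   using H F F' by simp_all
  have "a ** (?p ** u) = a ** (?p ** v)" "b ** (?p ** u) = b ** (?p ** v)"
   "a' ** (?q ** u) = a' ** (?q ** v)" "b' ** (?q ** u) = b' ** (?q ** v)"
   using H(1-3,6,7) t F F' by (simp_all add: pairing_eq_iff)
  hence "?p ** u = ?p ** v" "?q ** u = ?q ** v"
   using pullback_un[OF assms(1), of "?p ** u" "?p ** v"] pullback_un[OF assms(2), of "?q ** u" "?q ** v"]
    H(1-3) t F F' by simp_all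
  thus "u = v" using prd_eqI[of u v "dom b" "dom b'"] H(1-3) t F F' by simp
 }
qed (use pbkD[OF assms(1)] pbkD[OF assms(2)] in auto)

end

context degree_function
begin

abbreviation "TT == T0 C \<delta>"
abbreviation "scl == Scl TT"
abbreviation "HT == Hom TT"
abbreviation "ct == Cmp TT"
abbreviation "idT == Idn TT"
abbreviation "tn == TenM TT"
abbreviation "gr f == basis (graph C f)"

text \<open>An isomorphism is itself a pullback of the identity of its target.\<close>

lemma degree_iso [simp]:
 assumes "iso_arr C i"
 shows "\<delta> i = 1"
proof -
 have i: "ar i" using assms by simp
 let ?y = "cod i"
 have "pbk (idt C ?y) (idt C ?y) (idt C ?y) (idt C ?y)"
  using pullback_trivial[of "idt C ?y" ?y] i by simp
 from pullback_cmp_iso[OF this assms]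
 have "pbk (idt C ?y) (idt C ?y) i i" using i by simp
 thus ?thesis
  using degree_pullback[of "idt C ?y"] degree_idt[of ?y] i iso_surjective by simp
qed

text \<open>The product map is a composite of a base change of \<open>f\<close> and a base change of
  \<open>e\<close>, so both axioms of a degree function apply.\<close>

lemma prodm_surjective:
 assumes "srj e" "srj f"
 shows "srj (prodm e f)" "\<delta> (prodm e f) = \<delta> e * \<delta> f"
proof -
 have [simp]: "ar e" "ar f" using assms by auto
 let ?a = "pg (e ** pr1 C (dom e) (cod f)) (pr2 C (dom e) (cod f))"
  and ?b = "pg (pr1 C (dom e) (dom f)) (f ** pr2 C (dom e) (dom f))"
 have a: "pbk e (pr1 C (cod e) (cod f)) (pr1 C (dom e) (cod f)) ?a"
  by (rule pullback_pr1) auto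
 have b: "pbk f (pr2 C (dom e) (cod f)) (pr2 C (dom e) (dom f)) ?b"
  by (rule pullback_pr2) auto
 have s: "srj ?a" "srj ?b"
  using surjective_pullback a b assms by blast+
 have ab: "?a ** ?b = prodm e f" by simp
 show "srj (prodm e f)"
  using surjective_cmp[OF s] unfolding ab by simp
 have "\<delta> (?a ** ?b) = \<delta> ?a * \<delta> ?b" using s by (intro degree_cmp) auto
 thus "\<delta> (prodm e f) = \<delta> e * \<delta> f"
  unfolding ab using degree_pullback[OF _ a] degree_pullback[OF _ b] assms by simp
qed

text \<open>The morphism of \<open>T0\<close> represented by an arrow \<open>f\<close> into a product, i.e. by a span.\<close>

definition bas :: "'m => 'm set => 'k" where
 "bas f = (%t. \<delta> (surj_part C f) * basis (im C f) t)"

abbreviation sp :: "'m => 'm => 'm set => 'k" where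
 "sp p q == bas (pg p q)"

lemma bas_monic_surj:
 assumes "mon m" "srj e" "dom m = cod e"
 shows "bas (m ** e) = (%t. \<delta> e * basis (cls m) t)"
proof -
 obtain i where i: "iso_arr C i" "dom i = cod e" "surj_part C (m ** e) = i ** e"
  using surj_part_eq[OF assms] by blast
 hence "\<delta> (surj_part C (m ** e)) = \<delta> e"
  using degree_cmp[OF iso_surjective[OF i(1)] assms(2)] by simp
 thus ?thesis using surj_part_eq(1)[OF assms] by (simp add: bas_def)
qed

lemma bas_monic:
 assumes "mon m"
 shows "bas m = basis (cls m)"
 using bas_monic_surj[OF assms, of "idt C (dom m)"] assms by (simp add: iso_surjective)

text \<open>The reason for admitting spans that are not jointly monic: covering a span by a
  surjection costs only the scalar \<open>\<delta> e\<close>, so composites can be computed from any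
  pullback without first taking images.\<close>

lemma bas_surj:
 assumes "ar f" "srj e" "dom f = cod e"
 shows "bas (f ** e) = (%t. \<delta> e * bas f t)"
proof -
 note S = im_fact[OF assms(1)]
 note r = rep_sub[OF S(1)]
 have [simp]: "ar e" using assms by simp
 have "f ** e = rep (im C f) ** (surj_part C f ** e)"
  using S r assms assoc[of e "surj_part C f" "rep (im C f)"] by simp
 moreover have "bas (rep (im C f) ** (surj_part C f ** e)) =
   (%t. \<delta> (surj_part C f ** e) * basis (cls (rep (im C f))) t)"
  by (rule bas_monic_surj) (use S r assms surjective_cmp in auto)
 moreover have "\<delta> (surj_part C f ** e) = \<delta> (surj_part C f) * \<delta> e"
  using degree_cmp S assms by simp
 ultimately show ?thesis using r(3) by (simp add: bas_def mult_ac)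
qed

lemma bas_rep: "r : Sub x ==> bas (rep r) = basis r"
 using bas_monic rep_sub by metis

lemma T0_simps [simp]:
 "Obj TT = obj C"
 "idT x = gr (idt C x)"
 "TenO TT = pd"
 "UnitO TT = terminal C"
 by (simp_all add: T0_def)

lemma Scl_T0: "scl c v = (%r. c * v r)"
 by (simp add: T0_def)

lemma Scl_T0_apply: "scl c v r = c * v r"
 by (simp add: T0_def)

lemma Hom_T0: "v : HT x y \<longleftrightarrow> (ALL r. r ~: Sub (pd x y) --> v r = 0)"
 by (simp add: T0_def)

lemma bas_Hom:
 assumes "ar f" "cod f = pd x y"
 shows "bas f : HT x y"
 using im_fact(1)[OF assms(1)] assms by (auto simp: Hom_T0 bas_def basis_def)

lemma sp_Hom [simp]:
 "ar p ==> ar q ==> dom p = dom q ==> cod p = x ==> cod q = y ==>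
  sp p q : HT x y"
 by (rule bas_Hom) auto

lemma vs_T0: "vector_space (scl)"
 by unfold_locales (auto simp: fun_eq_iff algebra_simps fun_simps Scl_T0_apply)

lemma graph_sp:
 assumes "ar f"
 shows "gr f = sp (idt C (dom f)) f"
proof -
 have "mon (pg (idt C (dom f)) f)"
  using assms by (subst monic_pairing_iff) auto
 thus ?thesis by (simp add: graph_def bas_monic)
qed

lemma Hom_T0_expand:
 assumes "v : HT x y" "ob x" "ob y"
 shows "v = (SUM r:Sub (pd x y). scl (v r) (basis r))"
proof
 fix t
 have fin: "finite (Sub (pd x y))" using assms subobject_finite by simp
 have "(SUM r:Sub (pd x y). scl (v r) (basis r)) t =
  (SUM r:Sub (pd x y). if t = r then v r else 0)"
  by (simp add: fun_simps Scl_T0_apply basis_def if_distrib cong: if_cong)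
 also have "... = v t" using fin assms by (auto simp: Hom_T0)
 finally show "v t = (SUM r:Sub (pd x y). scl (v r) (basis r)) t" by simp
qed

lemma basis_sp:
 assumes "r : Sub (pd x y)" "ob x" "ob y"
 shows "basis r = sp (pr1 C x y ** rep r) (pr2 C x y ** rep r)"
  "pg (pr1 C x y ** rep r) (pr2 C x y ** rep r) = rep r"
 using pairing_eta[of "rep r" x y] rep_sub[OF assms(1)] assms bas_rep[OF assms(1)] by simp_all

text \<open>Linear identities in \<open>T0\<close> reduce to single spans, where they become
  statements about pasting pullback squares.\<close>

lemma Hom_T0_induct [consumes 3, case_names zero add Scl sp]:
 assumes "v : HT x y" "ob x" "ob y"
  and "P 0" "!!u w. P u ==> P w ==> P (u + w)" "!!c u. P u ==> P (scl c u)"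
  and "!!p q. ar p ==> ar q ==> dom p = dom q ==> cod p = x ==> cod q = y ==>
   mon (pg p q) ==> P (sp p q)"
 shows "P v"
proof -
 have "P (SUM r:S. scl (v r) (basis r))" if "S \<subseteq> Sub (pd x y)" for S
  using that
 proof (induction S rule: infinite_finite_induct)
  case (insert r F)
  hence r: "r : Sub (pd x y)" by simp
  have "P (basis r)"
   using assms(7)[of "pr1 C x y ** rep r" "pr2 C x y ** rep r"] rep_sub[OF r] assms(2,3)
    basis_sp[OF r] by simp
  thus ?case
   using insert assms(5)[OF assms(6) insert.IH] unfolding sum.insert[OF insert.hyps(1,2)] by blast
 qed (use assms(4) in auto)
 from this[OF order_refl] show ?thesis using Hom_T0_expand[OF assms(1-3)] by simp
qed

lemma Cmp_T0: "ct x y z w v = (SUM r:Sub (pd x y). SUM s:Sub (pd y z).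
  scl (v r * w s) (bas (rel_span C x y z r s)))"
proof
 fix t
 show "ct x y z w v t = (SUM r:Sub (pd x y). SUM s:Sub (pd y z).
  scl (v r * w s) (bas (rel_span C x y z r s))) t"
  by (simp add: T0_def bas_def rel_cmp_def fun_simps Scl_T0_apply cong: sum.cong)
qed

lemma TenM_T0: "tn x x' y y' v w = (SUM r:Sub (pd x x'). SUM s:Sub (pd y y').
  scl (v r * w s) (basis (rel_prod C x x' y y' r s)))"
proof
 fix t
 show "tn x x' y y' v w t = (SUM r:Sub (pd x x'). SUM s:Sub (pd y y').
  scl (v r * w s) (basis (rel_prod C x x' y y' r s))) t"
  by (simp add: T0_def fun_simps Scl_T0_apply cong: sum.cong)
qed

end

section \<open>Composition and tensor product of spans\<close>

context degree_function
begin

lemma bas_Scl: "bas f = scl (\<delta> (surj_part C f)) (basis (im C f))"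
 by (simp add: bas_def Scl_T0)

lemma ct_bilinear:
 "ct x y z g (f + f') = ct x y z g f + ct x y z g f'"
 "ct x y z (g + g') f = ct x y z g f + ct x y z g' f"
 "ct x y z g (scl c f) = scl c (ct x y z g f)"
 "ct x y z (scl c g) f = scl c (ct x y z g f)"
 by (rule ext, simp add: Cmp_T0 fun_simps Scl_T0_apply algebra_simps sum.distrib sum_distrib_left)+

lemma TenM_T0_bilinear:
 "tn x x' y y' f (g + g') = tn x x' y y' f g + tn x x' y y' f g'"
 "tn x x' y y' (f + f') g = tn x x' y y' f g + tn x x' y y' f' g"
 "tn x x' y y' f (scl c g) = scl c (tn x x' y y' f g)"
 "tn x x' y y' (scl c f) g = scl c (tn x x' y y' f g)"
 by (rule ext, simp add: TenM_T0 fun_simps Scl_T0_apply algebra_simps sum.distrib sum_distrib_left)+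

lemma sum_basis:
 assumes "finite A" "finite B" "r : A" "s : B"
 shows "(SUM r':A. SUM s':B. scl (basis r r' * basis s s') (F r' s')) = F r s"
proof
 fix t
 have "(SUM r':A. SUM s':B. scl (basis r r' * basis s s') (F r' s')) t =
  (SUM r':A. SUM s':B. basis r r' * basis s s' * F r' s' t)"
  by (simp add: fun_simps Scl_T0_apply)
 also have "... = (SUM r':A. if r' = r then SUM s':B. if s' = s then F r' s' t else 0 else 0)"
  by (intro sum.cong refl) (auto simp: basis_def intro!: sum.cong)
 also have "... = F r s t" using assms by simp
 finally show "(SUM r':A. SUM s':B. scl (basis r r' * basis s s') (F r' s')) t = F r s t" .
qed

lemma Cmp_basis:
 assumes "r : Sub (pd x y)" "s : Sub (pd y z)" "ob x" "ob y" "ob z"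
 shows "ct x y z (basis s) (basis r) = bas (rel_span C x y z r s)"
 unfolding Cmp_T0 by (rule sum_basis) (use assms subobject_finite in auto)

lemma TenM_basis:
 assumes "r : Sub (pd x x')" "s : Sub (pd y y')"
  "ob x" "ob x'" "ob y" "ob y'"
 shows "tn x x' y y' (basis r) (basis s) = basis (rel_prod C x x' y y' r s)"
 unfolding TenM_T0 by (rule sum_basis) (use assms subobject_finite in auto)

text \<open>
 Composition of spans is given by an arbitrary pullback: the comparison map to the pullback of
 the images is surjective, and its degree is the product of the two degrees.
\<close>

lemma Cmp_sp:
 assumes "ar p" "ar q" "dom p = dom q" "ar p'" "ar q'" "dom p' = dom q'"
  and ab: "pbk q p' a b"
  and xyz: "cod p = x" "cod q = y" "cod q' = z"
 shows "ct x y z (sp p' q') (sp p q) = sp (p ** a) (q' ** b)"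
proof -
 let ?f = "pg p q" and ?g = "pg p' q'"
 note AB = pbkD[OF ab]
 have xyz': "ob x" "ob y" "ob z" "cod p' = y" using assms AB by auto
 have f: "?f : arr C" "cod ?f = pd x y" and g: "?g : arr C" "cod ?g = pd y z"
  using assms xyz' by auto
 define r s where "r = im C ?f" and "s = im C ?g"
 define e e' where "e = surj_part C ?f" and "e' = surj_part C ?g"
 have R: "r : Sub (pd x y)" "ar e" "dom e = dom q" "cod e = dom (rep r)"
  "rep r ** e = ?f" "srj e"
  using im_fact[OF f(1)] f assms(1-3) by (auto simp: r_def e_def)
 have S: "s : Sub (pd y z)" "ar e'" "dom e' = dom q'" "cod e' = dom (rep s)"
  "rep s ** e' = ?g" "srj e'"
  using im_fact[OF g(1)] g assms(4-6) by (auto simp: s_def e'_def)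
 note r = rep_sub[OF R(1)] and s = rep_sub[OF S(1)]
 define R1 R2 S1 S2 where "R1 = pr1 C x y ** rep r" and "R2 = pr2 C x y ** rep r"
  and "S1 = pr1 C y z ** rep s" and "S2 = pr2 C y z ** rep s"
 have RS: "ar R1" "ar R2" "ar S1" "ar S2" "dom R1 = dom (rep r)"
  "dom R2 = dom (rep r)" "dom S1 = dom (rep s)" "dom S2 = dom (rep s)"
  "cod R1 = x" "cod R2 = y" "cod S1 = y" "cod S2 = z"
  using r s xyz' by (auto simp: R1_def R2_def S1_def S2_def)
 have pq: "R1 ** e = p" "R2 ** e = q" "S1 ** e' = p'" "S2 ** e' = q'"
  using R S r s xyz' assms by (auto simp: R1_def R2_def S1_def S2_def)
 have "EX z. (%(a, b). pbk R2 S1 a b) z"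
  using ex_pullback[of R2 S1] RS by (metis case_prodI)
 hence "(%(a, b). pbk R2 S1 a b) (SOME z. (%(a, b). pbk R2 S1 a b) z)"
  by (rule someI_ex)
 then obtain a0 b0 where ab0: "pbk R2 S1 a0 b0"
  and "(SOME z. (%(a, b). pbk R2 S1 a b) z) = (a0, b0)" by auto
 hence span: "rel_span C x y z r s = pg (R1 ** a0) (S2 ** b0)"
  by (simp add: rel_span_def R1_def R2_def S1_def S2_def)
 note AB0 = pbkD[OF ab0]
 obtain a1 b1 where ab1: "pbk e a0 a1 b1"
  using ex_pullback[of e a0] R AB0 RS by auto
 note AB1 = pbkD[OF ab1]
 have "pbk S1 (R2 ** e) (b0 ** b1) a1"
  by (rule pullback_paste[OF pullback_sym[OF ab0] pullback_sym[OF ab1]])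
 from pullback_sym[OF this] have ab01: "pbk (R2 ** e) S1 a1 (b0 ** b1)" .
 note AB01 = pbkD[OF ab01]
 obtain a2 b2 where ab2: "pbk e' (b0 ** b1) a2 b2"
  using ex_pullback[of e' "b0 ** b1"] S AB0 AB1 RS by auto
 note AB2 = pbkD[OF ab2]
 have "pbk q p' (a1 ** b2) a2"
  using pullback_paste[OF ab01 pullback_sym[OF ab2]] by (simp add: pq)
 then obtain i where i: "iso_arr C i" "dom i = dom b" "cod i = dom a2" "a = (a1 ** b2) ** i" "b = a2 ** i"
  using ab by (rule pullback_iso)
 have surj: "srj b1" "srj b2" "\<delta> b1 = \<delta> e" "\<delta> b2 = \<delta> e'"
  using ab1 ab2 R S surjective_pullback degree_pullback by blast+
 \<comment> \<open>The comparison map from the given pullback to that of the two images: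
   \<open>b1\<close> is a base change of \<open>e\<close> and \<open>b2\<close> one of
   \<open>e'\<close>, so its degree is the product of the two.\<close>
 define h where "h = b1 ** (b2 ** i)"
 have h: "srj h" "\<delta> h = \<delta> e * \<delta> e'"
  using surj i AB1 AB2 surjective_cmp iso_surjective degree_cmp by (auto simp: h_def AB0)
 have h': "ar h" "dom h = dom b" "cod h = dom b0"
  using i AB1 AB2 AB0 by (auto simp: h_def)
 have "p ** a = R1 ** (e ** (a1 ** (b2 ** i)))"
  unfolding i pq(1)[symmetric] using i AB0 AB1 AB2 RS R by simp
 also have "... = (R1 ** a0) ** h"
  unfolding h_def using i AB0 AB1 AB2 RS R eq_cmp[OF AB1(9), of "b2 ** i"] by simp
 finally have 1: "p ** a = (R1 ** a0) ** h" .
 have "q' ** b = S2 ** (e' ** (a2 ** i))"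
  unfolding i pq(4)[symmetric] using i AB0 AB1 AB2 RS S by simp
 also have "... = (S2 ** b0) ** h"
  unfolding h_def using i AB0 AB1 AB2 RS S eq_cmp[OF AB2(9), of i] by simp
 finally have 2: "q' ** b = (S2 ** b0) ** h" .
 have "sp (p ** a) (q' ** b) = bas (pg (R1 ** a0) (S2 ** b0) ** h)"
  unfolding 1 2 using h' RS AB0 by simp
 also have "... = scl (\<delta> h) (sp (R1 ** a0) (S2 ** b0))"
  unfolding Scl_T0 using h(1) h' RS AB0 by (intro bas_surj) auto
 also have "... = ct x y z (bas ?g) (bas ?f)"
  unfolding bas_Scl[of ?f] bas_Scl[of ?g] ct_bilinear
  using Cmp_basis[OF R(1) S(1)] xyz' h(2)
  by (simp add: r_def[symmetric] s_def[symmetric] e_def[symmetric] e'_def[symmetric] span fun_eq_iff Scl_T0_apply)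
 finally show ?thesis by simp
qed

text \<open>The product of the two images is again jointly monic, and the surjective parts combine
  to \<open>prodm e e'\<close>, whose degree is the product; thus both sides have the same image and
  the same scalar.\<close>

lemma TenM_sp:
 assumes "ar p" "ar q" "dom p = dom q" "ar p'" "ar q'" "dom p' = dom q'"
  and xy: "cod p = x" "cod q = x'" "cod p' = y" "cod q' = y'"
 shows "tn x x' y y' (sp p q) (sp p' q') = sp (prodm p p') (prodm q q')"
proof -
 let ?f = "pg p q" and ?g = "pg p' q'"
 have xy': "ob x" "ob x'" "ob y" "ob y'" using assms by auto
 have f: "?f : arr C" "cod ?f = pd x x'" and g: "?g : arr C" "cod ?g = pd y y'"
  using assms xy' by auto
 define r s where "r = im C ?f" and "s = im C ?g"
 define e e' where "e = surj_part C ?f" and "e' = surj_part C ?g"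
 have R: "r : Sub (pd x x')" "ar e" "dom e = dom q" "cod e = dom (rep r)"
  "rep r ** e = ?f" "srj e"
  using im_fact[OF f(1)] f assms(1-3) by (auto simp: r_def e_def)
 have S: "s : Sub (pd y y')" "ar e'" "dom e' = dom q'" "cod e' = dom (rep s)"
  "rep s ** e' = ?g" "srj e'"
  using im_fact[OF g(1)] g assms(4-6) by (auto simp: s_def e'_def)
 note r = rep_sub[OF R(1)] and s = rep_sub[OF S(1)]
 define R1 R2 S1 S2 where "R1 = pr1 C x x' ** rep r" and "R2 = pr2 C x x' ** rep r"
  and "S1 = pr1 C y y' ** rep s" and "S2 = pr2 C y y' ** rep s"
 have RS: "ar R1" "ar R2" "ar S1" "ar S2" "dom R1 = dom (rep r)"
  "dom R2 = dom (rep r)" "dom S1 = dom (rep s)" "dom S2 = dom (rep s)"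
  "cod R1 = x" "cod R2 = x'" "cod S1 = y" "cod S2 = y'"
  using r s xy' by (auto simp: R1_def R2_def S1_def S2_def)
 have pq: "R1 ** e = p" "R2 ** e = q" "S1 ** e' = p'" "S2 ** e' = q'"
  using R S r s xy' assms by (auto simp: R1_def R2_def S1_def S2_def)
 let ?m = "pg (prodm R1 S1) (prodm R2 S2)"
 have RS': "pg R1 R2 = rep r" "pg S1 S2 = rep s"
  using basis_sp(2)[OF R(1)] basis_sp(2)[OF S(1)] xy' by (auto simp: R1_def R2_def S1_def S2_def)
 have m: "mon ?m"
 proof (subst monic_pairing_iff, goal_cases)
  case 4
  show ?case
  proof (intro ballI impI)
   fix u v assume H: "ar u" "ar v" "dom u = dom v" "cod u = dom (prodm R1 S1)"
    "cod v = dom (prodm R1 S1)" "prodm R1 S1 ** u = prodm R1 S1 ** v" "prodm R2 S2 ** u = prodm R2 S2 ** v"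
   let ?a = "pr1 C (dom (rep r)) (dom (rep s))" and ?b = "pr2 C (dom (rep r)) (dom (rep s))"
   have t: "cod u = pd (dom (rep r)) (dom (rep s))" "cod v = pd (dom (rep r)) (dom (rep s))"
    using H RS r s by simp_all
   have "R1 ** (?a ** u) = R1 ** (?a ** v)" "R2 ** (?a ** u) = R2 ** (?a ** v)"
    "S1 ** (?b ** u) = S1 ** (?b ** v)" "S2 ** (?b ** u) = S2 ** (?b ** v)"
    using H(1-3,6,7) t RS r s by (simp_all add: pairing_eq_iff)
   hence "rep r ** (?a ** u) = rep r ** (?a ** v)" "rep s ** (?b ** u) = rep s ** (?b ** v)"
    unfolding RS'[symmetric] using H(1-3) t RS r s by simp_all
   hence "?a ** u = ?a ** v" "?b ** u = ?b ** v"
    using monicD[OF r(1), of "?a ** u" "?a ** v"] monicD[OF s(1), of "?b ** u" "?b ** v"]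
     H(1-3) t r s by simp_all
   thus "u = v" using prd_eqI[of u v "dom (rep r)" "dom (rep s)"] H(1-3) t r s by simp
  qed
 qed (use RS r s in auto)
 have rp: "rel_prod C x x' y y' r s = cls ?m"
  unfolding rel_prod_def Let_def using RS r s xy' by (simp add: R1_def R2_def S1_def S2_def)
 have "sp (prodm p p') (prodm q q') = bas (?m ** prodm e e')"
  using R S RS r s assms(3,6) xy unfolding pq[symmetric] by simp
 also have "... = (%t. \<delta> (prodm e e') * basis (cls ?m) t)"
  using prodm_surjective[OF R(6) S(6)] R S RS r s assms(2,5) by (intro bas_monic_surj[OF m]) auto
 also have "... = tn x x' y y' (bas ?f) (bas ?g)"
  unfolding bas_Scl[of ?f] bas_Scl[of ?g] TenM_T0_bilinear
  using TenM_basis[OF R(1) S(1)] xy' prodm_surjective[OF R(6) S(6)]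
  by (simp add: r_def[symmetric] s_def[symmetric] e_def[symmetric] e'_def[symmetric] rp fun_eq_iff Scl_T0_apply)
 finally show ?thesis by simp
qed

end

section \<open>The category \<open>T0\<close> as a linear tensor category\<close>

context degree_function
begin

lemma Cmp_T0_zero [simp]: "ct x y z 0 f = 0" "ct x y z g 0 = 0"
 using ct_bilinear(2)[of x y z 0 0 f] ct_bilinear(1)[of x y z g 0 0] by simp_all

lemma TenM_T0_zero [simp]: "tn x x' y y' 0 f = 0" "tn x x' y y' g 0 = 0"
 using TenM_T0_bilinear(2)[of x x' y y' 0 0 f] TenM_T0_bilinear(1)[of x x' y y' g 0 0] by simp_all

lemma T0_vs_subspace: "module.subspace (scl) (HT x y)"
proof -
 interpret vector_space "scl" by (rule vs_T0)
 show ?thesis by (rule subspaceI) (auto simp: Hom_T0 fun_simps Scl_T0_apply)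
qed

lemma T0_Hom_zero [simp]: "0 : HT x y"
 and T0_Hom_add: "f : HT x y ==> g : HT x y ==> f + g : HT x y"
 and T0_Hom_Scl: "f : HT x y ==> scl c f : HT x y"
 by (auto simp: Hom_T0 fun_simps Scl_T0_apply)

lemma T0_Cmp_Hom:
 assumes "ob x" "ob y" "ob z" "f : HT x y" "g : HT y z"
 shows "ct x y z g f : HT x z"
 using assms(4) assms(1,2)
proof (induction rule: Hom_T0_induct)
 case (sp p q)
 show ?case using assms(5) assms(2,3)
 proof (induction rule: Hom_T0_induct)
  case (sp p' q')
  obtain a b where ab: "pbk q p' a b"
   using ex_pullback[of q p'] sp \<open>cod q = y\<close> \<open>ar q\<close> by auto
  show ?case
   using Cmp_sp[OF _ _ _ _ _ _ ab] pbkD[OF ab] sp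
    \<open>ar p\<close> \<open>ar q\<close> \<open>dom p = dom q\<close> \<open>cod p = x\<close> \<open>cod q = y\<close> by simp
 qed (simp_all add: ct_bilinear T0_Hom_add T0_Hom_Scl)
qed (simp_all add: ct_bilinear T0_Hom_add T0_Hom_Scl)

lemma T0_TenM_Hom:
 assumes "ob x" "ob x'" "ob y" "ob y'" "f : HT x x'" "g : HT y y'"
 shows "tn x x' y y' f g : HT (pd x y) (pd x' y')"
 using assms(5) assms(1,2)
proof (induction rule: Hom_T0_induct)
 case (sp p q)
 show ?case using assms(6) assms(3,4)
 proof (induction rule: Hom_T0_induct)
  case (sp p' q')
  show ?case
   using TenM_sp[of p q p' q'] sp
    \<open>ar p\<close> \<open>ar q\<close> \<open>dom p = dom q\<close> \<open>cod p = x\<close> \<open>cod q = x'\<close> by simp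
 qed (simp_all add: TenM_T0_bilinear T0_Hom_add T0_Hom_Scl)
qed (simp_all add: TenM_T0_bilinear T0_Hom_add T0_Hom_Scl)

text \<open>Both sides are the span over the double fibre product, built once as the pullback of
  \<open>b\<close> and \<open>a'\<close> and read in two ways by pasting.\<close>

lemma ct_assoc_sp:
 assumes "ar p" "ar q" "dom p = dom q" "cod p = w" "cod q = x"
  "ar p'" "ar q'" "dom p' = dom q'" "cod p' = x" "cod q' = y"
  "ar p''" "ar q''" "dom p'' = dom q''" "cod p'' = y" "cod q'' = z"
 shows "ct w x z (ct x y z (sp p'' q'') (sp p' q')) (sp p q) =
  ct w y z (sp p'' q'') (ct w x y (sp p' q') (sp p q))"
proof -
 obtain a b where ab: "pbk q p' a b" using ex_pullback[of q p'] assms by auto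
 obtain a' b' where ab': "pbk q' p'' a' b'" using ex_pullback[of q' p''] assms by auto
 note F = pbkD[OF ab] and F' = pbkD[OF ab']
 obtain c d where cd: "pbk b a' c d" using ex_pullback[of b a'] assms F F' by auto
 note G = pbkD[OF cd]
 have "pbk q (p' ** a') (a ** c) d"
  by (rule pullback_paste[OF ab cd])
 moreover have "pbk (q' ** b) p'' c (b' ** d)"
  by (rule pullback_sym, rule pullback_paste[OF pullback_sym[OF ab'] pullback_sym[OF cd]])
 ultimately show ?thesis
  using Cmp_sp[OF _ _ _ _ _ _ ab, of p q' w x y] Cmp_sp[OF _ _ _ _ _ _ ab', of p' q'' x y z]
   Cmp_sp[of p q "p' ** a'" "q'' ** b'" "a ** c" d w x z] Cmp_sp[of "p ** a" "q' ** b" p'' q'' c "b' ** d" w y z]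
   assms F F' G by simp
qed

lemma ct_assoc:
 assumes "ob w" "ob x" "ob y" "ob z"
  and f: "f : HT w x" and g: "g : HT x y" and h: "h : HT y z"
 shows "ct w x z (ct x y z h g) f = ct w y z h (ct w x y g f)"
 using f assms(1,2)
proof (induction rule: Hom_T0_induct)
 case (sp p q)
 note 1 = sp(1-5)
 show ?case using g assms(2,3)
 proof (induction rule: Hom_T0_induct)
  case (sp p' q')
  note 2 = sp(1-5)
  show ?case using h assms(3,4)
  proof (induction rule: Hom_T0_induct)
   case (sp p'' q'')
   thus ?case using ct_assoc_sp 1 2 by blast
  qed (simp_all add: ct_bilinear)
 qed (simp_all add: ct_bilinear)
qed (simp_all add: ct_bilinear)

lemma T0_Cmp_Idn:
 assumes "ob x" "ob y" "f : HT x y"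
 shows "ct x x y f (gr (idt C x)) = f"
 using assms(3) assms(1,2)
proof (induction rule: Hom_T0_induct)
 case (sp p q)
 have "pbk (idt C x) p p (idt C (dom p))"
  using pullback_sym[OF pullback_trivial[of p x]] sp by simp
 from Cmp_sp[OF _ _ _ _ _ _ this, of "idt C x" q x x y] show ?case
  using sp assms by (simp add: graph_sp)
qed (simp_all add: ct_bilinear)

lemma T0_Idn_Cmp:
 assumes "ob x" "ob y" "f : HT x y"
 shows "ct x y y (gr (idt C y)) f = f"
 using assms(3) assms(1,2)
proof (induction rule: Hom_T0_induct)
 case (sp p q)
 have "pbk q (idt C y) (idt C (dom q)) q"
  using pullback_trivial[of q y] sp by simp
 from Cmp_sp[OF _ _ _ _ _ _ this, of p "idt C y" x y y] show ?case
  using sp assms by (simp add: graph_sp)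
qed (simp_all add: ct_bilinear)

lemma T0_TenM_Cmp_sp:
 assumes "ar p" "ar q" "dom p = dom q" "cod p = x" "cod q = x'"
  "ar p'" "ar q'" "dom p' = dom q'" "cod p' = x'" "cod q' = x''"
  "ar r" "ar s" "dom r = dom s" "cod r = y" "cod s = y'"
  "ar r'" "ar s'" "dom r' = dom s'" "cod r' = y'" "cod s' = y''"
 shows "tn x x'' y y'' (ct x x' x'' (sp p' q') (sp p q)) (ct y y' y'' (sp r' s') (sp r s)) =
  ct (pd x y) (pd x' y') (pd x'' y'')
   (tn x' x'' y' y'' (sp p' q') (sp r' s')) (tn x x' y y' (sp p q) (sp r s))"
proof -
 obtain a b where ab: "pbk q p' a b" using ex_pullback[of q p'] assms by auto
 obtain c d where cd: "pbk s r' c d" using ex_pullback[of s r'] assms by auto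
 note F = pbkD[OF ab] and G = pbkD[OF cd]
 have P: "pbk (prodm q s) (prodm p' r') (prodm a c) (prodm b d)"
  by (rule prodm_pullback[OF ab cd])
 have [simp]: "ob x" "ob x'" "ob y" "ob y'" "ob x''" "ob y''"
  using assms by auto
 have "tn x x'' y y'' (ct x x' x'' (sp p' q') (sp p q)) (ct y y' y'' (sp r' s') (sp r s)) =
  sp (prodm (p ** a) (r ** c)) (prodm (q' ** b) (s' ** d))"
  using Cmp_sp[OF _ _ _ _ _ _ ab, of p q' x x' x''] Cmp_sp[OF _ _ _ _ _ _ cd, of r s' y y' y'']
   TenM_sp[of "p ** a" "q' ** b" "r ** c" "s' ** d" x x'' y y''] assms F G by simp
 also have "... = sp (prodm p r ** prodm a c) (prodm q' s' ** prodm b d)"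
  using assms F G by simp
 also have "... = ct (pd x y) (pd x' y') (pd x'' y'')
   (sp (prodm p' r') (prodm q' s')) (sp (prodm p r) (prodm q s))"
  by (rule Cmp_sp[OF _ _ _ _ _ _ P, symmetric]) (use assms F G in auto)
 also have "... = ct (pd x y) (pd x' y') (pd x'' y'')
   (tn x' x'' y' y'' (sp p' q') (sp r' s')) (tn x x' y y' (sp p q) (sp r s))"
  using TenM_sp[of p q r s x x' y y'] TenM_sp[of p' q' r' s' x' x'' y' y''] assms by simp
 finally show ?thesis .
qed

lemma T0_TenM_Cmp:
 assumes "ob x" "ob x'" "ob x''" "ob y" "ob y'" "ob y''"
  and f: "f : HT x x'" and f': "f' : HT x' x''"
  and g: "g : HT y y'" and g': "g' : HT y' y''"
 shows "tn x x'' y y'' (ct x x' x'' f' f) (ct y y' y'' g' g) =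
  ct (pd x y) (pd x' y') (pd x'' y'')
   (tn x' x'' y' y'' f' g') (tn x x' y y' f g)"
 using f assms(1,2)
proof (induction rule: Hom_T0_induct)
 case (sp p q)
 note 1 = sp(1-5)
 show ?case using f' assms(2,3)
 proof (induction rule: Hom_T0_induct)
  case (sp p' q')
  note 2 = sp(1-5)
  show ?case using g assms(4,5)
  proof (induction rule: Hom_T0_induct)
   case (sp r s)
   note 3 = sp(1-5)
   show ?case using g' assms(5,6)
   proof (induction rule: Hom_T0_induct)
    case (sp r' s')
    thus ?case using T0_TenM_Cmp_sp 1 2 3 by blast
   qed (simp_all add: ct_bilinear TenM_T0_bilinear)
  qed (simp_all add: ct_bilinear TenM_T0_bilinear)
 qed (simp_all add: ct_bilinear TenM_T0_bilinear)
qed (simp_all add: ct_bilinear TenM_T0_bilinear)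

lemma T0_Idn_Hom: "ob x ==> gr (idt C x) : HT x x"
 by (simp add: graph_sp)

sublocale T0: linear_tensor_category "TT"
proof (rule linear_tensor_category.intro)
 fix x y assume "x : Obj TT" "y : Obj TT"
 thus "tn x x y y (idT x) (idT y) = idT (TenO TT x y)"
  using TenM_sp[of "idt C x" "idt C x" "idt C y" "idt C y" x x y y] by (simp add: graph_sp)
qed (auto simp: vs_T0 T0_vs_subspace T0_Cmp_Hom T0_TenM_Hom ct_assoc T0_Cmp_Idn T0_Idn_Cmp
  ct_bilinear TenM_T0_bilinear T0_TenM_Cmp T0_Idn_Hom)

end

section \<open>Completions of linear tensor categories\<close>

lemma nth_concat_map:
 assumes "i < length xs * length ys"
 shows "concat (map (%x. map (f x) ys) xs) ! i = f (xs ! (i div length ys)) (ys ! (i mod length ys))"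
 using assms
proof (induction xs arbitrary: i)
 case (Cons x xs)
 show ?case
 proof (cases "i < length ys")
  case False
  moreover have "length ys > 0" using Cons.prems by (cases "length ys = 0") auto
  ultimately have "i div length ys = Suc ((i - length ys) div length ys)"
   "i mod length ys = (i - length ys) mod length ys"
   by (auto simp: le_div_geq le_mod_geq)
  moreover have "i - length ys < length xs * length ys" using Cons.prems False by auto
  ultimately show ?thesis using Cons.IH[of "i - length ys"] False by (simp add: nth_append nth_Cons')
 qed (simp add: nth_append)
qed simp

lemma length_concat_map: "length (concat (map (%x. map (f x) ys) xs)) = length xs * length ys"
 by (induction xs) simp_all

lemma sum_div_mod:
 fixes f :: "nat => nat => 'a::comm_monoid_add"
 shows "(SUM k<m*n. f (k div n) (k mod n)) = (SUM i<m. SUM j<n. f i j)"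
proof (cases "n = 0")
 case False
 have "(SUM k<m*n. f (k div n) (k mod n)) = (SUM (i, j):{..<m}\<times>{..<n}. f i j)"
 proof (rule sum.reindex_bij_witness[of _ "%(i, j). i * n + j" "%k. (k div n, k mod n)"])
  fix b assume "b : {..<m} \<times> {..<n}"
  then obtain i j where b: "b = (i, j)" "i < m" "j < n" by auto
  have "i * n + j < Suc i * n" using b by simp
  also have "... <= m * n" using b by (intro mult_le_mono1) simp
  finally show "(case b of (i, j) => i * n + j) : {..<m*n}" using b by simp
 qed (use False in \<open>auto simp: less_mult_imp_div_less\<close>)
 thus ?thesis by (simp add: sum.cartesian_product)
qed simp

context linear_tensor_category
begin

lemma additive_Hom: "M : Hom (additive_completion D) xs ys \<longleftrightarrow>
  (ALL i < length ys. ALL j < length xs. M i j : Hom D (xs ! j) (ys ! i)) &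
  (ALL i j. ~ (i < length ys & j < length xs) --> M i j = 0)"
 by (auto simp: additive_completion_def)

lemma additive_simps:
 "Obj (additive_completion D) = lists (Obj D)"
 "Idn (additive_completion D) xs i j = (if i = j & i < length xs then Idn D (xs ! i) else 0)"
 "Cmp (additive_completion D) xs ys zs N M i j = (if i < length zs & j < length xs
  then SUM k<length ys. Cmp D (xs ! j) (ys ! k) (zs ! i) (N i k) (M k j) else 0)"
 "Scl (additive_completion D) c M i j = Scl D c (M i j)"
 "TenO (additive_completion D) xs ys = concat (map (%x. map (TenO D x) ys) xs)"
 "TenM (additive_completion D) xs xs' ys ys' M N i j =
  (if i < length xs' * length ys' & j < length xs * length ys
   then TenM D (xs ! (j div length ys)) (xs' ! (i div length ys'))
      (ys ! (j mod length ys)) (ys' ! (i mod length ys'))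
      (M (i div length ys') (j div length ys))
      (N (i mod length ys') (j mod length ys))
   else 0)"
 by (simp_all add: additive_completion_def)

lemma vector_space_additive: "vector_space (Scl (additive_completion D))"
 by unfold_locales (simp_all add: fun_eq_iff fun_simps additive_simps scale_right_distrib scale_left_distrib)

lemma in_lists_nth: "xs : lists A ==> i < length xs ==> xs ! i : A"
 by (auto simp: in_lists_conv_set)

lemma mod_div_bounds:
 fixes i m n :: nat
 assumes "i < m * n"
 shows "i div n < m" "i mod n < n"
 using assms by (cases n; simp add: less_mult_imp_div_less)+

theorem linear_tensor_category_additive: "linear_tensor_category (additive_completion D)"
proof -
 let ?A = "additive_completion D"
 interpret A: vector_space "Scl ?A" by (rule vector_space_additive)
 show ?thesis
 proof (rule linear_tensor_category.intro, goal_cases)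
  case (2 xs ys)
  thus ?case
   by (intro A.subspaceI)
    (auto simp: additive_Hom additive_simps fun_simps in_lists_nth intro!: Hom_add Hom_Scl)
 next
  case (3 xs)
  thus ?case by (auto simp: additive_Hom additive_simps in_lists_nth Idn_Hom)
 next
  case (4 xs ys zs f g)
  thus ?case
   by (auto simp: additive_Hom additive_simps in_lists_nth intro!: Hom_sum Cmp_Hom)
 next
  case (5 ws xs ys zs f g h)
  show ?case
  proof (intro ext)
   fix i j
   show "Cmp ?A ws xs zs (Cmp ?A xs ys zs h g) f i j = Cmp ?A ws ys zs h (Cmp ?A ws xs ys g f) i j"
   proof (cases "i < length zs & j < length ws")
    case True
    hence "Cmp ?A ws xs zs (Cmp ?A xs ys zs h g) f i j =
     (SUM k<length xs. SUM l<length ys. Cmp D (ws ! j) (xs ! k) (zs ! i)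
      (Cmp D (xs ! k) (ys ! l) (zs ! i) (h i l) (g l k)) (f k j))"
     by (simp add: additive_simps Cmp_sum_left)
    also have "... = (SUM k<length xs. SUM l<length ys. Cmp D (ws ! j) (ys ! l) (zs ! i)
      (h i l) (Cmp D (ws ! j) (xs ! k) (ys ! l) (g l k) (f k j)))"
     using 5 True by (intro sum.cong refl Cmp_assoc) (auto simp: additive_simps additive_Hom in_lists_nth)
    also have "... = (SUM l<length ys. SUM k<length xs. Cmp D (ws ! j) (ys ! l) (zs ! i)
      (h i l) (Cmp D (ws ! j) (xs ! k) (ys ! l) (g l k) (f k j)))"
     by (rule sum.swap)
    also have "... = Cmp ?A ws ys zs h (Cmp ?A ws xs ys g f) i j"
     using True by (simp add: additive_simps Cmp_sum_right)
    finally show ?thesis .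
   next
    case False
    show ?thesis by (simp only: additive_simps(3) if_not_P[OF False])
   qed
  qed
 next
  case (6 xs ys f)
  show ?case
  proof (intro ext)
   fix i j
   show "Cmp ?A xs xs ys f (Idn ?A xs) i j = f i j"
   proof (cases "i < length ys & j < length xs")
    case True
    have "Cmp ?A xs xs ys f (Idn ?A xs) i j =
      (SUM k<length xs. if k = j then Cmp D (xs ! j) (xs ! j) (ys ! i) (f i j) (Idn D (xs ! j)) else 0)"
     unfolding additive_simps(3) if_P[OF True]
     by (intro sum.cong refl) (auto simp: additive_simps)
    thus ?thesis
     using 6 True by (simp add: Cmp_Idn additive_simps additive_Hom in_lists_nth)
   qed (use 6 in \<open>auto simp: additive_simps additive_Hom\<close>)
  qed
 next
  case (7 xs ys f)
  show ?case
  proof (intro ext)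
   fix i j
   show "Cmp ?A xs ys ys (Idn ?A ys) f i j = f i j"
   proof (cases "i < length ys & j < length xs")
    case True
    have "Cmp ?A xs ys ys (Idn ?A ys) f i j =
      (SUM k<length ys. if k = i then Cmp D (xs ! j) (ys ! i) (ys ! i) (Idn D (ys ! i)) (f i j) else 0)"
     unfolding additive_simps(3) if_P[OF True]
     by (intro sum.cong refl) (auto simp: additive_simps)
    thus ?thesis
     using 7 True by (simp add: Idn_Cmp additive_simps additive_Hom in_lists_nth)
   qed (use 7 in \<open>auto simp: additive_simps additive_Hom\<close>)
  qed
 next
  case (12 xs ys)
  thus ?case by (auto simp: additive_simps TenO_Obj)
 next
  case (13 xs xs' ys ys' f g)
  thus ?case
   by (auto simp: additive_simps additive_Hom length_concat_map nth_concat_map mod_div_bounds in_lists_nth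
     intro!: TenM_Hom)
 next
  case (14 xs ys)
  show ?case
  proof (intro ext)
   fix i j
   \<comment> \<open>A position is determined by its quotient and remainder, so the Kronecker
     product of two identity matrices is the identity matrix.\<close>
   have "i div length ys = j div length ys & i mod length ys = j mod length ys \<longleftrightarrow> i = j"
    by (metis div_mult_mod_eq)
   thus "TenM ?A xs xs ys ys (Idn ?A xs) (Idn ?A ys) i j = Idn ?A (TenO ?A xs ys) i j"
    using 14 mod_div_bounds[of i "length xs" "length ys"] mod_div_bounds[of j "length xs" "length ys"]
    by (auto simp: additive_simps length_concat_map nth_concat_map TenM_Idn in_lists_nth)
  qed
 next
  case (15 xs xs' xs'' ys ys' ys'' f f' g g')
  show ?case
  proof (intro ext)
   fix i j
   let ?a = "i div length ys''" and ?b = "i mod length ys''" and ?c = "j div length ys" and ?d = "j mod length ys"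
   show "TenM ?A xs xs'' ys ys'' (Cmp ?A xs xs' xs'' f' f) (Cmp ?A ys ys' ys'' g' g) i j =
    Cmp ?A (TenO ?A xs ys) (TenO ?A xs' ys') (TenO ?A xs'' ys'')
     (TenM ?A xs' xs'' ys' ys'' f' g') (TenM ?A xs xs' ys ys' f g) i j"
   proof (cases "i < length xs'' * length ys'' & j < length xs * length ys")
    case True
    hence b: "?a < length xs''" "?b < length ys''" "?c < length xs" "?d < length ys"
     using mod_div_bounds by blast+
    have "TenM ?A xs xs'' ys ys'' (Cmp ?A xs xs' xs'' f' f) (Cmp ?A ys ys' ys'' g' g) i j =
     (SUM k<length xs'. SUM l<length ys'. TenM D (xs ! ?c) (xs'' ! ?a) (ys ! ?d) (ys'' ! ?b)
      (Cmp D (xs ! ?c) (xs' ! k) (xs'' ! ?a) (f' ?a k) (f k ?c))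
      (Cmp D (ys ! ?d) (ys' ! l) (ys'' ! ?b) (g' ?b l) (g l ?d)))"
     using True b by (simp add: additive_simps TenM_sum_left TenM_sum_right) (rule sum.swap)
    also have "... = (SUM k<length xs'. SUM l<length ys'.
      Cmp D (TenO D (xs ! ?c) (ys ! ?d)) (TenO D (xs' ! k) (ys' ! l)) (TenO D (xs'' ! ?a) (ys'' ! ?b))
       (TenM D (xs' ! k) (xs'' ! ?a) (ys' ! l) (ys'' ! ?b) (f' ?a k) (g' ?b l))
       (TenM D (xs ! ?c) (xs' ! k) (ys ! ?d) (ys' ! l) (f k ?c) (g l ?d)))"
     using 15 b by (intro sum.cong refl TenM_Cmp) (auto simp: additive_simps additive_Hom in_lists_nth)
    also have "... = (SUM m<length xs' * length ys'.
      Cmp D (TenO D (xs ! ?c) (ys ! ?d)) (TenO D (xs' ! (m div length ys')) (ys' ! (m mod length ys'))) (TenO D (xs'' ! ?a) (ys'' ! ?b))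
       (TenM D (xs' ! (m div length ys')) (xs'' ! ?a) (ys' ! (m mod length ys')) (ys'' ! ?b) (f' ?a (m div length ys')) (g' ?b (m mod length ys')))
       (TenM D (xs ! ?c) (xs' ! (m div length ys')) (ys ! ?d) (ys' ! (m mod length ys')) (f (m div length ys') ?c) (g (m mod length ys') ?d)))"
     by (rule sum_div_mod[symmetric])
    also have "... = Cmp ?A (TenO ?A xs ys) (TenO ?A xs' ys') (TenO ?A xs'' ys'')
     (TenM ?A xs' xs'' ys' ys'' f' g') (TenM ?A xs xs' ys ys' f g) i j"
     using True by (simp add: additive_simps length_concat_map nth_concat_map)
    finally show ?thesis .
   next
    case False
    have "length (TenO ?A xs'' ys'') = length xs'' * length ys''" "length (TenO ?A xs ys) = length xs * length ys"
     by (simp_all add: additive_simps length_concat_map)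
    thus ?thesis by (simp only: additive_simps(3,6) if_not_P[OF False])
   qed
  qed
 qed (auto simp: vector_space_additive additive_simps fun_eq_iff fun_simps Cmp_add_right Cmp_add_left Cmp_Scl_right
   Cmp_Scl_left TenM_add_right TenM_add_left TenM_Scl_right TenM_Scl_left sum.distrib scale_sum_right)
qed

lemma idempotent_simps:
 "Obj (idempotent_completion D) = {(X, p). X : Obj D & p : Hom D X X & Cmp D X X X p p = p}"
 "Hom (idempotent_completion D) (X, p) (Y, q) = {f : Hom D X Y. Cmp D X X Y f p = f & Cmp D X Y Y q f = f}"
 "Idn (idempotent_completion D) (X, p) = p"
 "Cmp (idempotent_completion D) (X, p) (Y, q) (Z, s) = Cmp D X Y Z"
 "Scl (idempotent_completion D) = Scl D"
 "TenO (idempotent_completion D) (X, p) (Y, q) = (TenO D X Y, TenM D X X Y Y p q)"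
 "TenM (idempotent_completion D) (X, p) (X', p') (Y, q) (Y', q') = TenM D X X' Y Y'"
 by (simp_all add: idempotent_completion_def)

theorem linear_tensor_category_idempotent: "linear_tensor_category (idempotent_completion D)"
proof (rule linear_tensor_category.intro, goal_cases)
 case (2 X Y)
 thus ?case
  by (cases X; cases Y)
   (auto simp: idempotent_simps Cmp_add_left Cmp_add_right Cmp_Scl_left Cmp_Scl_right
    intro!: subspaceI Hom_add Hom_Scl)
next
 case (4 X Y Z f g)
 thus ?case
  by (cases X; cases Y; cases Z)
   (auto simp: idempotent_simps Cmp_Hom Cmp_assoc Cmp_assoc[symmetric])
next
 case (5 W X Y Z f g h)
 thus ?case
  by (cases W; cases X; cases Y; cases Z) (auto simp: idempotent_simps Cmp_assoc)
next
 case (13 X X' Y Y' f g)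
 thus ?case
  by (cases X; cases X'; cases Y; cases Y')
   (auto simp: idempotent_simps TenM_Hom TenM_Cmp[symmetric])
next
 case (15 X X' X'' Y Y' Y'' f f' g g')
 thus ?case
  by (cases X; cases X'; cases X''; cases Y; cases Y'; cases Y'') (auto simp: idempotent_simps TenM_Cmp)
qed (auto simp: vs idempotent_simps TenO_Obj TenM_Hom TenM_Cmp[symmetric] Cmp_add_left Cmp_add_right
  Cmp_Scl_left Cmp_Scl_right TenM_add_right TenM_add_left TenM_Scl_right TenM_Scl_left)

end

section \<open>Subquotients in exact Mal'cev categories\<close>

lemma (in finitely_complete_category) pairing_injD:
 assumes "pg f g = pg f' g'" "ar f" "ar g" "dom f = dom g"
  "ar f'" "ar g'" "dom f' = dom g'" "cod f = cod f'" "cod g = cod g'"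
 shows "f = f'" "g = g'"
 using pairing_eq_iff[OF assms(2-)] assms(1) by blast+

context exact_malcev_category
begin

definition size :: "'a => nat" where
 "size x = card (Sub (pd x x))"

end

context degree_function
begin

text \<open>The composite is the image of the kernel pair of \<open>p\<close> under \<open>q\<close>
  in both coordinates. Being the diagonal of \<open>z\<close> means that \<open>q\<close> takes
  equal values on points with equal \<open>p\<close>, and that these values cover \<open>z\<close>.
  With \<open>subquotient_span\<close>, this turns a splitting of spans into a subquotient.\<close>

lemma sp_split:
 assumes pq: "ar p" "ar q" "dom p = dom q" "cod p = x" "cod q = z"
  and id: "ct z x z (sp p q) (sp q p) = idT z"
 shows "srj q"
  and "!!alpha beta. ar alpha ==> ar beta ==> dom alpha = dom beta ==> cod alpha = dom q ==>
   cod beta = dom q ==> p ** alpha = p ** beta ==> q ** alpha = q ** beta"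
proof -
 have z: "ob z" using pq by auto
 let ?d = "pg (idt C z) (idt C z)"
 have d: "mon ?d" using z by (subst monic_pairing_iff) auto
 obtain a b where ab: "pbk p p a b" using ex_pullback[of p p] pq by auto
 note F = pbkD[OF ab]
 let ?f = "pg (q ** a) (q ** b)"
 have f: "?f : arr C" "dom ?f = dom b" "cod ?f = pd z z" using F pq by auto
 note S = im_fact[OF f(1), unfolded f]
 note r = rep_sub[OF S(1)]
 have "sp (q ** a) (q ** b) = basis (cls ?d)"
  using Cmp_sp[OF _ _ _ _ _ _ ab, of q q z x z] id pq z by (simp add: graph_sp bas_monic[OF d])
 from fun_cong[OF this, of "cls ?d"] have "im C ?f = cls ?d"
  by (simp add: bas_def basis_def split: if_splits)
 hence "fth (rep (im C ?f)) ?d" "fth ?d (rep (im C ?f))"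
  using sub_of_eq_iff[OF r(1) d] r z by simp_all
 then obtain i j where i: "ar i" "dom i = dom (rep (im C ?f))" "cod i = z" "?d ** i = rep (im C ?f)"
  and j: "ar j" "dom j = z" "cod j = dom (rep (im C ?f))" "rep (im C ?f) ** j = ?d"
  unfolding fth_iff using z by auto
 define t where "t = i ** surj_part C ?f"
 have t: "ar t" "dom t = dom b" "cod t = z" using i S by (simp_all add: t_def)
 have "?d ** (i ** j) = ?d ** idt C z"
  using assoc[of j i ?d] i j z by (simp del: pairing_cmp)
 hence "i ** j = idt C z" using monicD[OF d, of "i ** j" "idt C z"] i j z by simp
 hence "srj i" using surjective_cancel[of i j] i j z by (simp add: iso_surjective)
 hence ts: "srj t" unfolding t_def using surjective_cmp[OF _ S(6)] S i by simp
 have "?d ** t = ?f"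
  unfolding t_def using assoc[of "surj_part C ?f" i ?d] i S z by (simp del: pairing_cmp)
 hence "pg t t = ?f" using t z by simp
 note 1 = pairing_injD[OF this]
 have 2: "t = q ** a" by (rule 1(1)) (use t F pq in simp_all)
 have 3: "t = q ** b" by (rule 1(2)) (use t F pq in simp_all)
 note qt = 2[symmetric] 3[symmetric]
 show "srj q" using surjective_cancel[of q a] ts F pq unfolding qt(1)[symmetric] by simp
 fix alpha beta assume u: "ar alpha" "ar beta" "dom alpha = dom beta" "cod alpha = dom q"
  "cod beta = dom q" "p ** alpha = p ** beta"
 then obtain k where k: "ar k" "cod k = dom b" "a ** k = alpha" "b ** k = beta"
  using pullback_ex[OF ab, of alpha beta] pq by auto
 show "q ** alpha = q ** beta"
  unfolding k(3,4)[symmetric] by (rule eq_cmp[OF trans[OF qt(1) qt(2)[symmetric]]]) (use F pq k in simp_all)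
qed

text \<open>The kernel pair of a mono is trivial, so the composite is the diagonal of
  \<open>z\<close> precomposed with \<open>e\<close>. When \<open>\<delta> e\<close> is 1, this
  exhibits \<open>[z]\<close> as a retract of \<open>[x]\<close>.\<close>

lemma ct_conv:
 assumes "mon m" "srj e" "dom e = dom m" "cod m = x" "cod e = z"
 shows "ct z x z (sp m e) (sp e m) = scl (\<delta> e) (idT z)"
proof -
 have 1: "pbk m m (idt C (dom m)) (idt C (dom m))"
 proof (rule pullbackI)
  fix c d assume "ar c" "ar d" "dom c = dom d" "cod c = dom m" "cod d = dom m" "m ** c = m ** d"
  thus "EX u:arr C. dom u = dom d & cod u = dom (idt C (dom m)) & idt C (dom m) ** u = c & idt C (dom m) ** u = d"
   using monicD[OF assms(1), of c d] assms(1) by (intro bexI[of _ c]) auto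
 qed (use assms in auto)
 have "ct z x z (sp m e) (sp e m) = bas (pg (idt C z) (idt C z) ** e)"
  by (subst Cmp_sp[OF _ _ _ _ _ _ 1]) (use assms in auto)
 thus ?thesis
  using bas_surj[OF _ assms(2), of "pg (idt C z) (idt C z)"] assms
  by (auto simp: graph_sp Scl_T0)
qed

lemma basis_Hom: "r : Sub (pd x y) ==> (basis r :: 'm set => 'k) : HT x y"
 by (auto simp: Hom_T0 basis_def)

lemma sp_cmp_sp:
 assumes "ar p" "ar q" "dom p = dom q" "ar p'" "ar q'" "dom p' = dom q'"
  "cod q = cod p'" "cod p = x" "cod q = y" "cod q' = z"
 obtains p'' q'' where "ar p''" "ar q''" "dom p'' = dom q''" "cod p'' = x" "cod q'' = z"
  "ct x y z (sp p' q') (sp p q) = sp p'' q''"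
proof -
 obtain a b where ab: "pbk q p' a b" using ex_pullback[of q p'] assms by auto
 show ?thesis
  by (rule that[of "p ** a" "q' ** b"]) (use Cmp_sp[OF _ _ _ _ _ _ ab] pbkD[OF ab] assms in auto)
qed

end

context exact_malcev_category
begin

text \<open>
 With all degrees equal to 1 a subquotient of \<open>x\<close> becomes a direct summand of \<open>[x]\<close>; since
 \<open>size\<close> is the dimension of the endomorphism ring, it is monotone, and finitely many
 endomorphisms of \<open>[x]\<close> are the graphs of the resulting idempotents.
\<close>

lemma size_subquotient_span:
 assumes "mon m" "srj e" "dom e = dom m"
 shows "size (cod e) <= size (cod m)"
  and "size (cod e) >= size (cod m) ==> iso_arr C m & iso_arr C e"
proof -
 interpret D: degree_function C "%_. 1 :: rat" by unfold_locales auto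
 let ?T = "T0 C (%_. 1 :: rat)"
 let ?x = "cod m" and ?z = "cod e" and ?c = "Cmp ?T" and ?a = "D.bas (pg m e)" and ?b = "D.bas (pg e m)"
 have me [simp]: "ar m" "ar e" "dom e = dom m" using assms by auto
 have ab: "?a : Hom ?T ?x ?z" "?b : Hom ?T ?z ?x" by auto
 note hom = ab D.T0.Cmp_Hom D.T0.Idn_Hom
 have split: "?c ?z ?x ?z ?a ?b = Idn ?T ?z"
  using D.ct_conv[OF assms refl refl] by (simp add: D.Scl_T0)
 \<comment> \<open>Conjugation by the retraction embeds the endomorphisms of \<open>z\<close> into
   those of \<open>x\<close>. As all degrees are 1, it maps basis elements to basis elements, so
   \<open>Sub (pd ?z ?z)\<close> injects into \<open>Sub (pd ?x ?x)\<close>.\<close>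
 define F where "F v = ?c ?x ?z ?x ?b (?c ?x ?z ?z v ?a)" for v
 have F: "?c ?z ?x ?z ?a (?c ?z ?x ?x (F v) ?b) = v" if v: "v : Hom ?T ?z ?z" for v
 proof -
  have "?c ?z ?x ?z ?a (?c ?z ?x ?x (F v) ?b) = ?c ?z ?z ?z (?c ?z ?x ?z ?a ?b) (?c ?z ?z ?z v (?c ?z ?x ?z ?a ?b))"
   unfolding F_def using v ab by (simp only: D.T0.Cmp_assoc D.T0.Cmp_Hom D.T0_simps tgt_obj me)
  thus ?thesis using v unfolding split by (simp only: D.T0.Cmp_Idn D.T0.Idn_Cmp D.T0_simps(1) tgt_obj me)
 qed
 have "EX t:Sub (pd ?x ?x). F (basis r) = basis t" if r: "r : Sub (pd ?z ?z)" for r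
 proof -
  obtain p q where pq: "basis r = D.bas (pg p q)" "ar p" "ar q" "dom p = dom q" "cod p = ?z" "cod q = ?z"
   using D.basis_sp(1)[OF r] rep_sub[OF r] by (metis cmp_arr me(2) pr_arr tgt_obj)
  obtain p' q' where pq': "?c ?x ?z ?z (basis r) ?a = D.bas (pg p' q')" "ar p'" "ar q'" "dom p' = dom q'" "cod p' = ?x" "cod q' = ?z"
   unfolding pq(1) by (rule D.sp_cmp_sp[of m e p q ?x ?z ?z]) (use pq in auto)
  obtain p'' q'' where "F (basis r) = D.bas (pg p'' q'')" "ar p''" "ar q''" "dom p'' = dom q''" "cod p'' = ?x" "cod q'' = ?x"
   unfolding F_def pq'(1) by (rule D.sp_cmp_sp[of p' q' e m ?x ?z ?x]) (use pq' in auto)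
  thus ?thesis using im_fact(1)[of "pg p'' q''"] by (auto simp: D.bas_def)
 qed
 then obtain G where G: "!!r. r : Sub (pd ?z ?z) ==> G r : Sub (pd ?x ?x) & F (basis r) = basis (G r)"
  by metis
 have inj: "inj_on G (Sub (pd ?z ?z))"
 proof (rule inj_onI)
  fix r s assume rs: "r : Sub (pd ?z ?z)" "s : Sub (pd ?z ?z)" "G r = G s"
  hence "basis r = (basis s :: 'b set => rat)"
   using G[OF rs(1)] G[OF rs(2)] F[OF D.basis_Hom[OF rs(1)]] F[OF D.basis_Hom[OF rs(2)]] by metis
  from fun_cong[OF this, of r] show "r = s" by (simp add: basis_def split: if_splits)
 qed
 have sub: "G ` Sub (pd ?z ?z) \<subseteq> Sub (pd ?x ?x)" and fin: "finite (Sub (pd ?x ?x))"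
  using G subobject_finite by auto
 show "size ?z <= size ?x" unfolding size_def using card_inj_on_le[OF inj sub fin] .
 \<comment> \<open>Equal finite cardinalities make the injection onto, so the identity of
   \<open>x\<close> is of the form \<open>?b\<close> after some \<open>?w\<close>; then
   \<open>?w\<close> equals \<open>?a\<close>, the retraction is invertible, and
   \<open>sp_split\<close> applies in the other direction as well.\<close>
 assume "size ?z >= size ?x"
 hence "G ` Sub (pd ?z ?z) = Sub (pd ?x ?x)"
  using card_seteq[OF fin sub] card_image[OF inj] by (simp add: size_def)
 moreover have "graph C (idt C ?x) : Sub (pd ?x ?x)"
  unfolding graph_def by (intro sub_of_subobjs) (auto simp: monic_pairing_iff)
 ultimately obtain r where r: "r : Sub (pd ?z ?z)" "Idn ?T ?x = F (basis r)"
  using G by (metis (no_types, lifting) D.T0_simps(2) imageE)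
 let ?w = "?c ?x ?z ?z (basis r) ?a"
 have w: "?w : Hom ?T ?x ?z" "?c ?x ?z ?x ?b ?w = Idn ?T ?x"
  using ab D.basis_Hom[OF r(1)] r(2) by (simp_all add: F_def D.T0.Cmp_Hom)
 have "?w = ?c ?x ?z ?z (?c ?z ?x ?z ?a ?b) ?w"
  unfolding split using w(1) by (simp only: D.T0.Idn_Cmp D.T0_simps(1) tgt_obj me)
 also have "... = ?a"
  using w ab by (simp only: D.T0.Cmp_assoc D.T0.Cmp_Idn D.T0_simps(1) tgt_obj me)
 finally have ba: "?c ?x ?z ?x ?b ?a = Idn ?T ?x" using w(2) by simp
 note S = D.sp_split[OF me(2,1,3) refl refl ba]
 have "mon e"
  by (rule monicI[OF me(2)], rule monicD[OF assms(1)]) (use S(2) me(3) in metis)+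
 thus "iso_arr C m & iso_arr C e" using S(1) assms surj_monic_iso by blast
qed

lemma size_monic:
 assumes "mon m"
 shows "size (dom m) <= size (cod m)"
  and "size (dom m) = size (cod m) ==> iso_arr C m"
 using size_subquotient_span[OF assms, of "idt C (dom m)"] assms by (auto simp: iso_surjective)

lemma size_subquotient: "subquotient C z x ==> size z <= size x"
 unfolding subquotient_def using size_subquotient_span by metis

lemma subquotient_iso:
 assumes "subquotient C z x" "size x <= size z"
 shows "iso_obj C z x"
proof -
 obtain m e where me: "mon m" "cod m = x" "srj e" "dom e = dom m" "cod e = z"
  using assms unfolding subquotient_def by blast
 hence "iso_arr C m" "iso_arr C e" using size_subquotient_span[OF me(1,3,4)] assms by auto
 hence "iso_obj C (dom m) x" "iso_obj C (dom m) z"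
  using me by (metis iso_obj_arr)+
 thus ?thesis using iso_obj_sym iso_obj_trans by blast
qed

lemma size_iso: "iso_obj C x y ==> size x = size y"
proof -
 have "size x <= size y" if "iso_obj C x y" for x y
  using that size_monic(1)[OF iso_monic] unfolding iso_obj_def by (auto simp: in_homs)
 thus "iso_obj C x y ==> size x = size y" using iso_obj_sym by (simp add: le_antisym)
qed

lemma proper_subquotient_iff: "proper_subquotient C z x \<longleftrightarrow> subquotient C z x & size z < size x"
 unfolding proper_subquotient_def
 using size_subquotient subquotient_iso size_iso by (metis leD le_less_linear linorder_not_le)

text \<open>The image of the pair of \<open>m\<close> and \<open>k\<close> is a partial surjection:
  two points with equal first coordinate lift, after a common surjective base change, to points with
  equal \<open>m\<close>, hence with equal \<open>k\<close>.\<close>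

lemma subquotient_span:
 assumes "ar m" "srj k" "dom m = dom k"
  and fib: "!!alpha beta. ar alpha ==> ar beta ==> dom alpha = dom beta ==> cod alpha = dom k ==>
   cod beta = dom k ==> m ** alpha = m ** beta ==> k ** alpha = k ** beta"
 shows "subquotient C (cod k) (cod m)"
proof -
 have [simp]: "ar m" "ar k" using assms by auto
 let ?w = "cod m" and ?z = "cod k"
 define s where "s = surj_part C (pg m k)"
 define d where "d = rep (im C (pg m k))"
 have S: "ar s" "dom s = dom k" "cod s = dom d" "d ** s = pg m k" "srj s"
  using im_fact[of "pg m k"] assms by (auto simp: s_def d_def)
 have d: "mon d" "ar d" "cod d = pd ?w ?z"
  using rep_sub[OF im_fact(1)[of "pg m k"]] assms by (auto simp: d_def)
 define d1 d2 where "d1 = pr1 C ?w ?z ** d" and "d2 = pr2 C ?w ?z ** d"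
 have D: "ar d1" "ar d2" "dom d1 = dom d" "dom d2 = dom d" "cod d1 = ?w" "cod d2 = ?z"
  "d1 ** s = m" "d2 ** s = k" "pg d1 d2 = d"
  using d S assms pairing_eta[of d ?w ?z] by (auto simp: d1_def d2_def)
 have surj: "srj d2"
  using surjective_cancel[of d2 s] D S assms by simp
 have "mon d1"
 proof (rule monicI)
  fix u v assume uv: "ar u" "ar v" "dom u = dom v" "cod u = dom d1" "cod v = dom d1" "d1 ** u = d1 ** v"
  obtain a b where ab: "pbk s u a b" using ex_pullback[of s u] S uv D by auto
  note F = pbkD[OF ab]
  obtain a' b' where ab': "pbk s (v ** b) a' b'" using ex_pullback[of s "v ** b"] S uv D F by auto
  note F' = pbkD[OF ab']
  have sb: "srj b" "srj b'" using surjective_pullback S(5) ab ab' by blast+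
  have 1: "s ** (a ** b') = u ** (b ** b')" using eq_cmp[OF F(9), of b'] F F' uv S by simp
  have 2: "s ** a' = v ** (b ** b')" using F F' uv S D by simp
  have "m ** (a ** b') = d1 ** (s ** (a ** b'))"
   using assoc[of "a ** b'" s d1] D S F F' uv by simp
  also have "... = d1 ** (s ** a')"
   unfolding 1 2 using eq_cmp[OF uv(6), of "b ** b'"] F F' uv D by simp
  also have "... = m ** a'"
   using assoc[of a' s d1] D S F F' uv by simp
  finally have "k ** (a ** b') = k ** a'"
   using fib[of "a ** b'" a'] F F' uv S D by simp
  hence "d2 ** (s ** (a ** b')) = d2 ** (s ** a')"
   using assoc[of "a ** b'" s d2] assoc[of a' s d2] D S F F' uv by simp
  hence "d2 ** (u ** (b ** b')) = d2 ** (v ** (b ** b'))" unfolding 1 2 .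
  moreover have "d1 ** (u ** (b ** b')) = d1 ** (v ** (b ** b'))"
   using eq_cmp[OF uv(6), of "b ** b'"] F F' uv D by simp
  ultimately have "d ** (u ** (b ** b')) = d ** (v ** (b ** b'))"
   unfolding D(9)[symmetric] using F(3-8) F'(3-8) uv(1-5) D(1-6) by simp
  hence eq: "u ** (b ** b') = v ** (b ** b')"
   using monicD[OF d(1), of "u ** (b ** b')" "v ** (b ** b')"] F F' uv D by simp
  have "srj (b ** b')" using surjective_cmp[OF sb] F F' uv D by simp
  thus "u = v"
   by (rule surj_epi[OF _ uv(1,2) _ _ _ eq]) (use F(3-8) F'(3-8) uv(1-5) D(1-6) in simp_all)
 qed (use D in simp)
 thus ?thesis
  unfolding subquotient_def using surj D by metis
qed

text \<open>A recombination principle. Of two points \<open>u\<close>, \<open>v\<close> with the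
  same \<open>k\<close>, some \<open>w\<close> has the \<open>r\<close>-value of \<open>u\<close>
  and the \<open>m\<close>-value of \<open>v\<close>. As \<open>m\<close> is mono, \<open>w\<close>
  and \<open>v\<close> have the same \<open>s\<close>-value, so \<open>r ** s\<close> is constant on
  the fibres of \<open>k\<close> and \<open>cod r\<close> is a subquotient of
  \<open>cod k\<close>.\<close>

lemma size_le_fibre:
 assumes s: "srj s" and r: "srj r" "dom r = cod s" and m: "mon m" "dom m = cod s"
  and k: "ar k" "dom k = dom s"
  and lift: "!!u v. ar u ==> ar v ==> dom u = dom v ==> cod u = dom s ==> cod v = dom s ==>
   k ** u = k ** v ==> EX w. ar w & dom w = dom v & cod w = dom s &
    r ** (s ** w) = r ** (s ** u) & m ** (s ** w) = m ** (s ** v)"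
 shows "size (cod r) <= size (cod k)"
proof -
 have [simp]: "ar s" "ar r" using s r by auto
 have "subquotient C (cod (r ** s)) (cod k)"
 proof (rule subquotient_span[OF k(1)])
  fix u v assume u: "ar u" "ar v" "dom u = dom v" "cod u = dom (r ** s)" "cod v = dom (r ** s)" "k ** u = k ** v"
  then obtain w where w: "ar w" "dom w = dom v" "cod w = dom s" "r ** (s ** w) = r ** (s ** u)" "m ** (s ** w) = m ** (s ** v)"
   using lift[of u v] r by auto
  hence "s ** w = s ** v" using monicD[OF m(1), of "s ** w" "s ** v"] u m r by simp
  thus "(r ** s) ** u = (r ** s) ** v" using w(4) u r by simp
 qed (use surjective_cmp s r k in simp_all)
 thus ?thesis using size_subquotient r by simp
qed

text \<open>Relate \<open>f\<close> to \<open>g\<close> when the pair of \<open>p ** f\<close> and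
  \<open>q ** g\<close> lies in the relation. This relation on \<open>dom q\<close> is reflexive, so
  by the Mal'cev condition it is symmetric. It holds for \<open>\<gamma>\<close> and
  \<open>alpha\<close> with witness \<open>beta\<close>; reversing it gives
  \<open>\<omega>\<close>.\<close>

lemma difunctional:
 assumes "ar p" "ar q" "dom p = dom q" "mon (pg p q)"
  and pts: "ar alpha" "ar beta" "ar \<gamma>" "dom alpha = t" "dom beta = t" "dom \<gamma> = t"
  "cod alpha = dom q" "cod beta = dom q" "cod \<gamma> = dom q" "q ** alpha = q ** beta" "p ** beta = p ** \<gamma>"
 shows "EX \<omega>. ar \<omega> & dom \<omega> = t & cod \<omega> = dom q & p ** \<omega> = p ** alpha & q ** \<omega> = q ** \<gamma>"
proof -
 let ?v = "dom q"
 have [simp]: "?v : obj C" "ob t" using assms by auto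
 define G where "G = pg (p ** pr1 C ?v ?v) (q ** pr2 C ?v ?v)"
 have G: "ar G" "dom G = pd ?v ?v" "cod G = pd (cod p) (cod q)"
  using assms by (auto simp: G_def)
 obtain a b where ab: "pbk (pg p q) G a b"
  using ex_pullback[of "pg p q" G] G assms by auto
 note F = pbkD[OF ab]
 have b: "mon b" using pullback_monic[OF ab assms(4)] .
 have D: "cls b : Sub (pd ?v ?v)" using b F G by (intro sub_of_subobjs) auto
 have fac: "fth (pg f g) b \<longleftrightarrow>
   (EX w:arr C. dom w = dom f & cod w = ?v & p ** w = p ** f & q ** w = q ** g)"
  if fg: "ar f" "ar g" "dom f = dom g" "cod f = ?v" "cod g = ?v" for f g
 proof
  assume "fth (pg f g) b"
  then obtain k where k: "ar k" "dom k = dom f" "cod k = dom b" "b ** k = pg f g"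
   unfolding fth_iff using fg by auto
  have "pg p q ** (a ** k) = G ** pg f g"
   using eq_cmp[OF F(9), of k] k F fg by simp
  hence "pg (p ** (a ** k)) (q ** (a ** k)) = pg (p ** f) (q ** g)"
   using k F fg assms by (simp add: G_def)
  hence "p ** (a ** k) = p ** f & q ** (a ** k) = q ** g"
   using k F fg assms by (subst (asm) pairing_eq_iff) auto
  thus "EX w:arr C. dom w = dom f & cod w = ?v & p ** w = p ** f & q ** w = q ** g"
   using k F assms by (intro bexI[of _ "a ** k"]) auto
 next
  assume "EX w:arr C. dom w = dom f & cod w = ?v & p ** w = p ** f & q ** w = q ** g"
  then obtain w where w: "ar w" "dom w = dom f" "cod w = ?v" "p ** w = p ** f" "q ** w = q ** g"
   by blast
  hence "pg p q ** w = G ** pg f g"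
   using fg assms by (simp add: G_def)
  then obtain k where "ar k" "dom k = dom (pg f g)" "cod k = dom b" "b ** k = pg f g"
   using pullback_ex[OF ab, of w "pg f g"] w(1-3) fg G assms(1-3) by auto
  thus "fth (pg f g) b" unfolding fth_iff by blast
 qed
 have "reflexive_relation C ?v (cls b)"
  unfolding reflexive_relation_def factors_sub_sub_of[OF b]
  using D fac[of "idt C ?v" "idt C ?v"] assms by (auto intro!: bexI[of _ "idt C ?v"])
 hence "equiv_relation C ?v (cls b)" using malcev by simp
 hence "sym (points_rel C ?v (cls b) t)"
  by (simp add: equiv_relation_def equiv_def)
 moreover have "(\<gamma>, alpha) : points_rel C ?v (cls b) t"
  unfolding points_rel_def factors_sub_sub_of[OF b] using fac[of \<gamma> alpha] pts
  by (auto simp: in_homs intro!: bexI[of _ beta])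
 ultimately have "(alpha, \<gamma>) : points_rel C ?v (cls b) t" by (rule symD)
 thus ?thesis
  unfolding points_rel_def factors_sub_sub_of[OF b] using fac[of alpha \<gamma>] pts by auto
qed

text \<open>
 Goursat's lemma: a relation from \<open>x\<close> to \<open>z\<close> which is not the graph of a partially defined
 surjection comes from a smaller object \<open>w\<close> than \<open>z\<close>, either a subobject or a quotient of \<open>z\<close>.
\<close>

lemma goursat:
 assumes "ar p" "ar q" "dom p = dom q" "mon (pg p q)"
  and "~ (mon p & srj q)"
 obtains (sub) m k where "mon m" "ar k" "dom k = dom q" "cod k = dom m" "cod m = cod q"
   "m ** k = q" "size (dom m) < size (cod q)"
 | (quot) f s1 s2 a where "srj f" "dom f = cod q" "ar s1" "ar s2" "dom s1 = dom s2"
   "cod s1 = cod p" "pbk s2 f a q" "s1 ** a = p" "size (cod f) < size (cod q)"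
proof (cases "srj q")
 case False
 note S = im_fact[OF assms(2)]
 note r = rep_sub[OF S(1)]
 have "~ iso_arr C (rep (im C q))"
  using False surjective_cmp[OF iso_surjective S(6), of "rep (im C q)"] S by auto
 hence "size (dom (rep (im C q))) < size (cod q)"
  using size_monic[OF r(1)] r by force
 thus ?thesis using sub[of "rep (im C q)" "surj_part C q"] S r by simp
next
 case True
 let ?v = "dom q" and ?x = "cod p" and ?z = "cod q"
 have np: "~ mon p" using True assms(5) by blast
 obtain k1 k2 where K: "pbk p p k1 k2" using ex_pullback[of p p] assms by auto
 note KF = pbkD[OF K]
 \<comment> \<open>\<open>R\<close> will relate two points of the target of \<open>q\<close> that
   locally are the \<open>q\<close>-values of points with the same \<open>p\<close>. Surjectivity of
   \<open>q\<close> makes it reflexive, so it is the kernel pair of some surjection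
   \<open>f\<close>.\<close>
 define kappa where "kappa = pg (q ** k1) (q ** k2)"
 have kappa: "ar kappa" "dom kappa = dom k2" "cod kappa = pd ?z ?z"
  using KF assms by (auto simp: kappa_def)
 define R where "R = im C kappa"
 note S = im_fact[OF kappa(1), folded R_def, unfolded kappa]
 note r = rep_sub[OF S(1)]
 obtain d where d: "ar d" "dom d = ?v" "cod d = dom k2" "k1 ** d = idt C ?v" "k2 ** d = idt C ?v"
  using pullback_ex[OF K, of "idt C ?v" "idt C ?v"] assms by auto
 have "kappa ** d = pg (idt C ?z) (idt C ?z) ** q"
  unfolding kappa_def using d KF assms by simp
 hence "fth (pg (idt C ?z) (idt C ?z)) (rep R)"
  unfolding R_def using im_factor[OF kappa(1) _ _ True, of "pg (idt C ?z) (idt C ?z)" d] kappa d assms by simp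
 hence "reflexive_relation C ?z R"
  unfolding reflexive_relation_def using S(1) factors_sub_rep[OF S(1)] assms by simp
 hence "effective C ?z R" using malcev exact assms(2) by simp
 then obtain f where f: "srj f" "dom f = ?z"
  "pbk f f (pr1 C ?z ?z ** rep R) (pr2 C ?z ?z ** rep R)"
  unfolding effective_def by blast
 note FF = pbkD[OF f(3)]
 let ?w = "cod f"
 \<comment> \<open>If \<open>f\<close> were mono, \<open>R\<close> would lie in the diagonal, so
   \<open>k1\<close> and \<open>k2\<close> would agree under \<open>q\<close> as well as under
   \<open>p\<close>; joint monicity would then make \<open>p\<close> mono.\<close>
 have "~ mon f"
 proof
  assume fm: "mon f"
  have 1: "pr1 C ?z ?z ** rep R = pr2 C ?z ?z ** rep R"
   using monicD[OF fm FF(3,4)] FF f by simp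
  have "q ** k1 = pr1 C ?z ?z ** (rep R ** surj_part C kappa)"
   unfolding S(5) unfolding kappa_def using KF assms by simp
  also have "... = pr2 C ?z ?z ** (rep R ** surj_part C kappa)"
   using eq_cmp[OF 1, of "surj_part C kappa"] r S(2-5) assms by simp
  also have "... = q ** k2"
   unfolding S(5) unfolding kappa_def using KF assms by simp
  finally have "k1 = k2"
   using assms(4) KF assms unfolding monic_pairing_iff[OF assms(1-3)] by simp
  have "mon p"
  proof (rule monicI)
   fix u v assume uv: "ar u" "ar v" "dom u = dom v" "cod u = dom p" "cod v = dom p" "p ** u = p ** v"
   thus "u = v" using pullback_ex[OF K, of u v] \<open>k1 = k2\<close> by metis
  qed (use assms in simp)
  thus False using np by simp
 qed
 hence "~ iso_arr C f" using iso_monic by blast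
 hence sz: "size ?w < size ?z" using size_subquotient_span[OF monic_idt f(1), of ?z] f assms by force
 have fa: "ar f" using f by simp
 \<comment> \<open>The legs \<open>s1\<close>, \<open>s2\<close> of the image of this pair form the
   relation between the source and the quotient of which the given relation should be the full
   preimage.\<close>
 let ?g = "pg p (f ** q)"
 have g: "?g : arr C" "dom ?g = ?v" "cod ?g = pd ?x ?w" using assms f fa by auto
 define sigma a where "sigma = rep (im C ?g)" and "a = surj_part C ?g"
 have A: "ar a" "dom a = ?v" "cod a = dom sigma" "sigma ** a = ?g" "srj a"
  using im_fact[OF g(1)] g by (auto simp: sigma_def a_def)
 have sigma: "mon sigma" "ar sigma" "cod sigma = pd ?x ?w"
  using rep_sub[OF im_fact(1)[OF g(1)]] g by (auto simp: sigma_def)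
 define s1 s2 where "s1 = pr1 C ?x ?w ** sigma" and "s2 = pr2 C ?x ?w ** sigma"
 have s: "ar s1" "ar s2" "dom s1 = dom sigma" "dom s2 = dom sigma" "cod s1 = ?x" "cod s2 = ?w"
  "s1 ** a = p" "s2 ** a = f ** q" "pg s1 s2 = sigma"
  using sigma A assms f fa pairing_eta[of sigma ?x ?w] by (auto simp: s1_def s2_def)
 \<comment> \<open>For compatible \<open>c\<close>, \<open>d\<close>, lift \<open>c\<close> locally
   to \<open>c'\<close>. Then \<open>q ** c'\<close> and \<open>d\<close> have the same value under
   \<open>f\<close>, hence are related by \<open>R\<close>, and difunctionality replaces the second
   coordinate \<open>q ** c'\<close> by \<open>d\<close>. Fill-in against the joint mono makes the
   result global.\<close>
 have "pbk s2 f a q"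
 proof (rule pullbackI)
  fix c d assume cd: "ar c" "ar d" "dom c = dom d" "cod c = dom s2" "cod d = dom f" "s2 ** c = f ** d"
  obtain c' e where ce: "pbk a c c' e" using ex_pullback[of a c] A cd s by auto
  note CF = pbkD[OF ce]
  have e: "srj e" using surjective_pullback[OF A(5) ce] .
  have "f ** (q ** c') = s2 ** (a ** c')" using eq_cmp[OF s(8), of c'] s A CF f fa assms by simp
  also have "... = f ** (d ** e)"
   unfolding CF(9) using eq_cmp[OF cd(6), of e] s CF cd f fa by simp
  finally obtain rho where rho: "ar rho" "dom rho = dom e" "cod rho = dom (rep R)"
   "(pr1 C ?z ?z ** rep R) ** rho = q ** c'" "(pr2 C ?z ?z ** rep R) ** rho = d ** e"
   using pullback_ex[OF f(3), of "q ** c'" "d ** e"] CF cd A f FF assms r by auto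
  have rq: "rep R ** rho = pg (q ** c') (d ** e)"
   using pairing_eta[of "rep R ** rho" ?z ?z] rho r assms by simp
  have "fth (pg (q ** c') (d ** e)) (rep R)"
   unfolding fth_iff using rho rq CF A cd f assms by (intro bexI[of _ rho]) auto
  then obtain e2 kappa' where e2: "srj e2" "cod e2 = dom (pg (q ** c') (d ** e))" "kappa' : arr C"
   "dom kappa' = dom e2" "cod kappa' = dom kappa" "kappa ** kappa' = pg (q ** c') (d ** e) ** e2"
   unfolding R_def using im_lift[OF kappa(1), of "pg (q ** c') (d ** e)"] CF A cd f assms kappa by auto
  have e2': "cod e2 = dom e" "ar e2" "cod kappa' = dom k2" using e2 CF A cd f assms kappa by auto
  have "pg (q ** (k1 ** kappa')) (q ** (k2 ** kappa')) = pg (q ** (c' ** e2)) (d ** (e ** e2))"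
   using e2(6) e2(3,4) e2' CF KF A cd f assms by (simp add: kappa_def)
  hence q: "q ** (k1 ** kappa') = q ** (c' ** e2)" "q ** (k2 ** kappa') = d ** (e ** e2)"
   using e2(3,4) e2' CF KF A cd f assms by (simp_all add: pairing_eq_iff)
  have p: "p ** (k1 ** kappa') = p ** (k2 ** kappa')"
   by (rule eq_cmp[OF KF(9)]) (use KF(1-8) e2(3) e2'(3) in simp_all)
  obtain \<omega> where \<omega>: "ar \<omega>" "dom \<omega> = dom e2" "cod \<omega> = ?v" "p ** \<omega> = p ** (c' ** e2)" "q ** \<omega> = q ** (k2 ** kappa')"
   using difunctional[OF assms(1-4), of "c' ** e2" "k1 ** kappa'" "k2 ** kappa'" "dom e2"] q p e2(3,4) e2' CF KF A cd assms
   by auto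
  have "p ** (c' ** e2) = (s1 ** c) ** (e ** e2)"
  proof -
   have "p ** (c' ** e2) = s1 ** ((a ** c') ** e2)"
    unfolding s(7)[symmetric] using s(1-6) A(1-3) CF(3-8) e2'(1,2) by simp
   thus ?thesis unfolding CF(9) using s(1-6) A(1-3) CF(3-8) cd(1-5) e2'(1,2) by simp
  qed
  hence eq: "pg p q ** \<omega> = pg (s1 ** c) d ** (e ** e2)"
   using \<omega> q s CF cd e2' f assms by simp
  have surj: "srj (e ** e2)" using surjective_cmp[OF e e2(1)] e2' by simp
  have "EX u. ar u & dom u = dom (pg (s1 ** c) d) & cod u = dom (pg p q) &
    pg p q ** u = pg (s1 ** c) d"
   by (rule surj_factor[OF surj assms(4) _ _ _ \<omega>(1) _ _ eq])
    (use assms(1-3) \<omega>(2,3) s(1-6) CF(3-8) cd(1-5) e2'(1,2) f(2) in simp_all)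
  then obtain u where u: "ar u" "dom u = dom d" "cod u = ?v" "pg p q ** u = pg (s1 ** c) d"
   using s(1-4) cd(1-4) assms(1-3) by auto
  hence u': "p ** u = s1 ** c" "q ** u = d"
   using cd s f assms by (simp_all add: pairing_eq_iff)
  have "sigma ** (a ** u) = pg (p ** u) (f ** (q ** u))"
   using assoc[of u a sigma] u A sigma assms fa f by simp
  also have "... = pg (s1 ** c) (s2 ** c)" using u' cd by simp
  also have "... = sigma ** c" unfolding s(9)[symmetric] using s(1-4) cd(1-4) by simp
  finally have "a ** u = c" using monicD[OF sigma(1), of "a ** u" c] u cd A s by simp
  thus "EX u:arr C. dom u = dom d & cod u = ?v & a ** u = c & q ** u = d"
   using u u' by blast
 next
  fix u v assume uv: "ar u" "ar v" "dom u = dom v" "cod u = ?v" "cod v = ?v"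
   "a ** u = a ** v" "q ** u = q ** v"
  have "p ** u = s1 ** (a ** u)" "p ** v = s1 ** (a ** v)"
   unfolding s(7)[symmetric] using s(1-6) A(1-3) uv(1-5) by simp_all
  hence "p ** u = p ** v" using uv(6) by simp
  thus "u = v"
   using assms(4) uv assms unfolding monic_pairing_iff[OF assms(1-3)] by simp
 qed (use s A f fa assms in auto)
 thus ?thesis using quot[OF f(1,2) s(1,2) _ s(5) _ s(7) sz] s by simp
qed

text \<open>With degrees 1, a subquotient \<open>z\<close> gives an idempotent on \<open>[x]\<close>
  that is a single basis element. Equal idempotents split the identity of \<open>z\<close> through
  \<open>w\<close> and conversely, so \<open>z\<close> and \<open>w\<close> are subquotients of each
  other and hence isomorphic.\<close>

lemma finite_subquotients:
 assumes X: "iso_representatives C X" and x: "ob x"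
 shows "finite {z : X. subquotient C z x}"
proof -
 interpret D: degree_function C "%_. 1 :: rat" by unfold_locales auto
 let ?T = "T0 C (%_. 1 :: rat)" and ?S = "{z : X. subquotient C z x}"
 let ?c = "Cmp ?T" and ?s = "%p q. D.bas (pg p q)"
 have "ALL z:?S. EX k. mon (fst k) & cod (fst k) = x & srj (snd k) & dom (snd k) = dom (fst k) & cod (snd k) = z"
  unfolding subquotient_def by fastforce
 from bchoice[OF this] obtain k where k: "ALL z:?S. mon (fst (k z)) & cod (fst (k z)) = x & srj (snd (k z)) &
   dom (snd (k z)) = dom (fst (k z)) & cod (snd (k z)) = z" ..
 define m e where "m z = fst (k z)" and "e z = snd (k z)" for z
 note me = bspec[OF k, folded m_def e_def]
 have arr: "m z : arr C" "e z : arr C" "dom (e z) = dom (m z)" "cod (m z) = x" "cod (e z) = z" "ob z" if "z : ?S" for z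
  using me[OF that] tgt_obj[of "e z"] by auto
 define P where "P z = ?c x z x (?s (e z) (m z)) (?s (m z) (e z))" for z
 have "EX t:Sub (pd x x). P z = basis t" if z: "z : ?S" for z
 proof -
  obtain p q where "P z = ?s p q" "ar p" "ar q" "dom p = dom q" "cod p = x" "cod q = x"
   unfolding P_def by (rule D.sp_cmp_sp[of "m z" "e z" "e z" "m z" x z x]) (use arr[OF z] in auto)
  thus ?thesis using im_fact(1)[of "pg p q"] by (auto simp: D.bas_def)
 qed
 then obtain R where R: "!!z. z : ?S ==> R z : Sub (pd x x) & P z = basis (R z)"
  by metis
 have sub: "subquotient C z w" if z: "z : ?S" and w: "w : ?S" and eq: "P z = P w" for z w
 proof -
  note z' = arr[OF z] and w' = arr[OF w]
  let ?a = "?s (m z) (e z)" and ?b = "?s (e z) (m z)" and ?a' = "?s (m w) (e w)" and ?b' = "?s (e w) (m w)"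
  have hom: "?a : Hom ?T x z" "?b : Hom ?T z x" "?a' : Hom ?T x w" "?b' : Hom ?T w x"
   "x : Obj ?T" "z : Obj ?T" "w : Obj ?T" using z' w' x by auto
  have split: "?c z x z ?a ?b = Idn ?T z"
   using D.ct_conv[of "m z" "e z" x z] me[OF z] by (simp add: D.Scl_T0)
  obtain p q where 1: "pbk (m z) (m w) p q" using ex_pullback[of "m z" "m w"] z' w' by auto
  note F = pbkD[OF 1]
  have "Idn ?T z = ?c z x z (?c x z z (?c z x z ?a ?b) ?a) ?b"
   using hom split by (simp only: D.T0.Idn_Cmp)
  also have "... = ?c z x z ?a (?c z x x (P z) ?b)"
   unfolding P_def using hom by (simp only: D.T0.Cmp_assoc D.T0.Cmp_Hom)
  also have "... = ?c z w z (?c w x z ?a ?b') (?c z x w ?a' ?b)"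
   unfolding eq unfolding P_def using hom by (simp only: D.T0.Cmp_assoc D.T0.Cmp_Hom)
  also have "?c w x z ?a ?b' = ?s (e w ** q) (e z ** p)"
   by (rule D.Cmp_sp[OF _ _ _ _ _ _ pullback_sym[OF 1]]) (use z' w' in auto)
  also have "?c z x w ?a' ?b = ?s (e z ** p) (e w ** q)"
   by (rule D.Cmp_sp[OF _ _ _ _ _ _ 1]) (use z' w' in auto)
  finally have id: "?c z w z (?s (e w ** q) (e z ** p)) (?s (e z ** p) (e w ** q)) = Idn ?T z" ..
  have pq: "e w ** q : arr C" "e z ** p : arr C" "dom (e w ** q) = dom (e z ** p)" "cod (e w ** q) = w" "cod (e z ** p) = z"
   using F z' w' by auto
  note S = D.sp_split[OF pq id]
  have "subquotient C (cod (e z ** p)) (cod (e w ** q))"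
   by (rule subquotient_span[OF pq(1) S(1) pq(3)]) (rule S(2))
  thus ?thesis using pq by simp
 qed
 have "inj_on R ?S"
 proof (rule inj_onI)
  fix z w assume zw: "z : ?S" "w : ?S" "R z = R w"
  hence "P z = P w" using R[OF zw(1)] R[OF zw(2)] by simp
  hence "subquotient C z w" "subquotient C w z" using sub[of z w] sub[of w z] zw by metis+
  hence "iso_obj C z w" using subquotient_iso size_subquotient by blast
  thus "z = w"
   using X zw iso_obj_refl[of z] arr(6)[OF zw(1)] unfolding iso_representatives_def by (metis (mono_tags, lifting) mem_Collect_eq)
 qed
 moreover have "R ` ?S \<subseteq> Sub (pd x x)" using R by blast
 ultimately show ?thesis
  using finite_imageD[OF finite_subset] subobject_finite[of "pd x x"] x by simp
qed

end

section \<open>Moebius inversion\<close>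

text \<open>Remove an element with a largest down-set. Such an element is maximal, so its unknown
  occurs in its own equation only and can be solved for last.\<close>

lemma finite_poset_inversion:
 fixes h :: "'a => 'b::ab_group_add"
 assumes "finite P" "!!a. a : P ==> lq a a"
  and "!!a b. a : P ==> b : P ==> lq a b ==> lq b a ==> a = b"
  and "!!a b c. a : P ==> b : P ==> c : P ==> lq a b ==> lq b c ==> lq a c"
 shows "EX g. ALL b:P. (SUM c:{c:P. lq c b}. g c) = h b"
 using assms
proof (induction "card P" arbitrary: P)
 case (Suc n)
 have "P ~= {}" using Suc.hyps(2) by auto
 define d where "d = (%m. card {c:P. lq c m})"
 have "Max (d ` P) : d ` P" using Suc.prems(1) \<open>P ~= {}\<close> by (intro Max_in) auto
 then obtain m where m: "m : P" "d m = Max (d ` P)" by auto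
 have max: "b = m" if "b : P" "lq m b" for b
 proof (rule ccontr)
  assume "b ~= m"
  hence "{c:P. lq c m} \<subset> {c:P. lq c b}"
   using Suc.prems(2-4) m that by (intro psubsetI subsetI) (blast, metis (mono_tags, lifting) mem_Collect_eq)
  hence "d m < d b" unfolding d_def using Suc.prems(1) by (intro psubset_card_mono) auto
  moreover have "d b <= Max (d ` P)" using that Suc.prems(1) by simp
  ultimately show False using m by simp
 qed
 have n: "n = card (P - {m})" using Suc.hyps(2) m Suc.prems(1) by simp
 have "EX g. ALL b:P - {m}. (SUM c:{c:P - {m}. lq c b}. g c) = h b"
  by (rule Suc.hyps(1)[OF n]) (use Suc.prems in blast)+
 then obtain g where g: "ALL b:P - {m}. (SUM c:{c:P - {m}. lq c b}. g c) = h b" by blast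
 define g' where "g' = g(m := h m - (SUM c:{c:P - {m}. lq c m}. g c))"
 have "(SUM c:{c:P. lq c b}. g' c) = h b" if b: "b : P" for b
 proof (cases "b = m")
  case True
  have "{c:P. lq c b} = insert m {c:P - {m}. lq c m}" using True m Suc.prems(2) by auto
  moreover have "(SUM c:{c:P - {m}. lq c m}. g' c) = (SUM c:{c:P - {m}. lq c m}. g c)"
   by (rule sum.cong) (auto simp: g'_def)
  ultimately show ?thesis using Suc.prems(1) True by (simp add: g'_def)
 next
  case False
  hence "{c:P. lq c b} = {c:P - {m}. lq c b}" using max b by auto
  moreover have "(SUM c:{c:P - {m}. lq c b}. g' c) = (SUM c:{c:P - {m}. lq c b}. g c)"
   by (rule sum.cong) (auto simp: g'_def)
  ultimately show ?thesis using g b False by simp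
 qed
 thus ?case by blast
next
 case 0
 hence "P = {}" using card_eq_0_iff by metis
 thus ?case by simp
qed

text \<open>Induction on the size of the down-set: all terms of the equation at \<open>b\<close>
  except the one at \<open>b\<close> already agree.\<close>

lemma finite_poset_inversion_unique:
 fixes g :: "'a => 'b::ab_group_add"
 assumes "finite P" "!!a. a : P ==> lq a a"
  and antisym: "!!a b. a : P ==> b : P ==> lq a b ==> lq b a ==> a = b"
  and trans: "!!a b c. a : P ==> b : P ==> c : P ==> lq a b ==> lq b c ==> lq a c"
  and eq: "!!b. b : P ==> (SUM c:{c:P. lq c b}. g c) = (SUM c:{c:P. lq c b}. g' c)"
  and "b : P"
 shows "g b = g' b"
 using \<open>b : P\<close>
proof (induction "card {c:P. lq c b}" arbitrary: b rule: less_induct)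
 case less
 have fin: "finite {c:P. lq c b}" using assms(1) by simp
 have *: "g c = g' c" if "c : {c:P. lq c b} - {b}" for c
 proof (rule less.hyps)
  have "{d:P. lq d c} \<subset> {c:P. lq c b}"
  proof (intro psubsetI subsetI)
   show "{d:P. lq d c} ~= {c:P. lq c b}"
    using that assms(2) less.prems antisym by blast
  qed (use that trans less.prems in blast)
  thus "card {d:P. lq d c} < card {c:P. lq c b}" using fin by (intro psubset_card_mono) auto
 qed (use that in auto)
 have b: "b : {c:P. lq c b}" using less.prems assms(2) by simp
 have "(SUM c:{c:P. lq c b} - {b}. g c) = (SUM c:{c:P. lq c b} - {b}. g' c)"
  using * by (intro sum.cong) auto
 thus ?case using eq[OF less.prems] sum.remove[OF fin b, of g] sum.remove[OF fin b, of g'] by simp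
qed

locale finite_poset =
 fixes P :: "'a set" and lq :: "'a => 'a => bool"
 assumes fin: "finite P"
  and lq_refl: "a : P ==> lq a a"
  and lq_antisym: "a : P ==> b : P ==> lq a b ==> lq b a ==> a = b"
  and lq_trans: "a : P ==> b : P ==> c : P ==> lq a b ==> lq b c ==> lq a c"
begin

definition moebius_spec :: "('a => 'a => int) => bool" where
 "moebius_spec \<mu> \<longleftrightarrow>
  (ALL a b. ~ (a : P & b : P & lq a b) --> \<mu> a b = 0) &
  (ALL a:P. ALL b:P. lq a b -->
    (SUM c:{c : P. lq a c & lq c b}. \<mu> a c) = (if a = b then 1 else 0))"

lemma moebius_unique:
 assumes "moebius_spec \<mu>" "moebius_spec \<nu>"
 shows "\<mu> = \<nu>"
proof (intro ext)
 fix a b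
 show "\<mu> a b = \<nu> a b"
 proof (cases "a : P & b : P & lq a b")
  case True
  let ?Q = "{c:P. lq a c}"
  show ?thesis
  proof (rule finite_poset_inversion_unique[of ?Q lq])
   fix c assume c: "c : ?Q"
   have "{d : ?Q. lq d c} = {d : P. lq a d & lq d c}" by auto
   thus "(SUM d:{d : ?Q. lq d c}. \<mu> a d) = (SUM d:{d : ?Q. lq d c}. \<nu> a d)"
    using assms True c by (simp add: moebius_spec_def)
  qed (use True fin lq_refl lq_antisym in \<open>auto intro: lq_trans\<close>)
 qed (use assms in \<open>simp add: moebius_spec_def\<close>)
qed

lemma moebius_exists: "EX \<mu>. moebius_spec \<mu>"
proof -
 have "EX g::'a => int. ALL b:{c:P. lq a c}. (SUM c:{c:{c:P. lq a c}. lq c b}. g c) = (if a = b then 1 else 0)" for a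
  by (rule finite_poset_inversion) (use fin lq_refl lq_antisym in \<open>auto intro: lq_trans\<close>)
 hence "ALL a. EX g::'a => int. ALL b:{c:P. lq a c}. (SUM c:{c:{c:P. lq a c}. lq c b}. g c) = (if a = b then 1 else 0)"
  by blast
 from choice[OF this] obtain g :: "'a => 'a => int" where g: "!!a b. b:{c:P. lq a c} ==>
  (SUM c:{c:{c:P. lq a c}. lq c b}. g a c) = (if a = b then 1 else 0)"
  by blast
 have "moebius_spec (%a b. if a : P & b : P & lq a b then g a b else 0)"
  unfolding moebius_spec_def
 proof (intro conjI ballI impI)
  fix a b assume ab: "a : P" "b : P" "lq a b"
  have "(SUM c:{c : P. lq a c & lq c b}. if a : P & c : P & lq a c then g a c else 0) =
   (SUM c:{c:{c:P. lq a c}. lq c b}. g a c)"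
   using ab by (intro sum.cong) auto
  thus "(SUM c:{c : P. lq a c & lq c b}. if a : P & c : P & lq a c then g a c else 0) =
   (if a = b then 1 else 0)"
   using g ab by simp
 qed auto
 thus ?thesis by blast
qed

lemma moebius_spec_moebius: "moebius_spec (moebius P lq)"
proof -
 have "EX! \<mu>. moebius_spec \<mu>" using moebius_exists moebius_unique by blast
 thus ?thesis
  unfolding moebius_def moebius_spec_def[symmetric] by (rule theI')
qed

lemma moebius_eq: "moebius_spec \<mu> ==> moebius P lq = \<mu>"
 using moebius_unique moebius_spec_moebius by blast

text \<open>The Moebius function depends only on the interval between its arguments. Hence the
  subobjects of a subobject \<open>u\<close> can be handled inside the poset of subobjects of the
  ambient object.\<close>

lemma moebius_order_ideal:
 assumes "finite_poset Q leQ" "u : P" "bij_betw F Q {p:P. lq p u}"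
  and F: "!!a b. a : Q ==> b : Q ==> leQ a b \<longleftrightarrow> lq (F a) (F b)"
  and ab: "a : Q" "b : Q"
 shows "moebius Q leQ a b = moebius P lq (F a) (F b)"
proof -
 interpret Q: finite_poset Q leQ by fact
 have FQ: "F a : P" "lq (F a) u" if "a : Q" for a
  using assms(3) that by (auto simp: bij_betw_def)
 have inj: "inj_on F Q" using assms(3) by (simp add: bij_betw_def)
 let ?\<mu> = "%a b. if a : Q & b : Q then moebius P lq (F a) (F b) else 0"
 have "Q.moebius_spec ?\<mu>"
  unfolding Q.moebius_spec_def
 proof (intro conjI ballI impI allI)
  fix a b assume "~ (a : Q & b : Q & leQ a b)"
  thus "?\<mu> a b = 0"
   using moebius_spec_moebius F FQ unfolding moebius_spec_def by auto
 next
  fix a b assume ab: "a : Q" "b : Q" "leQ a b"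
  have "F ` {c : Q. leQ a c & leQ c b} = {c : P. lq (F a) c & lq c (F b)}"
  proof (intro subset_antisym subsetI)
   fix c assume c: "c : {c : P. lq (F a) c & lq c (F b)}"
   hence "lq c u" using FQ ab assms(2) lq_trans by blast
   then obtain d where d: "d : Q" "c = F d"
    using c assms(3) unfolding bij_betw_def by (metis (mono_tags, lifting) imageE mem_Collect_eq)
   thus "c : F ` {c : Q. leQ a c & leQ c b}" using c F ab by auto
  qed (use F FQ ab in auto)
  hence "(SUM c:{c : P. lq (F a) c & lq c (F b)}. moebius P lq (F a) c) =
   (SUM c:{c : Q. leQ a c & leQ c b}. moebius P lq (F a) (F c))"
   using inj by (subst sum.reindex[symmetric, of F, unfolded o_def]) (auto intro: inj_on_subset)
  also have "... = (SUM c:{c : Q. leQ a c & leQ c b}. ?\<mu> a c)"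
   using ab by (intro sum.cong) auto
  finally have eq: "(SUM c:{c : P. lq (F a) c & lq c (F b)}. moebius P lq (F a) c) =
   (SUM c:{c : Q. leQ a c & leQ c b}. ?\<mu> a c)" .
  show "(SUM c:{c : Q. leQ a c & leQ c b}. ?\<mu> a c) = (if a = b then 1 else 0)"
  proof -
   have "(SUM c:{c : P. lq (F a) c & lq c (F b)}. moebius P lq (F a) c) = (if F a = F b then 1 else 0)"
    using moebius_spec_moebius F FQ ab unfolding moebius_spec_def by blast
   moreover have "F a = F b \<longleftrightarrow> a = b" using inj ab by (auto dest: inj_onD)
   ultimately show ?thesis using eq by simp
  qed
 qed
 from Q.moebius_eq[OF this] show ?thesis using ab by simp
qed

lemma moebius_inversion:
 fixes f :: "'a => 'b::comm_ring_1"
 assumes "t : P"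
 shows "(SUM u:{u:P. lq u t}. SUM w:{w:P. lq w u}. of_int (moebius P lq w u) * f w) = f t"
proof -
 have "(SUM u:{u:P. lq u t}. SUM w:{w:P. lq w u}. of_int (moebius P lq w u) * f w) =
  (SUM u:{u:P. lq u t}. SUM w:P. if lq w u then of_int (moebius P lq w u) * f w else 0)"
  by (rule sum.cong[OF refl]) (simp add: sum.inter_filter fin)
 also have "... = (SUM w:P. SUM u:{u:P. lq u t}. if lq w u then of_int (moebius P lq w u) * f w else 0)"
  by (rule sum.swap)
 also have "... = (SUM w:P. SUM u:{u:P. lq w u & lq u t}. of_int (moebius P lq w u) * f w)"
  by (rule sum.cong[OF refl], rule sum.mono_neutral_cong_right) (use fin in auto)
 also have "... = (SUM w:P. of_int (SUM u:{u:P. lq w u & lq u t}. moebius P lq w u) * f w)"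
  by (simp add: sum_distrib_right)
 also have "... = (SUM w:P. if w = t then f t else 0)"
 proof (rule sum.cong[OF refl])
  fix w assume w: "w : P"
  show "of_int (SUM u:{u:P. lq w u & lq u t}. moebius P lq w u) * f w = (if w = t then f t else 0)"
  proof (cases "lq w t")
   case True
   thus ?thesis using moebius_spec_moebius w assms unfolding moebius_spec_def by simp
  next
   case False
   hence "{u:P. lq w u & lq u t} = {}" using lq_trans w assms by blast
   moreover have "w ~= t" using False lq_refl w by blast
   ultimately show ?thesis by (simp del: Collect_empty_eq)
  qed
 qed
 also have "... = f t" using fin assms by simp
 finally show ?thesis .
qed

end

section \<open>The trace form\<close>

context exact_malcev_category
begin

lemma finite_poset_subobjs:
 assumes "ob x"
 shows "finite_poset (Sub x) (sub_le C)"
 by unfold_locales (use assms subobject_finite sub_le_refl sub_le_antisym sub_le_trans in blast)+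

text \<open>The map from any object to the terminal one is thereby a surjection, and so has a
  degree.\<close>

lemma surjective_to_terminal:
 assumes "ar f" "cod f = terminal C"
 shows "srj f"
 unfolding surjective_iff
proof (intro conjI allI impI)
 fix m assume m: "mon m" "cod m = cod f"
 hence "cls m = whole C (terminal C)"
  using terminal_no_proper_sub[OF is_terminal_terminal] sub_of_subobjs[of m "terminal C"] assms by auto
 thus "iso_arr C m" using sub_of_whole m assms by simp
qed (use assms in simp)

end

context degree_function
begin

text \<open>The categorical dimension of \<open>[x]\<close>, i.e. the trace of its identity.\<close>

definition deg :: "'o => 'k" where
 "deg x = \<delta> (to_term x)"

lemma deg_surj:
 assumes "srj e"
 shows "deg (dom e) = \<delta> e * deg (cod e)"
proof -
 have e: "ar e" using assms by simp
 have "to_term (dom e) = to_term (cod e) ** e"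
  using to_term_unique[of "to_term (cod e) ** e"] e by simp
 thus ?thesis
  unfolding deg_def using degree_cmp[OF _ assms, of "to_term (cod e)"] surjective_to_terminal e
  by (simp add: mult.commute)
qed

lemma deg_iso: "iso_arr C i ==> deg (dom i) = deg (cod i)"
 using deg_surj[OF iso_surjective] by simp

abbreviation diag :: "'o => 'm" where
 "diag x == pg (idt C x) (idt C x)"

text \<open>For \<open>f\<close> given by two legs, the pullback along the diagonal is their
  equalizer. The choice of pullback is harmless, since \<open>deg\<close> is invariant under
  isomorphism.\<close>

definition eqdeg :: "'o => 'm => 'k" where
 "eqdeg x f = (SOME d. EX a b. pbk f (diag x) a b & d = deg (dom b))"

lemma eqdeg_eq:
 assumes "pbk f (diag x) a b"
 shows "eqdeg x f = deg (dom b)"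
proof -
 have "EX a b. pbk f (diag x) a b & eqdeg x f = deg (dom b)"
  unfolding eqdeg_def by (rule someI_ex) (use assms in blast)
 then obtain a' b' where ab: "pbk f (diag x) a' b'" "eqdeg x f = deg (dom b')" by blast
 obtain i where "iso_arr C i" "dom i = dom b'" "cod i = dom b"
  using pullback_iso[OF assms ab(1)] by metis
 thus ?thesis using deg_iso ab(2) by metis
qed

text \<open>The categorical trace in coordinates: a relation on \<open>x\<close> contributes the
  degree of its intersection with the diagonal.\<close>

definition tr :: "'o => ('m set => 'k) => 'k" where
 "tr x v = (SUM r:Sub (pd x x). v r * eqdeg x (rep r))"

lemma tr_add: "tr x (v + w) = tr x v + tr x w"
 and tr_Scl: "tr x (scl c v) = c * tr x v"
 and tr_zero [simp]: "tr x 0 = 0"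
 by (simp_all add: tr_def fun_simps Scl_T0_apply algebra_simps sum.distrib sum_distrib_left)

lemma tr_diff: "tr x (v - w) = tr x v - tr x w"
 by (simp add: tr_def fun_simps algebra_simps sum_subtractf)

lemma tr_basis:
 assumes "r : Sub (pd x x)" "ob x"
 shows "tr x (basis r) = eqdeg x (rep r)"
proof -
 have "tr x (basis r) = (SUM s:Sub (pd x x). if s = r then eqdeg x (rep r) else 0)"
  unfolding tr_def by (rule sum.cong) (auto simp: basis_def)
 thus ?thesis using assms subobject_finite by simp
qed

text \<open>The trace formula for a span that need not be jointly monic: the degree of its
  surjective part is the factor by which \<open>deg\<close> grows when the equalizer is pulled back
  along that part.\<close>

lemma tr_bas:
 assumes "ar f" "cod f = pd x x" "pbk f (diag x) a b" "ob x"
 shows "tr x (bas f) = deg (dom b)"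
proof -
 note S = im_fact[OF assms(1), unfolded assms(2)]
 note r = rep_sub[OF S(1)]
 obtain a0 b0 where ab0: "pbk (rep (im C f)) (diag x) a0 b0"
  using ex_pullback[of "rep (im C f)" "diag x"] r assms by auto
 note F0 = pbkD[OF ab0]
 obtain a1 b1 where ab1: "pbk (surj_part C f) a0 a1 b1"
  using ex_pullback[of "surj_part C f" a0] S F0 by auto
 note F1 = pbkD[OF ab1]
 have "pbk (diag x) (rep (im C f) ** surj_part C f) (b0 ** b1) a1"
  by (rule pullback_paste[OF pullback_sym[OF ab0] pullback_sym[OF ab1]])
 hence P: "pbk f (diag x) a1 (b0 ** b1)"
  using pullback_sym S by simp
 have b1: "srj b1" "\<delta> b1 = \<delta> (surj_part C f)"
  using surjective_pullback[OF S(6) ab1] degree_pullback[OF S(6) ab1] by auto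
 have "deg (dom b) = deg (dom (b0 ** b1))"
  using eqdeg_eq[OF assms(3)] eqdeg_eq[OF P] by simp
 also have "... = \<delta> (surj_part C f) * deg (dom b0)"
  using deg_surj[OF b1(1)] b1(2) F0 F1 by simp
 also have "... = tr x (bas f)"
  unfolding bas_Scl tr_Scl tr_basis[OF S(1) assms(4)] eqdeg_eq[OF ab0] ..
 finally show ?thesis ..
qed

lemma pullback_pairing_swap:
 assumes "pbk (pg p q) (pg p' q') a b"
  "ar p" "ar q" "dom p = dom q" "ar p'" "ar q'" "dom p' = dom q'"
  "cod p = cod p'" "cod q = cod q'"
 shows "pbk (pg q p) (pg q' p') a b"
proof -
 note F = pbkD[OF assms(1)]
 have "pg (p ** a) (q ** a) = pg (p' ** b) (q' ** b)"
  using F(3-9) assms(2-) by simp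
 from pairing_injD[OF this] have e: "p ** a = p' ** b" "q ** a = q' ** b"
  using F(3-8) assms(2-) by simp_all
 show ?thesis
 proof (rule pullbackI)
  fix c d assume cd: "ar c" "ar d" "dom c = dom d" "cod c = dom (pg q p)"
   "cod d = dom (pg q' p')" "pg q p ** c = pg q' p' ** d"
  have "pg (q ** c) (p ** c) = pg (q' ** d) (p' ** d)"
   using cd assms(2-) by simp
  from pairing_injD[OF this] have "p ** c = p' ** d" "q ** c = q' ** d"
   using cd(1-5) assms(2-) by simp_all
  thus "EX u:arr C. dom u = dom d & cod u = dom b & a ** u = c & b ** u = d"
   using pullback_ex[OF assms(1) cd(1-3)] cd(4,5) cd(1-3) assms(2-) by auto
 next
  fix u v assume "ar u" "ar v" "dom u = dom v" "cod u = dom b"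
   "cod v = dom b" "a ** u = a ** v" "b ** u = b ** v"
  thus "u = v" by (rule pullback_un[OF assms(1)])
 qed (use F(1-8) assms(2-) e in auto)
qed

text \<open>Closing up the composite of two spans leaves the pairs of points that agree in both
  coordinates, i.e. the fibre product of one span with the converse of the other. This is symmetric
  in the two spans, whence cyclicity.\<close>

lemma tr_Cmp_sp:
 assumes "ar p" "ar q" "dom p = dom q" "ar p'" "ar q'" "dom p' = dom q'"
  and xy: "cod p = x" "cod q = y" "cod p' = y" "cod q' = x"
  and ab: "pbk (pg p q) (pg q' p') a b"
 shows "tr x (ct x y x (sp p' q') (sp p q)) = deg (dom b)"
proof -
 have [simp]: "ob x" "ob y" using assms by auto
 note F = pbkD[OF ab]
 have "pg (p ** a) (q ** a) = pg (q' ** b) (p' ** b)"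
  using F(3-9) assms(1-10) by simp
 from pairing_injD[OF this] have e: "p ** a = q' ** b" "q ** a = p' ** b"
  using F(3-8) assms(1-10) by simp_all
 obtain c d where cd: "pbk q p' c d" using ex_pullback[of q p'] assms(1-10) by auto
 note G = pbkD[OF cd]
 obtain u where u: "ar u" "dom u = dom b" "cod u = dom d" "c ** u = a" "d ** u = b"
  using pullback_ex[OF cd, of a b] e F(3-8) assms(1-10) by auto
 have ea: "p ** (c ** u) = q' ** (d ** u)" using e u by simp
 have "pbk (pg (p ** c) (q' ** d)) (diag x) u (p ** a)"
 proof (rule pullbackI)
  fix f g assume fg: "ar f" "ar g" "dom f = dom g" "cod f = dom (pg (p ** c) (q' ** d))"
   "cod g = dom (diag x)" "pg (p ** c) (q' ** d) ** f = diag x ** g"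
  have tf: "cod f = dom d" "cod g = x" using fg(4,5) G assms(1-10) by auto
  have "pg (p ** (c ** f)) (q' ** (d ** f)) = pg g g"
   using fg(1-3,6) tf G(1-8) assms(1-10) by simp
  from pairing_injD[OF this] have h: "p ** (c ** f) = g" "q' ** (d ** f) = g"
   using fg(1-3) tf G(1-8) assms(1-10) by simp_all
  have h': "q ** (c ** f) = p' ** (d ** f)"
   by (rule eq_cmp[OF G(9)]) (use fg(1-3) tf G(1-8) assms(1-10) in simp_all)
  have "pg p q ** (c ** f) = pg q' p' ** (d ** f)"
   using h h' fg(1-3) tf G(1-8) assms(1-10) by simp
  then obtain w where w: "ar w" "dom w = dom f" "cod w = dom b" "a ** w = c ** f" "b ** w = d ** f"
   using pullback_ex[OF ab, of "c ** f" "d ** f"] fg(1-3) tf G(1-8) assms(1-10) by auto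
  have "c ** (u ** w) = c ** f" "d ** (u ** w) = d ** f"
   using assoc[of w u c] assoc[of w u d] w u G(1-8) by simp_all
  hence uw: "u ** w = f"
   using pullback_un[OF cd, of "u ** w" f] w(1-3) u(1-3) fg(1) tf by simp
  have "(p ** a) ** w = g" using w h(1) F(3-8) assms(1-10) by simp
  thus "EX w:arr C. dom w = dom g & cod w = dom (p ** a) & u ** w = f & (p ** a) ** w = g"
   using w uw F(3-8) fg(3) assms(1-10) by (intro bexI[of _ w]) auto
 next
  fix f g assume fg: "ar f" "ar g" "dom f = dom g" "cod f = dom (p ** a)"
   "cod g = dom (p ** a)" "u ** f = u ** g"
  have t: "cod f = dom b" "cod g = dom b" using fg F assms(1-10) by auto
  have "a ** f = a ** g" "b ** f = b ** g"
   unfolding u(4,5)[symmetric] using fg(1-3,6) t u(1-3) G(1-8) by simp_all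
  thus "f = g" using pullback_un[OF ab] fg t by simp
 qed (use u(1-3) F(1-8) G(1-8) assms(1-10) e ea u(4,5) in auto)
 from tr_bas[OF _ _ this] have "tr x (sp (p ** c) (q' ** d)) = deg (dom b)"
  using G(1-8) F(1-8) assms(1-10) by simp
 thus ?thesis using Cmp_sp[OF assms(1-6) cd, of x y x] xy by simp
qed

lemma tr_cyclic:
 assumes "ob x" "ob y" "f : HT x y" "g : HT y x"
 shows "tr x (ct x y x g f) = tr y (ct y x y f g)"
 using assms(3,1,2)
proof (induction rule: Hom_T0_induct)
 case (sp p q)
 note 1 = sp(1-5)
 show ?case using assms(4,2,1)
 proof (induction rule: Hom_T0_induct)
  case (sp p' q')
  obtain a b where ab: "pbk (pg p q) (pg q' p') a b"
   using ex_pullback[of "pg p q" "pg q' p'"] 1 sp by auto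
  have "pbk (pg q p) (pg p' q') a b"
   by (rule pullback_pairing_swap[OF ab]) (use 1 sp in auto)
  from pullback_sym[OF this] have ba: "pbk (pg p' q') (pg q p) b a" .
  show ?case
   using tr_Cmp_sp[OF _ _ _ _ _ _ _ _ _ _ ab, of x y] tr_Cmp_sp[OF _ _ _ _ _ _ _ _ _ _ ba, of y x] 1 sp
    pbkD(6)[OF ab] by simp
 qed (simp_all add: ct_bilinear tr_add tr_Scl)
qed (simp_all add: ct_bilinear tr_add tr_Scl)

end

context nondegenerate_degree_function
begin

definition subdeg :: "'b set => 'c" where
 "subdeg u = deg (dom (rep u))"

text \<open>The Moebius transform of the degrees of the subobjects of \<open>x\<close>, evaluated at
  \<open>u\<close>.\<close>

definition somega :: "'a => 'b set => 'c" where
 "somega x u = (SUM w:{w:Sub x. sub_le C w u}. of_int (moebius (Sub x) (sub_le C) w u) * subdeg w)"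

lemma subdeg_sub_of:
 assumes "mon m"
 shows "subdeg (cls m) = deg (dom m)"
proof -
 obtain i where "iso_arr C i" "dom i = dom m" "cod i = dom (rep (cls m))"
  using rep_sub_of[OF assms] by metis
 thus ?thesis unfolding subdeg_def using deg_iso by metis
qed

lemma factors_through_monic_cmp:
 assumes u: "mon u" and ab: "ar a" "ar b" "cod a = dom u" "cod b = dom u"
 shows "fth (u ** a) (u ** b) \<longleftrightarrow> fth a b"
proof
 assume "fth (u ** a) (u ** b)"
 then obtain k where k: "ar k" "dom k = dom a" "cod k = dom b" "(u ** b) ** k = u ** a"
  unfolding fth_iff using ab u by auto
 hence "b ** k = a" using monicD[OF u, of "b ** k" a] ab u by simp
 thus "fth a b" unfolding fth_iff using k by blast
next
 assume "fth a b"
 then obtain k where "ar k" "dom k = dom a" "cod k = dom b" "b ** k = a"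
  unfolding fth_iff by blast
 thus "fth (u ** a) (u ** b)"
  unfolding fth_iff using ab u by (intro bexI[of _ k]) auto
qed

text \<open>The subobjects of \<open>u\<close> form the order ideal below \<open>u\<close>, and
  every one of them surjects onto the terminal object. The sum is therefore \<open>omega\<close> of
  the map from \<open>u\<close> to the terminal object.\<close>

lemma somega_nonzero:
 assumes x: "ob x" and u: "u : Sub x"
 shows "somega x u ~= 0"
proof -
 note r = rep_sub[OF u]
 let ?v = "dom (rep u)"
 interpret P: finite_poset "Sub x" "sub_le C" by (rule finite_poset_subobjs[OF x])
 have Q: "finite_poset (Sub ?v) (sub_le C)" by (rule finite_poset_subobjs) (use r in simp)
 define F where "F = (%y. cls (rep u ** rep y))"
 have m: "mon (rep u ** rep y)" "cod (rep u ** rep y) = x" "dom (rep u ** rep y) = dom (rep y)"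
  if "y : Sub ?v" for y
  using monic_cmp[OF r(1)] rep_sub[OF that] r by auto
 have Fs: "F (cls k) = cls (rep u ** k)" if k: "mon k" "cod k = ?v" for k
 proof -
  have ks: "cls k : Sub ?v" using sub_of_subobjs k by blast
  note K = rep_sub[OF ks]
  have "fth (rep (cls k)) k & fth k (rep (cls k))"
   using sub_of_eq_iff[OF K(1) k(1)] K k by simp
  thus ?thesis
   unfolding F_def using sub_of_eq_iff[OF m(1)[OF ks] monic_cmp[OF r(1) k(1)]] factors_through_monic_cmp[OF r(1)] K k r by simp
 qed
 have ord: "sub_le C a b \<longleftrightarrow> sub_le C (F a) (F b)" if ab: "a : Sub ?v" "b : Sub ?v" for a b
  unfolding F_def using sub_le_sub_of[OF m(1)[OF ab(1)] m(1)[OF ab(2)]] sub_le_iff[OF ab] m(2) ab rep_sub[OF ab(1)] rep_sub[OF ab(2)]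
   factors_through_monic_cmp[OF r(1)] by simp
 have bij: "bij_betw F (Sub ?v) {p:Sub x. sub_le C p u}"
  unfolding bij_betw_def
 proof (intro conjI subset_antisym subsetI)
  show "inj_on F (Sub ?v)"
  proof (rule inj_onI)
   fix a b assume ab: "a : Sub ?v" "b : Sub ?v" "F a = F b"
   have "F a : Sub x" using m ab by (auto simp: F_def intro: sub_of_subobjs)
   hence "sub_le C (F a) (F b)" "sub_le C (F b) (F a)" using ab(3) sub_le_refl by simp_all
   thus "a = b" using ord ab sub_le_antisym by metis
  qed
 next
  fix p assume "p : F ` Sub ?v"
  then obtain y where y: "y : Sub ?v" "p = F y" by blast
  have "fth (rep u ** rep y) (rep u)"
   using rep_sub[OF y(1)] r by (intro factors_through_cmp) auto
  hence "sub_le C p (cls (rep u))"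
   unfolding y(2) F_def using y(1) m r(1,2) by (subst sub_le_sub_of) auto
  thus "p : {p:Sub x. sub_le C p u}"
   using y m r(3) by (auto simp: F_def intro: sub_of_subobjs)
 next
  fix p assume p: "p : {p:Sub x. sub_le C p u}"
  hence p': "p : Sub x" by simp
  note rp = rep_sub[OF p']
  obtain k where k: "ar k" "dom k = dom (rep p)" "cod k = ?v" "rep u ** k = rep p"
   using p sub_le_iff[OF p' u] unfolding fth_iff by auto
  have km: "mon k" using monic_cancel[of "rep u" k] rp r k by simp
  have "p = F (cls k)" using Fs[OF km k(3)] k(4) rp(3) by simp
  thus "p : F ` Sub ?v" using km k sub_of_subobjs by blast
 qed
 have Fw: "F (whole C ?v) = u" using Fs[of "idt C ?v"] r by (simp add: whole_def)
 have t: "to_term ?v ** rep y = to_term (dom (rep y))" if "y : Sub ?v" for y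
  using to_term_unique[of "to_term ?v ** rep y"] rep_sub[OF that] r by simp
 have tw: "im C (to_term ?v ** rep y) = whole C (terminal C)" if "y : Sub ?v" for y
  using im_fact(1)[of "to_term ?v ** rep y"] terminal_no_proper_sub[OF is_terminal_terminal]
   rep_sub[OF that] r by simp
 have "omega C \<delta> (to_term ?v) =
  (SUM y:Sub ?v. of_int (moebius (Sub ?v) (sub_le C) y (whole C ?v)) * deg (dom (rep y)))"
  unfolding omega_def using r t tw by (intro sum.cong) (auto simp: deg_def)
 also have "... = (SUM y:Sub ?v. of_int (moebius (Sub x) (sub_le C) (F y) u) * subdeg (F y))"
 proof (intro sum.cong refl)
  fix y assume y: "y : Sub ?v"
  have "subdeg (F y) = deg (dom (rep y))"
   unfolding F_def using subdeg_sub_of m y by metis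
  thus "of_int (moebius (Sub ?v) (sub_le C) y (whole C ?v)) * deg (dom (rep y)) =
   of_int (moebius (Sub x) (sub_le C) (F y) u) * subdeg (F y)"
   using P.moebius_order_ideal[OF Q u bij ord y, of "whole C ?v"] r Fw by simp
 qed
 also have "... = somega x u"
  unfolding somega_def using bij by (subst sum.reindex_bij_betw[OF bij]) simp
 finally have "somega x u = omega C \<delta> (to_term ?v)" ..
 thus ?thesis using nondegenerate[of "to_term ?v"] surjective_to_terminal r by simp
qed

text \<open>
 The Gram matrix of the trace form is \<open>deg (r \<inter> s) = (SUM u <= r, s. \<omega> u)\<close>, a product of two unitriangular
 matrices and the diagonal matrix with the nonzero entries \<open>\<omega> u\<close>.
\<close>

theorem tr_surjective:
 assumes x: "ob x" and y: "ob y"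
 shows "EX v:HT y x. ALL s:Sub (pd x y). tr x (ct x y x v (basis s)) = phi s"
proof -
 let ?z = "pd x y"
 let ?S = "Sub ?z"
 have z: "?z : obj C" using x y by simp
 interpret P: finite_poset ?S "sub_le C" by (rule finite_poset_subobjs[OF z])
 \<comment> \<open>The converse relations; the Gram matrix pairs them with the relations from
   \<open>x\<close> to \<open>y\<close>.\<close>
 define tp where "tp r = sp (pr2 C x y ** rep r) (pr1 C x y ** rep r)" for r
 have tp: "tp r : HT y x" if "r : ?S" for r
  unfolding tp_def using rep_sub[OF that] x y by (intro sp_Hom) auto
 have gram: "tr x (ct x y x (tp r) (basis s)) = (SUM u:{u:?S. sub_le C u r & sub_le C u s}. somega ?z u)"
  if rs: "r : ?S" "s : ?S" for r s
 proof -
  note R = rep_sub[OF rs(1)] and S = rep_sub[OF rs(2)]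
  obtain a b where ab: "pbk (rep s) (rep r) a b"
   using ex_pullback[of "rep s" "rep r"] R S by auto
  note F = pbkD[OF ab]
  have "tr x (ct x y x (tp r) (basis s)) = deg (dom b)"
   unfolding tp_def basis_sp(1)[OF rs(2) x y]
   by (rule tr_Cmp_sp) (use ab R S x y basis_sp(2)[OF rs(1) x y] basis_sp(2)[OF rs(2) x y] in auto)
  also have "... = subdeg (cls (rep r ** b))"
   using subdeg_sub_of[of "rep r ** b"] monic_cmp[OF R(1) pullback_monic[OF ab S(1)]] F by simp
  also have "... = (SUM u:{u:?S. sub_le C u (cls (rep r ** b))}. somega ?z u)"
  proof -
   have "cls (rep r ** b) : ?S"
    using monic_cmp[OF R(1) pullback_monic[OF ab S(1)]] F R by (intro sub_of_subobjs) auto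
   from P.moebius_inversion[OF this, of subdeg] show ?thesis unfolding somega_def by simp
  qed
  also have "{u:?S. sub_le C u (cls (rep r ** b))} = {u:?S. sub_le C u r & sub_le C u s}"
  proof (intro Collect_cong conj_cong refl)
   fix u assume u: "u : ?S"
   note U = rep_sub[OF u]
   have rb: "mon (rep r ** b)" using monic_cmp[OF R(1) pullback_monic[OF ab S(1)]] F by simp
   have "sub_le C u (cls (rep r ** b)) \<longleftrightarrow> fth (rep u) (rep r ** b)"
    using sub_le_sub_of[OF U(1) rb] U F R by simp
   also have "... \<longleftrightarrow> fth (rep u) (rep r) & fth (rep u) (rep s)"
   proof (intro iffI conjI)
    assume *: "fth (rep u) (rep r ** b)"
    have "fth (rep r ** b) (rep r)" "fth (rep s ** a) (rep s)"
     using F(1-8) by (auto intro: factors_through_cmp)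
    thus "fth (rep u) (rep r)" "fth (rep u) (rep s)"
     using * F factors_through_trans by (metis cmp_arr(1))+
   next
    assume *: "fth (rep u) (rep r) & fth (rep u) (rep s)"
    then obtain k l where k: "ar k" "dom k = dom (rep u)" "cod k = dom (rep r)" "rep r ** k = rep u"
     and l: "ar l" "dom l = dom (rep u)" "cod l = dom (rep s)" "rep s ** l = rep u"
     unfolding fth_iff by blast
    then obtain w where w: "ar w" "dom w = dom k" "cod w = dom b" "b ** w = k"
     using pullback_ex[OF ab, of l k] by auto
    thus "fth (rep u) (rep r ** b)"
     unfolding fth_iff using k F by (intro bexI[of _ w]) auto
   qed
   finally show "sub_le C u (cls (rep r ** b)) \<longleftrightarrow> sub_le C u r & sub_le C u s"
    using sub_le_iff u rs by simp
  qed
  finally show ?thesis .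
 qed
 \<comment> \<open>The Gram system is solved along its factorization: \<open>psi\<close> by
   inversion downwards, then division by the diagonal entries, then \<open>c\<close> by inversion in
   the opposite order.\<close>
 obtain psi where psi: "ALL s:?S. (SUM u:{u:?S. sub_le C u s}. psi u) = phi s"
  using finite_poset_inversion[of ?S "sub_le C" phi] P.fin P.lq_refl P.lq_antisym P.lq_trans by blast
 have "EX c. ALL u:?S. (SUM r:{r:?S. sub_le C u r}. c r) = psi u / somega ?z u"
  by (rule finite_poset_inversion[of ?S "%a b. sub_le C b a"]) (use P.fin P.lq_refl P.lq_antisym P.lq_trans in blast)+
 then obtain c where c: "!!u. u:?S ==> (SUM r:{r:?S. sub_le C u r}. c r) = psi u / somega ?z u" by blast
 define v where "v = (SUM r:?S. scl (c r) (tp r))"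
 have "v : HT y x"
  unfolding v_def using tp x y by (intro T0.Hom_sum T0.Hom_Scl) auto
 moreover have "tr x (ct x y x v (basis s)) = phi s" if s: "s : ?S" for s
 proof -
  have trs: "tr x (SUM r:A. f r) = (SUM r:A. tr x (f r))" for f :: "'b set => 'b set => 'c" and A
   by (induction A rule: infinite_finite_induct) (simp_all add: tr_add)
  have "tr x (ct x y x v (basis s)) =
   (SUM r:?S. c r * (SUM u:{u:?S. sub_le C u r & sub_le C u s}. somega ?z u))"
   unfolding v_def T0.Cmp_sum_left T0.Cmp_Scl_left trs tr_Scl using gram s by simp
  also have "... = (SUM r:?S. SUM u:?S. if sub_le C u r & sub_le C u s then c r * somega ?z u else 0)"
   unfolding sum_distrib_left using P.fin by (simp add: sum.If_cases Int_def)
  also have "... = (SUM u:?S. SUM r:?S. if sub_le C u r & sub_le C u s then c r * somega ?z u else 0)"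
   by (rule sum.swap)
  also have "... = (SUM u:?S. if sub_le C u s then (SUM r:?S. if sub_le C u r then c r * somega ?z u else 0) else 0)"
   by (intro sum.cong refl) auto
  also have "... = (SUM u:?S. if sub_le C u s then psi u else 0)"
  proof (intro sum.cong refl)
   fix u assume u: "u : ?S"
   have "(SUM r:?S. if sub_le C u r then c r * somega ?z u else 0) = (SUM r:{r:?S. sub_le C u r}. c r) * somega ?z u"
    using P.fin by (simp add: sum.If_cases Int_def sum_distrib_right)
   thus "(if sub_le C u s then (SUM r:?S. if sub_le C u r then c r * somega ?z u else 0) else 0) =
     (if sub_le C u s then psi u else 0)"
    using c[OF u] somega_nonzero[OF z u] by simp
  qed
  also have "... = phi s"
   using psi s P.fin by (simp add: sum.If_cases Int_def)
  finally show ?thesis .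
 qed
 ultimately show ?thesis by blast
qed

end

section \<open>Central idempotents of the ideals of morphisms through small objects\<close>

context degree_function
begin

lemma gr_Hom [simp]: "ar f ==> dom f = x ==> cod f = y ==> gr f : HT x y"
 by (auto simp: graph_sp)

lemma ct_gr_sp:
 assumes "ar p" "ar q" "dom p = dom q" "cod p = x" "cod q = y"
  "ar g" "dom g = y" "cod g = z"
 shows "ct x y z (gr g) (sp p q) = sp p (g ** q)"
proof -
 have "ob y" using assms by auto
 thus ?thesis
  using Cmp_sp[OF assms(1-3) _ assms(6) _ pullback_trivial[of q y], of x y z] assms by (simp add: graph_sp)
qed

lemma ct_gr:
 assumes "ar f" "ar g" "dom f = x" "cod f = y" "dom g = y" "cod g = z"
 shows "ct x y z (gr g) (gr f) = gr (g ** f)"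
proof -
 have "ob x" using assms by auto
 thus ?thesis using ct_gr_sp[of "idt C x" f x y g z] assms by (simp add: graph_sp)
qed

section \<open>Partial surjections, and the ideals of morphisms through small objects\<close>

definition psurj :: "'o => 'o => 'm set set" where
 "psurj x z = {r : Sub (pd x z). mon (pr1 C x z ** rep r) & srj (pr2 C x z ** rep r)}"

lemma psurj_sub: "r : psurj x z ==> r : Sub (pd x z)"
 by (simp add: psurj_def)

lemma finite_psurj [simp]: "ob x ==> ob z ==> finite (psurj x z)"
 using subobject_finite by (simp add: psurj_def)

lemma psurj_sub_of:
 assumes "ar p" "ar q" "dom p = dom q" "cod p = x" "cod q = z" "mon (pg p q)"
 shows "cls (pg p q) : psurj x z \<longleftrightarrow> mon p & srj q"
proof -
 have [simp]: "ob x" "ob z" using assms by auto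
 let ?s = "cls (pg p q)"
 have s: "?s : Sub (pd x z)" using assms by (intro sub_of_subobjs) auto
 note r = rep_sub[OF s]
 obtain i where i: "iso_arr C i" "dom i = dom (pg p q)" "cod i = dom (rep ?s)" "rep ?s ** i = pg p q"
  using rep_sub_of[OF assms(6)] by metis
 obtain j where j: "ar i" "ar j" "dom j = cod i" "cod j = dom i" "j ** i = idt C (dom i)"
  "i ** j = idt C (cod i)" "iso_arr C j"
  using iso_arrE[OF i(1)] by metis
 let ?p = "pr1 C x z ** rep ?s" and ?q = "pr2 C x z ** rep ?s"
 have pq: "?p ** i = p" "?q ** i = q"
  using i j(1) r assms(1-5) by simp_all
 have "(?p ** i) ** j = ?p" "(?q ** i) ** j = ?q"
  using i(2,3) j r assms(1-5) by simp_all
 hence pq': "p ** j = ?p" "q ** j = ?q"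
  by (simp_all only: pq)
 have t: "cod i = dom ?p" "cod i = dom ?q" "dom p = cod j" "dom q = cod j"
  using i(2,3) j r assms(1-5) by simp_all
 have "mon ?p \<longleftrightarrow> mon p"
  using monic_cmp[of ?p i] monic_cmp[of p j] iso_monic[OF i(1)] iso_monic[OF j(7)] pq pq' t by metis
 moreover have "srj ?q \<longleftrightarrow> srj q"
  using surjective_cmp[of ?q i] surjective_cmp[of q j] iso_surjective[OF i(1)] iso_surjective[OF j(7)] pq pq' t by metis
 ultimately show ?thesis using s by (simp add: psurj_def)
qed

lemma psurj_subquotient: "r : psurj x z ==> ob x ==> ob z ==> subquotient C z x"
 unfolding psurj_def subquotient_def using rep_sub[of r "pd x z"]
 by (intro exI[of _ "pr1 C x z ** rep r"] exI[of _ "pr2 C x z ** rep r"]) auto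

definition Jid :: "nat => 'o => 'o => ('m set => 'k) set" where
 "Jid n x y = T0.span {ct x w y g f | w g f. ob w & size w < n & f : HT x w & g : HT w y}"

lemma Jid_zero [simp]: "0 : Jid n x y"
 and Jid_add: "f : Jid n x y ==> g : Jid n x y ==> f + g : Jid n x y"
 and Jid_Scl: "f : Jid n x y ==> scl c f : Jid n x y"
 and Jid_sum: "(!!i. i : I ==> F i : Jid n x y) ==> sum F I : Jid n x y"
 unfolding Jid_def by (auto intro: T0.span_zero T0.span_add T0.span_scale T0.span_sum)

lemma JidI: "ob w ==> size w < n ==> f : HT x w ==> g : HT w y ==> ct x w y g f : Jid n x y"
 unfolding Jid_def by (rule T0.span_base) blast

lemma Jid_induct [consumes 1, case_names zero add Scl ct]:
 assumes "v : Jid n x y" "P 0" "!!u w. P u ==> P w ==> P (u + w)" "!!c u. P u ==> P (scl c u)"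
  and "!!w g f. ob w ==> size w < n ==> f : HT x w ==> g : HT w y ==> P (ct x w y g f)"
 shows "P v"
 using assms(1) unfolding Jid_def
proof (rule T0.span_induct)
 show "T0.subspace (Collect P)"
  using assms(2-4) by (intro T0.subspaceI) auto
qed (use assms(5) in auto)

lemma Jid_Hom: "v : Jid n x y ==> ob x ==> ob y ==> v : HT x y"
 by (induction rule: Jid_induct) (auto intro: T0_Hom_add T0_Hom_Scl T0_Cmp_Hom)

lemma Jid_left:
 assumes "v : Jid n x y" "h : HT y z" "ob x" "ob y" "ob z"
 shows "ct x y z h v : Jid n x z"
 using assms(1)
proof (induction rule: Jid_induct)
 case (ct w g f)
 hence "ct x y z h (ct x w y g f) = ct x w z (ct w y z h g) f"
  using ct_assoc[of x w y z f g h] assms by simp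
 thus ?case using JidI[OF ct(1-3)] T0_Cmp_Hom ct assms by metis
qed (simp_all add: ct_bilinear Jid_add Jid_Scl)

lemma Jid_right:
 assumes "v : Jid n y z" "h : HT x y" "ob x" "ob y" "ob z"
 shows "ct x y z v h : Jid n x z"
 using assms(1)
proof (induction rule: Jid_induct)
 case (ct w g f)
 hence "ct x y z (ct y w z g f) h = ct x w z g (ct x y w f h)"
  using ct_assoc[of x y w z h f g] assms by simp
 thus ?case using JidI[OF ct(1,2) _ ct(4)] T0_Cmp_Hom ct assms by metis
qed (simp_all add: ct_bilinear Jid_add Jid_Scl)

lemma Jid_src:
 assumes "f : HT w y" "size w < n" "ob w" "ob y"
 shows "f : Jid n w y"
 using JidI[of w n "idT w" w f y] T0_Cmp_Idn[of w y f] assms by simp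

lemma Jid_tgt:
 assumes "f : HT x w" "size w < n" "ob w" "ob x"
 shows "f : Jid n x w"
 using JidI[of w n f x "idT w" w] T0_Idn_Cmp[of x w f] assms by simp

lemma Jid_mono: "v : Jid n x y ==> n <= m ==> v : Jid m x y"
 by (induction rule: Jid_induct) (auto intro: Jid_add Jid_Scl JidI)

text \<open>Each case of Goursat's lemma factors the relation through an object smaller than
  \<open>z\<close>: a proper subobject through which the second leg passes, or a proper quotient of
  \<open>z\<close> of which the relation is a preimage.\<close>

lemma goursat_Jid:
 assumes r: "r : Sub (pd x z)" "r ~: psurj x z" and xz: "ob x" "ob z"
 shows "basis r : Jid (size z) x z"
proof -
 note R = rep_sub[OF r(1)]
 define p q where "p = pr1 C x z ** rep r" and "q = pr2 C x z ** rep r"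
 have pq: "ar p" "ar q" "dom p = dom q" "cod p = x" "cod q = z" "mon (pg p q)"
  "basis r = sp p q"
  using R xz basis_sp[OF r(1) xz] by (auto simp: p_def q_def)
 have n: "~ (mon p & srj q)" using r by (auto simp: psurj_def p_def q_def)
 from pq(1-3,6) n show ?thesis
 proof (cases rule: goursat)
  case (sub m k)
  have "ct x (dom m) z (gr m) (sp p k) = sp p q"
   using ct_gr_sp[of p k x "dom m" m z] sub pq by simp
  thus ?thesis
   using JidI[of "dom m" "size z" "sp p k" x "gr m" z] sub pq by simp
 next
  case (quot f s1 s2 a)
  note F = pbkD[OF quot(7)]
  have fa: "ar f" using quot by simp
  have "ct x (cod f) z (sp f (idt C z)) (sp s1 s2) = sp p q"
   using Cmp_sp[OF quot(3,4,5) fa _ _ quot(7), of "idt C z" x "cod f" z] quot pq F xz by simp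
  thus ?thesis
   using JidI[of "cod f" "size z" "sp s1 s2" x "sp f (idt C z)" z] quot pq F fa xz by simp
 qed
qed

text \<open>If a composite of spans through \<open>w\<close> had image \<open>r\<close>, points of
  the fibre product over \<open>w\<close> could be recombined whenever they agree in
  \<open>w\<close>; by \<open>size_le_fibre\<close> this gives \<open>size z <= size w\<close>. With
  \<open>goursat_Jid\<close>, the ideal at level \<open>size z\<close> is exactly the span of the
  relations that are not partial surjections.\<close>

lemma Jid_psurj:
 assumes v: "v : Jid (size z) x z" and r: "r : psurj x z" and xz: "ob x" "ob z"
 shows "v r = 0"
 using v
proof (induction rule: Jid_induct)
 case (ct w g f)
 have rs: "r : Sub (pd x z)" using r by (simp add: psurj_def)
 note R = rep_sub[OF rs]
 show ?case using ct(3) xz(1) ct(1)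
 proof (induction rule: Hom_T0_induct)
  case (sp p q)
  note 1 = sp(1-5)
  show ?case using ct(4,1) xz(2)
  proof (induction rule: Hom_T0_induct)
   case (sp p' q')
   note 2 = sp(1-5)
   obtain a b where ab: "pbk q p' a b" using ex_pullback[of q p'] 1 2 by auto
   note F = pbkD[OF ab]
   let ?h = "pg (p ** a) (q' ** b)"
   have h: "?h : arr C" "cod ?h = pd x z" "dom ?h = dom b" using 1 2 F(1-8) by auto
   have e: "ct x w z (sp p' q') (sp p q) = bas ?h"
    by (rule Cmp_sp) (use 1 2 ab in auto)
   show ?case
   proof (cases "im C ?h = r")
    case True
    let ?p = "pr1 C x z ** rep r" and ?q = "pr2 C x z ** rep r"
    have pr: "mon ?p" "srj ?q" using r by (auto simp: psurj_def)
    define s where "s = surj_part C ?h"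
    have S: "ar s" "dom s = dom b" "cod s = dom (rep r)" "rep r ** s = ?h" "srj s"
     using im_fact[OF h(1)] h True by (auto simp: s_def)
    have ps: "?p ** s = p ** a" "?q ** s = q' ** b"
     using S R xz 1 2 F(1-8) by simp_all
    have "size (cod ?q) <= size (cod (q ** a))"
    proof (rule size_le_fibre[OF S(5) pr(2) _ pr(1)])
     fix alpha beta assume "ar alpha" "ar beta" "dom alpha = dom beta" "cod alpha = dom s" "cod beta = dom s"
      and eq: "(q ** a) ** alpha = (q ** a) ** beta"
     hence A: "ar alpha" "ar beta" "dom alpha = dom beta" "cod alpha = dom b" "cod beta = dom b"
      using S by auto
     have e: "?p ** (s ** c) = p ** (a ** c)" "?q ** (s ** c) = q' ** (b ** c)" if "ar c" "cod c = dom b" for c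
      using eq_cmp[OF ps(1), of c] eq_cmp[OF ps(2), of c] that S(1-3) R xz 1 2 F(1-8) by simp_all
     \<comment> \<open>Agreement in \<open>w\<close> allows the first half of \<open>beta\<close> to
       be joined to the second half of \<open>alpha\<close>.\<close>
     have "q ** (a ** beta) = q ** (a ** alpha)" using eq A 1 F(1-8) by simp
     also have "... = p' ** (b ** alpha)" by (rule eq_cmp[OF F(9)]) (use A F(1-8) in simp_all)
     finally obtain \<gamma> where \<gamma>: "ar \<gamma>" "dom \<gamma> = dom beta" "cod \<gamma> = dom b" "a ** \<gamma> = a ** beta" "b ** \<gamma> = b ** alpha"
      using pullback_ex[OF ab, of "a ** beta" "b ** alpha"] A F(1-8) by auto
     thus "EX w. ar w & dom w = dom beta & cod w = dom s & ?q ** (s ** w) = ?q ** (s ** alpha) & ?p ** (s ** w) = ?p ** (s ** beta)"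
      using e[OF \<gamma>(1,3)] e[OF A(1,4)] e[OF A(2,5)] S(2) by (intro exI[of _ \<gamma>]) simp
    qed (use S R xz 1 F(1-8) in simp_all)
    hence "size z <= size w" using R xz 1 F(1-8) by simp
    thus ?thesis using ct(2) by simp
   next
    case False
    thus ?thesis unfolding e by (auto simp: bas_def basis_def)
   qed
  qed (simp_all only: ct_bilinear Cmp_T0_zero, simp_all add: fun_simps Scl_T0_apply)
 qed (simp_all only: ct_bilinear Cmp_T0_zero, simp_all add: fun_simps Scl_T0_apply)
qed (simp_all add: fun_simps Scl_T0_apply)

text \<open>By Goursat's lemma, the omitted basis elements lie in the ideal; so, modulo the ideal at
  level \<open>size z\<close>, a morphism to \<open>z\<close> is given by its coefficients at
  partial surjections.\<close>

lemma Hom_mod_Jid: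
 assumes v: "v : HT x z" and xz: "ob x" "ob z"
 shows "v - (SUM r:psurj x z. scl (v r) (basis r)) : Jid (size z) x z"
proof -
 let ?S = "Sub (pd x z)"
 have fin: "finite ?S" using xz subobject_finite by simp
 have "(SUM r:?S. scl (v r) (basis r)) =
   (SUM r:psurj x z. scl (v r) (basis r)) + (SUM r:?S - psurj x z. scl (v r) (basis r))"
  using fin by (subst sum.subset_diff[of "psurj x z"]) (auto simp: psurj_def add.commute)
 hence "v = (SUM r:psurj x z. scl (v r) (basis r)) + (SUM r:?S - psurj x z. scl (v r) (basis r))"
  using Hom_T0_expand[OF v xz] by (rule trans[rotated])
 hence "v - (SUM r:psurj x z. scl (v r) (basis r)) = (SUM r:?S - psurj x z. scl (v r) (basis r))"
  by (metis (no_types, lifting) add_diff_cancel_left')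
 moreover have "... : Jid (size z) x z"
  using goursat_Jid xz by (intro Jid_sum Jid_Scl) auto
 ultimately show ?thesis by simp
qed

section \<open>Automorphisms acting on partial surjections\<close>

abbreviation Aut :: "'o => 'm set" where
 "Aut z == carrier (AG z)"

lemma Aut_iff: "g : Aut z \<longleftrightarrow> iso_arr C g & dom g = z & cod g = z"
 by (auto simp: aut_group_def in_homs)

lemma Aut_arr:
 assumes "g : Aut z"
 shows "ar g" "dom g = z" "cod g = z" "iso_arr C g" "mon g" "srj g" "ob z"
 using assms iso_monic iso_surjective src_obj by (auto simp: Aut_iff)

lemma Aut_mult:
 assumes "g : Aut z" "h : Aut z"
 shows "g ** h : Aut z"
 using iso_cmp[of h g] Aut_arr[OF assms(1)] Aut_arr[OF assms(2)] by (simp add: Aut_iff)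

lemma Aut_idt: "ob z ==> idt C z : Aut z"
 by (simp add: Aut_iff)

lemma Aut_inv:
 assumes "g : Aut z"
 obtains h where "h : Aut z" "h ** g = idt C z" "g ** h = idt C z"
 using assms iso_arrE[of g] unfolding Aut_iff by metis

lemma aut_group_simps [simp]:
 "x \<otimes>\<^bsub>AG z\<^esub> y = x ** y" "\<one>\<^bsub>AG z\<^esub> = idt C z"
 by (simp_all add: aut_group_def)

lemma group_aut_group:
 assumes "ob z"
 shows "Group.group (AG z)"
proof (rule groupI)
 show "EX y:Aut z. y \<otimes>\<^bsub>AG z\<^esub> x = \<one>\<^bsub>AG z\<^esub>" if "x : Aut z" for x
  using Aut_inv[OF that] by auto
next
 fix x y w assume "x : Aut z" "y : Aut z" "w : Aut z"
 note this[THEN Aut_arr(1)] this[THEN Aut_arr(2)] this[THEN Aut_arr(3)]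
 thus "x \<otimes>\<^bsub>AG z\<^esub> y \<otimes>\<^bsub>AG z\<^esub> w = x \<otimes>\<^bsub>AG z\<^esub> (y \<otimes>\<^bsub>AG z\<^esub> w)"
  by simp
next
 fix x assume "x : Aut z"
 note Aut_arr(1,2,3)[OF this]
 thus "\<one>\<^bsub>AG z\<^esub> \<otimes>\<^bsub>AG z\<^esub> x = x" by simp
qed (use assms Aut_mult Aut_idt in simp_all)

definition act :: "'o => 'o => 'm => 'm set => 'm set" where
 "act x z g r = cls (pg (pr1 C x z ** rep r) (g ** (pr2 C x z ** rep r)))"

lemma act_facts:
 assumes r: "r : Sub (pd x z)" and g: "g : Aut z" and xz: "ob x" "ob z"
 shows "mon (pg (pr1 C x z ** rep r) (g ** (pr2 C x z ** rep r)))" (is ?a)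
  and "ct x z z (gr g) (basis r) = basis (act x z g r)" (is ?b)
  and "act x z g r : Sub (pd x z)" (is ?c)
  and "act x z g r : psurj x z \<longleftrightarrow> r : psurj x z" (is ?d)
proof -
 note R = rep_sub[OF r]
 define p q where "p = pr1 C x z ** rep r" and "q = pr2 C x z ** rep r"
 have pq: "ar p" "ar q" "dom p = dom q" "cod p = x" "cod q = z" "pg p q = rep r"
  using R xz basis_sp[OF r(1) xz] by (auto simp: p_def q_def)
 obtain h where h: "h : Aut z" "h ** g = idt C z" "g ** h = idt C z" using Aut_inv[OF g] .
 note hA = Aut_arr(1-3,6)[OF h(1)] and gm = Aut_arr(5,6)[OF g]
 note g0 = g and g = Aut_arr(1-3)[OF g]
 have m: "mon (pg p q)" using pq R by simp
 show a: ?a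
  unfolding p_def[symmetric] q_def[symmetric]
 proof (subst monic_pairing_iff, goal_cases)
  case 4
  show ?case
  proof (intro ballI impI)
   fix u v assume uv: "ar u" "ar v" "dom u = dom v" "cod u = dom p" "cod v = dom p"
    "p ** u = p ** v" "(g ** q) ** u = (g ** q) ** v"
   have "q ** u = q ** v"
    by (rule monicD[OF gm(1)]) (use uv(1-5,7) pq(1-5) g in simp_all)
   thus "u = v" using m uv pq unfolding monic_pairing_iff[OF pq(1-3)] by simp
  qed
 qed (use pq g in auto)
 show ?c unfolding act_def using a R xz g by (intro sub_of_subobjs) auto
 have "ct x z z (gr g) (sp p q) = sp p (g ** q)"
  by (rule ct_gr_sp) (use pq g in auto)
 thus ?b
  using a bas_monic[OF a] bas_monic[OF m] R(3) pq(6) by (simp add: act_def p_def q_def)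
 have "srj (g ** q) \<longleftrightarrow> srj q"
 proof
  assume "srj (g ** q)"
  hence "srj (h ** (g ** q))" using surjective_cmp[of h "g ** q"] hA g pq by simp
  moreover have "h ** (g ** q) = q" using assoc[of q g h] hA h(2) g pq by simp
  ultimately show "srj q" by simp
 qed (use surjective_cmp[OF gm(2)] pq g in simp)
 thus ?d
  unfolding act_def p_def[symmetric] q_def[symmetric]
  using psurj_sub_of[of p "g ** q" x z] a pq g r by (simp add: p_def[symmetric] q_def[symmetric] psurj_def)
qed

lemma act_psurj: "r : psurj x z ==> g : Aut z ==> ob x ==> ob z ==> act x z g r : psurj x z"
 using act_facts(4) psurj_sub by blast

lemma basis_inj: "basis r = (basis s :: 'm set => 'k) \<longleftrightarrow> r = s"
 by (metis basis_def zero_neq_one)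

lemma act_act:
 assumes r: "r : Sub (pd x z)" and gh: "g : Aut z" "h : Aut z" and xz: "ob x" "ob z"
 shows "act x z g (act x z h r) = act x z (g ** h) r"
proof -
 have "(basis (act x z g (act x z h r)) :: 'm set => 'k) = ct x z z (gr g) (ct x z z (gr h) (basis r))"
  using act_facts r gh xz by simp
 also have "... = ct x z z (ct z z z (gr g) (gr h)) (basis r)"
  using ct_assoc[of x z z z "basis r" "gr h" "gr g"] basis_Hom[OF r]
   Aut_arr(1-3)[OF gh(1)] Aut_arr(1-3)[OF gh(2)] xz by simp
 also have "... = basis (act x z (g ** h) r)"
  using ct_gr[of h g z z z] act_facts(2)[OF r Aut_mult[OF gh] xz]
   Aut_arr(1-3)[OF gh(1)] Aut_arr(1-3)[OF gh(2)] by simp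
 finally show ?thesis by (simp add: basis_inj)
qed

lemma act_idt:
 assumes r: "r : Sub (pd x z)" and xz: "ob x" "ob z"
 shows "act x z (idt C z) r = r"
 unfolding act_def using rep_sub[OF r] xz basis_sp(2)[OF r xz] by simp

lemma graph_psurj:
 assumes "g : Aut z"
 shows "graph C g : psurj z z"
proof -
 note g = Aut_arr[OF assms]
 have m: "mon (pg (idt C z) g)" using g by (subst monic_pairing_iff) auto
 show ?thesis
  unfolding graph_def using psurj_sub_of[of "idt C z" g z z] m g by simp
qed

text \<open>Source and target have the same size, so both legs of the partial surjection are
  isomorphisms.\<close>

lemma psurj_graph:
 assumes r: "r : psurj z z" and z: "ob z"
 obtains g where "g : Aut z" "r = graph C g"
proof -
 have rs: "r : Sub (pd z z)" using r psurj_sub by blast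
 note R = rep_sub[OF rs]
 define p q where "p = pr1 C z z ** rep r" and "q = pr2 C z z ** rep r"
 have pq: "ar p" "ar q" "dom p = dom q" "cod p = z" "cod q = z" "mon p" "srj q"
  "pg p q = rep r" "dom (rep r) = dom q"
  using R z r basis_sp(2)[OF rs z z] by (auto simp: p_def q_def psurj_def)
 have "iso_arr C p" "iso_arr C q" using size_subquotient_span[OF pq(6,7)] pq by auto
 then obtain j where j: "ar j" "dom j = z" "cod j = dom p" "j ** p = idt C (dom p)" "p ** j = idt C z" "iso_arr C j"
  using iso_arrE pq by metis
 have g: "q ** j : Aut z" using iso_cmp[OF j(6) \<open>iso_arr C q\<close>] j(1-3) pq by (simp add: Aut_iff)
 have m: "mon (pg (idt C z) (q ** j))" using z j(1-3) pq(1-5) by (subst monic_pairing_iff) auto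
 have "rep r ** j = pg (idt C z) (q ** j)"
  unfolding pq(8)[symmetric] using j pq(1-5) by simp
 hence 1: "fth (pg (idt C z) (q ** j)) (rep r)"
  unfolding fth_iff using j R pq z by (intro bexI[of _ j]) auto
 have "pg (idt C z) (q ** j) ** p = pg p q"
  using j pq(1-5) z by simp
 hence 2: "fth (rep r) (pg (idt C z) (q ** j))"
  unfolding fth_iff pq(8)[symmetric] using j pq(1-5) z by (intro bexI[of _ p]) auto
 have "r = graph C (q ** j)"
  unfolding graph_def using sub_of_eq_iff[OF m R(1)] 1 2 R(2,3) j pq(1-5) z by simp
 thus ?thesis using that g by blast
qed

lemma graph_inj:
 assumes "g : Aut z" "h : Aut z" "graph C g = graph C h"
 shows "g = h"
proof -
 note A = Aut_arr(1-3,7)[OF assms(1)] Aut_arr(1-3)[OF assms(2)]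
 note assms = A(1-3,5-7) assms(3) and z = A(4)
 have m: "mon (pg (idt C z) g)" "mon (pg (idt C z) h)"
  using assms z by (subst monic_pairing_iff; auto)+
 have "fth (pg (idt C z) g) (pg (idt C z) h)"
  using assms(7) sub_of_eq_iff[OF m] assms(1-6) z by (simp add: graph_def)
 then obtain k where k: "ar k" "dom k = z" "cod k = z" "pg (idt C z) h ** k = pg (idt C z) g"
  unfolding fth_iff using assms(1-6) z by auto
 hence "pg k (h ** k) = pg (idt C z) g" using assms(1-6) z by simp
 from pairing_injD[OF this] have "k = idt C z" "h ** k = g" using k(1-3) assms(1-6) z by simp_all
 thus ?thesis using assms by simp
qed

lemma bij_graph: "ob z ==> bij_betw (graph C) (Aut z) (psurj z z)"
 unfolding bij_betw_def inj_on_def using graph_inj graph_psurj psurj_graph by blast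

lemma finite_Aut [simp]: "ob z ==> finite (Aut z)"
 using bij_betw_finite[OF bij_graph] finite_psurj by blast

end

section \<open>Identity elements of the ideals and their complements\<close>

context nondegenerate_degree_function
begin

lemma tr_sum: "tr x (SUM i:I. f i) = (SUM i:I. tr x (f i))"
 by (induction I rule: infinite_finite_induct) (simp_all add: tr_add)

lemma tr_Cmp_expand:
 assumes "ob x" "ob y" "w : HT x y"
 shows "tr x (ct x y x v w) = (SUM s:Sub (pd x y). w s * tr x (ct x y x v (basis s)))"
proof -
 have "tr x (ct x y x v w) = tr x (ct x y x v (SUM s:Sub (pd x y). scl (w s) (basis s)))"
  using Hom_T0_expand[OF assms(3,1,2)] by simp
 thus ?thesis by (simp add: T0.Cmp_sum_right ct_bilinear tr_sum tr_Scl)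
qed

lemma tr_nondegenerate:
 assumes xy: "ob x" "ob y" and w: "w : HT x y"
  and 0: "!!f. f : HT y x ==> tr x (ct x y x f w) = 0"
 shows "w = 0"
proof
 fix s
 show "w s = (0 :: 'b set => 'c) s"
 proof (cases "s : Sub (pd x y)")
  case True
  have fin: "finite (Sub (pd x y))" using xy subobject_finite by simp
  obtain v where v: "v : HT y x"
   "ALL s':Sub (pd x y). tr x (ct x y x v (basis s')) = (if s' = s then 1 else 0)"
   using tr_surjective[OF xy, of "%s'. if s' = s then 1 else 0"] by blast
  have "0 = (SUM s':Sub (pd x y). w s' * (if s' = s then 1 else 0))"
   using 0[OF v(1)] v(2) unfolding tr_Cmp_expand[OF xy w] by simp
  also have "... = w s" using True fin by (simp add: if_distrib cong: if_cong)
  finally show ?thesis by (simp add: fun_simps)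
 qed (use w in \<open>auto simp: Hom_T0 fun_simps\<close>)
qed

definition isC :: "nat => 'a => ('b set => 'c) => bool" where
 "isC n x c \<longleftrightarrow> c : Jid n x x & (ALL y:obj C. ALL f:Jid n x y. ct x x y f c = f) &
  (ALL y:obj C. ALL f:Jid n y x. ct y x x c f = f)"

lemma isC_D:
 assumes "isC n x c"
 shows "c : Jid n x x" "ob y ==> f : Jid n x y ==> ct x x y f c = f"
  "ob y ==> f : Jid n y x ==> ct y x x c f = f"
 using assms by (auto simp: isC_def)

lemma isC_unique: "isC n x c ==> isC n x c' ==> ob x ==> c = c'"
 unfolding isC_def by metis

text \<open>Both sides equal the composite of \<open>c\<close>, \<open>f\<close> and
  \<open>c'\<close>, because \<open>f\<close> after \<open>c\<close> and \<open>c'\<close> after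
  \<open>f\<close> both lie in the ideal.\<close>

lemma isC_central:
 assumes "isC n x c" "isC n y c'" "ob x" "ob y" "f : HT x y"
 shows "ct x x y f c = ct x y y c' f"
proof -
 note c = isC_D[OF assms(1)] and c' = isC_D[OF assms(2)]
 have h: "c : HT x x" "c' : HT y y" using Jid_Hom c(1) c'(1) assms by auto
 have "ct x x y f c = ct x y y c' (ct x x y f c)"
  using c'(3)[OF assms(3) Jid_left[OF c(1) assms(5)]] assms by simp
 also have "... = ct x x y (ct x y y c' f) c"
  using ct_assoc[of x x y y c f c'] h assms by simp
 also have "... = ct x y y c' f"
  using c(2)[OF assms(4) Jid_right[OF c'(1) assms(5)]] assms by simp
 finally show ?thesis .
qed

text \<open>The complementary idempotent \<open>\<epsilon>\<close>, projecting \<open>[z]\<close> to \<open>[z]\<^sup>0\<close>.\<close>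

lemma eps_facts:
 assumes c: "isC n z c" and z: "ob z" and e: "e = idT z - c"
 shows "e : HT z z" "ob x ==> f : Jid n x z ==> ct x z z e f = 0"
  "ob x ==> f : Jid n z x ==> ct z z x f e = 0"
  "ct z z z e e = e"
  "ob x ==> f : HT x z ==> f - ct x z z e f : Jid n x z"
  "ob x ==> f : HT x z ==> ct x z z e (ct x z z e f) = ct x z z e f"
  "ob x ==> f : HT z x ==> f - ct z z x f e : Jid n z x"
  "f : HT z z ==> ct z z z f e = ct z z z e f"
proof -
 note C = isC_D[OF c]
 have ch: "c : HT z z" using Jid_Hom C(1) z by blast
 show eh: "e : HT z z" unfolding e using T0.Hom_diff[of z z "idT z" c] ch z by simp
 show 1: "ob x ==> f : Jid n x z ==> ct x z z e f = 0" for x f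
  unfolding e T0.Cmp_diff_left using C(3)[of x f] T0_Idn_Cmp[of x z f] Jid_Hom z by simp
 show 2: "ob x ==> f : Jid n z x ==> ct z z x f e = 0"
  unfolding e T0.Cmp_diff_right using C(2)[of x f] T0_Cmp_Idn[of z x f] Jid_Hom z by simp
 show 3: "ct z z z e e = e"
 proof -
  have "ct z z z e e = ct z z z e (idT z - c)" by (simp only: e[symmetric])
  thus ?thesis using 1[OF z C(1)] T0_Cmp_Idn[of z z e] eh z by (simp add: T0.Cmp_diff_right)
 qed
 show "ob x ==> f : HT x z ==> f - ct x z z e f : Jid n x z"
  unfolding e T0.Cmp_diff_left using Jid_right[OF C(1), where h = f and x = x] T0_Idn_Cmp[of x z f] z by simp
 show "ob x ==> f : HT x z ==> ct x z z e (ct x z z e f) = ct x z z e f"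
  using ct_assoc[of x z z z f e e] 3 eh z by simp
 show "ob x ==> f : HT z x ==> f - ct z z x f e : Jid n z x"
  unfolding e T0.Cmp_diff_right using Jid_left[OF C(1), of f x] T0_Cmp_Idn[of z x f] z by simp
 show "f : HT z z ==> ct z z z f e = ct z z z e f"
  unfolding e T0.Cmp_diff_right T0.Cmp_diff_left
  using isC_central[OF c c z z, of f] T0_Idn_Cmp[of z z f] T0_Cmp_Idn[of z z f] z by simp
qed

lemma act_inject:
 assumes r: "r : psurj x z" "s : psurj x z" and g: "g : Aut z" and xz: "ob x" "ob z"
 shows "act x z g r = act x z g s \<longleftrightarrow> r = s"
proof -
 obtain h where h: "h : Aut z" "h ** g = idt C z" using Aut_inv[OF g] .
 have "act x z h (act x z g r) = r" if "r : psurj x z" for r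
  using act_act[OF psurj_sub[OF that] h(1) g xz] act_idt[OF psurj_sub[OF that] xz] h(2) by simp
 thus ?thesis using r by metis
qed

text \<open>The element \<open>u\<close> is dual to the orbit of \<open>a0\<close>: its composite
  with \<epsilon> a is the sum of those h\<epsilon> for which h carries \<open>a0\<close> to
  \<open>a\<close>. It is found from the values that this identity prescribes for traces, and the
  identity is then recovered by nondegeneracy.\<close>

lemma dual_basis:
 assumes c: "isC (size z) z c" and e: "e = idT z - c" and xz: "ob x" "ob z" and a0: "a0 : psurj x z"
 shows "EX u:HT z x. ct z z x u e = u & (ALL a:psurj x z. ct z x z (ct x z z e (basis a)) u =
  (SUM h:Aut z. if act x z h a0 = a then ct z z z (gr h) e else 0))"
proof -
 let ?S = "Sub (pd x z)"
 note E = eps_facts[OF c xz(2) e]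
 \<comment> \<open>The trace of the desired right-hand side, as a function of the partial
   surjection. Cyclicity forces these values on the pairing with \<open>u\<close>.\<close>
 define phi where "phi s = (SUM h:Aut z. if act x z h a0 = s then tr z (ct z z z (gr h) e) else 0)" for s
 have phi0: "phi s = 0" if "s ~: psurj x z" for s
  unfolding phi_def by (rule sum.neutral) (use act_psurj[OF a0 _ xz] that in auto)
 have gh: "gr h : HT z z" if "h : Aut z" for h using Aut_arr(1-3)[OF that] by auto
 have phi1: "phi (act x z g a) = (SUM h:Aut z. if act x z h a0 = a then tr z (ct z z z (gr g) (ct z z z (gr h) e)) else 0)"
  if a: "a : psurj x z" and g: "g : Aut z" for g a
 proof -
  obtain g' where g': "g' : Aut z" "g' ** g = idt C z" "g ** g' = idt C z" using Aut_inv[OF g] .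
  note A = Aut_arr(1-3)[OF g] Aut_arr(1-3)[OF g'(1)]
  show ?thesis
   unfolding phi_def
  proof (rule sum.reindex_bij_witness[of _ "%h. g ** h" "%k. g' ** k"])
   fix k assume k: "k : Aut z"
   note K = Aut_arr(1-3)[OF k]
   show gk: "g ** (g' ** k) = k" using assoc[of k g' g] g'(3) A K by simp
   show k': "g' ** k : Aut z" using Aut_mult k g' by blast
   have "act x z k a0 = act x z g (act x z (g' ** k) a0)" using act_act[OF psurj_sub[OF a0] g k' xz] gk by simp
   hence "act x z (g' ** k) a0 = a \<longleftrightarrow> act x z k a0 = act x z g a"
    using act_inject[OF act_psurj[OF a0 k' xz] a g xz] by simp
   moreover have "ct z z z (gr g) (ct z z z (gr (g' ** k)) e) = ct z z z (gr k) e"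
    using ct_assoc[OF xz(2,2,2,2) E(1) gh[OF k'] gh[OF g]] ct_gr[of "g' ** k" g z z z] gk A Aut_arr(1-3)[OF k'] by simp
   ultimately show "(if act x z (g' ** k) a0 = a then tr z (ct z z z (gr g) (ct z z z (gr (g' ** k)) e)) else 0) =
    (if act x z k a0 = act x z g a then tr z (ct z z z (gr k) e) else 0)" by simp
  next
   fix h assume h: "h : Aut z"
   show "g' ** (g ** h) = h" using assoc[of h g g'] g'(2) A Aut_arr(1-3)[OF h] by simp
   show "g ** h : Aut z" using Aut_mult h g by blast
  qed
 qed
 obtain u0 where u0: "u0 : HT z x" "ALL s:?S. tr x (ct x z x u0 (basis s)) = phi s"
  using tr_surjective[OF xz, of phi] by blast
 have Phi: "tr x (ct x z x u0 v) = (SUM s:?S. v s * phi s)" if "v : HT x z" for v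
  using tr_Cmp_expand[OF xz that, of u0] u0 by simp
 \<comment> \<open>Elements of the ideal have zero coefficients at partial surjections, and
   \<open>phi\<close> is zero at all other relations; so the pairing with \<open>u0\<close> does not
   see the ideal.\<close>
 have Phi0: "tr x (ct x z x u0 v) = 0" if v: "v : Jid (size z) x z" for v
  unfolding Phi[OF Jid_Hom[OF v xz]]
 proof (rule sum.neutral, rule ballI)
  fix s show "v s * phi s = 0"
   using Jid_psurj[OF v _ xz, of s] phi0[of s] by (cases "s : psurj x z") auto
 qed
 define u where "u = ct z z x u0 e"
 have u: "u : HT z x" "ct z z x u e = u"
  unfolding u_def using T0_Cmp_Hom[OF xz(2) xz(2) xz(1) E(1) u0(1)]
   ct_assoc[of z z z x e e u0] E(1,4) u0 xz by simp_all
 have tu: "tr x (ct x z x u v) = tr x (ct x z x u0 v)" if v: "v : HT x z" for v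
 proof -
  have "tr x (ct x z x u v) = tr x (ct x z x u0 (ct x z z e v))"
   unfolding u_def using ct_assoc[of x z z x v e u0] E(1) u0 v xz by simp
  also have "... = tr x (ct x z x u0 v) - tr x (ct x z x u0 (v - ct x z z e v))"
   by (simp add: T0.Cmp_diff_right tr_diff)
  finally show ?thesis using Phi0[OF E(5)[OF xz(1) v]] by simp
 qed
 have "ct z x z (ct x z z e (basis a)) u = (SUM h:Aut z. if act x z h a0 = a then ct z z z (gr h) e else 0)" (is "?t = ?d")
  if a: "a : psurj x z" for a
 proof -
  have as: "a : ?S" using a psurj_sub by auto
  have ah: "basis a : HT x z" using as basis_Hom by blast
  have eah: "ct x z z e (basis a) : HT x z" using T0_Cmp_Hom ah E(1) xz by blast
  have th: "?t : HT z z" "?d : HT z z"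
   using T0_Cmp_Hom[OF xz(2,1,2) u(1) eah] T0_Cmp_Hom[OF xz(2,2,2) E(1) gh] xz by (auto intro!: T0.Hom_sum)
  \<comment> \<open>Modulo the ideal, the test morphism \<open>f\<close> is a combination
    \<open>F\<close> of group elements. For these, both traces come down to the values of
    \<open>phi\<close> on translates of \<open>a\<close>.\<close>
  have "tr z (ct z z z f (?t - ?d)) = 0" if f: "f : HT z z" for f
  proof -
   define F where "F = (SUM r:psurj z z. scl (f r) (basis r))"
   have fF: "f - F : Jid (size z) z z" unfolding F_def using Hom_mod_Jid[OF f xz(2) xz(2)] .
   have Fh: "F : HT z z"
    unfolding F_def using psurj_sub xz by (intro T0.Hom_sum T0.Hom_Scl) (auto intro: basis_Hom)
   have Fe: "F = (SUM g:Aut z. scl (f (graph C g)) (gr g))"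
    unfolding F_def
    using sum.reindex_bij_betw[OF bij_graph[OF xz(2)], of "%r. scl (f r) (basis r)"] by simp
   have "tr z (ct z z z f ?t) = tr z (ct z x z (ct x z z f (ct x z z e (basis a))) u)"
    using ct_assoc[of z x z z u "ct x z z e (basis a)" f] eah u(1) f xz by simp
   also have "... = tr x (ct x z x u (ct x z z f (ct x z z e (basis a))))"
    using tr_cyclic[OF xz(2,1) u(1), of "ct x z z f (ct x z z e (basis a))"] T0_Cmp_Hom[OF xz(1,2,2) eah f] by simp
   also have "... = tr x (ct x z x u0 (ct x z z f (ct x z z e (basis a))))"
    using tu[OF T0_Cmp_Hom[OF xz(1,2,2) eah f]] .
   also have "ct x z z f (ct x z z e (basis a)) = ct x z z F (ct x z z e (basis a))"
   proof -
    have "ct x z z (f - F) (ct x z z e (basis a)) = ct x z z (ct z z z (f - F) e) (basis a)"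
     using ct_assoc[of x z z z "basis a" e "f - F"] ah E(1) Jid_Hom[OF fF] xz by simp
    also have "... = 0" using E(3)[OF xz(2) fF] by simp
    finally show ?thesis by (simp add: T0.Cmp_diff_left)
   qed
   also have "tr x (ct x z x u0 (ct x z z F (ct x z z e (basis a)))) = tr x (ct x z x u0 (ct x z z F (basis a)))"
   proof -
    have "ct x z z F (basis a - ct x z z e (basis a)) : Jid (size z) x z"
     using Jid_left[OF E(5)[OF xz(1) ah] Fh xz(1,2,2)] .
    from Phi0[OF this] show ?thesis by (simp add: T0.Cmp_diff_right tr_diff)
   qed
   also have "... = (SUM g:Aut z. f (graph C g) * phi (act x z g a))"
    unfolding Fe T0.Cmp_sum_left T0.Cmp_sum_right ct_bilinear tr_sum tr_Scl
    using act_facts(2,3)[OF as _ xz] u0 by (intro sum.cong) auto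
   also have "... = (SUM g:Aut z. f (graph C g) * tr z (ct z z z (gr g) ?d))"
    unfolding T0.Cmp_sum_right tr_sum using phi1[OF a] by (intro sum.cong) (auto intro!: sum.cong)
   also have "... = tr z (ct z z z F ?d)"
    unfolding Fe T0.Cmp_sum_left ct_bilinear tr_sum tr_Scl ..
   also have "ct z z z F ?d = ct z z z f ?d"
   proof -
    have "ct z z z (f - F) (ct z z z (gr h) e) = 0" if h: "h : Aut z" for h
     using ct_assoc[OF xz(2,2,2,2) gh[OF h] E(1) Jid_Hom[OF fF xz(2,2)]] E(3)[OF xz(2) fF] E(8)[OF gh[OF h]] by simp
    hence "ct z z z (f - F) ?d = 0" unfolding T0.Cmp_sum_right by (intro sum.neutral) auto
    thus ?thesis by (simp add: T0.Cmp_diff_left)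
   qed
   finally show ?thesis by (simp add: T0.Cmp_diff_right tr_diff)
  qed
  hence "?t - ?d = 0"
   using T0.Hom_diff[of z z ?t ?d] th xz by (intro tr_nondegenerate[OF xz(2,2)]) auto
  thus ?thesis by simp
 qed
 thus ?thesis using u by blast
qed

end

locale represented_nondegenerate_degree_function = nondegenerate_degree_function C \<delta>
 for C :: "('o, 'm) cat" (structure) and \<delta> :: "'m => 'k::field_char_0" +
 fixes X :: "'o set"
 assumes reps: "iso_representatives C X"
begin

lemma X_obj [simp]: "z : X ==> ob z"
 using reps by (auto simp: iso_representatives_def)

lemma X_iso_eq: "z : X ==> w : X ==> iso_obj C z w ==> z = w"
 using reps iso_obj_refl X_obj unfolding iso_representatives_def by blast

lemma X_rep:
 assumes "ob x"
 obtains z where "z : X" "iso_obj C x z"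
 using reps assms unfolding iso_representatives_def by blast

text \<open>Carried along the induction to record how the identity of the ideal is built: from
  morphisms through the idempotents \<epsilon> z of small subquotients of \<open>x\<close> in
  \<open>X\<close>. The summand \<open>[x]\<^sup>1\<close> and the decomposition into simple objects
  are read off from this. The identity \<open>c\<close> of the ideal at \<open>z\<close> is
  quantified, as \<open>cid\<close> is available only after the induction.\<close>

definition Ssp :: "nat => 'o => ('m set => 'k) set" where
 "Ssp n x = T0.span {ct x z x g (ct x z z (idT z - c) f) | z c f g. z : X & size z < n &
  subquotient C z x & isC (size z) z c & f : HT x z & g : HT z x}"

lemma Ssp_mono: "n <= m ==> Ssp n x \<subseteq> Ssp m x"
 unfolding Ssp_def by (rule T0.span_mono) force

text \<open>A subquotient of equal size is isomorphic, and \<open>X\<close> contains only one object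
  of each isomorphism class.\<close>

lemma psurj_same_size:
 assumes "z : X" "w : X" "size z = size w" "psurj w z ~= {}"
 shows "z = w"
proof -
 obtain r where "r : psurj w z" using assms by blast
 hence "subquotient C z w" using psurj_subquotient assms by simp
 hence "iso_obj C z w" using subquotient_iso assms by simp
 thus ?thesis using X_iso_eq assms by blast
qed

text \<open>
 The identity of the ideal at level \<open>n + 1\<close> is that at level \<open>n\<close> plus the sum of the \<open>u\<^sub>a \<epsilon> a\<close>, for \<open>a\<close>
 averaged over the \<open>Aut\<close>-orbits of partial surjections \<open>a\<close> to the objects of size \<open>n\<close>, where \<open>u\<^sub>a\<close>
 is dual to \<open>a\<close> up to the action.
\<close>

lemma isC_step:
 assumes IH: "!!x. ob x ==> isC n x (cc x) & cc x : Ssp n x" and x: "ob x"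
 shows "EX c. isC (Suc n) x c & c : Ssp (Suc n) x"
proof -
 define Z where "Z = {z : X. size z = n & subquotient C z x}"
 define \<epsilon> where "\<epsilon> z = idT z - cc z" for z
 have finZ: "finite Z"
  using finite_subquotients[OF reps x] by (rule rev_finite_subset) (auto simp: Z_def)
 have zX: "z : X" "ob z" "size z = n" "subquotient C z x" if "z : Z" for z
  using that by (auto simp: Z_def)
 have E: "isC (size z) z (cc z)" if "ob z" "size z = n" for z using IH that by simp
 note EF = eps_facts[OF E _ \<epsilon>_def]
 define P where "P z a0 w \<longleftrightarrow> w : HT z x & ct z z x w (\<epsilon> z) = w & (ALL a:psurj x z. ct z x z (ct x z z (\<epsilon> z) (basis a)) w =
  (SUM h:Aut z. if act x z h a0 = a then ct z z z (gr h) (\<epsilon> z) else 0))" for z a0 w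
 define u where "u z a0 = (SOME w. P z a0 w)" for z a0
 have "P z a0 (u z a0)" if "z : Z" "a0 : psurj x z" for z a0
 proof -
  have "EX w. P z a0 w"
   using dual_basis[OF E[OF zX(2,3)[OF that(1)]] \<epsilon>_def x zX(2)[OF that(1)] that(2)] unfolding P_def by blast
  thus ?thesis unfolding u_def by (rule someI_ex)
 qed
 hence u: "u z a0 : HT z x" "ct z z x (u z a0) (\<epsilon> z) = u z a0"
  "a : psurj x z ==> ct z x z (ct x z z (\<epsilon> z) (basis a)) (u z a0) = (SUM h:Aut z. if act x z h a0 = a then ct z z z (gr h) (\<epsilon> z) else 0)"
  if "z : Z" "a0 : psurj x z" for z a0 a
  using that unfolding P_def by auto
 define v where "v z a = ct x z z (\<epsilon> z) (basis a)" for z a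
 have bh: "basis a : HT x z" if "z : X" "a : psurj x z" for z a
  using psurj_sub basis_Hom that by blast
 have vh: "v z a : HT x z" if "z : Z" "a : psurj x z" for z a
  unfolding v_def using T0_Cmp_Hom[OF x zX(2) zX(2) bh EF(1)] that zX by blast
 \<comment> \<open>For each \<open>h\<close> exactly one \<open>a'\<close> is carried to
   \<open>a\<close>, so the undivided sum acts on \<open>v z a\<close> as multiplication by the
   order of \<open>Aut z\<close>. Characteristic 0 allows the division.\<close>
 define d where "d = (SUM z:Z. SUM a:psurj x z. scl (1 / of_nat (card (Aut z))) (ct x z x (u z a) (v z a)))"
 define c where "c = cc x + d"
 have ccx: "cc x : Jid n x x" using isC_D(1) IH x by blast
 have dJ: "d : Jid (Suc n) x x"
  unfolding d_def using u(1) vh zX by (intro Jid_sum Jid_Scl JidI) auto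
 have cJ: "c : Jid (Suc n) x x"
  unfolding c_def using dJ Jid_mono[OF ccx, of "Suc n"] by (intro Jid_add) auto
 have ch: "c : HT x x" using cJ Jid_Hom x by blast
 \<comment> \<open>\<open>u z a\<close> absorbs \<open>\<epsilon> z\<close> on the right, and a
   morphism of \<open>Jid n\<close> followed on that side by \<open>\<epsilon> z\<close> vanishes;
   so \<open>d\<close> does not disturb the identity already found at level
   \<open>n\<close>.\<close>
 have r0: "ct x x y f c = f" if f: "f : Jid n x y" and y: "ob y" for y f
 proof -
  have fh: "f : HT x y" using Jid_Hom f x y by blast
  have "ct x x y f (ct x z x (u z a) (v z a)) = 0" if za: "z : Z" "a : psurj x z" for z a
  proof -
   have "ct z x y f (u z a) = ct z x y f (ct z z x (u z a) (\<epsilon> z))" using u(2)[OF za] by simp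
   also have "... = ct z z y (ct z x y f (u z a)) (\<epsilon> z)"
    using ct_assoc[of z z x y "\<epsilon> z" "u z a" f] u(1)[OF za] EF(1)[of z] fh zX[OF za(1)] x y by simp
   also have "... = 0"
    using EF(3)[of z y "ct z x y f (u z a)"] Jid_right[OF f u(1)[OF za]] zX[OF za(1)] x y by simp
   finally show ?thesis
    using ct_assoc[of x z x y "v z a" "u z a" f] u(1)[OF za] vh[OF za] fh zX[OF za(1)] x y by simp
  qed
  hence "ct x x y f d = 0"
   unfolding d_def T0.Cmp_sum_right ct_bilinear by (simp add: sum.neutral)
  moreover have "ct x x y f (cc x) = f" using isC_D(2) IH x y f by blast
  ultimately show ?thesis by (simp add: c_def T0.Cmp_add_right)
 qed
 have rv: "ct x x z (v z a) c = v z a" if za: "z : Z" "a : psurj x z" for z a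
 proof -
  note z = zX[OF za(1)]
  have "ct x x z (v z a) (cc x) = ct x z z (cc z) (v z a)"
   using isC_central[of n x "cc x" z "cc z" "v z a"] IH x z vh[OF za] by simp
  also have "... = 0"
  proof -
   have "ct x z z (cc z) (v z a) = ct x z z (ct z z z (cc z) (\<epsilon> z)) (basis a)"
    unfolding v_def using ct_assoc[of x z z z "basis a" "\<epsilon> z" "cc z"] bh[OF z(1) za(2)] EF(1)[of z]
     isC_D(1)[of n z "cc z"] IH[of z] Jid_Hom x z by simp
   also have "ct z z z (cc z) (\<epsilon> z) = 0"
    using EF(3)[of z z "cc z"] isC_D(1)[of n z "cc z"] IH[of z] z by simp
   finally show ?thesis by simp
  qed
  finally have 1: "ct x x z (v z a) (cc x) = 0" .
  have 2: "ct x x z (v z a) (ct x z' x (u z' a') (v z' a')) = (if z' = z then SUM h:Aut z. if act x z h a' = a then v z a else 0 else 0)"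
   if za': "z' : Z" "a' : psurj x z'" for z' a'
  proof -
   note z' = zX[OF za'(1)]
   have *: "ct x x z (v z a) (ct x z' x (u z' a') (v z' a')) = ct x z' z (ct z' x z (v z a) (u z' a')) (v z' a')"
    using ct_assoc[of x z' x z "v z' a'" "u z' a'" "v z a"] u(1)[OF za'] vh[OF za'] vh[OF za] z z' x by simp
   show ?thesis
   proof (cases "z' = z")
    case True
    have "ct x z z (ct z z z (gr h) (\<epsilon> z)) (v z a') = v z (act x z h a')" if h: "h : Aut z" for h
    proof -
     have as: "a' : psurj x z" using za'(2) True by simp
     have H: "gr h : HT z z" using Aut_arr(1-3)[OF h] by auto
     have "ct x z z (ct z z z (gr h) (\<epsilon> z)) (v z a') = ct x z z (gr h) (v z a')"
      unfolding v_def using ct_assoc[OF x z(2,2,2) _ _ H] EF(1,6)[of z] T0_Cmp_Hom[OF x z(2,2) bh[OF z(1) as]] bh[OF z(1) as] x z by simp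
     also have "... = ct x z z (ct z z z (gr h) (\<epsilon> z)) (basis a')"
      unfolding v_def using ct_assoc[OF x z(2,2,2) bh[OF z(1) as] _ H] EF(1)[of z] z by simp
     also have "... = v z (act x z h a')"
      unfolding v_def act_facts(2)[OF psurj_sub[OF as] h x z(2), symmetric]
      using ct_assoc[OF x z(2,2,2) bh[OF z(1) as] H] EF(1,8)[of z] H z by simp
     finally show ?thesis .
    qed
    thus ?thesis
     unfolding * using u(3)[OF za(1), of a' a] za za'(2) True
     by (auto simp: v_def[of z a, symmetric] T0.Cmp_sum_left intro!: sum.cong)
   next
    \<comment> \<open>Between different objects of \<open>X\<close> of size \<open>n\<close> there
      is no partial surjection, so the composite lies in \<open>Jid n\<close> and is killed by
      \<open>\<epsilon> z\<close>.\<close>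
    case False
    have h: "ct z' x z (basis a) (u z' a') : HT z' z"
     using T0_Cmp_Hom u(1)[OF za'] bh[OF z(1) za(2)] x z z' by blast
    have "psurj z' z = {}" using psurj_same_size[of z z'] False z z' by auto
    hence "ct z' x z (basis a) (u z' a') : Jid n z' z"
     using Hom_mod_Jid[OF h] z z' by simp
    hence "ct z' z z (\<epsilon> z) (ct z' x z (basis a) (u z' a')) = 0"
     using EF(2)[of z z'] z z' by simp
    moreover have "ct z' x z (v z a) (u z' a') = ct z' z z (\<epsilon> z) (ct z' x z (basis a) (u z' a'))"
     unfolding v_def using ct_assoc[of z' x z z "u z' a'" "basis a" "\<epsilon> z"] u(1)[OF za'] bh[OF z(1) za(2)]
      EF(1)[of z] x z z' by simp
    ultimately show ?thesis using False unfolding * by simp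
   qed
  qed
  have "(SUM a':psurj x z. SUM h:Aut z. if act x z h a' = a then v z a else 0) = (SUM h:Aut z. v z a)"
  proof (subst sum.swap, rule sum.cong[OF refl])
   fix h assume h: "h : Aut z"
   obtain h' where h': "h' : Aut z" "h ** h' = idt C z" using Aut_inv[OF h] .
   let ?b = "act x z h' a"
   have b: "?b : psurj x z" using act_psurj za(2) h'(1) x z by blast
   have "act x z h ?b = a"
    using act_act[OF psurj_sub[OF za(2)] h h'(1) x z(2)] act_idt[OF psurj_sub[OF za(2)] x z(2)] h'(2) by simp
   hence "act x z h a' = a \<longleftrightarrow> a' = ?b" if "a' : psurj x z" for a'
    using act_inject[OF that b h x z(2)] by simp
   hence "(SUM a':psurj x z. if act x z h a' = a then v z a else 0) = (SUM a':psurj x z. if a' = ?b then v z a else 0)"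
    by (intro sum.cong) auto
   thus "(SUM a':psurj x z. if act x z h a' = a then v z a else 0) = v z a" using b x z by simp
  qed
  hence 3: "(SUM a':psurj x z. SUM h:Aut z. if act x z h a' = a then v z a else 0) = scl (of_nat (card (Aut z))) (v z a)"
   by (simp add: fun_eq_iff fun_simps Scl_T0_apply)
  have "ct x x z (v z a) d = (SUM z':Z. if z' = z then (SUM a':psurj x z. scl (1 / of_nat (card (Aut z)))
    (SUM h:Aut z. if act x z h a' = a then v z a else 0)) else 0)"
   unfolding d_def T0.Cmp_sum_right ct_bilinear using 2 by (intro sum.cong refl) auto
  also have "... = scl (1 / of_nat (card (Aut z))) (scl (of_nat (card (Aut z))) (v z a))"
   using finZ za by (simp add: T0.scale_sum_right[symmetric] 3)
  also have "... = v z a"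
   using Aut_idt[OF z(2)] finite_Aut[OF z(2)] by (auto simp: fun_eq_iff Scl_T0_apply card_eq_0_iff)
  finally show ?thesis using 1 by (simp add: c_def T0.Cmp_add_right)
 qed
 have rz: "ct x x z f c = f" if z: "z : X" "size z = n" and f: "f : HT x z" for z f
 proof -
  have zo: "ob z" using z by simp
  let ?F = "SUM r:psurj x z. scl (f r) (basis r)"
  have fF: "f - ?F : Jid n x z" using Hom_mod_Jid[OF f x zo] z by simp
  have "ct x x z (basis r) c = basis r" if r: "r : psurj x z" for r
  proof -
   have zZ: "z : Z" using z psurj_subquotient[OF r x zo] by (simp add: Z_def)
   have rh: "basis r : HT x z" using bh z r by simp
   have "ct x x z (ct x z z (\<epsilon> z) (basis r)) c = ct x z z (\<epsilon> z) (basis r)" using rv[OF zZ r] by (simp add: v_def)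
   moreover have "ct x x z (basis r - ct x z z (\<epsilon> z) (basis r)) c = basis r - ct x z z (\<epsilon> z) (basis r)"
    using r0[of "basis r - ct x z z (\<epsilon> z) (basis r)" z] EF(5)[of z x "basis r"] rh x zo z by simp
   ultimately show ?thesis by (simp add: T0.Cmp_diff_left)
  qed
  hence "ct x x z ?F c = ?F" by (simp add: T0.Cmp_sum_left ct_bilinear)
  moreover have "ct x x z (f - ?F) c = f - ?F" using r0[OF fF zo] .
  ultimately show ?thesis by (simp add: T0.Cmp_diff_left)
 qed
 have right: "ct x x y f c = f" if f: "f : Jid (Suc n) x y" and y: "ob y" for y f
  using f
 proof (induction rule: Jid_induct)
  case (ct w g f)
  show ?case
  proof (cases "size w < n")
   case True
   thus ?thesis using r0 JidI ct y by blast
  next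
   case False
   hence sw: "size w = n" using ct by simp
   obtain z where z: "z : X" "iso_obj C w z" using X_rep ct by blast
   have sz: "size z = n" using size_iso[OF z(2)] sw by simp
   obtain i where i: "iso_arr C i" "dom i = w" "cod i = z"
    using z by (auto simp: iso_obj_def in_homs)
   obtain j where j: "ar i" "ar j" "dom j = z" "cod j = w" "j ** i = idt C w"
    using iso_arrE[OF i(1)] i by metis
   have zo: "ob z" using z by simp
   define f' where "f' = ct x w z (gr i) f"
   have f': "f' : HT x z" unfolding f'_def using T0_Cmp_Hom[OF x ct(1) zo ct(3), of "gr i"] i j by simp
   have "f = ct x z w (gr j) f'"
    unfolding f'_def using ct_assoc[of x w z w f "gr i" "gr j"] ct_gr[of i j w z w] i j ct x zo T0_Idn_Cmp[of x w f] by simp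
   hence "ct x x w f c = f"
    using ct_assoc[of x x z w c f' "gr j"] rz[OF z(1) sz f'] f' ch i j ct x zo by simp
   thus ?thesis using ct_assoc[of x x w y c f g] ch ct x y by simp
  qed
 qed (simp_all add: ct_bilinear)
 \<comment> \<open>A right identity of the ideal is also a left one: by cyclicity the trace pairing
   with any \<open>g\<close> does not distinguish \<open>ct y x x c f\<close> from
   \<open>f\<close>.\<close>
 have left: "ct y x x c f = f" if f: "f : Jid (Suc n) y x" and y: "ob y" for y f
 proof -
  have fh: "f : HT y x" using Jid_Hom f x y by blast
  have "ct y x x c f - f = 0"
  proof (rule tr_nondegenerate[OF y x])
   show "ct y x x c f - f : HT y x" using T0.Hom_diff[of y x] T0_Cmp_Hom[OF y x x fh ch] fh x y by simp
   fix g assume g: "g : HT x y"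
   have gf: "ct x y x f g : Jid (Suc n) x x" using Jid_right[OF f g x y x] .
   have "tr y (ct y x y g (ct y x x c f)) = tr y (ct y x y (ct x x y g c) f)"
    using ct_assoc[of y x x y f c g] fh ch g x y by simp
   also have "... = tr x (ct x y x f (ct x x y g c))"
    using tr_cyclic[OF y x fh T0_Cmp_Hom[OF x x y ch g]] .
   also have "... = tr x (ct x x x (ct x y x f g) c)"
    using ct_assoc[of x x y x c g f] fh ch g x y by simp
   also have "... = tr x (ct x y x f g)" using right[OF gf x] by simp
   also have "... = tr y (ct y x y g f)" using tr_cyclic[OF y x fh g] by simp
   finally show "tr y (ct y x y g (ct y x x c f - f)) = 0"
    by (simp add: T0.Cmp_diff_right tr_diff)
  qed
  thus ?thesis by simp
 qed
 have "d : Ssp (Suc n) x"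
  unfolding d_def Ssp_def
 proof (intro T0.span_sum T0.span_scale T0.span_base CollectI)
  fix z a assume za: "z : Z" "a : psurj x z"
  show "EX z' c f g. ct x z x (u z a) (v z a) = ct x z' x g (ct x z' z' (idT z' - c) f) & z' : X &
   size z' < Suc n & subquotient C z' x & isC (size z') z' c & f : HT x z' & g : HT z' x"
   using zX[OF za(1)] E[of z] u(1)[OF za] bh[OF zX(1)[OF za(1)] za(2)]
   by (intro exI[of _ z] exI[of _ "cc z"] exI[of _ "basis a"] exI[of _ "u z a"]) (simp add: v_def \<epsilon>_def)
 qed
 moreover have "cc x : Ssp (Suc n) x" using IH[OF x] Ssp_mono[of n "Suc n" x] by auto
 ultimately have "c : Ssp (Suc n) x"
  unfolding c_def Ssp_def by (intro T0.span_add) auto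
 moreover have "isC (Suc n) x c" unfolding isC_def using cJ right left by blast
 ultimately show ?thesis by blast
qed

theorem isC_exists: "ALL x:obj C. EX c. isC n x c & c : Ssp n x"
proof (induction n)
 case 0
 have J: "Jid 0 x y = {0}" for x y by (simp add: Jid_def)
 have "isC 0 x 0" for x by (simp add: isC_def J)
 thus ?case by (auto simp: Ssp_def T0.span_zero)
next
 case (Suc n)
 then obtain cc where "!!x. ob x ==> isC n x (cc x) & cc x : Ssp n x" by metis
 thus ?case using isC_step by blast
qed

definition cid :: "nat => 'o => 'm set => 'k" where
 "cid n x = (THE c. isC n x c)"

lemma cid:
 assumes "ob x"
 shows "isC n x (cid n x)" "cid n x : Ssp n x"
proof -
 obtain c where c: "isC n x c" "c : Ssp n x" using isC_exists assms by blast
 hence "cid n x = c" unfolding cid_def using isC_unique assms by blast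
 thus "isC n x (cid n x)" "cid n x : Ssp n x" using c by auto
qed

definition eps :: "'o => 'm set => 'k" where
 "eps z = idT z - cid (size z) z"

lemmas eps = eps_facts[OF cid(1) _ eps_def]

text \<open>Above the size of \<open>x\<close> the ideal contains the identity of \<open>x\<close>.
  Combined with membership in \<open>Ssp\<close>, this decomposes the identity through the
  idempotents \<epsilon> z.\<close>

lemma cid_large:
 assumes "ob x" "size x < n"
 shows "cid n x = idT x"
proof -
 have "idT x : Jid n x x" using Jid_src[of "idT x" x x n] assms by simp
 hence "ct x x x (cid n x) (idT x) = idT x" using isC_D(3)[OF cid(1)] assms by blast
 thus ?thesis using T0_Cmp_Idn[of x x "cid n x"] Jid_Hom[OF isC_D(1)[OF cid(1)]] assms by simp
qed

end

section \<open>Characters of finite groups\<close>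

context
 fixes G :: "('g, 'b) monoid_scheme"
begin

lemma is_rep_D:
 assumes "is_rep G n rho"
 shows "g : carrier G ==> rho g : carrier_mat n n" "rho \<one>\<^bsub>G\<^esub> = 1\<^sub>m n"
  "g : carrier G ==> h : carrier G ==> rho (g \<otimes>\<^bsub>G\<^esub> h) = rho g * rho h"
 using assms by (auto simp: is_rep_def)

lemma rep_entry:
 assumes "is_rep G n rho" "g : carrier G" "h : carrier G" "i < n" "j < n"
 shows "rho (g \<otimes>\<^bsub>G\<^esub> h) $$ (i, j) = (SUM k<n. rho g $$ (i, k) * rho h $$ (k, j))"
 using is_rep_D(1)[OF assms(1) assms(2)] is_rep_D(1)[OF assms(1) assms(3)] is_rep_D(3)[OF assms(1-3)] assms(4,5)
 by (simp add: scalar_prod_def lessThan_atLeast0)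

lemma trace_mult_comm:
 fixes A B :: "'k::comm_ring_1 mat"
 assumes "A : carrier_mat m n" "B : carrier_mat n m"
 shows "(SUM i<m. (A * B) $$ (i, i)) = (SUM i<n. (B * A) $$ (i, i))"
proof -
 have "(SUM i<m. (A * B) $$ (i, i)) = (SUM i<m. SUM j<n. A $$ (i, j) * B $$ (j, i))"
  using assms by (simp add: scalar_prod_def lessThan_atLeast0)
 also have "... = (SUM j<n. SUM i<m. A $$ (i, j) * B $$ (j, i))" by (rule sum.swap)
 also have "... = (SUM i<n. (B * A) $$ (i, i))"
  using assms by (simp add: scalar_prod_def lessThan_atLeast0 mult.commute)
 finally show ?thesis .
qed

definition intertwiner :: "nat => ('g => 'k::field mat) => nat => ('g => 'k mat) => 'k mat => bool" where
 "intertwiner n rho m sigma A \<longleftrightarrow> A : carrier_mat m n & (ALL g:carrier G. sigma g * A = A * rho g)"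

lemma invariant_kernel:
 assumes "is_rep G n rho" "is_rep G m sigma" "intertwiner n rho m sigma A"
 shows "invariant_subspace G n rho {v : carrier_vec n. A *\<^sub>v v = 0\<^sub>v m}"
proof -
 have A: "A : carrier_mat m n" "!!g. g : carrier G ==> sigma g * A = A * rho g"
  using assms(3) by (auto simp: intertwiner_def)
 have "rho g *\<^sub>v v : carrier_vec n & A *\<^sub>v (rho g *\<^sub>v v) = 0\<^sub>v m"
  if g: "g : carrier G" and v: "v : carrier_vec n" "A *\<^sub>v v = 0\<^sub>v m" for g v
 proof -
  note R = is_rep_D(1)[OF assms(1) g] and S = is_rep_D(1)[OF assms(2) g]
  have "A *\<^sub>v (rho g *\<^sub>v v) = (sigma g * A) *\<^sub>v v"
   using A(2)[OF g] assoc_mult_mat_vec[OF A(1) R v(1)] by simp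
  also have "... = sigma g *\<^sub>v 0\<^sub>v m" using assoc_mult_mat_vec[OF S A(1) v(1)] v by simp
  also have "... = 0\<^sub>v m" using S by (intro eq_vecI) (auto simp: scalar_prod_def)
  finally show ?thesis using R v by simp
 qed
 moreover have "A *\<^sub>v 0\<^sub>v n = 0\<^sub>v m" using A(1) by (intro eq_vecI) (auto simp: scalar_prod_def)
 moreover have "A *\<^sub>v (v + w) = 0\<^sub>v m" if "v : carrier_vec n" "w : carrier_vec n" "A *\<^sub>v v = 0\<^sub>v m" "A *\<^sub>v w = 0\<^sub>v m" for v w
  using that mult_add_distrib_mat_vec[OF A(1), of v w] by simp
 moreover have "A *\<^sub>v (c \<cdot>\<^sub>v v) = 0\<^sub>v m" if "v : carrier_vec n" "A *\<^sub>v v = 0\<^sub>v m" for v c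
  using that mult_mat_vec[OF A(1), of v c] by (auto intro!: eq_vecI)
 ultimately show ?thesis
  unfolding invariant_subspace_def by (simp add: subset_iff)
qed

lemma invariant_image:
 assumes "is_rep G n rho" "is_rep G m sigma" "intertwiner n rho m sigma A"
 shows "invariant_subspace G m sigma ((*\<^sub>v) A ` carrier_vec n)"
proof -
 have A: "A : carrier_mat m n" "!!g. g : carrier G ==> sigma g * A = A * rho g"
  using assms(3) by (auto simp: intertwiner_def)
 show ?thesis
  unfolding invariant_subspace_def
 proof (intro conjI ballI allI; (elim imageE)?)
  fix g v w assume g: "g : carrier G" and v: "v = A *\<^sub>v w" "w : carrier_vec n"
  note R = is_rep_D(1)[OF assms(1) g] and S = is_rep_D(1)[OF assms(2) g]
  have "sigma g *\<^sub>v v = (sigma g * A) *\<^sub>v w" unfolding v using assoc_mult_mat_vec[OF S A(1) v(2)] by simp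
  also have "... = A *\<^sub>v (rho g *\<^sub>v w)" using A(2)[OF g] assoc_mult_mat_vec[OF A(1) R v(2)] by simp
  finally show "sigma g *\<^sub>v v : (*\<^sub>v) A ` carrier_vec n" using R v by auto
 next
  show "0\<^sub>v m : (*\<^sub>v) A ` carrier_vec n"
   using A(1) by (intro image_eqI[of _ _ "0\<^sub>v n"]) (auto simp: scalar_prod_def intro!: eq_vecI)
 next
  fix v w v' w' assume "v = A *\<^sub>v v'" "v' : carrier_vec n" "w = A *\<^sub>v w'" "w' : carrier_vec n"
  thus "v + w : (*\<^sub>v) A ` carrier_vec n"
   using mult_add_distrib_mat_vec[OF A(1), of v' w'] by (intro image_eqI[of _ _ "v' + w'"]) auto
 next
  fix c v v' assume "v = A *\<^sub>v v'" "v' : carrier_vec n"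
  thus "c \<cdot>\<^sub>v v : (*\<^sub>v) A ` carrier_vec n"
   using mult_mat_vec[OF A(1), of v' c] by (intro image_eqI[of _ _ "c \<cdot>\<^sub>v v'"]) auto
 qed (use A(1) in auto)
qed

lemma mat_eq_zero:
 fixes A :: "'k::field mat"
 assumes "A : carrier_mat m n" "!!v. v : carrier_vec n ==> A *\<^sub>v v = 0\<^sub>v m"
 shows "A = 0\<^sub>m m n"
proof (rule eq_matI)
 fix i j assume ij: "i < dim_row (0\<^sub>m m n)" "j < dim_col (0\<^sub>m m n)"
 have "A $$ (i, j) = (A *\<^sub>v unit_vec n j) $ i"
  using ij assms(1) by simp
 thus "A $$ (i, j) = 0\<^sub>m m n $$ (i, j)" using assms(2)[of "unit_vec n j"] ij by simp
qed (use assms in auto)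

lemma schur_iso:
 fixes rho sigma :: "'g => 'k::field mat"
 assumes "is_irr_rep G n rho" "is_irr_rep G m sigma" "intertwiner n rho m sigma A" "A ~= 0\<^sub>m m n"
 shows "rep_char G n rho = rep_char G m sigma"
proof
 have r: "is_rep G n rho" "is_rep G m sigma" using assms by (auto simp: is_irr_rep_def)
 have A: "A : carrier_mat m n" "!!g. g : carrier G ==> sigma g * A = A * rho g"
  using assms(3) by (auto simp: intertwiner_def)
 let ?K = "{v : carrier_vec n. A *\<^sub>v v = 0\<^sub>v m}" and ?I = "(*\<^sub>v) A ` carrier_vec n"
 have "?K ~= carrier_vec n" using mat_eq_zero[OF A(1)] assms(4) by blast
 hence K: "?K = {0\<^sub>v n}"
  using invariant_kernel[OF r assms(3)] assms(1) unfolding is_irr_rep_def by blast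
 have "?I ~= {0\<^sub>v m}" using mat_eq_zero[OF A(1)] assms(4) by blast
 hence I: "?I = carrier_vec m"
  using invariant_image[OF r assms(3)] assms(2) unfolding is_irr_rep_def by blast
 have "ALL i. EX v. v : carrier_vec n & A *\<^sub>v v = unit_vec m i"
 proof
  fix i
  have "unit_vec m i : ?I" unfolding I by simp
  thus "EX v. v : carrier_vec n & A *\<^sub>v v = unit_vec m i" by auto
 qed
 then obtain v where v: "!!i. v i : carrier_vec n" "!!i. A *\<^sub>v v i = unit_vec m i" by metis
 \<comment> \<open>The columns of \<open>B\<close> are preimages of the unit vectors, so
   \<open>B\<close> is a right inverse; injectivity of \<open>A\<close> makes it two-sided.\<close>
 define B where "B = mat n m (%(i, j). v j $ i)"
 have "col B j = v j" if "j < m" for j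
  using v(1)[of j] that by (intro eq_vecI) (simp_all add: B_def)
 moreover have "B : carrier_mat n m" by (simp add: B_def)
 ultimately have B: "B : carrier_mat n m" "!!j. j < m ==> col B j = v j" by blast+
 have AB: "A * B = 1\<^sub>m m"
 proof (rule eq_matI)
  fix i j assume ij: "i < dim_row (1\<^sub>m m)" "j < dim_col (1\<^sub>m m)"
  have "(A * B) $$ (i, j) = (A *\<^sub>v v j) $ i" using ij A B by (simp add: B_def)
  thus "(A * B) $$ (i, j) = 1\<^sub>m m $$ (i, j)" using v(2)[of j] ij by simp
 qed (use A B in auto)
 have BA: "B * A = 1\<^sub>m n"
 proof -
  have D: "B * A - 1\<^sub>m n : carrier_mat n n" using A B by auto
  have "B * A - 1\<^sub>m n = 0\<^sub>m n n"
  proof (rule mat_eq_zero[OF D])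
   fix w :: "'k vec" assume w: "w : carrier_vec n"
   have "A *\<^sub>v ((B * A - 1\<^sub>m n) *\<^sub>v w) = (A * (B * A - 1\<^sub>m n)) *\<^sub>v w"
    using assoc_mult_mat_vec[OF A(1) D w] by simp
   also have "A * (B * A - 1\<^sub>m n) = A * (B * A) - A * 1\<^sub>m n"
    by (rule mult_minus_distrib_mat) (use A B in auto)
   also have "A * (B * A) = A" using assoc_mult_mat[OF A(1) B(1) A(1)] AB A(1) by simp
   also have "A - A * 1\<^sub>m n = 0\<^sub>m m n" using A(1) by (auto intro!: eq_matI)
   also have "0\<^sub>m m n *\<^sub>v w = 0\<^sub>v m" using w by (auto intro!: eq_vecI simp: scalar_prod_def)
   finally have "(B * A - 1\<^sub>m n) *\<^sub>v w : ?K" using D w by simp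
   thus "(B * A - 1\<^sub>m n) *\<^sub>v w = 0\<^sub>v n" using K by blast
  qed
  hence e: "(B * A - 1\<^sub>m n) $$ (i, j) = 0" if "i < n" "j < n" for i j using that by simp
  show ?thesis
  proof (rule eq_matI)
   fix i j assume "i < dim_row (1\<^sub>m n)" "j < dim_col (1\<^sub>m n)"
   thus "(B * A) $$ (i, j) = 1\<^sub>m n $$ (i, j)" using e[of i j] A B by simp
  qed (use A B in auto)
 qed
 fix g show "rep_char G n rho g = rep_char G m sigma g"
 proof (cases "g : carrier G")
  case True
  note R = is_rep_D(1)[OF r(1) True] and S = is_rep_D(1)[OF r(2) True]
  have "sigma g = sigma g * (A * B)" using AB S by simp
  also have "... = (sigma g * A) * B" using assoc_mult_mat[OF S A(1) B(1)] by simp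
  also have "... = A * (rho g * B)" unfolding A(2)[OF True] using assoc_mult_mat[OF A(1) R B(1)] .
  finally have s: "sigma g = A * (rho g * B)" .
  have "(SUM i<m. sigma g $$ (i, i)) = (SUM i<n. ((rho g * B) * A) $$ (i, i))"
   unfolding s by (rule trace_mult_comm) (use A B R in auto)
  also have "(rho g * B) * A = rho g" using assoc_mult_mat[OF R B(1) A(1)] BA R by simp
  finally show ?thesis using True by (simp add: rep_char_def)
 qed (simp add: rep_char_def)
qed

lemma schur_scalar:
 fixes rho :: "'g => 'k::alg_closed_field mat"
 assumes "is_irr_rep G n rho" "intertwiner n rho n rho A"
 obtains l where "A = l \<cdot>\<^sub>m 1\<^sub>m n"
proof -
 have r: "is_rep G n rho" "n > 0" using assms by (auto simp: is_irr_rep_def)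
 have A: "A : carrier_mat n n" "!!g. g : carrier G ==> rho g * A = A * rho g"
  using assms(2) by (auto simp: intertwiner_def)
 have "degree (char_poly A) > 0" using degree_monic_char_poly[OF A(1)] r by simp
 then obtain l where "poly (char_poly A) l = 0" using alg_closed_imp_poly_has_root by blast
 hence "eigenvalue A l" using eigenvalue_root_char_poly[OF A(1)] by simp
 then obtain v where v: "v : carrier_vec n" "v ~= 0\<^sub>v n" "A *\<^sub>v v = l \<cdot>\<^sub>v v"
  using A(1) by (auto simp: eigenvalue_def eigenvector_def)
 define D where "D = A - l \<cdot>\<^sub>m 1\<^sub>m n"
 have D: "D : carrier_mat n n" using A(1) by (intro carrier_matI) (auto simp: D_def)
 have "intertwiner n rho n rho D"
  unfolding intertwiner_def
 proof (intro conjI ballI)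
  fix g assume g: "g : carrier G"
  note R = is_rep_D(1)[OF r(1) g]
  have "rho g * D = rho g * A - rho g * (l \<cdot>\<^sub>m 1\<^sub>m n)" unfolding D_def
   by (rule mult_minus_distrib_mat) (use R A in auto)
  also have "... = A * rho g - (l \<cdot>\<^sub>m 1\<^sub>m n) * rho g"
   using A(2)[OF g] mult_smult_distrib[OF R one_carrier_mat, of l] mult_smult_assoc_mat[OF one_carrier_mat R, of l] R by simp
  also have "... = D * rho g" unfolding D_def
   by (rule minus_mult_distrib_mat[symmetric]) (use R A in auto)
  finally show "rho g * D = D * rho g" .
 qed (rule D)
 from invariant_kernel[OF r(1) r(1) this]
 have inv: "{w : carrier_vec n. D *\<^sub>v w = 0\<^sub>v n} = {0\<^sub>v n} \<or> {w : carrier_vec n. D *\<^sub>v w = 0\<^sub>v n} = carrier_vec n"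
  using assms(1) unfolding is_irr_rep_def by blast
 have "D *\<^sub>v v = A *\<^sub>v v - (l \<cdot>\<^sub>m 1\<^sub>m n) *\<^sub>v v"
  unfolding D_def by (rule minus_mult_distrib_mat_vec) (use A v in auto)
 also have "(l \<cdot>\<^sub>m 1\<^sub>m n) *\<^sub>v v = l \<cdot>\<^sub>v v" using v(1) by (intro eq_vecI) auto
 also have "A *\<^sub>v v - l \<cdot>\<^sub>v v = 0\<^sub>v n" using v by simp
 finally have "D *\<^sub>v v = 0\<^sub>v n" .
 hence "{w : carrier_vec n. D *\<^sub>v w = 0\<^sub>v n} = carrier_vec n" using inv v by blast
 hence D0: "D = 0\<^sub>m n n" using D by (intro mat_eq_zero) auto
 have "A = l \<cdot>\<^sub>m 1\<^sub>m n"
 proof (rule eq_matI)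
  fix i j assume "i < dim_row (l \<cdot>\<^sub>m 1\<^sub>m n)" "j < dim_col (l \<cdot>\<^sub>m 1\<^sub>m n)"
  hence "D $$ (i, j) = A $$ (i, j) - (l \<cdot>\<^sub>m 1\<^sub>m n) $$ (i, j)"
   using A(1) unfolding D_def by (intro index_minus_mat) auto
  thus "A $$ (i, j) = (l \<cdot>\<^sub>m 1\<^sub>m n) $$ (i, j)"
   using \<open>i < dim_row _\<close> \<open>j < dim_col _\<close> by (simp add: D0)
 qed (use A in auto)
 thus ?thesis using that by blast
qed

end

locale finite_group = Group.group G for G :: "('g, 'b) monoid_scheme" (structure) +
 assumes fin: "finite (carrier G)"
begin

lemma sum_translate:
 assumes "h : carrier G"
 shows "(SUM g:carrier G. f (h \<otimes> g)) = (SUM g:carrier G. f g)"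
 by (rule sum.reindex_bij_witness[of _ "%g. inv h \<otimes> g" "%g. h \<otimes> g"])
  (use assms in \<open>auto simp: m_assoc[symmetric]\<close>)

lemma sum_inv: "(SUM g:carrier G. f (inv g)) = (SUM g:carrier G. f g)"
 by (rule sum.reindex_bij_witness[of _ "%g. inv g" "%g. inv g"]) auto

text \<open>The matrix is the sum over g of sigma(g) E rho(g^-1), where E is the elementary matrix
  with entry 1 at (j, k). Translating the summation variable shows that it intertwines.\<close>

lemma intertwiner_average:
 assumes r: "is_rep G n rho" "is_rep G m sigma" and jk: "j < m" "k < n"
 shows "intertwiner G n rho m sigma (mat m n (%(i, l). SUM g:carrier G. sigma g $$ (i, j) * rho (inv g) $$ (k, l)))"
  (is "intertwiner G n rho m sigma ?A")
 unfolding intertwiner_def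
proof (intro conjI ballI)
 fix h assume h: "h : carrier G"
 note R = is_rep_D(1)[OF r(1)] and S = is_rep_D(1)[OF r(2)]
 show "sigma h * ?A = ?A * rho h"
 proof (rule eq_matI)
  fix i l assume "i < dim_row (?A * rho h)" "l < dim_col (?A * rho h)"
  hence il: "i < m" "l < n" using R[OF h] by auto
  have "(sigma h * ?A) $$ (i, l) = (SUM p<m. sigma h $$ (i, p) * (SUM g:carrier G. sigma g $$ (p, j) * rho (inv g) $$ (k, l)))"
   using S[OF h] il by (simp add: scalar_prod_def lessThan_atLeast0)
  also have "... = (SUM p<m. SUM g:carrier G. sigma h $$ (i, p) * sigma g $$ (p, j) * rho (inv g) $$ (k, l))"
   by (simp add: sum_distrib_left mult.assoc)
  also have "... = (SUM g:carrier G. SUM p<m. sigma h $$ (i, p) * sigma g $$ (p, j) * rho (inv g) $$ (k, l))"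
   by (rule sum.swap)
  also have "... = (SUM g:carrier G. sigma (h \<otimes> g) $$ (i, j) * rho (inv g) $$ (k, l))"
   using rep_entry[OF r(2) h _ il(1) jk(1)] by (intro sum.cong) (simp_all add: sum_distrib_right)
  also have "... = (SUM g:carrier G. sigma (h \<otimes> g) $$ (i, j) * rho (inv (h \<otimes> g) \<otimes> h) $$ (k, l))"
   using h by (intro sum.cong refl) (simp add: inv_mult_group m_assoc)
  also have "... = (SUM g:carrier G. sigma g $$ (i, j) * rho (inv g \<otimes> h) $$ (k, l))"
   by (rule sum_translate[OF h])
  also have "... = (SUM g:carrier G. SUM q<n. sigma g $$ (i, j) * rho (inv g) $$ (k, q) * rho h $$ (q, l))"
   using rep_entry[OF r(1) _ h jk(2) il(2)] by (intro sum.cong refl) (simp add: sum_distrib_left mult.assoc)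
  also have "... = (SUM q<n. SUM g:carrier G. sigma g $$ (i, j) * rho (inv g) $$ (k, q) * rho h $$ (q, l))"
   by (rule sum.swap)
  also have "... = (?A * rho h) $$ (i, l)"
   using R[OF h] il by (simp add: scalar_prod_def lessThan_atLeast0 sum_distrib_right)
  finally show "(sigma h * ?A) $$ (i, l) = (?A * rho h) $$ (i, l)" .
 qed (use R[OF h] S[OF h] in auto)
qed auto

lemma schur_orthogonality_ne:
 fixes rho sigma :: "'g => 'k::field mat"
 assumes "is_irr_rep G n rho" "is_irr_rep G m sigma" "rep_char G n rho ~= rep_char G m sigma"
  and ij: "i < m" "j < m" "k < n" "l < n"
 shows "(SUM g:carrier G. sigma g $$ (i, j) * rho (inv g) $$ (k, l)) = 0"
proof -
 let ?A = "mat m n (%(i, l). SUM g:carrier G. sigma g $$ (i, j) * rho (inv g) $$ (k, l))"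
 have "intertwiner G n rho m sigma ?A"
  using intertwiner_average ij assms(1,2) by (auto simp: is_irr_rep_def)
 hence "?A = 0\<^sub>m m n" using schur_iso assms(1-3) by blast
 hence "?A $$ (i, l) = 0" using ij by simp
 thus ?thesis using ij by simp
qed

lemma order_pos: "order G > 0"
 using fin by (simp add: order_gt_0_iff_finite)

lemma schur_orthogonality_eq:
 fixes rho :: "'g => 'k::{alg_closed_field, field_char_0} mat"
 assumes "is_irr_rep G n rho" and ij: "i < n" "j < n" "k < n" "l < n"
 shows "(SUM g:carrier G. rho g $$ (i, j) * rho (inv g) $$ (k, l)) =
  (if i = l & j = k then of_nat (order G) / of_nat n else 0)"
proof -
 let ?A = "mat n n (%(i, l). SUM g:carrier G. rho g $$ (i, j) * rho (inv g) $$ (k, l))"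
 have r: "is_rep G n rho" "n > 0" using assms by (auto simp: is_irr_rep_def)
 have "intertwiner G n rho n rho ?A" using intertwiner_average ij r by blast
 then obtain c where c: "?A = c \<cdot>\<^sub>m 1\<^sub>m n" using schur_scalar assms(1) by blast
 have e: "(SUM g:carrier G. rho g $$ (i, j) * rho (inv g) $$ (k, l)) = (if i = l then c else 0)"
  if "i < n" "l < n" for i l
 proof -
  have "?A $$ (i, l) = (c \<cdot>\<^sub>m 1\<^sub>m n) $$ (i, l)" using c by simp
  thus ?thesis using that by simp
 qed
 \<comment> \<open>The scalar \<open>c\<close> is determined by the trace of the matrix, where the
   summation over \<open>i\<close> collapses the two factors into one representation matrix at the
   unit element.\<close>
 have "of_nat n * c = (SUM i<n. SUM g:carrier G. rho g $$ (i, j) * rho (inv g) $$ (k, i))"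
  using e by simp
 also have "... = (SUM g:carrier G. SUM i<n. rho (inv g) $$ (k, i) * rho g $$ (i, j))"
  by (subst sum.swap) (simp add: mult.commute)
 also have "... = (SUM g:carrier G. rho (inv g \<otimes> g) $$ (k, j))"
  by (intro sum.cong refl rep_entry[OF r(1) inv_closed _ ij(3,2), symmetric])
 also have "... = (if j = k then of_nat (order G) else 0)"
  using ij is_rep_D(2)[OF r(1)] by (auto simp: order_def)
 finally have "c = (if j = k then of_nat (order G) / of_nat n else 0)"
  using r(2) by (auto simp: field_simps)
 thus ?thesis using e[OF ij(1,4)] by simp
qed

lemma char_orthogonality:
 fixes chi psi :: "'g => 'k::{alg_closed_field, field_char_0}"
 assumes "chi : irr_chars G" "psi : irr_chars G"
 shows "(SUM g:carrier G. chi g * psi (inv g)) = (if chi = psi then of_nat (order G) else 0)"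
proof -
 obtain n rho where chi: "chi = rep_char G n rho" "is_irr_rep G n rho" using assms by (auto simp: irr_chars_def)
 obtain m sigma where psi: "psi = rep_char G m sigma" "is_irr_rep G m sigma" using assms by (auto simp: irr_chars_def)
 have swap: "(SUM g:carrier G. rep_char G n rho g * rep_char G m sigma (inv g)) =
  (SUM i<n. SUM k<m. SUM g:carrier G. rho g $$ (i, i) * sigma (inv g) $$ (k, k))" for n m and rho sigma :: "'g => 'k mat"
 proof -
  have "(SUM g:carrier G. rep_char G n rho g * rep_char G m sigma (inv g)) =
   (SUM g:carrier G. SUM i<n. SUM k<m. rho g $$ (i, i) * sigma (inv g) $$ (k, k))"
   by (intro sum.cong refl) (simp add: rep_char_def sum_product)
  also have "... = (SUM i<n. SUM g:carrier G. SUM k<m. rho g $$ (i, i) * sigma (inv g) $$ (k, k))"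
   by (rule sum.swap)
  also have "... = (SUM i<n. SUM k<m. SUM g:carrier G. rho g $$ (i, i) * sigma (inv g) $$ (k, k))"
   by (intro sum.cong refl) (rule sum.swap)
  finally show ?thesis .
 qed
 show ?thesis
 proof (cases "chi = psi")
  case False
  hence "(SUM g:carrier G. chi g * psi (inv g)) = 0"
   unfolding chi psi swap using schur_orthogonality_ne[OF psi(2) chi(2)] chi psi by (simp add: sum.neutral)
  thus ?thesis using False by simp
 next
  case True
  have n: "n > 0" using chi by (auto simp: is_irr_rep_def)
  have "(SUM g:carrier G. chi g * psi (inv g)) = (SUM g:carrier G. rep_char G n rho g * rep_char G n rho (inv g))"
   using True chi by simp
  also have "... = (SUM i<n. SUM k<n. if i = k then of_nat (order G) / of_nat n else 0)"
   unfolding swap using schur_orthogonality_eq[OF chi(2)] by (intro sum.cong refl) simp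
  also have "... = of_nat (order G)" using n by simp
  finally show ?thesis using True by simp
 qed
qed

end

text \<open>An enumeration of \<open>A\<close> turns matrices indexed by any finite set into genuine
  ones. Thus direct sums, blocks and the regular representation can be given on their natural index
  sets.\<close>

lemma ex_rep_indexed:
 fixes m :: "'g => 'x => 'x => 'k::field"
 assumes fin: "finite A" and one: "!!a b. a : A ==> b : A ==> m \<one>\<^bsub>G\<^esub> a b = (if a = b then 1 else 0)"
  and mult: "!!g h a b. g : carrier G ==> h : carrier G ==> a : A ==> b : A ==>
   m (g \<otimes>\<^bsub>G\<^esub> h) a b = (SUM c:A. m g a c * m h c b)"
 shows "EX sigma. is_rep G (card A) sigma & rep_char G (card A) sigma = (%g. if g : carrier G then SUM a:A. m g a a else 0)"
proof -
 obtain xs where xs: "set xs = A" "distinct xs" using fin finite_distinct_list by blast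
 have len: "length xs = card A" using xs distinct_card by metis
 have nth: "xs ! i : A" if "i < card A" for i using that xs len by auto
 have sum: "(SUM i<card A. f (xs ! i)) = (SUM b:A. f b)" for f :: "_ => 'k"
  using sum.reindex_bij_betw[OF bij_betw_nth[OF xs(2) len[symmetric, THEN arg_cong, of lessThan] xs(1)[symmetric]], of f] .
 define sigma where "sigma g = mat (card A) (card A) (%(i, j). m g (xs ! i) (xs ! j))" for g
 have "is_rep G (card A) sigma"
  unfolding is_rep_def
 proof (intro conjI ballI)
  show "sigma \<one>\<^bsub>G\<^esub> = 1\<^sub>m (card A)"
   using one nth nth_eq_iff_index_eq[OF xs(2)] len by (intro eq_matI) (auto simp: sigma_def)
  fix g h assume gh: "g : carrier G" "h : carrier G"
  show "sigma (g \<otimes>\<^bsub>G\<^esub> h) = sigma g * sigma h"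
  proof (rule eq_matI)
   fix i j assume "i < dim_row (sigma g * sigma h)" "j < dim_col (sigma g * sigma h)"
   hence ij: "i < card A" "j < card A" by (auto simp: sigma_def)
   thus "sigma (g \<otimes>\<^bsub>G\<^esub> h) $$ (i, j) = (sigma g * sigma h) $$ (i, j)"
    using mult[OF gh nth[OF ij(1)] nth[OF ij(2)]] sum[of "%c. m g (xs ! i) c * m h c (xs ! j)"]
    by (simp add: sigma_def scalar_prod_def lessThan_atLeast0)
  qed (simp_all add: sigma_def)
 qed (simp add: sigma_def)
 moreover have "rep_char G (card A) sigma = (%g. if g : carrier G then SUM a:A. m g a a else 0)"
  using sum by (auto simp: rep_char_def sigma_def fun_eq_iff)
 ultimately show ?thesis by blast
qed

text \<open>
 A maximal set \<open>J\<close> of coordinates whose span meets \<open>W\<close> trivially gives bases of \<open>W\<close> and of the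
 quotient in reduced form: \<open>W\<close> has a basis \<open>w i\<close>, \<open>i ~: J\<close>, with \<open>w i - e i\<close> supported in \<open>J\<close>.
\<close>

lemma rep_char_invariant_subspace:
 fixes rho :: "'g => 'k::field mat"
 assumes r: "is_rep G n rho" and G: "Group.group G" and W: "invariant_subspace G n rho W" "W ~= {0\<^sub>v n}" "W ~= carrier_vec n"
 shows "EX k l rho1 rho2. k < n & l < n & is_rep G k rho1 & is_rep G l rho2 &
  rep_char G n rho = (%g. rep_char G k rho1 g + rep_char G l rho2 g)"
proof -
 interpret Group.group G by fact
 \<comment> \<open>Vectors are replaced by functions on nat that vanish from \<open>n\<close> on, so
   that coordinates can be addressed by subsets of the index range.\<close>
 define S where "S = {f :: nat => 'k. (ALL i>=n. f i = 0) & vec n f : W}"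
 have Wc: "W \<subseteq> carrier_vec n" using W by (simp add: invariant_subspace_def)
 have Wcl: "0\<^sub>v n : W" "!!v w. v : W ==> w : W ==> v + w : W" "!!c v. v : W ==> c \<cdot>\<^sub>v v : W"
  "!!g v. g : carrier G ==> v : W ==> rho g *\<^sub>v v : W"
  using W(1) by (auto simp: invariant_subspace_def)
 have S_0: "(%_. 0) : S" using Wcl(1) by (simp add: S_def zero_vec_def)
 have S_add: "(%i. f i + h i) : S" if "f : S" "h : S" for f h
 proof -
  have "vec n (%i. f i + h i) = vec n f + vec n h" by (intro eq_vecI) auto
  thus ?thesis using that Wcl(2) by (simp add: S_def)
 qed
 have S_scale: "(%i. c * f i) : S" if "f : S" for f c
 proof -
  have "vec n (%i. c * f i) = c \<cdot>\<^sub>v vec n f" by (intro eq_vecI) auto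
  thus ?thesis using that Wcl(3) by (simp add: S_def)
 qed
 have S_sum: "(%i. SUM a:A. F a i) : S" if "!!a. a : A ==> F a : S" for F and A :: "nat set"
  using that by (induction A rule: infinite_finite_induct) (auto intro: S_0 S_add)
 define op where "op g f = (%i. if i < n then SUM j<n. rho g $$ (i, j) * f j else 0)" for g and f :: "nat => 'k"
 have S_op: "op g f : S" if "f : S" "g : carrier G" for f g
 proof -
  have "vec n (op g f) = rho g *\<^sub>v vec n f"
   using is_rep_D(1)[OF r that(2)] by (intro eq_vecI) (auto simp: op_def scalar_prod_def lessThan_atLeast0)
  thus ?thesis using that Wcl(4) by (simp add: S_def op_def)
 qed
 have op_sum: "op g (%i. SUM a:A. c a * F a i) i = (SUM a:A. c a * op g (F a) i)" for g A c i and F :: "nat => nat => 'k"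
  by (simp add: op_def sum_distrib_left) (subst sum.swap, simp add: mult_ac)
 have op_mult: "op (g \<otimes>\<^bsub>G\<^esub> h) f = op g (op h f)" if "g : carrier G" "h : carrier G" for g h f
 proof
  fix i
  have "(SUM j<n. rho (g \<otimes>\<^bsub>G\<^esub> h) $$ (i, j) * f j) = (SUM k<n. rho g $$ (i, k) * (SUM j<n. rho h $$ (k, j) * f j))" if "i < n"
   unfolding sum_distrib_left
   using rep_entry[OF r \<open>g : carrier G\<close> \<open>h : carrier G\<close> that]
   by (subst sum.swap) (simp add: sum_distrib_right sum_distrib_left mult_ac)
  thus "op (g \<otimes>\<^bsub>G\<^esub> h) f i = op g (op h f) i" by (simp add: op_def)
 qed
 have op_one: "op \<one>\<^bsub>G\<^esub> f i = f i" if "i < n" for f i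
  using that is_rep_D(2)[OF r] by (simp add: op_def if_distrib[of "%x. x * _"] cong: if_cong)
 define ok where "ok J \<longleftrightarrow> J \<subseteq> {..<n} & (ALL f:S. (ALL i. i ~: J --> f i = 0) --> (ALL i. f i = 0))" for J
 have "ok {}" by (simp add: ok_def)
 moreover have "ALL J. ok J --> card J <= n" using card_mono[of "{..<n}"] by (auto simp: ok_def)
 ultimately obtain J where J: "ok J" and max: "!!K. ok K ==> card K <= card J"
  using ex_has_greatest_nat[of ok "{}" card "Suc n"] by (metis less_Suc_eq_le)
 define I where "I = {..<n} - J"
 have fin: "finite I" "finite J" "J \<subseteq> {..<n}" using J finite_subset by (auto simp: I_def ok_def)
 have split: "(SUM a<n. F a) = (SUM a:I. F a) + (SUM a:J. F a)" for F :: "nat => 'k"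
  unfolding I_def using fin by (intro sum.subset_diff) auto
 have zero: "f i = 0" if "f : S" "!!i. i : I ==> f i = 0" for f i
 proof -
  have "f k = 0" if "k ~: J" for k using \<open>f : S\<close> \<open>!!i. i : I ==> f i = 0\<close>[of k] that by (cases "k < n") (auto simp: S_def I_def)
  thus ?thesis using J \<open>f : S\<close> by (simp add: ok_def)
 qed
 have "ALL i:I. EX f. f : S & f i = 1 & (ALL k. k ~: insert i J --> f k = 0)"
 proof
  fix i assume i: "i : I"
  hence "~ ok (insert i J)" using max[of "insert i J"] fin by (auto simp: I_def)
  then obtain f k where f: "f : S" "ALL k. k ~: insert i J --> f k = 0" "f k ~= 0"
   using i J unfolding ok_def I_def by blast
  have "f i ~= 0"
  proof
   assume "f i = 0"
   hence "f k' = 0" if "k' : I" for k' using f(2) that by (cases "k' = i") (auto simp: I_def)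
   thus False using zero[OF f(1), of k] f(3) by blast
  qed
  thus "EX f. f : S & f i = 1 & (ALL k. k ~: insert i J --> f k = 0)"
   using S_scale[OF f(1), of "1 / f i"] f(2) by (intro exI[of _ "%k. 1 / f i * f k"]) auto
 qed
 then obtain w where w: "!!i. i : I ==> w i : S" "!!i. i : I ==> w i i = 1" "!!i k. i : I ==> k ~: insert i J ==> w i k = 0"
  by metis
 have w_I: "w i k = (if k = i then 1 else 0)" if "i : I" "k : I" for i k using w that by (auto simp: I_def)
 have expand: "f k = (SUM i:I. f i * w i k)" if f: "f : S" for f k
 proof -
  have "(%k. f k + (-1) * (SUM i:I. f i * w i k)) : S"
   using w(1) f by (intro S_add S_scale S_sum) auto
  from zero[OF this, of k] show ?thesis using w_I fin by (simp add: if_distrib cong: if_cong)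
 qed
 \<comment> \<open>The adapted basis: the vectors \<open>w a\<close> of \<open>W\<close> for
   \<open>a\<close> in \<open>I\<close>, the unit vectors for \<open>a\<close> in \<open>J\<close>.
   The function \<open>co\<close> gives coordinates with respect to it.\<close>
 define u where "u a k = (if a : I then w a k else if k = a then 1 else 0)" for a k
 define co where "co f a = (if a : I then f a else f a - (SUM i:I. f i * w i a))" for f :: "nat => 'k" and a
 have co_S: "co f a = 0" if "f : S" "a : J" for f a using expand[OF that(1), of a] that(2) by (simp add: co_def I_def)
 have co_sum: "co (%i. SUM a:A. c a * F a i) b = (SUM a:A. c a * co (F a) b)" for A c b and F :: "nat => nat => 'k"
 proof -
  have "(SUM i:I. (SUM a:A. c a * F a i) * w i b) = (SUM a:A. c a * (SUM i:I. F a i * w i b))"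
   by (simp add: sum_distrib_right sum_distrib_left mult.assoc) (rule sum.swap)
  thus ?thesis by (simp add: co_def right_diff_distrib sum_subtractf)
 qed
 have co_expand: "op g f = (%k. SUM a<n. co (op g f) a * u a k)" for g f
 proof
  fix k
  have e: "(SUM a:J. co (op g f) a * u a k) = (SUM a:J. if a = k then co (op g f) k else 0)"
   by (intro sum.cong) (auto simp: u_def I_def)
  have "(SUM a:I. co (op g f) a * u a k) = (SUM a:I. op g f a * w a k)" by (simp add: co_def u_def)
  also have "... = (if k : J then op g f k - co (op g f) k else op g f k)"
  proof (cases "k : J")
   case False
   hence "(SUM a:I. op g f a * w a k) = (SUM a:I. if a = k then op g f k else 0)"
    using w(2,3) by (intro sum.cong) auto
   thus ?thesis using False fin by (auto simp: I_def op_def)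
  qed (simp add: co_def I_def)
  finally show "op g f k = (SUM a<n. co (op g f) a * u a k)" unfolding split e using fin by simp
 qed
 have mult: "co (op (g \<otimes>\<^bsub>G\<^esub> h) (u b)) a = (SUM c<n. co (op g (u c)) a * co (op h (u b)) c)"
  if gh: "g : carrier G" "h : carrier G" for g h a b
 proof -
  have "op g (op h (u b)) = (%k. SUM c<n. co (op h (u b)) c * op g (u c) k)"
   using arg_cong[OF co_expand[of h "u b"], of "op g"] op_sum[of g "co (op h (u b))" u "{..<n}"] by (simp add: fun_eq_iff)
  hence "co (op g (op h (u b))) a = (SUM c<n. co (op h (u b)) c * co (op g (u c)) a)" by (simp only: co_sum)
  thus ?thesis by (simp add: op_mult[OF gh] mult.commute)
 qed
 have one: "co (op \<one>\<^bsub>G\<^esub> (u b)) a = (if a = b then 1 else 0)" if "a < n" "b < n" for a b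
 proof -
  have "(SUM i:I. op \<one>\<^bsub>G\<^esub> (u b) i * w i a) = (SUM i:I. if i = b then w i a else 0)"
   using op_one w_I that(2) by (intro sum.cong) (auto simp: I_def u_def)
  thus ?thesis using op_one[OF that(1)] w_I that fin by (auto simp: co_def u_def I_def)
 qed
 \<comment> \<open>Invariance of \<open>W\<close> makes the matrices block triangular in the adapted
   basis; the two diagonal blocks are the subrepresentation and the quotient.\<close>
 have tri: "co (op g (u b)) a = 0" if "g : carrier G" "b : I" "a : J" for g a b
 proof -
  have "u b = w b" using that(2) by (simp add: u_def fun_eq_iff)
  thus ?thesis using co_S[OF S_op[OF w(1)[OF that(2)] that(1)] that(3)] by simp
 qed
 obtain rho1 where rho1: "is_rep G (card I) rho1" "rep_char G (card I) rho1 = (%g. if g : carrier G then SUM a:I. co (op g (u a)) a else 0)"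
  by (rule exE[OF ex_rep_indexed[where G = G and A = I and m = "%g a b. co (op g (u b)) a"]])
   (use fin(1) one tri in \<open>auto simp: mult split I_def\<close>)
 obtain rho2 where rho2: "is_rep G (card J) rho2" "rep_char G (card J) rho2 = (%g. if g : carrier G then SUM a:J. co (op g (u a)) a else 0)"
  by (rule exE[OF ex_rep_indexed[where G = G and A = J and m = "%g a b. co (op g (u b)) a"]])
   (use fin(2,3) one tri in \<open>auto simp: mult split subset_iff\<close>)
 have "rep_char G n rho g = rep_char G (card I) rho1 g + rep_char G (card J) rho2 g" for g
 proof (cases "g : carrier G")
  case True
  \<comment> \<open>The diagonal entries differ from those of \<open>rho\<close> by terms
    \<open>rho g $$ (i, j) * w i j\<close>, added for \<open>i\<close> in \<open>I\<close> and
    subtracted for \<open>j\<close> in \<open>J\<close>; they cancel in the trace.\<close>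
  have "co (op g (u i)) i = rho g $$ (i, i) + (SUM j:J. rho g $$ (i, j) * w i j)" if "i : I" for i
  proof -
   have "(SUM a:I. rho g $$ (i, a) * w i a) = (SUM a:I. if a = i then rho g $$ (i, i) else 0)"
    using w_I[OF that] by (intro sum.cong) auto
   thus ?thesis using that fin by (simp add: co_def op_def split u_def) (simp add: I_def)
  qed
  moreover have "co (op g (u j)) j = rho g $$ (j, j) - (SUM i:I. rho g $$ (i, j) * w i j)" if "j : J" for j
  proof -
   have "op g (u j) i = rho g $$ (i, j)" if "i < n" for i
    using that \<open>j : J\<close> fin(3) by (auto simp: op_def u_def I_def if_distrib cong: if_cong)
   thus ?thesis using that fin(3) by (auto simp: co_def I_def intro!: sum.cong)
  qed
  moreover have "(SUM i:I. SUM j:J. rho g $$ (i, j) * w i j) = (SUM j:J. SUM i:I. rho g $$ (i, j) * w i j)" by (rule sum.swap)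
  ultimately show ?thesis using True rho1(2) rho2(2) by (simp add: rep_char_def[of G n] split sum.distrib sum_subtractf)
 qed (simp add: rho1 rho2 rep_char_def[of G n])
 moreover have "J ~= {..<n}"
 proof
  assume "J = {..<n}"
  have "v = 0\<^sub>v n" if "v : W" for v
  proof (rule eq_vecI)
   have "v : carrier_vec n" using that Wc by blast
   hence "(%i. if i < n then v $ i else 0) : S"
    using that by (auto simp: S_def elim!: back_subst[of "%v. v : W"] intro!: eq_vecI)
   from zero[OF this] have "(if i < n then v $ i else 0) = 0" for i using \<open>J = _\<close> by (simp add: I_def)
   thus "v $ i = 0\<^sub>v n $ i" if "i < dim_vec (0\<^sub>v n)" for i using that by (metis dim_vec index_zero_vec)
   show "dim_vec v = dim_vec (0\<^sub>v n)" using \<open>v : carrier_vec n\<close> by simp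
  qed
  thus False using W(2) Wcl(1) by blast
 qed
 moreover have "J ~= {}"
 proof
  assume "J = {}"
  have "v : W" if "v : carrier_vec n" for v
  proof -
   have "(%k. SUM i:I. v $ i * w i k) : S" using w(1) by (intro S_sum S_scale)
   moreover have "vec n (%k. SUM i:I. v $ i * w i k) = v"
    using that by (intro eq_vecI) (auto simp: \<open>J = {}\<close> I_def w_I[unfolded I_def] if_distrib[of "%x. _ * x"] cong: if_cong)
   ultimately show ?thesis by (simp add: S_def)
  qed
  thus False using W(3) Wc by blast
 qed
 ultimately show ?thesis
  using rho1(1) rho2(1) psubset_card_mono[of "{..<n}" J] psubset_card_mono[of "{..<n}" I] fin(3) unfolding I_def
  by (intro exI[of _ "card ({..<n} - J)"] exI[of _ "card J"] exI[of _ rho1] exI[of _ rho2]) auto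
qed

lemma ex_direct_sum:
 fixes rho sigma :: "'g => 'k::field mat"
 assumes "is_rep G n rho" "is_rep G m sigma" "Group.group G"
 shows "EX k \<tau>. is_rep G k \<tau> & rep_char G k \<tau> = (%g. rep_char G n rho g + rep_char G m sigma g)"
proof -
 interpret Group.group G by fact
 let ?A = "{..<n} <+> {..<m}"
 let ?m = "%g a b. case a of Inl i => (case b of Inl j => rho g $$ (i, j) | Inr j => 0) | Inr i => (case b of Inl j => 0 | Inr j => sigma g $$ (i, j))"
 have "EX \<tau>. is_rep G (card ?A) \<tau> & rep_char G (card ?A) \<tau> = (%g. if g : carrier G then SUM a:?A. ?m g a a else 0)"
  by (rule ex_rep_indexed[where m = ?m])
   (auto simp: is_rep_D(2)[OF assms(1)] is_rep_D(2)[OF assms(2)] rep_entry[OF assms(1)] rep_entry[OF assms(2)] sum.Plus split: if_splits)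
 moreover have "(%g. if g : carrier G then SUM a:?A. ?m g a a else 0) = (%g. rep_char G n rho g + rep_char G m sigma g)"
  by (rule ext) (simp add: rep_char_def sum.Plus)
 ultimately show ?thesis by (simp only:) blast
qed

context finite_group
begin

text \<open>Induction on the dimension along a filtration. Characters are additive on
  subrepresentation and quotient, so no complement of an invariant subspace has to be
  produced.\<close>

lemma rep_char_irr_list:
 fixes rho :: "'g => 'k::field mat"
 assumes "is_rep G n rho"
 shows "EX xs. set xs \<subseteq> irr_chars G & rep_char G n rho = (%g. SUM psi<-xs. psi g)"
 using assms
proof (induction n arbitrary: rho rule: less_induct)
 case (less n)
 consider "n = 0" | "is_irr_rep G n rho" | W where "n > 0" "invariant_subspace G n rho W" "W ~= {0\<^sub>v n}" "W ~= carrier_vec n"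
  using less.prems unfolding is_irr_rep_def by blast
 thus ?case
 proof cases
  case 1
  thus ?thesis by (intro exI[of _ "[]"]) (auto simp: rep_char_def)
 next
  case 2
  thus ?thesis by (intro exI[of _ "[rep_char G n rho]"]) (auto simp: irr_chars_def)
 next
  case 3
  obtain k l rho1 rho2 where kl: "k < n" "l < n" "is_rep G k rho1" "is_rep G l rho2"
   "rep_char G n rho = (%g. rep_char G k rho1 g + rep_char G l rho2 g)"
   using rep_char_invariant_subspace[OF less.prems group_axioms 3(2-4)] by blast
  obtain xs ys where "set xs \<subseteq> irr_chars G" "rep_char G k rho1 = (%g. SUM psi<-xs. psi g)"
   "set ys \<subseteq> irr_chars G" "rep_char G l rho2 = (%g. SUM psi<-ys. psi g)"
   using less.IH[OF kl(1,3)] less.IH[OF kl(2,4)] by blast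
  thus ?thesis using kl(5) by (intro exI[of _ "xs @ ys"]) auto
 qed
qed

lemma ex_regular_rep:
 "EX (rho :: 'g => 'k::field mat). is_rep G (order G) rho &
  rep_char G (order G) rho = (%g. if g = \<one> then of_nat (order G) else 0)"
proof -
 let ?m = "%g a b. if g \<otimes> b = a then 1 else 0 :: 'k"
 have "EX rho. is_rep G (card (carrier G)) rho & rep_char G (card (carrier G)) rho = (%g. if g : carrier G then SUM a:carrier G. ?m g a a else 0)"
  by (rule ex_rep_indexed[where m = ?m]) (use fin in \<open>auto simp: m_assoc if_distrib[of "%x. _ * x"] cong: if_cong\<close>)
 moreover have "(if g : carrier G then SUM a:carrier G. ?m g a a else 0) = (if g = \<one> then of_nat (order G) else 0)" for g
  using sum.cong[of "carrier G" "carrier G" "%a. ?m g a a" "%a. if g = \<one> then 1 else 0"] by (auto simp: order_def r_cancel_one')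
 ultimately show ?thesis by (simp add: order_def)
qed

end

section \<open>Irreducible characters and the lattice they span\<close>

locale finite_group_chars = finite_group G for G :: "('g, 'b) monoid_scheme" (structure) +
 fixes I :: "('g => 'k::{alg_closed_field, field_char_0}) set"
 defines "I == irr_chars G"
begin

lemma char_one: "rep_char G n rho \<one> = (of_nat n :: 'k)" if "is_rep G n rho"
 using is_rep_D(2)[OF that] by (simp add: rep_char_def)

lemma irr_charsE:
 assumes "psi : I"
 obtains n rho where "is_irr_rep G n rho" "rep_char G n rho = psi" "n > 0" "psi \<one> = of_nat n"
proof -
 obtain n rho where "is_irr_rep G n rho" "rep_char G n rho = psi" using assms by (auto simp: I_def irr_chars_def)
 thus thesis using that char_one[of n rho] unfolding is_irr_rep_def by metis
qed

lemma inner: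
 "phi : I ==> psi : I ==> (SUM g:carrier G. phi g * psi (inv g)) = (if phi = psi then of_nat (order G) else 0)"
 unfolding I_def by (rule char_orthogonality)

lemma char_list_inner:
 assumes "set xs \<subseteq> I" "psi : I"
 shows "(SUM g:carrier G. (SUM phi<-xs. phi g) * psi (inv g)) = of_nat (count_list xs psi) * of_nat (order G)"
 using assms(1)
proof (induction xs)
 case (Cons phi xs)
 thus ?case
  using inner[of phi psi] assms(2) by (simp add: distrib_right sum.distrib)
qed simp

lemma sum_list_count:
 fixes phi :: "'x => 'k"
 assumes "set xs \<subseteq> J" "finite J"
 shows "(SUM x<-xs. phi x) = (SUM x:J. of_nat (count_list xs x) * phi x)"
 using assms(1)
proof (induction xs)
 case (Cons y xs)
 have "(SUM x:J. of_nat (count_list (y # xs) x) * phi x) =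
   (SUM x:J. (if x = y then phi x else 0) + of_nat (count_list xs x) * phi x)"
  by (intro sum.cong refl) (auto simp: algebra_simps)
 thus ?case using Cons assms(2) by (simp add: sum.distrib)
qed simp

text \<open>By orthogonality every irreducible character occurs in the regular character, with
  multiplicity its value at the unit element. Its decomposition is a finite list, which also yields
  finiteness of \<open>I\<close>.\<close>

lemma irr_chars_regular:
 shows "finite I" "g : carrier G ==> (SUM psi:I. psi \<one> * psi g) = (if g = \<one> then of_nat (order G) else 0)"
proof -
 obtain rho :: "'g => 'k mat" where rho: "is_rep G (order G) rho"
  "rep_char G (order G) rho = (%g. if g = \<one> then of_nat (order G) else 0)"
  using ex_regular_rep by blast
 obtain xs where xs: "set xs \<subseteq> I" "rep_char G (order G) rho = (%g. SUM psi<-xs. psi g)"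
  using rep_char_irr_list[OF rho(1)] unfolding I_def by blast
 have c: "of_nat (count_list xs psi) = psi \<one>" if "psi : I" for psi
 proof -
  have "of_nat (count_list xs psi) * of_nat (order G) = (SUM g:carrier G. rep_char G (order G) rho g * psi (inv g))"
   using char_list_inner[OF xs(1) that] xs(2) by simp
  also have "... = (SUM g:carrier G. if g = \<one> then of_nat (order G) * psi (inv g) else 0)"
   using rho(2) by (intro sum.cong) auto
  also have "... = of_nat (order G) * psi \<one>" using fin by simp
  finally show ?thesis using order_pos by simp
 qed
 have "psi : set xs" if "psi : I" for psi
 proof -
  have "psi \<one> ~= 0" using irr_charsE[OF that] by (metis of_nat_eq_0_iff less_irrefl)
  hence "count_list xs psi ~= 0" using c[OF that] by (metis of_nat_0)
  thus ?thesis by (metis count_notin)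
 qed
 hence I: "set xs = I" using xs by auto
 thus "finite I" by auto
 have "(SUM psi<-xs. psi g) = (SUM psi:I. of_nat (count_list xs psi) * psi g)"
  by (rule sum_list_count) (use xs \<open>finite I\<close> in auto)
 thus "(SUM psi:I. psi \<one> * psi g) = (if g = \<one> then of_nat (order G) else 0)" if "g : carrier G"
  using fun_cong[OF xs(2), of g] fun_cong[OF rho(2), of g] c I by simp
qed

definition comb :: "(('g => 'k) => int) => 'g => 'k" where
 "comb c = (%g. SUM psi:I. of_int (c psi) * psi g)"

lemma comb_inner:
 assumes "psi : I"
 shows "(SUM g:carrier G. comb c g * psi (inv g)) = of_int (c psi) * of_nat (order G)"
proof -
 have "(SUM g:carrier G. comb c g * psi (inv g)) = (SUM phi:I. of_int (c phi) * (SUM g:carrier G. phi g * psi (inv g)))"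
  unfolding comb_def sum_distrib_left sum_distrib_right by (subst sum.swap) (simp add: mult.assoc)
 also have "... = (SUM phi:I. if phi = psi then of_int (c psi) * of_nat (order G) else 0)"
  using assms inner by (intro sum.cong) auto
 finally show ?thesis using assms irr_chars_regular(1) by simp
qed

lemma comb_inject:
 assumes "comb c = comb d" "psi : I"
 shows "c psi = d psi"
 using comb_inner[OF assms(2), of c] comb_inner[OF assms(2), of d] assms(1) order_pos by simp

lemma comb_add: "(%g. comb c g + comb d g) = comb (%psi. c psi + d psi)"
 and comb_diff: "(%g. comb c g - comb d g) = comb (%psi. c psi - d psi)"
 and comb_minus: "(%g. - comb c g) = comb (%psi. - c psi)"
 and comb_zero: "(%g. 0) = comb (%psi. 0)"
 by (simp_all add: comb_def distrib_right left_diff_distrib sum.distrib sum_subtractf sum_negf)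

lemma rep_char_comb: "is_rep G n rho ==> EX c. rep_char G n rho = comb c"
proof -
 assume "is_rep G n rho"
 then obtain xs where xs: "set xs \<subseteq> I" "rep_char G n rho = (%g. SUM psi<-xs. psi g)"
  using rep_char_irr_list unfolding I_def by blast
 have "(SUM psi<-xs. psi g) = comb (%psi. int (count_list xs psi)) g" for g
  using sum_list_count[OF xs(1) irr_chars_regular(1), of "%psi. psi g"] by (simp add: comb_def)
 thus ?thesis using xs(2) by auto
qed

text \<open>One inclusion decomposes characters into irreducible ones. For the other, the positive
  and negative parts of the coefficients are realized by direct sums.\<close>

lemma carrier_rep_ring: "carrier (rep_ring G) = range comb"
proof
 show "carrier (rep_ring G) \<subseteq> range comb"
 proof
  fix f :: "'g => 'k" assume "f : carrier (rep_ring G)"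
  then obtain n rho m sigma where f: "f = (%g. rep_char G n rho g - rep_char G m sigma g)" "is_rep G n rho" "is_rep G m sigma"
   by (auto simp: rep_ring_def)
  obtain c d where "rep_char G n rho = comb c" "rep_char G m sigma = comb d" using rep_char_comb f(2,3) by blast
  thus "f : range comb" using f(1) comb_diff by simp
 qed
 let ?P = "%f. EX n rho. is_rep G n rho & rep_char G n rho = (f :: 'g => 'k)"
 have "is_rep G 0 (%g. 1\<^sub>m 0 :: 'k mat)" by (auto simp: is_rep_def)
 hence "?P (%g. 0)" by (intro exI[of _ 0] exI) (auto simp: rep_char_def)
 moreover have "?P (%g. f g + f' g)" if "?P f" "?P f'" for f f'
  using that ex_direct_sum[OF _ _ group_axioms] by blast
 ultimately have sum: "?P (%g. SUM a:A. f a g)" if "!!a. a : A ==> ?P (f a)" for A and f :: "'x => 'g => 'k"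
  using that by (induction A rule: infinite_finite_induct) simp_all
 have pos: "?P (comb (%psi. int (c psi)))" for c
 proof -
  have "?P (%g. SUM psi:I. SUM k<c psi. psi g)"
   by (intro sum) (use irr_charsE in \<open>unfold is_irr_rep_def, metis\<close>)
  thus ?thesis by (simp add: comb_def)
 qed
 have "comb c : carrier (rep_ring G)" for c
 proof -
  obtain n rho m sigma where r: "is_rep G n rho" "rep_char G n rho = comb (%psi. int (nat (c psi)))"
   "is_rep G m sigma" "rep_char G m sigma = comb (%psi. int (nat (- c psi)))"
   using pos[of "%psi. nat (c psi)"] pos[of "%psi. nat (- c psi)"] by blast
  have "(%psi. int (nat (c psi)) - int (nat (- c psi))) = c" by auto
  hence "comb c = (%g. rep_char G n rho g - rep_char G m sigma g)" using r by (simp add: comb_diff)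
  thus ?thesis unfolding rep_ring_def using r(1,3) by auto
 qed
 thus "range comb \<subseteq> carrier (rep_ring G)" by auto
qed

lemma group_rep_ring: "comm_group (add_monoid (rep_ring G :: ('g => 'k) ring))"
proof (rule comm_groupI)
 fix x :: "'g => 'k" assume "x : carrier (add_monoid (rep_ring G))"
 then obtain c where "x = comb c" using carrier_rep_ring by auto
 hence "(%g. - x g) : carrier (add_monoid (rep_ring G))" using carrier_rep_ring comb_minus[of c] by simp
 thus "EX y:carrier (add_monoid (rep_ring G)). y \<otimes>\<^bsub>add_monoid (rep_ring G)\<^esub> x = \<one>\<^bsub>add_monoid (rep_ring G)\<^esub>"
  by (rule bexI[rotated]) (simp add: rep_ring_def)
next
 fix x y :: "'g => 'k" assume "x : carrier (add_monoid (rep_ring G))" "y : carrier (add_monoid (rep_ring G))"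
 then obtain c d where "x = comb c" "y = comb d" using carrier_rep_ring by auto
 thus "x \<otimes>\<^bsub>add_monoid (rep_ring G)\<^esub> y : carrier (add_monoid (rep_ring G))"
  using carrier_rep_ring comb_add[of c d] by (simp add: rep_ring_def)
next
 show "\<one>\<^bsub>add_monoid (rep_ring G)\<^esub> : carrier (add_monoid (rep_ring G :: ('g => 'k) ring))"
  using carrier_rep_ring comb_zero by (simp add: rep_ring_def)
qed (auto simp: rep_ring_def add_ac)

end

section \<open>The Grothendieck ring of a linear tensor category\<close>

context linear_tensor_category
begin

lemma complementI:
 assumes "X : Obj D" "Y : Obj D" "Z : Obj D" "i : Hom D X Z" "j : Hom D Y Z" "p : Hom D Z X" "q : Hom D Z Y"
  "Cmp D X Z X p i = Idn D X" "Cmp D Y Z Y q j = Idn D Y" "Cmp D X Z Y q i = 0" "Cmp D Y Z X p j = 0"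
  "Cmp D Z X Z i p + Cmp D Z Y Z j q = Idn D Z"
 shows "is_complement D Z X i Y j"
 unfolding is_complement_def is_biproduct_def
 by (rule exI[of _ p], rule exI[of _ q]) (use assms in auto)

lemma complementE:
 assumes "is_complement D Z X i Y j"
 obtains p q where "X : Obj D" "Y : Obj D" "Z : Obj D" "i : Hom D X Z" "j : Hom D Y Z" "p : Hom D Z X" "q : Hom D Z Y"
  "Cmp D X Z X p i = Idn D X" "Cmp D Y Z Y q j = Idn D Y" "Cmp D X Z Y q i = 0" "Cmp D Y Z X p j = 0"
  "Cmp D Z X Z i p + Cmp D Z Y Z j q = Idn D Z"
proof -
 obtain p q where pq: "is_biproduct D Z {0, 1::nat} (%n. if n = 0 then X else Y)
  (%n. if n = 0 then i else j) (%n. if n = 0 then p else q)"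
  using assms by (auto simp: is_complement_def)
 thus thesis
  by (intro that[of p q]) (auto simp: is_biproduct_def)
qed

text \<open>Tensoring with a fixed object preserves direct sum decompositions, by bifunctoriality
  and bilinearity. The defining relations of the Grothendieck ring are thus stable under
  multiplication.\<close>

lemma complement_TenO_left:
 assumes "is_complement D Z X i Y j" "W : Obj D"
 shows "is_complement D (TenO D Z W) (TenO D X W) (TenM D X Z W W i (Idn D W)) (TenO D Y W) (TenM D Y Z W W j (Idn D W))"
 using assms(1)
proof (rule complementE)
 fix p q assume A: "X : Obj D" "Y : Obj D" "Z : Obj D" "i : Hom D X Z" "j : Hom D Y Z" "p : Hom D Z X" "q : Hom D Z Y"
  "Cmp D X Z X p i = Idn D X" "Cmp D Y Z Y q j = Idn D Y" "Cmp D X Z Y q i = 0" "Cmp D Y Z X p j = 0"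
  "Cmp D Z X Z i p + Cmp D Z Y Z j q = Idn D Z"
 have W: "Idn D W : Hom D W W" "Cmp D W W W (Idn D W) (Idn D W) = Idn D W"
  using assms(2) Idn_Hom Cmp_Idn by auto
 have T: "Cmp D (TenO D U W) (TenO D U' W) (TenO D U'' W) (TenM D U' U'' W W g (Idn D W)) (TenM D U U' W W f (Idn D W)) =
   TenM D U U'' W W (Cmp D U U' U'' g f) (Idn D W)"
  if "U : Obj D" "U' : Obj D" "U'' : Obj D" "f : Hom D U U'" "g : Hom D U' U''" for U U' U'' f g
  using TenM_Cmp[OF that(1-3) assms(2) assms(2) assms(2) that(4,5) W(1) W(1)] W(2) by simp
 show ?thesis
  by (rule complementI[where p = "TenM D Z X W W p (Idn D W)" and q = "TenM D Z Y W W q (Idn D W)"])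
   (use A(1-7) assms(2) W in \<open>simp_all add: T TenO_Obj TenM_Hom A(8-11) TenM_Idn TenM_add_left[symmetric] A(12)\<close>)
qed

lemma complement_TenO_right:
 assumes "is_complement D Z X i Y j" "W : Obj D"
 shows "is_complement D (TenO D W Z) (TenO D W X) (TenM D W W X Z (Idn D W) i) (TenO D W Y) (TenM D W W Y Z (Idn D W) j)"
 using assms(1)
proof (rule complementE)
 fix p q assume A: "X : Obj D" "Y : Obj D" "Z : Obj D" "i : Hom D X Z" "j : Hom D Y Z" "p : Hom D Z X" "q : Hom D Z Y"
  "Cmp D X Z X p i = Idn D X" "Cmp D Y Z Y q j = Idn D Y" "Cmp D X Z Y q i = 0" "Cmp D Y Z X p j = 0"
  "Cmp D Z X Z i p + Cmp D Z Y Z j q = Idn D Z"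
 have W: "Idn D W : Hom D W W" "Cmp D W W W (Idn D W) (Idn D W) = Idn D W"
  using assms(2) Idn_Hom Cmp_Idn by auto
 have T: "Cmp D (TenO D W U) (TenO D W U') (TenO D W U'') (TenM D W W U' U'' (Idn D W) g) (TenM D W W U U' (Idn D W) f) =
   TenM D W W U U'' (Idn D W) (Cmp D U U' U'' g f)"
  if "U : Obj D" "U' : Obj D" "U'' : Obj D" "f : Hom D U U'" "g : Hom D U' U''" for U U' U'' f g
  using TenM_Cmp[OF assms(2) assms(2) assms(2) that(1-3) W(1) W(1) that(4,5)] W(2) by simp
 show ?thesis
  by (rule complementI[where p = "TenM D W W Z X (Idn D W) p" and q = "TenM D W W Z Y (Idn D W) q"])
   (use A(1-7) assms(2) W in \<open>simp_all add: T TenO_Obj TenM_Hom A(8-11) TenM_Idn TenM_add_right[symmetric] A(12)\<close>)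
qed

abbreviation FG :: "('o \<Rightarrow>\<^sub>0 int) monoid" where
 "FG == free_Abelian_group (Obj D)"

abbreviation GR :: "('o \<Rightarrow>\<^sub>0 int) set" where
 "GR == groth_relations D"

definition omult :: "('o \<Rightarrow>\<^sub>0 int) => ('o \<Rightarrow>\<^sub>0 int) => 'o \<Rightarrow>\<^sub>0 int" where
 "omult a b = frag_extend (%X. frag_extend (%Y. frag_of (TenO D X Y)) b) a"

definition gcls :: "('o \<Rightarrow>\<^sub>0 int) => ('o \<Rightarrow>\<^sub>0 int) set" where
 "gcls a = GR +>\<^bsub>object_ring D\<^esub> a"

lemma FG_simps: "carrier FG = {c. Poly_Mapping.keys c \<subseteq> Obj D}" "\<one>\<^bsub>FG\<^esub> = 0" "a \<otimes>\<^bsub>FG\<^esub> b = a + b"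
 by (auto simp: free_Abelian_group_def)

lemma frag_of_FG: "frag_of X : carrier FG \<longleftrightarrow> X : Obj D"
 by (simp add: FG_simps)

lemma FG_cl: "0 : carrier FG" "a : carrier FG ==> b : carrier FG ==> a + b : carrier FG"
 "a : carrier FG ==> - a : carrier FG" "a : carrier FG ==> b : carrier FG ==> a - b : carrier FG"
 "a : carrier FG ==> frag_cmul n a : carrier FG"
 using keys_add[of a b] keys_diff[of a b] keys_cmul[of n a] by (auto simp: FG_simps)

lemma FG_sum: "(!!i. i : I ==> f i : carrier FG) ==> sum f I : carrier FG"
 by (induction I rule: infinite_finite_induct) (simp_all add: FG_cl del: carrier_free_Abelian_group_iff)

lemma FG_inv: "a : carrier FG ==> inv\<^bsub>FG\<^esub> a = - a"
 by (rule group.inv_equality[OF group_free_Abelian_group]) (auto simp: FG_simps)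

lemma FG_induct [consumes 1, case_names zero one diff]:
 assumes "a : carrier FG" "P 0" "!!X. X : Obj D ==> P (frag_of X)" "!!a b. P a ==> P b ==> P (a - b)"
 shows "P a"
 using frag_induction[of a "Obj D" P] assms by (auto simp: FG_simps)

lemma GR_subgroup: "subgroup GR FG"
 unfolding groth_relations_def
proof (rule group.generate_is_subgroup[OF group_free_Abelian_group], safe)
 fix X Y Z i j assume "is_complement D Z X i Y j"
 thus "frag_of Z - frag_of X - frag_of Y : carrier FG"
  by (rule complementE) (intro FG_cl, auto simp only: frag_of_FG)
qed

lemma GR_cl: "0 : GR" "a : GR ==> b : GR ==> a + b : GR" "a : GR ==> - a : GR" "a : GR ==> a : carrier FG"
 using subgroup.one_closed[OF GR_subgroup] subgroup.m_closed[OF GR_subgroup, of a b]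
  subgroup.m_inv_closed[OF GR_subgroup, of a] subgroup.mem_carrier[OF GR_subgroup, of a] FG_inv[of a]
 by (auto simp: FG_simps)

lemma GR_diff: "a : GR ==> b : GR ==> a - b : GR"
 using GR_cl(2)[of a "- b"] GR_cl(3) by simp

lemma GR_complement: "is_complement D Z X i Y j ==> frag_of Z - frag_of X - frag_of Y : GR"
 unfolding groth_relations_def by (rule generate.incl) blast

lemma GR_induct [consumes 1, case_names zero complement add uminus]:
 assumes r: "r : GR" and "P 0" "!!X Y Z i j. is_complement D Z X i Y j ==> P (frag_of Z - frag_of X - frag_of Y)"
  and "!!a b. P a ==> P b ==> P (a + b)" "!!a. P a ==> P (- a)"
 shows "P r"
 using r unfolding groth_relations_def
proof (induction r rule: generate.induct)
 case (inv h)
 hence "P h" "h : GR" using GR_complement assms(3) by blast+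
 thus ?case using FG_inv[OF GR_cl(4)] assms(5) by metis
qed (use assms in \<open>auto simp: FG_simps\<close>)

lemma omult_simps: "omult (a + a') b = omult a b + omult a' b" "omult (a - a') b = omult a b - omult a' b"
 "omult (- a) b = - omult a b" "omult 0 b = 0" "omult a 0 = 0"
 "omult a (b + b') = omult a b + omult a b'" "omult a (b - b') = omult a b - omult a b'" "omult a (- b) = - omult a b"
 "omult (frag_of X) (frag_of Y) = frag_of (TenO D X Y)"
proof -
 show r: "omult a (b + b') = omult a b + omult a b'" for b b'
  by (simp add: omult_def frag_extend_def frag_cmul_distrib2 sum.distrib frag_extend_add[unfolded frag_extend_def])
 show m: "omult a (- b) = - omult a b" for b
  using r[of b "- b"] by (simp add: omult_def frag_extend_eq_0 add_eq_0_iff)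
 show "omult a (b - b') = omult a b - omult a b'" using r[of b "- b'"] m[of b'] by simp
qed (simp_all add: omult_def frag_extend_add frag_extend_diff frag_extend_minus frag_extend_eq_0)

lemma omult_FG: "a : carrier FG ==> b : carrier FG ==> omult a b : carrier FG"
proof (induction a rule: FG_induct)
 case (one X)
 from \<open>b : carrier FG\<close> show ?case
  by (induction b rule: FG_induct) (use one in \<open>auto simp: omult_simps frag_of_FG TenO_Obj simp del: carrier_free_Abelian_group_iff intro: FG_cl\<close>)
qed (auto simp: omult_simps simp del: carrier_free_Abelian_group_iff intro: FG_cl)

text \<open>The relations absorb products from both sides, so multiplication of cosets is well
  defined. This is checked on generators, since the formal combinations satisfy the ring axioms only
  up to isomorphism of objects.\<close>

lemma omult_GR:
 assumes "r : GR" "b : carrier FG"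
 shows "omult r b : GR" "omult b r : GR"
proof -
 have "omult r b : GR & omult b r : GR"
  using assms(2)
 proof (induction b rule: FG_induct)
  case (one W)
  from assms(1) show ?case
  proof (induction r rule: GR_induct)
   case (complement X Y Z i j)
   show ?case
    using GR_complement[OF complement_TenO_left[OF complement one]] GR_complement[OF complement_TenO_right[OF complement one]]
    by (simp add: omult_simps)
  qed (auto simp: omult_simps intro: GR_cl)
 qed (auto simp: omult_simps intro: GR_cl GR_diff)
 thus "omult r b : GR" "omult b r : GR" by auto
qed

lemma mem_gcls: "b : gcls a \<longleftrightarrow> b - a : GR"
proof -
 have "gcls a = (%r. r + a) ` GR" by (auto simp: gcls_def a_r_coset_def r_coset_def object_ring_def)
 thus ?thesis by (auto simp: image_iff intro: bexI[of _ "b - a"])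
qed

lemma gcls_eq: "gcls a = gcls b \<longleftrightarrow> a - b : GR"
proof
 assume "gcls a = gcls b"
 moreover have "a : gcls a" by (simp add: mem_gcls GR_cl)
 ultimately show "a - b : GR" by (simp add: mem_gcls)
next
 assume ab: "a - b : GR"
 have "c - a : GR \<longleftrightarrow> c - b : GR" for c
  using GR_cl(2)[OF _ ab, of "c - a"] GR_diff[OF _ ab, of "c - b"] by auto
 thus "gcls a = gcls b" by (auto simp: mem_gcls)
qed

lemma groth_add_monoid: "add_monoid (groth_ring D) = FG Mod GR"
 by (simp add: groth_ring_def FactRing_def object_ring_def FactGroup_def A_RCOSETS_def set_add_def free_Abelian_group_def)

lemma comm_group_groth: "comm_group (add_monoid (groth_ring D))"
proof -
 have "comm_group FG" by (simp add: abelian_free_Abelian_group)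
 thus ?thesis unfolding groth_add_monoid by (rule comm_group.abelian_FactGroup) (rule GR_subgroup)
qed

lemma groth_carrier: "carrier (groth_ring D) = gcls ` carrier FG"
 by (auto simp: groth_ring_def FactRing_def A_RCOSETS_def RCOSETS_def gcls_def a_r_coset_def object_ring_def)

lemma groth_zero: "\<zero>\<^bsub>groth_ring D\<^esub> = gcls 0"
 using mem_gcls[of _ 0] by (auto simp: groth_ring_def FactRing_def)

lemma groth_add: "gcls a \<oplus>\<^bsub>groth_ring D\<^esub> gcls b = gcls (a + b)"
proof -
 have "gcls a \<oplus>\<^bsub>groth_ring D\<^esub> gcls b = {x + y | x y. x : gcls a & y : gcls b}"
  by (auto simp: groth_ring_def FactRing_def set_add_def set_mult_def object_ring_def)
 also have "... = gcls (a + b)"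
 proof safe
  fix x y assume "x : gcls a" "y : gcls b"
  thus "x + y : gcls (a + b)" using GR_cl(2)[of "x - a" "y - b"] by (simp add: mem_gcls algebra_simps)
 next
  fix x assume "x : gcls (a + b)"
  thus "EX u v. x = u + v & u : gcls a & v : gcls b"
   by (intro exI[of _ "x - b"] exI[of _ b]) (auto simp: mem_gcls GR_cl algebra_simps)
 qed
 finally show ?thesis .
qed

lemma groth_mult:
 assumes "a : carrier FG" "b : carrier FG"
 shows "gcls a \<otimes>\<^bsub>groth_ring D\<^esub> gcls b = gcls (omult a b)"
proof -
 have "gcls a \<otimes>\<^bsub>groth_ring D\<^esub> gcls b = (\<Union>x\<in>gcls a. \<Union>y\<in>gcls b. gcls (omult x y))"
  by (simp add: groth_ring_def FactRing_def rcoset_mult_def object_ring_def gcls_def[of "omult _ _"] omult_def[symmetric] gcls_def)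
 moreover have "gcls (omult x y) = gcls (omult a b)" if "x : gcls a" "y : gcls b" for x y
 proof -
  have xa: "x - a : GR" "y - b : GR" using that by (auto simp: mem_gcls)
  have "y : carrier FG" using FG_cl(2)[OF GR_cl(4)[OF xa(2)] assms(2)] by simp
  hence "omult (x - a) y + omult a (y - b) : GR"
   using omult_GR xa assms by (intro GR_cl) auto
  thus ?thesis by (simp add: gcls_eq omult_simps)
 qed
 moreover have "a : gcls a" "b : gcls b" by (auto simp: mem_gcls GR_cl)
 ultimately show ?thesis by blast
qed

lemma groth_class_eq: "groth_class D X = gcls (frag_of X)"
 by (simp add: groth_class_def gcls_def)

end

section \<open>The tensor envelope\<close>

text \<open>The matrix with a single entry, between lists of length one; entries outside the index
  range are zero by convention.\<close>

definition emb :: "'h::zero => nat => nat => 'h" where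
 "emb v = (%i j. if i = 0 & j = 0 then v else 0)"

lemma emb_add: "emb (u + v) = emb u + emb (v :: 'h::ab_group_add)"
 and emb_zero [simp]: "emb 0 = 0"
 and emb_inject [simp]: "emb u = emb v \<longleftrightarrow> u = v"
 by (auto simp: emb_def fun_eq_iff fun_simps)

lemma emb_sum: "emb (sum f I) = (SUM i:I. emb (f i :: 'h::ab_group_add))"
 by (induction I rule: infinite_finite_induct) (simp_all add: emb_add)

context linear_tensor_category
begin

text \<open>In the idempotent completion every retract is a direct summand: the complement is the
  image of the idempotent 1 - kr.\<close>

lemma split_complement:
 fixes W :: "'o \<times> 'h"
 defines "K == idempotent_completion D"
 assumes "Y : Obj K" "W : Obj K" "k : Hom K Y W" "r : Hom K W Y" "Cmp K Y W Y r k = Idn K Y"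
 shows "is_complement K W Y k (fst W, Idn K W - Cmp K W Y W k r) (Idn K W - Cmp K W Y W k r)"
proof -
 obtain Y' e W' p where YW: "Y = (Y', e)" "W = (W', p)" by fastforce
 note S = idempotent_simps
 have A: "Y' : Obj D" "e : Hom D Y' Y'" "Cmp D Y' Y' Y' e e = e"
   "W' : Obj D" "p : Hom D W' W'" "Cmp D W' W' W' p p = p"
   "k : Hom D Y' W'" "Cmp D Y' Y' W' k e = k" "Cmp D Y' W' W' p k = k"
   "r : Hom D W' Y'" "Cmp D W' W' Y' r p = r" "Cmp D W' Y' Y' e r = r" "Cmp D Y' W' Y' r k = e"
  using assms by (auto simp: K_def YW S)
 interpret K: linear_tensor_category K unfolding K_def by (rule linear_tensor_category_idempotent)
 define kr where "kr = Cmp D W' Y' W' k r"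
 have kr: "kr : Hom D W' W'" "Cmp D W' W' W' p kr = kr" "Cmp D W' W' W' kr p = kr"
   "Cmp D W' W' W' kr kr = kr" "Cmp D Y' W' W' kr k = k" "Cmp D W' W' Y' r kr = r"
 proof -
  show h: "kr : Hom D W' W'" unfolding kr_def using A by (intro Cmp_Hom)
  show "Cmp D W' W' W' p kr = kr" "Cmp D W' W' W' kr p = kr"
   unfolding kr_def using A Cmp_assoc[of W' Y' W' W' r k p] Cmp_assoc[of W' W' Y' W' p r k] by simp_all
  show 1: "Cmp D Y' W' W' kr k = k" "Cmp D W' W' Y' r kr = r"
   unfolding kr_def using A Cmp_assoc[of Y' W' Y' W' k r k] Cmp_assoc[of W' Y' W' Y' r k r] by simp_all
  show "Cmp D W' W' W' kr kr = kr"
   using 1 Cmp_assoc[of W' W' Y' W' kr r k] A h by (simp add: kr_def)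
 qed
 have q: "Cmp D W' W' W' (p - kr) (p - kr) = p - kr" "p - kr : Hom D W' W'"
  using kr A by (auto simp: Cmp_diff_left Cmp_diff_right intro: Hom_diff)
 have Z: "(W', p - kr) : Obj K" using q A by (simp add: K_def S)
 show ?thesis
  by (rule K.complementI[where p = r and q = "Idn K W - Cmp K W Y W k r"])
   (use assms(2-) A kr q Z in \<open>simp_all add: K_def YW S kr_def[symmetric] Cmp_diff_left Cmp_diff_right\<close>)
qed

definition inc :: "'o list => nat => nat => nat => 'h" where
 "inc xs m = (%i j. if i = m & j = 0 then Idn D (xs ! m) else 0)"

definition prj :: "'o list => nat => nat => nat => 'h" where
 "prj xs m = (%i j. if i = 0 & j = m then Idn D (xs ! m) else 0)"

lemma inc_prj:
 assumes "xs : lists (Obj D)"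
 defines "A == additive_completion D"
 shows "m < length xs ==> inc xs m : Hom A [xs ! m] xs" "m < length xs ==> prj xs m : Hom A xs [xs ! m]"
  "m < length xs ==> l < length xs ==> Cmp A [xs ! m] xs [xs ! l] (prj xs l) (inc xs m) = (if m = l then Idn A [xs ! m] else 0)"
  "(SUM m<length xs. Cmp A xs [xs ! m] xs (inc xs m) (prj xs m)) = Idn A xs"
proof -
 have x: "i < length xs ==> xs ! i : Obj D" for i using assms(1) by (auto simp: in_lists_conv_set)
 have I: "Cmp D (xs ! i) (xs ! i) (xs ! i) (Idn D (xs ! i)) (Idn D (xs ! i)) = Idn D (xs ! i)" if "i < length xs" for i
  using Cmp_Idn x[OF that] Idn_Hom by blast
 show "m < length xs ==> inc xs m : Hom A [xs ! m] xs" "m < length xs ==> prj xs m : Hom A xs [xs ! m]"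
  using x Idn_Hom by (auto simp: A_def additive_Hom inc_def prj_def)
 show "Cmp A [xs ! m] xs [xs ! l] (prj xs l) (inc xs m) = (if m = l then Idn A [xs ! m] else 0)" if "m < length xs" "l < length xs"
 proof (intro ext)
  fix i j
  have "(SUM k<length xs. Cmp D (xs ! m) (xs ! k) (xs ! l) (prj xs l 0 k) (inc xs m k 0)) =
   (SUM k<length xs. if k = m then (if m = l then Idn D (xs ! m) else 0) else 0)"
   by (intro sum.cong refl) (use I that in \<open>auto simp: inc_def prj_def\<close>)
  thus "Cmp A [xs ! m] xs [xs ! l] (prj xs l) (inc xs m) i j = (if m = l then Idn A [xs ! m] else 0) i j"
   using that by (auto simp: A_def additive_simps fun_simps)
 qed
 show "(SUM m<length xs. Cmp A xs [xs ! m] xs (inc xs m) (prj xs m)) = Idn A xs"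
 proof (intro ext)
  fix i j
  have "Cmp A xs [xs ! m] xs (inc xs m) (prj xs m) i j = (if m = i then (if i = j then Idn D (xs ! i) else 0) else 0)"
   if "m < length xs" "i < length xs" "j < length xs" for m
   using that I by (auto simp: A_def additive_simps inc_def prj_def)
  thus "(SUM m<length xs. Cmp A xs [xs ! m] xs (inc xs m) (prj xs m)) i j = Idn A xs i j"
   by (cases "i < length xs & j < length xs") (auto simp: fun_simps A_def additive_simps)
 qed
qed

lemma emb_Hom: "M : Hom (additive_completion D) [x] [y] \<longleftrightarrow> (EX v:Hom D x y. M = emb v)"
proof
 assume M: "M : Hom (additive_completion D) [x] [y]"
 have "M i j = emb (M 0 0) i j" for i j
  using M unfolding additive_Hom emb_def by (cases "i = 0 & j = 0") auto
 hence "M = emb (M 0 0)" by blast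
 moreover have "M 0 0 : Hom D x y" using M by (simp add: additive_Hom)
 ultimately show "EX v:Hom D x y. M = emb v" by blast
qed (auto simp: additive_Hom emb_def)

lemma emb_Cmp: "Cmp (additive_completion D) [x] [y] [z] (emb g) (emb f) = emb (Cmp D x y z g f)"
 by (auto simp: additive_simps emb_def fun_eq_iff)

lemma emb_Idn: "Idn (additive_completion D) [x] = emb (Idn D x)"
 by (auto simp: additive_simps emb_def fun_eq_iff)

lemma emb_Scl: "Scl (additive_completion D) c (emb v) = emb (Scl D c v)"
 by (auto simp: additive_simps emb_def fun_eq_iff)

lemma emb_TenM: "TenM (additive_completion D) [x] [x'] [y] [y'] (emb f) (emb g) = emb (TenM D x x' y y' f g)"
 by (auto simp: additive_simps emb_def fun_eq_iff)

lemma emb_TenO: "TenO (additive_completion D) [x] [y] = [TenO D x y]"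
 by (simp add: additive_simps)

text \<open>Extends an additive cyclic function on endomorphisms to matrices by summing along the
  diagonal. It is applied both to the trace \<open>tr\<close> and to the characters
  \<open>cx\<close>.\<close>

definition mtr :: "('o => 'h => 'c::comm_monoid_add) => 'o list => (nat => nat => 'h) => 'c" where
 "mtr t xs M = (SUM i<length xs. t (xs ! i) (M i i))"

lemma mtr_cyclic:
 assumes "!!x. t x 0 = 0" and "!!x f g. t x (f + g) = t x f + t x g"
  and "!!x y f g. x : Obj D ==> y : Obj D ==> f : Hom D x y ==> g : Hom D y x ==> t x (Cmp D x y x g f) = t y (Cmp D y x y f g)"
  and xs: "xs : lists (Obj D)" "ys : lists (Obj D)"
  and M: "M : Hom (additive_completion D) xs ys" "N : Hom (additive_completion D) ys xs"
 shows "mtr t xs (Cmp (additive_completion D) xs ys xs N M) = mtr t ys (Cmp (additive_completion D) ys xs ys M N)"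
proof -
 have s: "t x (SUM i:I. f i) = (SUM i:I. t x (f i))" for x I and f :: "nat => 'h"
  by (induction I rule: infinite_finite_induct) (simp_all add: assms(1,2))
 have "mtr t xs (Cmp (additive_completion D) xs ys xs N M) =
   (SUM i<length xs. SUM k<length ys. t (xs ! i) (Cmp D (xs ! i) (ys ! k) (xs ! i) (N i k) (M k i)))"
  by (simp add: mtr_def additive_simps s)
 also have "... = (SUM i<length xs. SUM k<length ys. t (ys ! k) (Cmp D (ys ! k) (xs ! i) (ys ! k) (M k i) (N i k)))"
  using xs M by (intro sum.cong refl assms(3)) (auto simp: in_lists_nth additive_Hom)
 also have "... = (SUM k<length ys. SUM i<length xs. t (ys ! k) (Cmp D (ys ! k) (xs ! i) (ys ! k) (M k i) (N i k)))"
  by (rule sum.swap)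
 also have "... = mtr t ys (Cmp (additive_completion D) ys xs ys M N)"
  by (simp add: mtr_def additive_simps s)
 finally show ?thesis .
qed

end

section \<open>Characters of A(z) on objects of the envelope\<close>

context degree_function
begin

abbreviation "AC == additive_completion TT"
abbreviation "TE == tensor_envelope C \<delta>"

sublocale AC: linear_tensor_category AC
 by (rule T0.linear_tensor_category_additive)

sublocale TE: linear_tensor_category TE
 unfolding tensor_envelope_def by (rule AC.linear_tensor_category_idempotent)

lemma TE_simps:
 "P : Obj TE \<longleftrightarrow> fst P : Obj AC & snd P : Hom AC (fst P) (fst P) & Cmp AC (fst P) (fst P) (fst P) (snd P) (snd P) = snd P"
 "f : Hom TE P Q \<longleftrightarrow> f : Hom AC (fst P) (fst Q) & Cmp AC (fst P) (fst P) (fst Q) f (snd P) = f &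
  Cmp AC (fst P) (fst Q) (fst Q) (snd Q) f = f"
 "Idn TE P = snd P" "Cmp TE P Q R = Cmp AC (fst P) (fst Q) (fst R)" "Scl TE = Scl AC"
 "TenO TE P Q = (TenO AC (fst P) (fst Q), TenM AC (fst P) (fst P) (fst Q) (fst Q) (snd P) (snd Q))"
 "TenM TE P P' Q Q' = TenM AC (fst P) (fst P') (fst Q) (fst Q')"
 by (simp_all add: tensor_envelope_def idempotent_completion_def split_beta)

lemmas TE_split_complement = AC.split_complement[folded tensor_envelope_def]

definition idem :: "'o => ('m set => 'k) => 'o list \<times> (nat => nat => 'm set => 'k)" where
 "idem x e = ([x], emb e)"

lemma br_idem: "br C \<delta> x = idem x (idT x)"
 unfolding br_def idem_def T0.emb_Idn ..

lemma br_arr_emb: "br_arr C f = emb (gr f)"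
 by (simp add: br_arr_def emb_def)

lemma idem_Obj [simp]: "idem x e : Obj TE \<longleftrightarrow> ob x & e : HT x x & ct x x x e e = e"
 by (auto simp: TE_simps idem_def T0.additive_simps T0.emb_Cmp T0.emb_Hom)

lemma idem_Hom: "M : Hom TE (idem x e) (idem y f) \<longleftrightarrow> (EX v:HT x y. ct x x y v e = v & ct x y y f v = v & M = emb v)"
 by (auto simp: TE_simps idem_def T0.emb_Hom T0.emb_Cmp)

lemma idem_Cmp: "Cmp TE (idem x e) (idem y f) (idem z g) (emb v) (emb u) = emb (ct x y z v u)"
 by (simp add: TE_simps idem_def T0.emb_Cmp)

lemma idem_Idn: "Idn TE (idem x e) = emb e"
 by (simp add: TE_simps idem_def)

lemma br_Obj [simp]: "ob x ==> br C \<delta> x : Obj TE"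
 by (simp add: br_idem T0_Cmp_Idn)

lemma br_Hom: "ob x ==> ob y ==> M : Hom TE (br C \<delta> x) (br C \<delta> y) \<longleftrightarrow> (EX v:HT x y. M = emb v)"
 using T0_Cmp_Idn[of x y] T0_Idn_Cmp[of x y] by (auto simp: br_idem idem_Hom)

lemma TenO_idem: "TenO TE (idem x e) (idem y f) = idem (pd x y) (tn x x y y e f)"
 by (simp add: TE_simps idem_def T0.emb_TenO T0.emb_TenM)

text \<open>The trace of the map sending u to h u M on the space of morphisms from \<open>x\<close>
  to \<open>z\<close> modulo \<open>Jid (size z)\<close>, in the basis of partial
  surjections.\<close>

definition cx :: "'o => 'm => 'o => ('m set => 'k) => 'k" where
 "cx z h x M = (SUM a:psurj x z. ct x z z (gr h) (ct x x z (basis a) M) a)"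

text \<open>The value at \<open>h\<close> of the character of A(z) on the morphisms from P to
  \<open>[z]\<close> modulo the ideal: the trace of \<open>h\<close> on the image of the idempotent
  \<open>snd P\<close>. It is zero off the group, in accordance with the convention for class
  functions.\<close>

definition ch :: "'o => 'm => 'o list \<times> (nat => nat => 'm set => 'k) => 'k" where
 "ch z h P = (if h : Aut z then T0.mtr (cx z h) (fst P) (snd P) else 0)"

text \<open>The ideal is stable under composition with \<open>M\<close>, so the coefficients of a
  composite at partial surjections depend only on those of \<open>u\<close>.\<close>

lemma coef_right:
 assumes "u : HT x z" "M : HT y x" "b : psurj y z" and o: "ob x" "ob y" "ob z"
 shows "ct y x z u M b = (SUM a:psurj x z. u a * ct y x z (basis a) M b)"
proof -
 let ?u = "SUM a:psurj x z. scl (u a) (basis a)"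
 have "ct y x z (u - ?u) M : Jid (size z) y z"
  using Jid_right[OF Hom_mod_Jid[OF assms(1) o(1,3)] assms(2)] o by simp
 hence "ct y x z u M b - ct y x z ?u M b = 0"
  using Jid_psurj[of "ct y x z (u - ?u) M" z y b] assms(3) o by (simp add: T0.Cmp_diff_left fun_simps)
 thus ?thesis by (simp add: T0.Cmp_sum_left ct_bilinear) (simp add: fun_simps Scl_T0_apply)
qed

lemma cx_add: "cx z h x (M + N) = cx z h x M + cx z h x N"
 and cx_zero [simp]: "cx z h x 0 = 0"
 by (simp_all add: cx_def T0.Cmp_add_right) (simp_all add: fun_simps sum.distrib)

lemma cx_sum: "cx z h x (SUM i:I. M i) = (SUM i:I. cx z h x (M i))"
 by (induction I rule: infinite_finite_induct) (simp_all add: cx_add)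

lemma cx_Scl: "cx z h x (scl c M) = c * cx z h x M"
 by (simp add: cx_def ct_bilinear Scl_T0_apply sum_distrib_left)

text \<open>The ordinary identity of the traces of AB and BA, for the maps that \<open>M\<close> and
  \<open>N\<close> induce between two quotients by the ideal. Both sides expand into one double sum
  over the two bases.\<close>

lemma cx_cyclic:
 assumes z: "ob z" and h: "h : Aut z" and o: "ob x" "ob y" and M: "M : HT x y" and N: "N : HT y x"
 shows "cx z h x (ct x y x N M) = cx z h y (ct y x y M N)"
proof -
 have hh: "gr h : HT z z" using Aut_arr(1-3)[OF h] by simp
 have B: "basis a : HT w z" "ct w z z (gr h) (basis a) : HT w z" if "a : psurj w z" "ob w" for a w
  using basis_Hom[OF psurj_sub[OF that(1)]] T0_Cmp_Hom[of w z z "basis a" "gr h"] hh z that by auto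
 let ?s = "%a b. ct y x z (basis a) N b * ct x y z (ct y z z (gr h) (basis b)) M a"
 have "ct x z z (gr h) (ct x x z (basis a) (ct x y x N M)) a = (SUM b:psurj y z. ?s a b)" if a: "a : psurj x z" for a
 proof -
  have aN: "ct y x z (basis a) N : HT y z" using T0_Cmp_Hom B N o z a by blast
  let ?u = "ct y x z (basis a) N"
  have "ct x z z (gr h) (ct x x z (basis a) (ct x y x N M)) = ct x y z (ct y z z (gr h) ?u) M"
   using ct_assoc[of x y x z M N "basis a"] ct_assoc[of x y z z M ?u "gr h"] aN B(1)[OF a o(1)] hh M N o z by simp
  moreover have "ct x z z (gr h) (ct x y z ?u M) a = (SUM b:psurj y z. ?u b * ct x z z (gr h) (ct x y z (basis b) M) a)"
  proof -
   let ?U = "SUM b:psurj y z. scl (?u b) (basis b)"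
   have "ct x z z (gr h) (ct x y z (?u - ?U) M) : Jid (size z) x z"
    using Jid_left[OF Jid_right[OF Hom_mod_Jid[OF aN o(2) z] M] hh] o z by simp
   hence "ct x z z (gr h) (ct x y z (?u - ?U) M) a = 0" using Jid_psurj a o z by blast
   hence "ct x z z (gr h) (ct x y z ?u M) a = ct x z z (gr h) (ct x y z ?U M) a"
    by (simp add: T0.Cmp_diff_left T0.Cmp_diff_right fun_simps)
   thus ?thesis
    by (simp add: T0.Cmp_sum_left T0.Cmp_sum_right ct_bilinear) (simp add: fun_simps Scl_T0_apply)
  qed
  moreover have "ct x z z (gr h) (ct x y z (basis b) M) = ct x y z (ct y z z (gr h) (basis b)) M" if "b : psurj y z" for b
   using ct_assoc[of x y z z M "basis b" "gr h"] B[OF that o(2)] hh M o z by simp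
  ultimately show ?thesis
   using ct_assoc[of x y z z M ?u "gr h"] aN hh M o z by simp
 qed
 hence 1: "cx z h x (ct x y x N M) = (SUM a:psurj x z. SUM b:psurj y z. ?s a b)" by (simp add: cx_def)
 have "ct y z z (gr h) (ct y y z (basis b) (ct y x y M N)) b = (SUM a:psurj x z. ?s a b)" if b: "b : psurj y z" for b
 proof -
  let ?v = "ct x y z (ct y z z (gr h) (basis b)) M"
  have v: "?v : HT x z" using T0_Cmp_Hom B[OF b o(2)] M o z by blast
  have "ct y z z (gr h) (ct y y z (basis b) (ct y x y M N)) = ct y y z (ct y z z (gr h) (basis b)) (ct y x y M N)"
   using ct_assoc[of y y z z "ct y x y M N" "basis b" "gr h"] T0_Cmp_Hom[of y x y N M] B(1)[OF b o(2)] hh M N o z by simp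
  also have "... = ct y x z ?v N"
   using ct_assoc[of y x y z N M "ct y z z (gr h) (basis b)"] B(2)[OF b o(2)] M N o z by simp
  finally show ?thesis using coef_right[OF v N b o z] by (simp add: mult.commute)
 qed
 thus ?thesis unfolding 1 by (subst sum.swap) (simp add: cx_def)
qed

lemma mtr_cx_cyclic:
 assumes "ob z" "h : Aut z" "P : Obj TE" "Q : Obj TE" "M : Hom TE P Q" "N : Hom TE Q P"
 shows "T0.mtr (cx z h) (fst P) (Cmp TE P Q P N M) = T0.mtr (cx z h) (fst Q) (Cmp TE Q P Q M N)"
 unfolding TE_simps(4)
 by (rule T0.mtr_cyclic) (use assms in \<open>simp_all add: cx_add cx_cyclic TE_simps T0.additive_simps\<close>)

text \<open>The identity of \<open>R\<close> is a sum of two idempotents factoring through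
  \<open>P\<close> and \<open>Q\<close>; cyclicity moves their traces to \<open>P\<close> and
  \<open>Q\<close>.\<close>

lemma ch_complement:
 assumes "ob z" "is_complement TE R P i Q j"
 shows "ch z h R = ch z h P + ch z h Q"
proof (cases "h : Aut z")
 case True
 show ?thesis using assms(2)
 proof (rule TE.complementE)
  fix p q assume A: "P : Obj TE" "Q : Obj TE" "R : Obj TE" "i : Hom TE P R" "j : Hom TE Q R" "p : Hom TE R P" "q : Hom TE R Q"
   "Cmp TE P R P p i = Idn TE P" "Cmp TE Q R Q q j = Idn TE Q" "Cmp TE R P R i p + Cmp TE R Q R j q = Idn TE R"
  have "ch z h R = T0.mtr (cx z h) (fst R) (Cmp TE R P R i p) + T0.mtr (cx z h) (fst R) (Cmp TE R Q R j q)"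
   using True A(10)[symmetric] by (simp add: ch_def TE_simps(3) T0.mtr_def fun_simps cx_add sum.distrib)
  also have "... = ch z h P + ch z h Q"
   using mtr_cx_cyclic[OF assms(1) True] A True by (simp add: ch_def TE_simps(3))
  finally show ?thesis .
 qed
qed (simp add: ch_def)

lemma ch_retract:
 assumes "ob z" "h : Aut z" "ob x" "P : Obj TE" "s : Hom TE P (br C \<delta> x)" "r : Hom TE (br C \<delta> x) P"
  "Cmp TE P (br C \<delta> x) P r s = Idn TE P" "Cmp TE (br C \<delta> x) P (br C \<delta> x) s r = emb e"
 shows "ch z h P = cx z h x e"
 using mtr_cx_cyclic[OF assms(1,2,4) br_Obj[OF assms(3)] assms(5,6)] assms
 by (simp add: ch_def TE_simps(3) T0.mtr_def br_idem idem_def) (simp add: emb_def)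

end

context nondegenerate_degree_function
begin

text \<open>A nonzero entry of \<open>M\<close> has a partner with nonzero trace in
  \<open>T0\<close>. Placed in a matrix and compressed by the idempotents of \<open>P\<close> and
  \<open>Q\<close>, this partner keeps its trace with \<open>M\<close>, because \<open>M\<close>
  absorbs both idempotents.\<close>

lemma TE_nondegenerate:
 assumes "P : Obj TE" "Q : Obj TE" and M: "M : Hom TE P Q" "M ~= 0"
 shows "EX N:Hom TE Q P. Cmp TE P Q P N M ~= 0 & Cmp TE Q P Q M N ~= 0"
proof -
 let ?xs = "fst P" and ?ys = "fst Q"
 let ?t = "T0.mtr tr"
 have cyc: "?t xs (Cmp AC xs ys xs N' M') = ?t ys (Cmp AC ys xs ys M' N')"
  if "xs : Obj AC" "ys : Obj AC" "M' : Hom AC xs ys" "N' : Hom AC ys xs" for xs ys M' N'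
  by (rule T0.mtr_cyclic) (use that in \<open>simp_all add: tr_add tr_cyclic T0.additive_simps\<close>)
 have P: "?xs : Obj AC" "?ys : Obj AC" "snd P : Hom AC ?xs ?xs" "snd Q : Hom AC ?ys ?ys"
  "Cmp AC ?xs ?xs ?xs (snd P) (snd P) = snd P" "Cmp AC ?ys ?ys ?ys (snd Q) (snd Q) = snd Q"
  "M : Hom AC ?xs ?ys" "Cmp AC ?xs ?xs ?ys M (snd P) = M" "Cmp AC ?xs ?ys ?ys (snd Q) M = M"
  using assms by (simp_all add: TE_simps)
 have xy: "i < length ?xs ==> ?xs ! i : obj C" "i < length ?ys ==> ?ys ! i : obj C" for i
  using P(1,2) by (auto simp: T0.additive_simps in_lists_conv_set)
 obtain i j where "M i j ~= 0" using M(2) by (auto simp: fun_eq_iff fun_simps)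
 hence ij: "i < length ?ys" "j < length ?xs" "M i j : HT (?xs ! j) (?ys ! i)" "M i j ~= 0"
  using P(7) by (auto simp: T0.additive_Hom)
 then obtain w where w: "w : HT (?ys ! i) (?xs ! j)" "tr (?xs ! j) (ct (?xs ! j) (?ys ! i) (?xs ! j) w (M i j)) ~= 0"
  using tr_nondegenerate[OF xy(1) xy(2)] by blast
 define W where "W = (%k l. if k = j & l = i then w else 0)"
 have W: "W : Hom AC ?ys ?xs" using w ij by (auto simp: T0.additive_Hom W_def)
 have 1: "?t ?xs (Cmp AC ?xs ?ys ?xs W M) ~= 0"
 proof -
  have "Cmp AC ?xs ?ys ?xs W M k k = (if k = j then ct (?xs ! j) (?ys ! i) (?xs ! j) w (M i j) else 0)" if "k < length ?xs" for k
  proof -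
   have "(SUM l<length ?ys. ct (?xs ! k) (?ys ! l) (?xs ! k) (W k l) (M l k)) =
     (SUM l<length ?ys. if l = i then if k = j then ct (?xs ! j) (?ys ! i) (?xs ! j) w (M i j) else 0 else 0)"
    by (intro sum.cong refl) (simp add: W_def)
   thus ?thesis using that ij by (simp add: T0.additive_simps)
  qed
  hence "?t ?xs (Cmp AC ?xs ?ys ?xs W M) = (SUM k<length ?xs. if k = j then tr (?xs ! j) (ct (?xs ! j) (?ys ! i) (?xs ! j) w (M i j)) else 0)"
   unfolding T0.mtr_def by (intro sum.cong) auto
  thus ?thesis using w ij by simp
 qed
 note cH = AC.Cmp_Hom and ca = AC.Cmp_assoc
 \<comment> \<open>The compression that turns the elementary matrix \<open>W\<close> into a morphism
   of the idempotent completion.\<close>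
 define N where "N = Cmp AC ?ys ?xs ?xs (snd P) (Cmp AC ?ys ?ys ?xs W (snd Q))"
 have Wq: "Cmp AC ?ys ?ys ?xs W (snd Q) : Hom AC ?ys ?xs" using cH P W by blast
 have N: "N : Hom AC ?ys ?xs" unfolding N_def using cH P Wq by blast
 have NT: "N : Hom TE Q P"
  using N ca[OF P(2) P(1) P(1) P(1) Wq P(3) P(3)] ca[OF P(2) P(2) P(1) P(1) P(4) Wq P(3)]
   ca[OF P(2) P(2) P(2) P(1) P(4) P(4) W] P(5,6) by (simp add: TE_simps N_def)
 have "Cmp AC ?xs ?ys ?xs N M = Cmp AC ?xs ?xs ?xs (snd P) (Cmp AC ?xs ?ys ?xs W M)"
  using ca[OF P(1) P(2) P(1) P(1) P(7) Wq P(3)] ca[OF P(1) P(2) P(2) P(1) P(7) P(4) W] P(9) by (simp add: N_def)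
 hence "?t ?xs (Cmp AC ?xs ?ys ?xs N M) = ?t ?xs (Cmp AC ?xs ?xs ?xs (Cmp AC ?xs ?ys ?xs W M) (snd P))"
  using cyc[OF P(1) P(1) cH[OF P(1) P(2) P(1) P(7) W] P(3)] by simp
 also have "... = ?t ?xs (Cmp AC ?xs ?ys ?xs W M)"
  using ca[OF P(1) P(1) P(2) P(1) P(3) P(7) W] P(8) by simp
 finally have "?t ?xs (Cmp AC ?xs ?ys ?xs N M) ~= 0" using 1 by simp
 moreover have "?t ?xs (Cmp AC ?xs ?ys ?xs N M) = ?t ?ys (Cmp AC ?ys ?xs ?ys M N)" by (rule cyc[OF P(1,2,7) N])
 moreover have "?t zs 0 = 0" for zs by (simp add: T0.mtr_def fun_simps)
 ultimately have "Cmp AC ?xs ?ys ?xs N M ~= 0" "Cmp AC ?ys ?xs ?ys M N ~= 0" by metis+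
 thus ?thesis using NT by (auto simp: TE_simps)
qed

end

context linear_tensor_category
begin

text \<open>The maps are assembled into one row and one column; orthogonality of the biproduct
  removes the mixed terms.\<close>

lemma biproduct_retract:
 assumes B: "is_biproduct D W I Xs iota \<pi>" and Y: "Y : Obj D"
  and k: "!!i. i : I ==> k i : Hom D Y (Xs i)" and r: "!!i. i : I ==> r i : Hom D (Xs i) Y"
  and sum: "(SUM i:I. Cmp D Y (Xs i) Y (r i) (k i)) = Idn D Y"
 shows "EX k':Hom D Y W. EX r':Hom D W Y. Cmp D Y W Y r' k' = Idn D Y"
proof (intro bexI)
 have B: "W : Obj D" "!!i. i : I ==> Xs i : Obj D" "!!i. i : I ==> iota i : Hom D (Xs i) W"
  "!!i. i : I ==> \<pi> i : Hom D W (Xs i)" "finite I"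
  "!!i j. i : I ==> j : I ==> Cmp D (Xs i) W (Xs j) (\<pi> j) (iota i) = (if i = j then Idn D (Xs i) else 0)"
  using B by (auto simp: is_biproduct_def)
 let ?k = "SUM i:I. Cmp D Y (Xs i) W (iota i) (k i)" and ?r = "SUM i:I. Cmp D W (Xs i) Y (r i) (\<pi> i)"
 show kh: "?k : Hom D Y W" and rh: "?r : Hom D W Y"
  using B Y k r by (auto intro!: Hom_sum Cmp_Hom)
 have "Cmp D Y W Y (Cmp D W (Xs i) Y (r i) (\<pi> i)) ?k = Cmp D Y (Xs i) Y (r i) (k i)" if i: "i : I" for i
 proof -
  have "Cmp D Y W (Xs i) (\<pi> i) (Cmp D Y (Xs j) W (iota j) (k j)) = (if j = i then k i else 0)" if j: "j : I" for j
   using Cmp_assoc[OF Y B(2)[OF j] B(1) B(2)[OF i] k[OF j] B(3)[OF j] B(4)[OF i]] B(6)[OF j i] Idn_Cmp[OF Y B(2)[OF j] k[OF j]] by auto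
  hence "Cmp D Y W (Xs i) (\<pi> i) ?k = (SUM j:I. if j = i then k i else 0)"
   unfolding Cmp_sum_right by (intro sum.cong) auto
  hence "Cmp D Y W (Xs i) (\<pi> i) ?k = k i" using B(5) i by simp
  thus ?thesis using Cmp_assoc[OF Y B(1) B(2)[OF i] Y kh B(4)[OF i] r[OF i]] by simp
 qed
 thus "Cmp D Y W Y ?r ?k = Idn D Y" using sum by (simp add: Cmp_sum_left)
qed

end

section \<open>The direct summands \<open>[x]\<^sup>1\<close> and \<open>[x]\<^sup>0\<close>\<close>

locale envelope = represented_nondegenerate_degree_function C \<delta> X
 for C :: "('o, 'm) cat" (structure) and \<delta> :: "'m => 'k::{alg_closed_field, field_char_0}" and X
begin

abbreviation ce :: "'o => 'm set => 'k" where
 "ce x == cid (size x) x"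

lemma ce_facts:
 assumes "ob x"
 shows "ce x : HT x x" "ct x x x (ce x) (ce x) = ce x" "ct x x x (eps x) (ce x) = 0" "ct x x x (ce x) (eps x) = 0" "ce x + eps x = idT x"
  "ct x x x (eps x) (eps x) = eps x" "eps x : HT x x"
  "ob y ==> size y < size x ==> f : HT y x ==> ct y x x (ce x) f = f"
proof -
 note c = isC_D[OF cid(1)[OF assms, of "size x"]]
 show "ce x : HT x x" using Jid_Hom[OF c(1)] assms by blast
 show "ct x x x (ce x) (ce x) = ce x" "ct x x x (eps x) (ce x) = 0" "ct x x x (ce x) (eps x) = 0"
  using c eps(2,3)[OF assms, of x "ce x"] assms by auto
 show "ce x + eps x = idT x" by (simp add: eps_def)
 show "ct x x x (eps x) (eps x) = eps x" "eps x : HT x x" using eps(1,4)[OF assms assms] by (simp_all only:)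
 show "ct y x x (ce x) f = f" if "ob y" "size y < size x" "f : HT y x"
  using c(3)[of y f] Jid_src[OF that(3,2,1)] that assms by blast
qed

lemma ce_central: "ob x ==> f : HT x x ==> ct x x x f (ce x) = ct x x x (ce x) f"
 using isC_central[OF cid(1) cid(1)] by blast

lemma Ssp_list:
 assumes "v : Ssp n x"
 shows "EX L. (ALL (z, f, g):set L. z : X & size z < n & subquotient C z x & f : HT x z & g : HT z x) &
  v = (SUM (z, f, g)<-L. ct x z x g (ct x z z (eps z) f))"
 using assms unfolding Ssp_def
proof (induction rule: T0.span_induct_alt)
 case base
 show ?case by (intro exI[of _ "[]"]) simp
next
 case (step c a v)
 obtain z d f g where a: "a = ct x z x g (ct x z z (idT z - d) f)" "z : X" "size z < n" "subquotient C z x"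
  "isC (size z) z d" "f : HT x z" "g : HT z x" using step(1) by blast
 have "d = ce z" using isC_unique[OF a(5) cid(1)] a(2) by simp
 hence "scl c a = ct x z x (scl c g) (ct x z z (eps z) f)"
  using a(1) by (simp add: eps_def ct_bilinear)
 moreover have "ob x" using a(4) by (auto simp: subquotient_def)
 hence "scl c g : HT z x" using T0.Hom_Scl[of z x g c] a by simp
 moreover obtain L where "ALL (z, f, g):set L. z : X & size z < n & subquotient C z x & f : HT x z & g : HT z x"
  "v = (SUM (z, f, g)<-L. ct x z x g (ct x z z (eps z) f))" using step(2) by blast
 ultimately show ?case using a by (intro exI[of _ "(z, f, scl c g) # L"]) auto
qed

lemma idem_eps_Obj: "ob x ==> idem x (eps x) : Obj TE" "ob x ==> idem x (ce x) : Obj TE"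
 using ce_facts by auto

lemma complement_eps:
 assumes x: "ob x"
 shows "is_complement TE (br C \<delta> x) (idem x (ce x)) (emb (ce x)) (idem x (eps x)) (emb (eps x))"
 unfolding br_idem
 by (rule TE.complementI[where p = "emb (ce x)" and q = "emb (eps x)"])
  (use ce_facts(1-7)[OF x] x T0_Cmp_Idn[of x x] T0_Idn_Cmp[of x x] in
   \<open>auto simp: idem_Hom idem_Cmp idem_Idn emb_add[symmetric]\<close>)

lemma proper_obj: "proper_subquotient C z x ==> ob z"
 by (auto simp: proper_subquotient_def subquotient_def)

lemma list_biproduct:
 assumes "set zs \<subseteq> obj C"
 shows "is_biproduct TE (zs, Idn AC zs) {..<length zs} (%n. br C \<delta> (zs ! n)) (T0.inc zs) (T0.prj zs)"
proof -
 have z: "zs : lists (Obj TT)" "zs : Obj AC" using assms by (auto simp: T0.additive_simps)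
 have zn: "zs ! n : obj C" if "n < length zs" for n using assms that by auto
 note ip = T0.inc_prj[OF z(1)]
 have b: "[zs ! n] : Obj AC" if "n < length zs" for n using zn[OF that] by (simp add: T0.additive_simps)
 show ?thesis
  unfolding is_biproduct_def
  using ip z b AC.Idn_Hom[OF z(2)] AC.Cmp_Idn AC.Idn_Cmp zn
  by (auto simp: TE_simps br_def AC.Idn_Hom)
qed

text \<open>\<open>ce x\<close> is the identity of the ideal of morphisms through objects smaller
  than \<open>x\<close>. Its expansion in \<open>Ssp\<close> runs through proper subquotients, which
  makes its image a retract of their sum; and every morphism from a proper subquotient lies in the
  ideal, so \<open>ce x\<close> fixes it.\<close>

lemma top1_ce:
 assumes x: "ob x"
 shows "is_top1 C \<delta> x (idem x (ce x)) (emb (ce x))"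
 unfolding is_top1_def
proof (intro conjI allI impI)
 show "is_summand TE (br C \<delta> x) (idem x (ce x)) (emb (ce x))"
  unfolding is_summand_def using complement_eps[OF x] by blast
 obtain L where L: "ALL (z, f, g):set L. z : X & size z < size x & subquotient C z x & f : HT x z & g : HT z x"
  "ce x = (SUM (z, f, g)<-L. ct x z x g (ct x z z (eps z) f))"
  using Ssp_list[OF cid(2)[OF x]] by blast
 define z f g where "z i = fst (L ! i)" and "f i = fst (snd (L ! i))" and "g i = snd (snd (L ! i))" for i
 have zfg: "z i : X" "z i : obj C" "size (z i) < size x" "subquotient C (z i) x" "f i : HT x (z i)" "g i : HT (z i) x" if "i < length L" for i
  using L(1) nth_mem[OF that] X_obj by (auto simp: z_def f_def g_def split_beta)
 let ?zs = "map z [0..<length L]"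
 have ps: "ALL w:set ?zs. proper_subquotient C w x" using zfg by (auto simp: proper_subquotient_iff)
 have "set ?zs \<subseteq> obj C" using zfg by auto
 note B = list_biproduct[OF this]
 have sum: "ce x = (SUM i<length L. ct x (z i) x (g i) (ct x (z i) (z i) (eps (z i)) (f i)))"
  unfolding L(2) sum_list_sum_nth by (simp add: z_def f_def g_def split_beta atLeast0LessThan)
 \<comment> \<open>Both factors are compressed by \<open>ce x\<close>, which makes them morphisms
   from and to the object cut out by \<open>ce x\<close>; the sum of their composites is
   \<open>ce x\<close> cubed, i.e. \<open>ce x\<close>.\<close>
 let ?k = "%i. ct x (z i) (z i) (eps (z i)) (ct x x (z i) (f i) (ce x))" and ?r = "%i. ct (z i) x x (ce x) (g i)"
 note c = ce_facts[OF x]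
 have k: "?k i : HT x (z i)" "ct x x (z i) (?k i) (ce x) = ?k i" "?r i : HT (z i) x" "ct (z i) x x (ce x) (?r i) = ?r i"
  if "i < length L" for i
 proof -
  note z = zfg[OF that] and e = eps(1)[OF zfg(2)[OF that]]
  have fc: "ct x x (z i) (f i) (ce x) : HT x (z i)" using T0_Cmp_Hom z x c(1) by blast
  show "?k i : HT x (z i)" using T0_Cmp_Hom fc e z x by blast
  show "?r i : HT (z i) x" using T0_Cmp_Hom z x c(1) by blast
  show "ct x x (z i) (?k i) (ce x) = ?k i"
   using ct_assoc[of x x "z i" "z i" "ce x" "ct x x (z i) (f i) (ce x)" "eps (z i)"]
    ct_assoc[of x x x "z i" "ce x" "ce x" "f i"] fc e z x c by simp
  show "ct (z i) x x (ce x) (?r i) = ?r i"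
   using ct_assoc[of "z i" x x x "g i" "ce x" "ce x"] z x c by simp
 qed
 have "(SUM i<length L. ct x (z i) x (?r i) (?k i)) = ct x x x (ce x) (ct x x x (ce x) (ce x))"
 proof -
  have "ct x (z i) x (?r i) (?k i) = ct x x x (ce x) (ct x x x (ct x (z i) x (g i) (ct x (z i) (z i) (eps (z i)) (f i))) (ce x))"
   if "i < length L" for i
  proof -
   note z = zfg[OF that] and e = eps(1)[OF zfg(2)[OF that]]
   have ef: "ct x (z i) (z i) (eps (z i)) (f i) : HT x (z i)" using T0_Cmp_Hom z x e by blast
   show ?thesis
    using ct_assoc[of x "z i" x x "?k i" "g i" "ce x"] ct_assoc[of x x "z i" x "ce x" "ct x (z i) (z i) (eps (z i)) (f i)" "g i"]
     ct_assoc[of x x "z i" "z i" "ce x" "f i" "eps (z i)"] k(1)[OF that] z x c ef e by simp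
  qed
  hence "(SUM i<length L. ct x (z i) x (?r i) (?k i)) =
    ct x x x (ce x) (ct x x x (SUM i<length L. ct x (z i) x (g i) (ct x (z i) (z i) (eps (z i)) (f i))) (ce x))"
   by (simp add: T0.Cmp_sum_right T0.Cmp_sum_left)
  thus ?thesis unfolding sum[symmetric] .
 qed
 hence kr: "(SUM i<length L. Cmp TE (idem x (ce x)) (br C \<delta> (?zs ! i)) (idem x (ce x)) (emb (?r i)) (emb (?k i))) = Idn TE (idem x (ce x))"
  using c by (simp add: br_idem idem_Cmp idem_Idn emb_sum[symmetric])
 have "EX k':Hom TE (idem x (ce x)) (?zs, Idn AC ?zs). EX r':Hom TE (?zs, Idn AC ?zs) (idem x (ce x)).
   Cmp TE (idem x (ce x)) (?zs, Idn AC ?zs) (idem x (ce x)) r' k' = Idn TE (idem x (ce x))"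
  by (rule TE.biproduct_retract[OF B idem_eps_Obj(2)[OF x], of "%i. emb (?k i)" "%i. emb (?r i)"])
   (use kr k zfg x T0_Idn_Cmp[of x] T0_Cmp_Idn[of _ x] in \<open>auto simp: br_idem idem_Hom\<close>)
 then obtain k' r' where kr': "k' : Hom TE (idem x (ce x)) (?zs, Idn AC ?zs)" "r' : Hom TE (?zs, Idn AC ?zs) (idem x (ce x))"
  "Cmp TE (idem x (ce x)) (?zs, Idn AC ?zs) (idem x (ce x)) r' k' = Idn TE (idem x (ce x))" by blast
 have W: "(?zs, Idn AC ?zs) : Obj TE" using B by (simp add: is_biproduct_def)
 have "is_summand TE (?zs, Idn AC ?zs) (idem x (ce x)) k'"
  unfolding is_summand_def using TE_split_complement[OF idem_eps_Obj(2)[OF x] W kr'] by blast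
 thus "EX zs W iota \<pi> k. (ALL z:set zs. proper_subquotient C z x) &
   is_biproduct TE W {..<length zs} (%n. br C \<delta> (zs ! n)) iota \<pi> & is_summand TE W (idem x (ce x)) k"
  using ps B by blast
next
 fix z f assume zf: "proper_subquotient C z x & f : Hom TE (br C \<delta> z) (br C \<delta> x)"
 hence z: "ob z" "size z < size x" using proper_obj proper_subquotient_iff by blast+
 obtain v where v: "v : HT z x" "f = emb v" using zf br_Hom[OF z(1) x] by blast
 have "ct z x x (ce x) v = v" using ce_facts(8)[OF x z v(1)] .
 thus "EX u:Hom TE (br C \<delta> z) (idem x (ce x)). f = Cmp TE (br C \<delta> z) (idem x (ce x)) (br C \<delta> x) (emb (ce x)) u"
  using v z T0_Cmp_Idn[of z x v] x by (intro bexI[of _ f]) (auto simp: br_idem idem_Cmp idem_Hom)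
qed

lemma top0_eps: "ob x ==> is_top0 C \<delta> x (idem x (eps x)) (emb (eps x))"
 unfolding is_top0_def using top1_ce complement_eps by blast

text \<open>Whatever summand and complement are chosen, the idempotent of the complement is
  \<open>eps x\<close>. The idempotent \<open>e\<close> of the summand and \<open>ce x\<close>
  absorb each other, one from each defining property, and centrality of \<open>ce x\<close> makes
  them equal.\<close>

lemma top0_D:
 assumes x: "ob x" and top: "is_top0 C \<delta> x Z j"
 obtains q where "Z : Obj TE" "j : Hom TE Z (br C \<delta> x)" "q : Hom TE (br C \<delta> x) Z"
  "Cmp TE Z (br C \<delta> x) Z q j = Idn TE Z" "Cmp TE (br C \<delta> x) Z (br C \<delta> x) j q = emb (eps x)"
proof -
 let ?b = "br C \<delta> x"
 obtain Y i where top1: "is_top1 C \<delta> x Y i" and comp: "is_complement TE ?b Y i Z j"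
  using top by (auto simp: is_top0_def)
 note c = ce_facts[OF x]
 have b: "?b : Obj TE" using x by simp
 show thesis using comp
 proof (rule TE.complementE)
  fix p q assume A: "Y : Obj TE" "Z : Obj TE" "?b : Obj TE" "i : Hom TE Y ?b" "j : Hom TE Z ?b" "p : Hom TE ?b Y" "q : Hom TE ?b Z"
   "Cmp TE Y ?b Y p i = Idn TE Y" "Cmp TE Z ?b Z q j = Idn TE Z" "Cmp TE ?b Y ?b i p + Cmp TE ?b Z ?b j q = Idn TE ?b"
  have "Cmp TE ?b Y ?b i p : Hom TE ?b ?b" using TE.Cmp_Hom A by blast
  then obtain e where e: "e : HT x x" "Cmp TE ?b Y ?b i p = emb e" using br_Hom[OF x x] by blast
  \<comment> \<open>A morphism from a proper subquotient factors through the inclusion of the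
    summand, so \<open>e\<close> fixes it.\<close>
  have fac: "ct z x x e v = v" if z: "ob z" "subquotient C z x" "size z < size x" and v: "v : HT z x" for z v
  proof -
   have vH: "emb v : Hom TE (br C \<delta> z) ?b" using br_Hom[OF z(1) x] v by blast
   then obtain u where u: "u : Hom TE (br C \<delta> z) Y" "emb v = Cmp TE (br C \<delta> z) Y ?b i u"
    using top1 z unfolding is_top1_def proper_subquotient_iff by blast
   have "Cmp TE (br C \<delta> z) ?b Y p (emb v) = u"
    unfolding u(2) using TE.Cmp_assoc[of "br C \<delta> z" Y ?b Y u i p] TE.Idn_Cmp[of "br C \<delta> z" Y u] A u z x by simp
   hence "Cmp TE (br C \<delta> z) ?b ?b (emb e) (emb v) = emb v"
    using TE.Cmp_assoc[of "br C \<delta> z" ?b Y ?b "emb v" p i] A(1,4,6) b vH e(2) u(2) z(1) by simp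
   thus ?thesis by (simp add: br_idem idem_Cmp)
  qed
  \<comment> \<open>The expansion of \<open>ce x\<close> consists of morphisms that end with a
    morphism from a proper subquotient; each of them is fixed by \<open>e\<close>.\<close>
  have ec: "ct x x x e (ce x) = ce x"
  proof -
   obtain L where L: "ALL (z, f, g):set L. z : X & size z < size x & subquotient C z x & f : HT x z & g : HT z x"
    "ce x = (SUM (z, f, g)<-L. ct x z x g (ct x z z (eps z) f))"
    using Ssp_list[OF cid(2)[OF x]] by blast
   have "ct x x x e (SUM (z, f, g)<-L. ct x z x g (ct x z z (eps z) f)) = (SUM (z, f, g)<-L. ct x z x g (ct x z z (eps z) f))"
    using L(1)
   proof (induction L)
    case (Cons a L)
    obtain z f g where a: "a = (z, f, g)" by (cases a)
    have z: "ob z" "size z < size x" "subquotient C z x" "f : HT x z" "g : HT z x" using Cons a by auto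
    have ef: "ct x z z (eps z) f : HT x z" using T0_Cmp_Hom eps(1) z x by blast
    show ?case
     using Cons fac[OF z(1,3,2,5)] ct_assoc[of x z x x "ct x z z (eps z) f" g e] ef e z x by (simp add: a T0.Cmp_add_right)
   qed simp
   thus ?thesis using L(2) by simp
  qed
  \<comment> \<open>The summand is a retract of a sum of proper subquotients. Hence \<open>e\<close>
    factors through that sum, and each component out of it is fixed by \<open>ce x\<close>.\<close>
  have ce: "ct x x x (ce x) e = e"
  proof -
   obtain zs W iota \<pi> k where W: "ALL z:set zs. proper_subquotient C z x" "is_biproduct TE W {..<length zs} (%n. br C \<delta> (zs ! n)) iota \<pi>"
    "is_summand TE W Y k" using top1 by (auto simp: is_top1_def)
   have zs: "zs ! m : obj C" "size (zs ! m) < size x" if "m < length zs" for m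
    using W(1) nth_mem[OF that] proper_obj proper_subquotient_iff by blast+
   obtain Y' j' where "is_complement TE W Y k Y' j'" using W(3) by (auto simp: is_summand_def)
   then obtain r where kr: "W : Obj TE" "k : Hom TE Y W" "r : Hom TE W Y" "Cmp TE Y W Y r k = Idn TE Y"
    by (rule TE.complementE) blast
   have BW: "iota m : Hom TE (br C \<delta> (zs ! m)) W" "\<pi> m : Hom TE W (br C \<delta> (zs ! m))" if "m < length zs" for m
    using W(2) that by (auto simp: is_biproduct_def)
   define s where "s = Cmp TE ?b W ?b (Cmp TE W Y ?b i r) (Cmp TE ?b Y W k p)"
   have ir: "Cmp TE W Y ?b i r : Hom TE W ?b" "Cmp TE ?b Y W k p : Hom TE ?b W" using TE.Cmp_Hom A kr by blast+
   have s: "s = emb e"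
   proof -
    have "s = Cmp TE ?b Y ?b i (Cmp TE ?b W Y r (Cmp TE ?b Y W k p))"
     unfolding s_def using TE.Cmp_assoc[of ?b W Y ?b "Cmp TE ?b Y W k p" r i] A kr ir by simp
    also have "Cmp TE ?b W Y r (Cmp TE ?b Y W k p) = p"
     using TE.Cmp_assoc[of ?b Y W Y p k r] A kr TE.Idn_Cmp[of ?b Y p] by simp
    finally show ?thesis using e by simp
   qed
   have ceH: "emb (ce x) : Hom TE ?b ?b" using br_Hom[OF x x] c(1) by blast
   have m: "Cmp TE W ?b ?b (emb (ce x)) (Cmp TE W (br C \<delta> (zs ! m)) ?b (Cmp TE (br C \<delta> (zs ! m)) W ?b (Cmp TE W Y ?b i r) (iota m)) (\<pi> m)) =
     Cmp TE W (br C \<delta> (zs ! m)) ?b (Cmp TE (br C \<delta> (zs ! m)) W ?b (Cmp TE W Y ?b i r) (iota m)) (\<pi> m)" if mm: "m < length zs" for m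
   proof -
    let ?z = "br C \<delta> (zs ! m)"
    have z: "?z : Obj TE" using zs[OF mm] by simp
    have "Cmp TE ?z W ?b (Cmp TE W Y ?b i r) (iota m) : Hom TE ?z ?b" using TE.Cmp_Hom ir kr BW[OF mm] z b by blast
    then obtain v where v: "v : HT (zs ! m) x" "Cmp TE ?z W ?b (Cmp TE W Y ?b i r) (iota m) = emb v" "emb v : Hom TE ?z ?b"
     using br_Hom[OF zs(1)[OF mm] x] by metis
    have "Cmp TE ?z ?b ?b (emb (ce x)) (emb v) = emb v"
     using c(8)[OF zs[OF mm] v(1)] by (simp add: br_idem idem_Cmp)
    thus ?thesis
     unfolding v(2) using TE.Cmp_assoc[of W ?z ?b ?b "\<pi> m" "emb v" "emb (ce x)"] kr z b BW[OF mm] v(3) ceH by simp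
   qed
   have "Cmp TE W Y ?b i r = Cmp TE W W ?b (Cmp TE W Y ?b i r) (SUM m<length zs. Cmp TE W (br C \<delta> (zs ! m)) W (iota m) (\<pi> m))"
    using W(2) TE.Cmp_Idn[OF kr(1) b ir(1)] by (simp add: is_biproduct_def)
   also have "... = (SUM m<length zs. Cmp TE W (br C \<delta> (zs ! m)) ?b (Cmp TE (br C \<delta> (zs ! m)) W ?b (Cmp TE W Y ?b i r) (iota m)) (\<pi> m))"
    unfolding TE.Cmp_sum_right using TE.Cmp_assoc[OF kr(1) _ kr(1) b BW(2) BW(1) ir(1)] zs by (intro sum.cong) auto
   finally have S: "Cmp TE W Y ?b i r = ..." .
   have "Cmp TE W ?b ?b (emb (ce x)) v = v"
    if "v = (SUM m<length zs. Cmp TE W (br C \<delta> (zs ! m)) ?b (Cmp TE (br C \<delta> (zs ! m)) W ?b (Cmp TE W Y ?b i r) (iota m)) (\<pi> m))" for v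
    unfolding that TE.Cmp_sum_right by (intro sum.cong refl m) simp
   note this[OF S]
   hence "Cmp TE ?b ?b ?b (emb (ce x)) s = s"
    unfolding s_def using TE.Cmp_assoc[OF b kr(1) b b ir(2,1) ceH] by simp
   thus ?thesis unfolding s by (simp add: br_idem idem_Cmp)
  qed
  have "e = ce x" using ec ce ce_central[OF x e(1)] by simp
  hence "emb (ce x) + Cmp TE ?b Z ?b j q = emb (ce x + eps x)"
   using A(10) e(2) by (simp only: c(5) br_idem idem_Idn)
  hence "Cmp TE ?b Z ?b j q = emb (eps x)" by (simp add: emb_add)
  thus thesis using that A by blast
 qed
qed

end

section \<open>Matrix units of the group algebra\<close>

context envelope
begin

abbreviation IC :: "'o => ('m => 'k) set" where
 "IC x == irr_chars (AG x)"

abbreviation oA :: "'o => 'k" where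
 "oA x == of_nat (order (AG x))"

abbreviation invA :: "'o => 'm => 'm" where
 "invA x t == inv\<^bsub>AG x\<^esub> t"

lemma aut_chars: "ob x ==> finite_group_chars (AG x)"
 unfolding finite_group_chars_def finite_group_def finite_group_axioms_def
 using group_aut_group by simp

text \<open>The image of the group element \<open>t\<close> in the endomorphism algebra of
  \<open>[x]\<^sup>0\<close>.\<close>

definition geps :: "'o => 'm => 'm set => 'k" where
 "geps x t = ct x x x (gr t) (eps x)"

lemma geps_facts:
 assumes "ob x" "t : Aut x"
 shows "geps x t : HT x x" "s : Aut x ==> ct x x x (gr s) (geps x t) = geps x (s ** t)"
  "ct x x x (geps x t) (eps x) = geps x t" "ct x x x (eps x) (geps x t) = geps x t"
  "g : Aut x ==> geps x t (graph C g) = (if g = t then 1 else 0)"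
proof -
 note e = ce_facts(6,7)[OF assms(1)] and t = Aut_arr(1-3)[OF assms(2)]
 have gt: "gr t : HT x x" using t by simp
 show "geps x t : HT x x" unfolding geps_def using T0_Cmp_Hom gt e assms by blast
 show "ct x x x (gr s) (geps x t) = geps x (s ** t)" if "s : Aut x"
  unfolding geps_def using ct_assoc[of x x x x "eps x" "gr t" "gr s"] ct_gr[of t s x x x] Aut_arr(1-3)[OF that] gt e t assms by simp
 show 1: "ct x x x (geps x t) (eps x) = geps x t"
  unfolding geps_def using ct_assoc[of x x x x "eps x" "eps x" "gr t"] gt e assms by simp
 have c: "ct x x x (gr t) (eps x) = ct x x x (eps x) (gr t)" using eps(8)[OF assms(1) assms(1) gt] .
 show "ct x x x (eps x) (geps x t) = geps x t"
  unfolding geps_def c using ct_assoc[of x x x x "gr t" "eps x" "eps x"] gt e assms by simp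
 show "geps x t (graph C g) = (if g = t then 1 else 0)" if "g : Aut x"
 proof -
  have "gr t - geps x t : Jid (size x) x x" using eps(7)[OF assms(1) assms(1) assms(1) gt] by (simp add: geps_def)
  hence "(gr t - geps x t) (graph C g) = 0" using Jid_psurj graph_psurj[OF that] assms by blast
  thus ?thesis using graph_inj[OF that assms(2)] by (auto simp: fun_simps basis_def split: if_splits)
 qed
qed

text \<open>Modulo the ideal only graphs of automorphisms remain among the endomorphisms of
  \<open>x\<close>, so the elements \<open>geps x t\<close> span the endomorphisms of
  \<open>[x]\<^sup>0\<close>.\<close>

lemma comp_eps:
 assumes "ob x" "w : HT x x"
 shows "ct x x x w (eps x) = (SUM t:Aut x. scl (w (graph C t)) (geps x t))"
proof -
 have "ct x x x (w - (SUM r:psurj x x. scl (w r) (basis r))) (eps x) = 0"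
  using eps(3)[OF assms(1) assms(1) assms(1) Hom_mod_Jid[OF assms(2,1,1)]] .
 hence "ct x x x w (eps x) = (SUM r:psurj x x. scl (w r) (ct x x x (basis r) (eps x)))"
  by (simp add: T0.Cmp_diff_left T0.Cmp_sum_left ct_bilinear)
 also have "... = (SUM t:Aut x. scl (w (graph C t)) (geps x t))"
  unfolding geps_def by (rule sum.reindex_bij_betw[OF bij_graph[OF assms(1)], symmetric])
 finally show ?thesis .
qed

text \<open>The matrix unit with entry 1 at (a, b) in the block of \<open>rho\<close>, by Fourier
  inversion in the group algebra; hence the inverse group element, the transposed indices and the
  factor n / |A(x)|.\<close>

definition munit :: "'o => nat => ('m => 'k mat) => nat => nat => 'm set => 'k" where
 "munit x n rho a b = (SUM t:Aut x. scl (of_nat n / oA x * rho (invA x t) $$ (b, a)) (geps x t))"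

lemma munit_eps:
 assumes "ob x"
 shows "munit x n rho a b : HT x x" "ct x x x (eps x) (munit x n rho a b) = munit x n rho a b"
  "ct x x x (munit x n rho a b) (eps x) = munit x n rho a b"
 using geps_facts[OF assms] assms
 by (auto simp: munit_def T0.Cmp_sum_left T0.Cmp_sum_right ct_bilinear intro!: T0.Hom_sum T0.Hom_Scl)

lemma Scl_sum: "scl (SUM i:I. f i) v = (SUM i:I. scl (f i) v)"
 by (rule T0.scale_sum_left)

lemma gr_munit:
 assumes x: "ob x" and rho: "is_rep (AG x) n rho" and ab: "a < n" "b < n" and s: "s : Aut x"
 shows "ct x x x (gr s) (munit x n rho a b) = (SUM l<n. scl (rho s $$ (l, a)) (munit x n rho l b))"
proof -
 interpret G: finite_group_chars "AG x" "IC x" by (rule aut_chars[OF x])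
 have "ct x x x (gr s) (munit x n rho a b) = (SUM t:Aut x. scl (of_nat n / oA x * rho (invA x t) $$ (b, a)) (geps x (s ** t)))"
  unfolding munit_def T0.Cmp_sum_right using geps_facts(2)[OF x _ s] by (intro sum.cong) (auto simp: ct_bilinear)
 also have "... = (SUM t:Aut x. scl (of_nat n / oA x * rho (invA x (s ** t) ** s) $$ (b, a)) (geps x (s ** t)))"
 proof (intro sum.cong refl)
  fix t assume t: "t : Aut x"
  have "invA x (s ** t) ** s = invA x t"
   using G.inv_mult_group[OF s t] G.m_assoc[OF G.inv_closed[OF t] G.inv_closed[OF s] s] G.l_inv[OF s] G.r_one[OF G.inv_closed[OF t]] by simp
  thus "scl (of_nat n / oA x * rho (invA x t) $$ (b, a)) (geps x (s ** t)) =
   scl (of_nat n / oA x * rho (invA x (s ** t) ** s) $$ (b, a)) (geps x (s ** t))" by simp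
 qed
 also have "... = (SUM u:Aut x. scl (of_nat n / oA x * rho (invA x u ** s) $$ (b, a)) (geps x u))"
  using G.sum_translate[OF s, of "%u. scl (of_nat n / oA x * rho (invA x u ** s) $$ (b, a)) (geps x u)"] by simp
 also have "... = (SUM u:Aut x. SUM l<n. scl (rho s $$ (l, a)) (scl (of_nat n / oA x * rho (invA x u) $$ (b, l)) (geps x u)))"
 proof (intro sum.cong refl)
  fix u assume u: "u : Aut x"
  have "rho (invA x u ** s) $$ (b, a) = (SUM l<n. rho (invA x u) $$ (b, l) * rho s $$ (l, a))"
   using rep_entry[OF rho G.inv_closed[OF u] s ab(2,1)] by simp
  thus "scl (of_nat n / oA x * rho (invA x u ** s) $$ (b, a)) (geps x u) =
   (SUM l<n. scl (rho s $$ (l, a)) (scl (of_nat n / oA x * rho (invA x u) $$ (b, l)) (geps x u)))"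
   by (simp add: sum_distrib_left Scl_sum mult_ac)
 qed
 also have "... = (SUM l<n. scl (rho s $$ (l, a)) (munit x n rho l b))"
  unfolding munit_def T0.scale_sum_right by (rule sum.swap)
 finally show ?thesis .
qed

text \<open>The matrix units are determined by their multiplication with the group elements: by Schur
 orthogonality they can be recovered from the elements \<open>g\<epsilon>\<close>.\<close>

lemma munit_unique:
 assumes x: "ob x" and rep: "is_irr_rep (AG x) m sigma" "a < m" "b < m"
  and J: "finite J" "!!psi. psi : J ==> is_irr_rep (AG x) (n psi) (rho psi) & rep_char (AG x) (n psi) (rho psi) = psi"
  and v: "v = (SUM psi:J. SUM k<n psi. f psi k k)" "ct x x x (eps x) v = v"
  and f: "!!t psi k. t : Aut x ==> psi : J ==> k < n psi ==>
   ct x x x (gr t) (f psi k k) = (SUM l<n psi. scl (rho psi t $$ (l, k)) (f psi l k))"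
  and eq: "!!psi. psi : J ==> rep_char (AG x) m sigma = psi ==> m = n psi & sigma = rho psi" and h: "v : HT x x"
 shows "ct x x x (munit x m sigma a b) v = (if rep_char (AG x) m sigma : J then f (rep_char (AG x) m sigma) a b else 0)"
proof -
 interpret G: finite_group_chars "AG x" "IC x" by (rule aut_chars[OF x])
 let ?chi = "rep_char (AG x) m sigma" and ?c = "of_nat m / oA x"
 have m: "(of_nat m :: 'k) ~= 0" "oA x ~= 0" using rep(2) G.order_pos by auto
 have gv: "ct x x x (geps x t) v = (SUM psi:J. SUM k<n psi. SUM l<n psi. scl (rho psi t $$ (l, k)) (f psi l k))" if t: "t : Aut x" for t
 proof -
  have "ct x x x (geps x t) v = ct x x x (gr t) v"
   unfolding geps_def using ct_assoc[of x x x x v "eps x" "gr t"] ce_facts(7)[OF x] Aut_arr(1-3)[OF t] h x v(2) by simp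
  thus ?thesis using f[OF t] by (simp add: v(1) T0.Cmp_sum_right)
 qed
 have "ct x x x (munit x m sigma a b) v =
   (SUM t:Aut x. SUM psi:J. SUM k<n psi. SUM l<n psi. scl (?c * (rho psi t $$ (l, k) * sigma (invA x t) $$ (b, a))) (f psi l k))"
  unfolding munit_def T0.Cmp_sum_left
  by (intro sum.cong refl) (simp add: ct_bilinear gv T0.scale_sum_right mult_ac)
 also have "... = (SUM psi:J. SUM k<n psi. SUM l<n psi. scl (?c * (SUM t:Aut x. rho psi t $$ (l, k) * sigma (invA x t) $$ (b, a))) (f psi l k))"
  by (subst sum.swap, intro sum.cong refl, subst sum.swap, intro sum.cong refl, subst sum.swap)
   (simp add: Scl_sum sum_distrib_left)
 also have "... = (SUM psi:J. if psi = ?chi then f ?chi a b else 0)"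
 proof (intro sum.cong refl)
  fix psi assume psi: "psi : J"
  show "(SUM k<n psi. SUM l<n psi. scl (?c * (SUM t:Aut x. rho psi t $$ (l, k) * sigma (invA x t) $$ (b, a))) (f psi l k)) =
   (if psi = ?chi then f ?chi a b else 0)"
  proof (cases "psi = ?chi")
   case False
   have "(SUM t:Aut x. rho psi t $$ (l, k) * sigma (invA x t) $$ (b, a)) = 0" if "k < n psi" "l < n psi" for k l
    using G.schur_orthogonality_ne[OF rep(1), of "n psi" "rho psi" l k b a] J(2)[OF psi] False rep that by auto
   thus ?thesis using False by (simp add: sum.neutral)
  next
   case True
   hence e: "n psi = m" "rho psi = sigma" using eq[OF psi] by auto
   have "(SUM k<m. SUM l<m. scl (?c * (SUM t:Aut x. sigma t $$ (l, k) * sigma (invA x t) $$ (b, a))) (f psi l k)) =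
    (SUM k<m. SUM l<m. if l = a then if k = b then f psi a b else 0 else 0)"
    using m by (intro sum.cong refl) (auto simp: G.schur_orthogonality_eq[OF rep(1) _ _ rep(3,2)])
   thus ?thesis using True e rep by simp
  qed
 qed
 finally show ?thesis using J(1) by simp
qed

definition cdim :: "'o => ('m => 'k) => nat" where
 "cdim x psi = (SOME n. EX rho. is_irr_rep (AG x) n rho & rep_char (AG x) n rho = psi)"

definition crep :: "'o => ('m => 'k) => 'm => 'k mat" where
 "crep x psi = (SOME rho. is_irr_rep (AG x) (cdim x psi) rho & rep_char (AG x) (cdim x psi) rho = psi)"

lemma crep:
 assumes "psi : IC x"
 shows "is_irr_rep (AG x) (cdim x psi) (crep x psi) & rep_char (AG x) (cdim x psi) (crep x psi) = psi"
proof -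
 have "EX n rho. is_irr_rep (AG x) n rho & rep_char (AG x) n rho = psi"
  using assms by (auto simp: irr_chars_def)
 hence "EX rho. is_irr_rep (AG x) (cdim x psi) rho & rep_char (AG x) (cdim x psi) rho = psi"
  unfolding cdim_def by (rule someI_ex)
 thus ?thesis unfolding crep_def by (rule someI_ex)
qed

abbreviation mu :: "'o => ('m => 'k) => nat => nat => 'm set => 'k" where
 "mu x psi == munit x (cdim x psi) (crep x psi)"

lemma sum_munit:
 assumes "is_rep (AG x) n rho" "ob x"
 shows "(SUM k<n. munit x n rho k k) = (SUM t:Aut x. scl (of_nat n / oA x * rep_char (AG x) n rho (invA x t)) (geps x t))"
proof -
 interpret G: finite_group_chars "AG x" "IC x" by (rule aut_chars[OF assms(2)])
 show ?thesis
  unfolding munit_def by (subst sum.swap) (auto simp: rep_char_def sum_distrib_left Scl_sum intro!: sum.cong)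
qed

text \<open>The diagonal matrix units of one block sum to its central idempotent. Over all blocks
  the coefficient of \<open>t\<close> becomes the regular character at its inverse, which is zero
  except at the unit element.\<close>

lemma sum_mu:
 assumes x: "ob x"
 shows "(SUM psi:IC x. SUM k<cdim x psi. mu x psi k k) = eps x"
proof -
 interpret G: finite_group_chars "AG x" "IC x" by (rule aut_chars[OF x])
 have o: "oA x ~= 0" using G.order_pos by auto
 have "(SUM psi:IC x. SUM k<cdim x psi. mu x psi k k) =
   (SUM psi:IC x. SUM t:Aut x. scl (of_nat (cdim x psi) / oA x * psi (invA x t)) (geps x t))"
  using sum_munit[OF _ x] crep by (intro sum.cong refl) (auto simp: is_irr_rep_def)
 also have "... = (SUM t:Aut x. scl ((SUM psi:IC x. of_nat (cdim x psi) * psi (invA x t)) / oA x) (geps x t))"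
  by (subst sum.swap) (simp add: Scl_sum sum_divide_distrib)
 also have "... = (SUM t:Aut x. if t = idt C x then eps x else 0)"
 proof (intro sum.cong refl)
  fix t assume t: "t : Aut x"
  have "(SUM psi:IC x. of_nat (cdim x psi) * psi (invA x t)) = (SUM psi:IC x. psi (idt C x) * psi (invA x t))"
   using G.char_one crep by (intro sum.cong refl) (metis aut_group_simps(2) is_irr_rep_def)
  also have "... = (if invA x t = idt C x then oA x else 0)"
   using G.irr_chars_regular(2)[OF G.inv_closed[OF t]] by simp
  also have "invA x t = idt C x \<longleftrightarrow> t = idt C x" using G.inv_eq_1_iff[OF t] by simp
  finally show "scl ((SUM psi:IC x. of_nat (cdim x psi) * psi (invA x t)) / oA x) (geps x t) = (if t = idt C x then eps x else 0)"
   using o T0_Idn_Cmp[of x x "eps x"] ce_facts(7)[OF x] x by (auto simp: geps_def)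
 qed
 finally show ?thesis using Aut_idt[OF x] x by simp
qed

lemma munit_mult:
 assumes x: "ob x" and r: "is_irr_rep (AG x) m sigma" "is_irr_rep (AG x) n rho"
  and ab: "a < m" "b < m" "c < n" "d < n"
  and eq: "rep_char (AG x) m sigma = rep_char (AG x) n rho ==> m = n & sigma = rho"
 shows "ct x x x (munit x m sigma a b) (munit x n rho c d) =
  (if rep_char (AG x) m sigma = rep_char (AG x) n rho & b = c then munit x m sigma a d else 0)"
proof -
 have rp: "is_rep (AG x) n rho" using r by (simp add: is_irr_rep_def)
 \<comment> \<open>Column \<open>c\<close> of this array is column \<open>d\<close> of the matrix
   units, all other columns are zero. Its diagonal sum is the unit at (c, d), so
   \<open>munit_unique\<close> becomes the multiplication rule.\<close>
 define f where "f phi k l = (if l = c then munit x n rho k d else 0)" for phi :: "'m => 'k" and k l :: nat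
 let ?chi = "rep_char (AG x) m sigma" and ?psi = "rep_char (AG x) n rho"
 have "ct x x x (munit x m sigma a b) (munit x n rho c d) = (if ?chi : {?psi} then f ?chi a b else 0)"
  by (rule munit_unique[where n = "%_. n" and rho = "%_. rho"])
   (use assms munit_eps[OF x] gr_munit[OF x rp _ ab(4)] in \<open>auto simp: f_def\<close>)
 thus ?thesis using eq by (auto simp: f_def)
qed

lemma mu_mult:
 assumes "ob x" and "chi : IC x" "a < cdim x chi" "b < cdim x chi" "psi : IC x" "c < cdim x psi" "d < cdim x psi"
 shows "ct x x x (mu x chi a b) (mu x psi c d) = (if chi = psi & b = c then mu x chi a d else 0)"
 using munit_mult[of x "cdim x chi" "crep x chi" "cdim x psi" "crep x psi" a b c d] crep assms by auto

text \<open>A concrete model of the simple object, cut out of \<open>[x]\<close> by the primitive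
  idempotent at position (0, 0) of its block.\<close>

definition Sobj :: "'o => ('m => 'k) => 'o list \<times> (nat => nat => 'm set => 'k)" where
 "Sobj x psi = idem x (mu x psi 0 0)"

lemma cdim_pos: "psi : IC x ==> 0 < cdim x psi"
 using crep by (simp add: is_irr_rep_def)

lemma Sobj_Obj: "ob x ==> psi : IC x ==> Sobj x psi : Obj TE"
 using mu_mult[of x psi 0 0 psi 0 0] cdim_pos[of psi x] munit_eps(1) by (simp add: Sobj_def)

text \<open>The \<open>k\<close>-th copy of the simple object is embedded by the unit at (k, 0) and
  projected to by the unit at (0, k); a column of matrix units transforms under the group by the
  matrices of the representation.\<close>

lemma top0_chi_Sobj:
 assumes x: "ob x" and chi: "chi : IC x"
 shows "is_top0_chi C \<delta> x chi (Sobj x chi)"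
 unfolding is_top0_chi_def
proof (intro exI conjI)
 let ?Z = "idem x (eps x)" and ?iota = "%(psi, k). emb (mu x psi k 0)" and ?\<pi> = "%(psi, k). emb (mu x psi 0 k)"
 interpret G: finite_group_chars "AG x" "IC x" by (rule aut_chars[OF x])
 note m = munit_eps[OF x] and Z = idem_eps_Obj(1)[OF x] and c0 = cdim_pos[of _ x]
 show "is_top0 C \<delta> x ?Z (emb (eps x))" using top0_eps x .
 show "is_top0_action C \<delta> x ?Z (emb (eps x)) (%g. emb (geps x g))"
  unfolding is_top0_action_def br_idem br_arr_emb
  using geps_facts[OF x] by (auto simp: idem_Hom idem_Cmp) (simp add: geps_def)
 show "ALL psi:IC x. is_irr_rep (AG x) (cdim x psi) (crep x psi) & rep_char (AG x) (cdim x psi) (crep x psi) = psi"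
  using crep by blast
 show "ALL g:Aut x. ALL psi:IC x. ALL k<cdim x psi. Cmp TE (Sobj x psi) ?Z ?Z (emb (geps x g)) (?iota (psi, k)) =
   (SUM l<cdim x psi. Scl TE (crep x psi g $$ (l, k)) (?iota (psi, l)))"
 proof (intro ballI allI impI)
  fix g psi k assume g: "g : Aut x" and psi: "psi : IC x" "k < cdim x psi"
  have "ct x x x (geps x g) (mu x psi k 0) = ct x x x (gr g) (mu x psi k 0)"
   unfolding geps_def using ct_assoc[of x x x x "mu x psi k 0" "eps x" "gr g"] m ce_facts(7)[OF x] Aut_arr(1-3)[OF g] x by simp
  also have "... = (SUM l<cdim x psi. scl (crep x psi g $$ (l, k)) (mu x psi l 0))"
   using gr_munit[OF x _ psi(2) c0[OF psi(1)] g] crep[OF psi(1)] by (simp add: is_irr_rep_def)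
  finally show "Cmp TE (Sobj x psi) ?Z ?Z (emb (geps x g)) (?iota (psi, k)) =
   (SUM l<cdim x psi. Scl TE (crep x psi g $$ (l, k)) (?iota (psi, l)))"
   by (simp add: Sobj_def idem_Cmp emb_sum TE_simps(5) T0.emb_Scl)
 qed
 show "is_biproduct TE ?Z (SIGMA psi:IC x. {..<cdim x psi}) (%(psi, k). Sobj x psi) ?iota ?\<pi>"
  unfolding is_biproduct_def
 proof (intro conjI ballI)
  show "finite (SIGMA psi:IC x. {..<cdim x psi})" using G.irr_chars_regular(1) by auto
  show "(SUM i:(SIGMA psi:IC x. {..<cdim x psi}). Cmp TE ?Z (case i of (psi, k) => Sobj x psi) ?Z (?iota i) (?\<pi> i)) = Idn TE ?Z"
  proof -
   have "(SUM i:(SIGMA psi:IC x. {..<cdim x psi}). Cmp TE ?Z (case i of (psi, k) => Sobj x psi) ?Z (?iota i) (?\<pi> i)) =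
    (SUM (psi, k):(SIGMA psi:IC x. {..<cdim x psi}). emb (mu x psi k k))"
    by (intro sum.cong refl) (auto simp: Sobj_def idem_Cmp mu_mult[OF x] c0)
   also have "... = emb (SUM psi:IC x. SUM k<cdim x psi. mu x psi k k)"
    using G.irr_chars_regular(1) by (simp add: sum.Sigma[symmetric] emb_sum)
   finally show ?thesis by (simp add: sum_mu[OF x] idem_Idn)
  qed
 qed (use m Sobj_Obj[OF x] Z c0 in \<open>auto simp: Sobj_def idem_Hom idem_Cmp idem_Idn mu_mult[OF x]\<close>)
qed (use chi in auto)

text \<open>The inclusions and projections of an arbitrary decomposition compose to an array that
  transforms like matrix units and has diagonal sum \<open>eps x\<close>. By
  \<open>munit_unique\<close> it contains the matrix unit at (0, 0), so every such object is cut out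
  by this idempotent, whatever choices were made.\<close>

lemma top0_chi_D:
 assumes x: "ob x" and top: "is_top0_chi C \<delta> x chi S"
 obtains n rho s r where "is_irr_rep (AG x) n rho" "rep_char (AG x) n rho = chi" "S : Obj TE"
  "s : Hom TE S (br C \<delta> x)" "r : Hom TE (br C \<delta> x) S" "Cmp TE S (br C \<delta> x) S r s = Idn TE S"
  "Cmp TE (br C \<delta> x) S (br C \<delta> x) s r = emb (munit x n rho 0 0)"
proof -
 let ?b = "br C \<delta> x"
 interpret G: finite_group_chars "AG x" "IC x" by (rule aut_chars[OF x])
 obtain Z j a S' n rho iota \<pi> where top0: "is_top0 C \<delta> x Z j" and act: "is_top0_action C \<delta> x Z j a"
  and rep: "ALL psi:IC x. is_irr_rep (AG x) (n psi) (rho psi) & rep_char (AG x) (n psi) (rho psi) = psi"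
  and bi: "is_biproduct TE Z (SIGMA psi:IC x. {..<n psi}) (%(psi, k). S' psi) iota \<pi>"
  and ai: "ALL g:Aut x. ALL psi:IC x. ALL k<n psi. Cmp TE (S' psi) Z Z (a g) (iota (psi, k)) = (SUM l<n psi. Scl TE (rho psi g $$ (l, k)) (iota (psi, l)))"
  and chi: "chi : IC x" "S = S' chi"
  using top unfolding is_top0_chi_def by blast
 obtain q where q: "Z : Obj TE" "j : Hom TE Z ?b" "q : Hom TE ?b Z" "Cmp TE Z ?b Z q j = Idn TE Z" "Cmp TE ?b Z ?b j q = emb (eps x)"
  using top0_D[OF x top0] .
 have b: "?b : Obj TE" using x by simp
 have B: "S' psi : Obj TE" "iota (psi, k) : Hom TE (S' psi) Z" "\<pi> (psi, k) : Hom TE Z (S' psi)"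
  "Cmp TE (S' psi) Z (S' psi) (\<pi> (psi, k)) (iota (psi, k)) = Idn TE (S' psi)" if "psi : IC x" "k < n psi" for psi k
  using bi that by (auto simp: is_biproduct_def)
 define s where "s psi k = Cmp TE (S' psi) Z ?b j (iota (psi, k))" for psi k
 define r where "r psi k = Cmp TE ?b Z (S' psi) (\<pi> (psi, k)) q" for psi k
 have sr: "s psi k : Hom TE (S' psi) ?b" "r psi k : Hom TE ?b (S' psi)" if "psi : IC x" "k < n psi" for psi k
  unfolding s_def r_def using TE.Cmp_Hom B[OF that] q b by blast+
 define f where "f psi k l = Cmp TE ?b (S' psi) ?b (s psi k) (r psi l) 0 0" for psi k l
 have f: "Cmp TE ?b (S' psi) ?b (s psi k) (r psi l) = emb (f psi k l)" "f psi k l : HT x x" if "psi : IC x" "k < n psi" "l < n psi" for psi k l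
 proof -
  have "Cmp TE ?b (S' psi) ?b (s psi k) (r psi l) : Hom TE ?b ?b" using TE.Cmp_Hom sr B b that by blast
  then obtain v where "v : HT x x" "Cmp TE ?b (S' psi) ?b (s psi k) (r psi l) = emb v" using br_Hom[OF x x] by blast
  thus "Cmp TE ?b (S' psi) ?b (s psi k) (r psi l) = emb (f psi k l)" "f psi k l : HT x x" by (auto simp: f_def emb_def)
 qed
 have sum: "(SUM psi:IC x. SUM k<n psi. f psi k k) = eps x"
 proof -
  have kk: "emb (f psi k k) = Cmp TE ?b Z ?b j (Cmp TE ?b Z Z (Cmp TE Z (S' psi) Z (iota (psi, k)) (\<pi> (psi, k))) q)"
   if "psi : IC x" "k < n psi" for psi k
   unfolding f(1)[OF that that(2), symmetric] s_def r_def
   using TE.Cmp_assoc[of ?b "S' psi" Z ?b "Cmp TE ?b Z (S' psi) (\<pi> (psi, k)) q" "iota (psi, k)" j]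
    TE.Cmp_assoc[of ?b Z "S' psi" Z q "\<pi> (psi, k)" "iota (psi, k)"] TE.Cmp_Hom[of ?b Z "S' psi" q "\<pi> (psi, k)"] B[OF that] q b by simp
  have "emb (SUM psi:IC x. SUM k<n psi. f psi k k) = (SUM psi:IC x. SUM k<n psi. Cmp TE ?b Z ?b j (Cmp TE ?b Z Z (Cmp TE Z (S' psi) Z (iota (psi, k)) (\<pi> (psi, k))) q))"
   unfolding emb_sum using kk by (intro sum.cong) auto
  also have "... = Cmp TE ?b Z ?b j (Cmp TE ?b Z Z (SUM (psi, k):(SIGMA psi:IC x. {..<n psi}). Cmp TE Z (S' psi) Z (iota (psi, k)) (\<pi> (psi, k))) q)"
   using G.irr_chars_regular(1) by (simp add: TE.Cmp_sum_left TE.Cmp_sum_right sum.Sigma[symmetric])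
  also have "(SUM (psi, k):(SIGMA psi:IC x. {..<n psi}). Cmp TE Z (S' psi) Z (iota (psi, k)) (\<pi> (psi, k))) = Idn TE Z"
   using bi by (simp add: is_biproduct_def split_beta)
  finally show ?thesis using TE.Idn_Cmp[OF b q(1) q(3)] q(5) by simp
 qed
 have gf: "ct x x x (gr t) (f psi k l) = (SUM m<n psi. scl (rho psi t $$ (m, k)) (f psi m l))"
  if t: "t : Aut x" and k: "psi : IC x" "k < n psi" "l < n psi" for t psi k l
 proof -
  have at: "a t : Hom TE Z Z" "Cmp TE Z ?b ?b (emb (gr t)) j = Cmp TE Z Z ?b j (a t)"
   using act t by (auto simp: is_top0_action_def br_arr_emb)
  have gt: "emb (gr t) : Hom TE ?b ?b" using br_Hom[OF x x] Aut_arr(1-3)[OF t] by auto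
  have "Cmp TE (S' psi) ?b ?b (emb (gr t)) (s psi k) = Cmp TE (S' psi) Z ?b j (Cmp TE (S' psi) Z Z (a t) (iota (psi, k)))"
   unfolding s_def using TE.Cmp_assoc[OF B(1)[OF k(1,2)] q(1) b b B(2)[OF k(1,2)] q(2) gt]
    TE.Cmp_assoc[OF B(1)[OF k(1,2)] q(1) q(1) b B(2)[OF k(1,2)] at(1) q(2)] at(2) by simp
  also have "... = (SUM m<n psi. Scl TE (rho psi t $$ (m, k)) (s psi m))"
   using ai t k by (simp add: TE.Cmp_sum_right TE.Cmp_Scl_right s_def)
  finally have "Cmp TE ?b ?b ?b (emb (gr t)) (emb (f psi k l)) = (SUM m<n psi. Scl TE (rho psi t $$ (m, k)) (emb (f psi m l)))"
   using TE.Cmp_assoc[OF b B(1)[OF k(1,2)] b b sr(2)[OF k(1,3)] sr(1)[OF k(1,2)] gt] f(1)[OF k(1) _ k(3)] k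
   by (simp add: TE.Cmp_sum_left TE.Cmp_Scl_left)
  thus ?thesis by (simp add: br_idem idem_Cmp TE_simps(5) T0.emb_Scl emb_sum[symmetric])
 qed
 note rchi = rep[rule_format, OF chi(1)]
 have n0: "0 < n chi" using rchi by (simp add: is_irr_rep_def)
 have "ct x x x (munit x (n chi) (rho chi) 0 0) (eps x) = (if rep_char (AG x) (n chi) (rho chi) : IC x then f (rep_char (AG x) (n chi) (rho chi)) 0 0 else 0)"
  by (rule munit_unique[where n = n and rho = rho])
   (use x rchi n0 rep sum gf ce_facts(6,7)[OF x] G.irr_chars_regular(1) in auto)
 hence f0: "f chi 0 0 = munit x (n chi) (rho chi) 0 0" using munit_eps(3)[OF x] rchi chi by simp
 have "Cmp TE S ?b S (r chi 0) (s chi 0) = Idn TE S"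
  unfolding chi(2) r_def s_def
  using TE.Cmp_assoc[of "S' chi" ?b Z "S' chi" "Cmp TE (S' chi) Z ?b j (iota (chi, 0))" q "\<pi> (chi, 0)"]
   TE.Cmp_assoc[of "S' chi" Z ?b Z "iota (chi, 0)" j q] TE.Idn_Cmp[OF B(1) q(1) B(2)] sr(1)[OF chi(1) n0, unfolded s_def]
   B[OF chi(1) n0] q b chi n0 by simp
 thus thesis
  using that[of "n chi" "rho chi" "s chi 0" "r chi 0"] rchi B(1)[OF chi(1) n0] sr[OF chi(1) n0] f(1)[OF chi(1) n0 n0] f0 chi(2) by simp
qed

end

section \<open>Characters and endomorphisms of the simple objects\<close>

context envelope
begin

text \<open>If \<open>z\<close> differs from \<open>x\<close>, a partial surjection from
  \<open>x\<close> to \<open>z\<close> has a smaller target, so \<open>eps x\<close> kills it. If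
  \<open>z\<close> is \<open>x\<close>, the trace of u mapped to h u t counts the g with g^-1 h g =
  t^-1, and Schur orthogonality turns the sum of entries of rho(g^-1 h g) into the character at
  \<open>h\<close>.\<close>

lemma cx_munit:
 assumes x: "x : X" and z: "z : X" and h: "h : Aut z" and rho: "is_irr_rep (AG x) n rho"
 shows "cx z h x (munit x n rho 0 0) = (if z = x then rep_char (AG x) n rho h else 0)"
proof (cases "z = x")
 case False
 have "ct x x z (basis a) (munit x n rho 0 0) = 0" if a: "a : psurj x z" for a
 proof -
  have "subquotient C z x" using psurj_subquotient[OF a] x z by simp
  hence sz: "size z < size x"
   using subquotient_iso[of z x] X_iso_eq[OF z x] False by (meson not_le_imp_less)
  have a: "basis a : HT x z" using basis_Hom psurj_sub a by blast
  hence "ct x x z (basis a) (eps x) = 0"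
   using eps(3)[of x z "basis a"] Jid_tgt[OF a sz] x z by simp
  thus ?thesis
   using ct_assoc[of x x x z "munit x n rho 0 0" "eps x" "basis a"] munit_eps[of x n rho 0 0] ce_facts(7)[of x] a x z by simp
 qed
 thus ?thesis using False by (simp add: cx_def fun_simps)
next
 case True
 have xo: "ob x" using x by simp
 interpret G: finite_group_chars "AG x" "IC x" by (rule aut_chars[OF xo])
 have r: "is_rep (AG x) n rho" "0 < n" using rho by (auto simp: is_irr_rep_def)
 have h: "h : Aut x" using h True by simp
 have "cx x h x (geps x t) = (SUM g:Aut x. if invA x g ** h ** g = invA x t then 1 else 0)" if t: "t : Aut x" for t
 proof -
  have "cx x h x (geps x t) = (SUM g:Aut x. ct x x x (gr h) (ct x x x (gr g) (geps x t)) (graph C g))"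
   unfolding cx_def by (rule sum.reindex_bij_betw[OF bij_graph[OF xo], symmetric])
  also have "... = (SUM g:Aut x. if invA x g ** h ** g = invA x t then 1 else 0)"
  proof (intro sum.cong refl)
   fix g assume g: "g : Aut x"
   have gt: "g ** t : Aut x" "h ** (g ** t) : Aut x" using Aut_mult g t h by auto
   have "g = h ** (g ** t) \<longleftrightarrow> invA x t = invA x g ** h ** g"
   proof -
    have "h ** g : Aut x" "g = (h ** g) ** t \<longleftrightarrow> h ** g = g ** invA x t"
     using Aut_mult[OF h g] G.inv_solve_right[of "h ** g" g t] g t by auto
    moreover have "invA x t = invA x g ** (h ** g) \<longleftrightarrow> h ** g = g ** invA x t"
     using G.inv_solve_left[OF G.inv_closed[OF t] g \<open>h ** g : Aut x\<close>] by simp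
    ultimately show ?thesis
     using G.m_assoc[OF G.inv_closed[OF g] h g] G.m_assoc[OF h g t] by (simp only: aut_group_simps)
   qed
   thus "ct x x x (gr h) (ct x x x (gr g) (geps x t)) (graph C g) = (if invA x g ** h ** g = invA x t then 1 else 0)"
    using geps_facts(2)[OF xo t g] geps_facts(2)[OF xo gt(1) h] geps_facts(5)[OF xo gt(2) g] by auto
  qed
  finally show ?thesis .
 qed
 hence "cx x h x (munit x n rho 0 0) =
   (SUM t:Aut x. SUM g:Aut x. of_nat n / oA x * (if invA x g ** h ** g = invA x t then rho (invA x t) $$ (0, 0) else 0))"
  unfolding munit_def cx_sum cx_Scl by (intro sum.cong refl) (simp add: sum_distrib_left if_distrib mult.assoc cong: if_cong)
 also have "... = (SUM t:Aut x. SUM g:Aut x. of_nat n / oA x * (if invA x g ** h ** g = t then rho t $$ (0, 0) else 0))"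
  by (rule G.sum_inv)
 also have "... = (SUM g:Aut x. of_nat n / oA x * rho (invA x g ** h ** g) $$ (0, 0))"
 proof (subst sum.swap, intro sum.cong refl)
  fix g assume g: "g : Aut x"
  have "invA x g ** h ** g : Aut x" using Aut_mult[OF Aut_mult[OF G.inv_closed[OF g] h] g] .
  thus "(SUM t:Aut x. of_nat n / oA x * (if invA x g ** h ** g = t then rho t $$ (0, 0) else 0)) =
   of_nat n / oA x * rho (invA x g ** h ** g) $$ (0, 0)" using xo by (simp add: sum_distrib_left[symmetric] sum_divide_distrib[symmetric])
 qed
 also have "... = of_nat n / oA x * (SUM g:Aut x. SUM b<n. SUM a<n. rho h $$ (a, b) * (rho g $$ (b, 0) * rho (invA x g) $$ (0, a)))"
 proof -
  have "rho (invA x g ** h ** g) $$ (0, 0) = (SUM b<n. SUM a<n. rho h $$ (a, b) * (rho g $$ (b, 0) * rho (invA x g) $$ (0, a)))" if g: "g : Aut x" for g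
  proof -
   have ig: "invA x g ** h : Aut x" using Aut_mult[OF G.inv_closed[OF g] h] .
   have "rho (invA x g ** h ** g) $$ (0, 0) = (SUM b<n. rho (invA x g ** h) $$ (0, b) * rho g $$ (b, 0))"
    using rep_entry[OF r(1) ig g r(2,2)] by simp
   also have "... = (SUM b<n. (SUM a<n. rho (invA x g) $$ (0, a) * rho h $$ (a, b)) * rho g $$ (b, 0))"
    using rep_entry[OF r(1) G.inv_closed[OF g] h r(2)] by (intro sum.cong) auto
   finally show ?thesis by (simp add: sum_distrib_right sum_distrib_left mult_ac)
  qed
  thus ?thesis by (simp add: sum_distrib_left)
 qed
 also have "... = of_nat n / oA x * (SUM b<n. SUM a<n. rho h $$ (a, b) * (SUM g:Aut x. rho g $$ (b, 0) * rho (invA x g) $$ (0, a)))"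
  by (subst sum.swap, rule arg_cong[of _ _ "(*) _"], intro sum.cong refl, subst sum.swap) (simp add: sum_distrib_left)
 also have "... = of_nat n / oA x * (SUM b<n. SUM a<n. if a = b then rho h $$ (b, b) * (oA x / of_nat n) else 0)"
  by (intro arg_cong[of _ _ "(*) _"] sum.cong refl) (auto simp: G.schur_orthogonality_eq[OF rho _ r(2) r(2)])
 also have "... = rep_char (AG x) n rho h"
  using r(2) G.order_pos h by (simp add: rep_char_def sum_distrib_right[symmetric] sum_divide_distrib[symmetric])
 finally show ?thesis using True by simp
qed

lemma ch_top0_chi:
 assumes "x : X" "z : X" "is_top0_chi C \<delta> x chi S"
 shows "ch z h S = (if z = x then chi h else 0)"
proof -
 have x: "ob x" and z: "ob z" using assms by auto
 show ?thesis using x assms(3)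
 proof (rule top0_chi_D)
  fix n rho s r assume *: "is_irr_rep (AG x) n rho" "rep_char (AG x) n rho = chi" "S : Obj TE"
   "s : Hom TE S (br C \<delta> x)" "r : Hom TE (br C \<delta> x) S" "Cmp TE S (br C \<delta> x) S r s = Idn TE S"
   "Cmp TE (br C \<delta> x) S (br C \<delta> x) s r = emb (munit x n rho 0 0)"
  show ?thesis
  proof (cases "h : Aut z")
   case True
   show ?thesis using ch_retract[OF z True x *(3-7)] cx_munit[OF assms(1,2) True *(1)] *(2) by simp
  next
   case False
   thus ?thesis using *(2)[symmetric] by (auto simp: ch_def rep_char_def)
  qed
 qed
qed

text \<open>Endomorphisms are compressions by the matrix unit at (0, 0) of elements of the group
  algebra. A group element takes this unit to its column, of which only the entry at (0, 0) survives
  the second compression.\<close>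

lemma End_top0_chi:
 assumes x: "ob x" and S: "is_top0_chi C \<delta> x chi S" and u: "u : Hom TE S S"
 shows "EX l. u = Scl TE l (Idn TE S)"
 using x S
proof (rule top0_chi_D)
 let ?b = "br C \<delta> x"
 fix n rho s r assume *: "is_irr_rep (AG x) n rho" "S : Obj TE" "s : Hom TE S ?b" "r : Hom TE ?b S"
  "Cmp TE S ?b S r s = Idn TE S" "Cmp TE ?b S ?b s r = emb (munit x n rho 0 0)"
 let ?e = "munit x n rho"
 have n: "is_rep (AG x) n rho" "0 < n" using *(1) by (auto simp: is_irr_rep_def)
 have b: "?b : Obj TE" using x by simp
 note A = TE.Cmp_assoc and e = munit_eps[OF x]
 have su: "Cmp TE S S ?b s u : Hom TE S ?b" using TE.Cmp_Hom * u b by blast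
 have "Cmp TE ?b S ?b (Cmp TE S S ?b s u) r : Hom TE ?b ?b" using TE.Cmp_Hom su * b by blast
 then obtain w where w: "w : HT x x" "Cmp TE ?b S ?b (Cmp TE S S ?b s u) r = emb w" using br_Hom[OF x x] by blast
 have "Cmp TE S ?b ?b (emb w) s = Cmp TE S S ?b s u"
  unfolding w(2)[symmetric] using A[OF *(2) b *(2) b *(3,4) su] *(5) TE.Cmp_Idn[OF *(2) b su] by simp
 hence u_w: "Cmp TE S ?b S r (Cmp TE S ?b ?b (emb w) s) = u"
  using A[OF *(2) *(2) b *(2) u *(3,4)] *(5) TE.Idn_Cmp[OF *(2,2) u] by simp
 have "ct x x x w (?e 0 0) = (SUM t:Aut x. SUM l<n. scl (w (graph C t) * rho t $$ (l, 0)) (?e l 0))"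
 proof -
  have "ct x x x w (?e 0 0) = ct x x x (ct x x x w (eps x)) (?e 0 0)"
   using ct_assoc[of x x x x "?e 0 0" "eps x" w] e w ce_facts(7)[OF x] x by simp
  also have "... = (SUM t:Aut x. scl (w (graph C t)) (ct x x x (geps x t) (?e 0 0)))"
   by (simp add: comp_eps[OF x w(1)] T0.Cmp_sum_left ct_bilinear)
  also have "... = (SUM t:Aut x. SUM l<n. scl (w (graph C t) * rho t $$ (l, 0)) (?e l 0))"
  proof (intro sum.cong refl)
   fix t assume t: "t : Aut x"
   have "ct x x x (geps x t) (?e 0 0) = ct x x x (gr t) (?e 0 0)"
    unfolding geps_def using ct_assoc[of x x x x "?e 0 0" "eps x" "gr t"] e ce_facts(7)[OF x] Aut_arr(1-3)[OF t] x by simp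
   thus "scl (w (graph C t)) (ct x x x (geps x t) (?e 0 0)) =
    (SUM l<n. scl (w (graph C t) * rho t $$ (l, 0)) (?e l 0))"
    using gr_munit[OF x n(1,2,2) t] by (simp add: T0.scale_sum_right)
  qed
  finally show ?thesis .
 qed
 hence "ct x x x (?e 0 0) (ct x x x w (?e 0 0)) =
   (SUM t:Aut x. SUM l<n. if l = 0 then scl (w (graph C t) * rho t $$ (0, 0)) (?e 0 0) else 0)"
  using munit_mult[OF x *(1,1) n(2,2) _ n(2)] n
  by (auto simp: T0.Cmp_sum_right ct_bilinear if_distrib[of "Scl _ _"] intro!: sum.cong cong: if_cong)
 also have "... = scl (SUM t:Aut x. w (graph C t) * rho t $$ (0, 0)) (?e 0 0)"
  using n by (simp add: Scl_sum)
 finally obtain l where l: "ct x x x (?e 0 0) (ct x x x w (?e 0 0)) = scl l (?e 0 0)" by blast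
 have wH: "emb w : Hom TE ?b ?b" "emb (?e 0 0) : Hom TE ?b ?b" using br_Hom[OF x x] w e by blast+
 have es: "Cmp TE S ?b ?b (emb (?e 0 0)) s = s"
  unfolding *(6)[symmetric] using A[OF *(2) b *(2) b *(3,4,3)] *(5) TE.Cmp_Idn[OF *(2) b *(3)] by simp
 have re: "Cmp TE ?b ?b S r (emb (?e 0 0)) = r"
  unfolding *(6)[symmetric] using A[OF b *(2) b *(2) *(4,3,4)] *(5) TE.Idn_Cmp[OF b *(2) *(4)] by simp
 have ws: "Cmp TE S ?b ?b (emb w) s : Hom TE S ?b" using TE.Cmp_Hom wH * b by blast
 have "u = Cmp TE S ?b S (Cmp TE ?b ?b S r (emb (?e 0 0))) (Cmp TE S ?b ?b (emb w) (Cmp TE S ?b ?b (emb (?e 0 0)) s))"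
  using u_w es re by simp
 also have "... = Cmp TE S ?b S r (Cmp TE S ?b ?b (Cmp TE ?b ?b ?b (emb (?e 0 0)) (Cmp TE ?b ?b ?b (emb w) (emb (?e 0 0)))) s)"
  using A[OF *(2) b b *(2) ws wH(2) *(4)] A[OF *(2) b b b *(3) wH(2) wH(1)] es
   A[OF *(2) b b b *(3) TE.Cmp_Hom[OF b b b wH(2,1)] wH(2)] by simp
 also have "Cmp TE ?b ?b ?b (emb (?e 0 0)) (Cmp TE ?b ?b ?b (emb w) (emb (?e 0 0))) = Scl TE l (emb (?e 0 0))"
  by (simp add: br_idem idem_Cmp l TE_simps(5) T0.emb_Scl)
 finally show "EX l. u = Scl TE l (Idn TE S)" using es *(5) by (auto simp: TE.Cmp_Scl_left TE.Cmp_Scl_right)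
qed

lemma top0_chi_Obj:
 assumes "x : X" "is_top0_chi C \<delta> x chi S"
 shows "S : Obj TE" "Idn TE S ~= 0"
proof -
 have x: "ob x" using assms by simp
 show S: "S : Obj TE" using top0_chi_D[OF x assms(2)] by metis
 obtain n rho where r: "is_rep (AG x) n rho" "0 < n" "rep_char (AG x) n rho = chi"
  using top0_chi_D[OF x assms(2)] unfolding is_irr_rep_def by metis
 interpret G: finite_group_chars "AG x" "IC x" by (rule aut_chars[OF x])
 have "ch x (idt C x) S = of_nat n" using ch_top0_chi[OF assms(1,1,2)] G.char_one[OF r(1)] r(3) by simp
 hence "ch x (idt C x) S ~= 0" using r(2) by simp
 thus "Idn TE S ~= 0" by (auto simp: ch_def T0.mtr_def TE_simps(3) fun_simps split: if_splits)
qed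

lemma Scl_Idn_inverse:
 assumes "S : Obj TE" "Idn TE S ~= 0" "P : Obj TE" "i : Hom TE P S" "g : Hom TE S P" "Cmp TE S P S i g ~= 0"
  "Cmp TE S P S i g = Scl TE l (Idn TE S)"
 shows "Cmp TE S P S i (Scl TE (1 / l) g) = Idn TE S" "Cmp TE S P S (Scl TE (1 / l) i) g = Idn TE S"
 using assms by (auto simp: TE.Cmp_Scl_right TE.Cmp_Scl_left)

text \<open>A nonzero \<open>i\<close> has a partner \<open>g\<close> with nonzero composite, which
  is a scalar since endomorphisms are; after rescaling, \<open>i\<close> is split epi, and a mono
  that is split epi is invertible.\<close>

lemma simple_top0_chi:
 assumes x: "x : X" and S: "is_top0_chi C \<delta> x chi S"
 shows "simple_object TE S"
 unfolding simple_object_def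
proof (intro conjI ballI impI)
 note S' = top0_chi_Obj[OF x S]
 show "S : Obj TE" "Idn TE S ~= 0" using S' by auto
 fix P i assume P: "P : Obj TE" and i: "i : Hom TE P S"
  and m: "ALL W:Obj TE. ALL f:Hom TE W P. ALL g:Hom TE W P. Cmp TE W P S i f = Cmp TE W P S i g --> f = g"
 show "i = 0 \<or> (EX k:Hom TE S P. Cmp TE P S P k i = Idn TE P & Cmp TE S P S i k = Idn TE S)"
 proof (cases "i = 0")
  case False
  then obtain g where g: "g : Hom TE S P" "Cmp TE S P S i g ~= 0" using TE_nondegenerate[OF P S'(1) i] by blast
  have "Cmp TE S P S i g : Hom TE S S" using TE.Cmp_Hom S'(1) P g(1) i by blast
  then obtain l where "Cmp TE S P S i g = Scl TE l (Idn TE S)" using End_top0_chi[OF _ S] x by auto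
  hence 1: "Cmp TE S P S i (Scl TE (1 / l) g) = Idn TE S" (is "Cmp TE S P S i ?k = _")
   using Scl_Idn_inverse[OF S' P i g] by blast
  have k: "?k : Hom TE S P" using TE.Hom_Scl g S' P by blast
  have "Cmp TE P P S i (Cmp TE P S P ?k i) = Cmp TE P P S i (Idn TE P)"
   using TE.Cmp_assoc[OF P S'(1) P S'(1) i k i] 1 TE.Idn_Cmp[OF P S'(1) i] TE.Cmp_Idn[OF P S'(1) i] by simp
  hence "Cmp TE P S P ?k i = Idn TE P" using m P TE.Cmp_Hom[OF P S'(1) P i k] TE.Idn_Hom[OF P] by blast
  thus ?thesis using 1 k by blast
 qed simp
qed

section \<open>Decomposition of objects into simple ones\<close>

definition Simp :: "('o list \<times> (nat => nat => 'm set => 'k)) set" where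
 "Simp = {Sobj z psi | z psi. z : X & psi : IC z}"

text \<open>\<open>fac P n M\<close> says that \<open>M\<close> is a sum of \<open>n\<close>
  endomorphisms of \<open>P\<close>, each factoring through a simple object. The count
  \<open>n\<close> is what decreases when a simple summand is split off.\<close>

inductive fac :: "'o list \<times> (nat => nat => 'm set => 'k) => nat => (nat => nat => 'm set => 'k) => bool" for P where
 fac_zero: "fac P 0 0"
| fac_Suc: "fac P n M ==> S : Simp ==> p : Hom TE S P ==> q : Hom TE P S ==> fac P (Suc n) (Cmp TE P S P p q + M)"

lemma Simp_Obj: "S : Simp ==> S : Obj TE"
 using Sobj_Obj by (auto simp: Simp_def)

lemma fac_add:
 assumes "fac P n M" "fac P m N"
 shows "fac P (n + m) (M + N)"
 using assms(1)
proof (induction rule: fac.induct)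
 case (fac_Suc n M S p q)
 thus ?case using fac.fac_Suc[OF fac_Suc(5,2-4)] by (simp add: add.assoc)
qed (use assms in simp)

lemma fac_sum: "(!!i. i : I ==> EX n. fac P n (f i)) ==> EX n. fac P n (sum f I)"
proof (induction I rule: infinite_finite_induct)
 case (insert i I)
 then obtain n m where "fac P n (f i)" "fac P m (sum f I)" by blast
 hence "fac P (n + m) (f i + sum f I)" by (rule fac_add)
 thus ?case using insert(1,2) by auto
qed (auto intro: fac_zero)

lemma fac_sandwich:
 assumes "fac P n M" "A : Hom TE P Q" "B : Hom TE Q P" "P : Obj TE" "Q : Obj TE"
 shows "fac Q n (Cmp TE Q P Q A (Cmp TE Q P P M B))"
 using assms(1)
proof (induction rule: fac.induct)
 case (fac_Suc n M S p q)
 note S = Simp_Obj[OF fac_Suc(2)] and A = TE.Cmp_Hom and ca = TE.Cmp_assoc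
 have H: "Cmp TE S P Q A p : Hom TE S Q" "Cmp TE Q P S q B : Hom TE Q S" using A S fac_Suc assms by blast+
 have "Cmp TE Q P Q A (Cmp TE Q P P (Cmp TE P S P p q) B) = Cmp TE Q S Q (Cmp TE S P Q A p) (Cmp TE Q P S q B)"
  using ca[OF assms(5,4) S assms(4) assms(3) fac_Suc(4,3)] ca[OF assms(5) S assms(4,5) H(2) fac_Suc(3) assms(2)] by simp
 thus ?case
  using fac.fac_Suc[OF fac_Suc(5,2) H] by (simp add: TE.Cmp_add_left TE.Cmp_add_right)
qed (simp add: fac_zero)

text \<open>The idempotents \<epsilon> z are sums of diagonal matrix units, which factor through
  simple objects; the identity of \<open>[x]\<close> is a sum of morphisms through these
  idempotents; an arbitrary \<open>P\<close> is reached through its coordinates, compressed by its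
  idempotent.\<close>

lemma fac_Idn:
 assumes P: "P : Obj TE"
 shows "EX n. fac P n (Idn TE P)"
proof -
 have e: "EX n. fac (br C \<delta> z) n (emb (eps z))" if z: "z : X" for z
 proof -
  have zo: "ob z" using z by simp
  have "EX n. fac (br C \<delta> z) n (emb (mu z psi k k))" if psi: "psi : IC z" "k < cdim z psi" for psi k
  proof -
   note c = cdim_pos[OF psi(1)] and m = mu_mult[OF zo psi(1) _ _ psi(1)] and e = munit_eps(1)[OF zo]
   have "Cmp TE (br C \<delta> z) (Sobj z psi) (br C \<delta> z) (emb (mu z psi k 0)) (emb (mu z psi 0 k)) = emb (mu z psi k k)"
    using m psi c by (simp add: br_idem Sobj_def idem_Cmp)
   moreover have "emb (mu z psi k 0) : Hom TE (Sobj z psi) (br C \<delta> z)" "emb (mu z psi 0 k) : Hom TE (br C \<delta> z) (Sobj z psi)"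
    using m psi c e[of "cdim z psi" "crep z psi"] zo T0_Cmp_Idn[OF zo zo e] T0_Idn_Cmp[OF zo zo e]
    by (auto simp: br_idem Sobj_def idem_Hom)
   moreover have "Sobj z psi : Simp" using psi z by (auto simp: Simp_def)
   ultimately show ?thesis using fac_Suc[OF fac_zero] by (metis add_0_right)
  qed
  hence "EX n. fac (br C \<delta> z) n (SUM psi:IC z. SUM k<cdim z psi. emb (mu z psi k k))" by (intro fac_sum) auto
  thus ?thesis by (simp add: emb_sum[symmetric] sum_mu[OF zo])
 qed
 have b: "EX n. fac (br C \<delta> x) n (emb (idT x))" if x: "ob x" for x
 proof -
  \<comment> \<open>At level one above its size, the identity of \<open>x\<close> is itself the
    identity of the ideal, so the expansion in \<open>Ssp\<close> applies to it.\<close>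
  obtain L where L: "ALL (z, f, g):set L. z : X & size z < Suc (size x) & subquotient C z x & f : HT x z & g : HT z x"
   "idT x = (SUM (z, f, g)<-L. ct x z x g (ct x z z (eps z) f))"
   using Ssp_list[OF cid(2)[OF x, of "Suc (size x)"]] cid_large[OF x] by auto
  have "EX n. fac (br C \<delta> x) n (emb (SUM (z, f, g)<-L. ct x z x g (ct x z z (eps z) f)))" using L(1)
  proof (induction L)
   case (Cons a L)
   obtain z f g where a: "a = (z, f, g)" "z : X" "f : HT x z" "g : HT z x" using Cons.prems by (cases a) auto
   have "emb f : Hom TE (br C \<delta> x) (br C \<delta> z)" "emb g : Hom TE (br C \<delta> z) (br C \<delta> x)" using br_Hom a x by auto
   moreover obtain n where "fac (br C \<delta> z) n (emb (eps z))" using e[OF a(2)] by blast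
   moreover have "Cmp TE (br C \<delta> x) (br C \<delta> z) (br C \<delta> x) (emb g) (Cmp TE (br C \<delta> x) (br C \<delta> z) (br C \<delta> z) (emb (eps z)) (emb f)) =
    emb (ct x z x g (ct x z z (eps z) f))" by (simp add: br_idem idem_Cmp)
   ultimately have "EX n. fac (br C \<delta> x) n (emb (ct x z x g (ct x z z (eps z) f)))"
    using fac_sandwich[of "br C \<delta> z" n "emb (eps z)" "emb g" "br C \<delta> x" "emb f"] a x by auto
   moreover obtain m where "fac (br C \<delta> x) m (emb (SUM (z, f, g)<-L. ct x z x g (ct x z z (eps z) f)))"
    using Cons by auto
   ultimately show ?case using fac_add[of "br C \<delta> x"] by (simp add: a(1) emb_add) blast
  qed (auto intro: fac_zero)
  thus ?thesis by (simp only: L(2)[symmetric])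
 qed
 let ?xs = "fst P"
 have o: "?xs : lists (Obj TT)" "?xs : Obj AC" using P by (auto simp: TE_simps T0.additive_simps)
 have p: "snd P : Hom AC ?xs ?xs" "Cmp AC ?xs ?xs ?xs (snd P) (snd P) = snd P" using P by (auto simp: TE_simps)
 note ip = T0.inc_prj[OF o(1)] and cH = AC.Cmp_Hom and ca = AC.Cmp_assoc
 have "EX n. fac P n (Cmp AC ?xs [?xs ! m] ?xs (Cmp AC [?xs ! m] ?xs ?xs (snd P) (T0.inc ?xs m)) (Cmp AC ?xs ?xs [?xs ! m] (T0.prj ?xs m) (snd P)))"
  if m: "m < length ?xs" for m
 proof -
  have xm: "?xs ! m : obj C" using o(1) m by (auto simp: in_lists_conv_set)
  hence bm: "[?xs ! m] : Obj AC" by (simp add: T0.additive_simps)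
  note i = ip(1)[OF m] and j = ip(2)[OF m]
  have h: "Cmp AC [?xs ! m] ?xs ?xs (snd P) (T0.inc ?xs m) : Hom AC [?xs ! m] ?xs"
   "Cmp AC ?xs ?xs [?xs ! m] (T0.prj ?xs m) (snd P) : Hom AC ?xs [?xs ! m]" using cH o bm i j p by blast+
  have "Cmp AC [?xs ! m] ?xs ?xs (snd P) (T0.inc ?xs m) : Hom TE (br C \<delta> (?xs ! m)) P"
   "Cmp AC ?xs ?xs [?xs ! m] (T0.prj ?xs m) (snd P) : Hom TE P (br C \<delta> (?xs ! m))"
   using h ca[OF bm o(2,2,2) i p(1,1)] ca[OF o(2,2,2) bm p(1,1) j] p AC.Cmp_Idn[OF bm o(2) h(1)] AC.Idn_Cmp[OF o(2) bm h(2)]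
   by (auto simp: TE_simps br_def)
  moreover obtain n where "fac (br C \<delta> (?xs ! m)) n (emb (idT (?xs ! m)))" using b[OF xm] by blast
  ultimately have "fac P n (Cmp TE P (br C \<delta> (?xs ! m)) P (Cmp AC [?xs ! m] ?xs ?xs (snd P) (T0.inc ?xs m))
   (Cmp TE P (br C \<delta> (?xs ! m)) (br C \<delta> (?xs ! m)) (emb (idT (?xs ! m))) (Cmp AC ?xs ?xs [?xs ! m] (T0.prj ?xs m) (snd P))))"
   using fac_sandwich P xm br_Obj by blast
  thus ?thesis
   using AC.Idn_Cmp[OF o(2) bm h(2)] unfolding T0.emb_Idn[symmetric] TE_simps(4) br_def fst_conv by auto
 qed
 hence "EX n. fac P n (SUM m<length ?xs. Cmp AC ?xs [?xs ! m] ?xs (Cmp AC [?xs ! m] ?xs ?xs (snd P) (T0.inc ?xs m)) (Cmp AC ?xs ?xs [?xs ! m] (T0.prj ?xs m) (snd P)))"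
  by (intro fac_sum) auto
 also have "(SUM m<length ?xs. Cmp AC ?xs [?xs ! m] ?xs (Cmp AC [?xs ! m] ?xs ?xs (snd P) (T0.inc ?xs m)) (Cmp AC ?xs ?xs [?xs ! m] (T0.prj ?xs m) (snd P))) =
  (SUM m<length ?xs. Cmp AC ?xs ?xs ?xs (snd P) (Cmp AC ?xs ?xs ?xs (Cmp AC ?xs [?xs ! m] ?xs (T0.inc ?xs m) (T0.prj ?xs m)) (snd P)))"
 proof (intro sum.cong refl)
  fix m assume "m : {..<length ?xs}"
  hence m: "m < length ?xs" by simp
  have "?xs ! m : obj C" using o(1) m by (auto simp: in_lists_conv_set)
  hence bm: "[?xs ! m] : Obj AC" by (simp add: T0.additive_simps)
  note i = ip(1)[OF m] and j = ip(2)[OF m]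
  have h: "Cmp AC ?xs ?xs [?xs ! m] (T0.prj ?xs m) (snd P) : Hom AC ?xs [?xs ! m]" using cH o bm i j p by blast+
  show "Cmp AC ?xs [?xs ! m] ?xs (Cmp AC [?xs ! m] ?xs ?xs (snd P) (T0.inc ?xs m)) (Cmp AC ?xs ?xs [?xs ! m] (T0.prj ?xs m) (snd P)) =
   Cmp AC ?xs ?xs ?xs (snd P) (Cmp AC ?xs ?xs ?xs (Cmp AC ?xs [?xs ! m] ?xs (T0.inc ?xs m) (T0.prj ?xs m)) (snd P))"
   using ca[OF o(2) bm o(2,2) h i p(1)] ca[OF o(2,2) bm o(2) p(1) j i] by simp
 qed
 also have "... = snd P"
  unfolding AC.Cmp_sum_right[symmetric] AC.Cmp_sum_left[symmetric] ip(4) using AC.Idn_Cmp[OF o(2,2) p(1)] p by simp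
 finally show ?thesis by (simp add: TE_simps(3))
qed

text \<open>Split off the simple objects through which the identity of \<open>P\<close> factors, one by one.\<close>

lemma simple_class:
 assumes "P : Obj TE"
 shows "EX a. Poly_Mapping.keys a \<subseteq> Simp & frag_of P - a : TE.GR"
proof -
 obtain n where "fac P n (Idn TE P)" using fac_Idn[OF assms] by blast
 thus ?thesis using assms
 proof (induction n arbitrary: P)
  case 0
  hence "Idn TE P = 0" by (auto elim: fac.cases)
  have "is_complement TE P P 0 P 0"
   by (rule TE.complementI[where p = 0 and q = 0]) (use 0 \<open>Idn TE P = 0\<close> in auto)
  hence "frag_of P - frag_of P - frag_of P : TE.GR" by (rule TE.GR_complement)
  hence "- (frag_of P - frag_of P - frag_of P) : TE.GR" by (rule TE.GR_cl(3))
  thus ?case by (intro exI[of _ 0]) simp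
 next
  case (Suc n)
  obtain S p q M where a: "Idn TE P = Cmp TE P S P p q + M" "S : Simp" "p : Hom TE S P" "q : Hom TE P S" "fac P n M"
   using Suc.prems(1) by (auto elim: fac.cases)
  note P = Suc.prems(2)
  obtain z psi where z: "z : X" "psi : IC z" "S = Sobj z psi" using a by (auto simp: Simp_def)
  have top: "is_top0_chi C \<delta> z psi S" using top0_chi_Sobj z by simp
  note S = top0_chi_Obj[OF z(1) top]
  show ?case
  proof (cases "p = 0")
   case True
   thus ?thesis using Suc.IH[OF _ P] a(1,5) by simp
  next
   case False
   then obtain g where g: "g : Hom TE P S" "Cmp TE S P S g p ~= 0" using TE_nondegenerate[OF S(1) P a(3)] by blast
   have "Cmp TE S P S g p : Hom TE S S" using TE.Cmp_Hom S P a g by blast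
   then obtain l where l: "Cmp TE S P S g p = Scl TE l (Idn TE S)" using End_top0_chi[OF _ top] z by auto
   define g' where "g' = Scl TE (1 / l) g"
   have g': "g' : Hom TE P S" "Cmp TE S P S g' p = Idn TE S"
    using Scl_Idn_inverse(2)[OF S P g(1) a(3) g(2) l] TE.Hom_Scl g S P by (auto simp: g'_def)
   define Q where "Q = (fst P, Idn TE P - Cmp TE P S P p g')"
   have c: "is_complement TE P S p Q (Idn TE P - Cmp TE P S P p g')"
    unfolding Q_def by (rule TE_split_complement[OF S(1) P a(3) g'])
   let ?k = "Idn TE P - Cmp TE P S P p g'"
   have pg: "Cmp TE P S P p g' : Hom TE P P" using TE.Cmp_Hom S P a g' by blast
   have k: "?k : Hom TE P P" using TE.Hom_diff TE.Idn_Hom P pg by blast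
   have Q: "Q : Obj TE" "?k : Hom TE Q P" using TE.complementE[OF c] by metis+
   have kk: "Cmp TE P P P ?k ?k = ?k" using Q(1) by (simp add: TE_simps Q_def)
   hence kQ: "?k : Hom TE P Q" using k by (simp add: TE_simps Q_def)
   have kp: "Cmp TE S P P ?k p = 0"
    using TE.Idn_Cmp[OF S(1) P a(3)] TE.Cmp_assoc[OF S(1) P S(1) P a(3) g'(1) a(3)] g'(2) TE.Cmp_Idn[OF S(1) P a(3)]
    by (simp add: TE.Cmp_diff_left)
   \<comment> \<open>Compression to the complement kills the term through \<open>p\<close>, because
     \<open>?k\<close> after \<open>p\<close> is zero; the other \<open>n\<close> terms remain and
     sum to the identity of \<open>Q\<close>.\<close>
   have "Cmp TE P P P ?k (Cmp TE P P P (Cmp TE P S P p q) ?k) = 0"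
    using TE.Cmp_assoc[OF P P S(1) P k a(4,3)] TE.Cmp_assoc[OF P S(1) P P TE.Cmp_Hom[OF P P S(1) k a(4)] a(3) k] kp by simp
   hence "Cmp TE P P P ?k (Cmp TE P P P M ?k) = Cmp TE P P P ?k (Cmp TE P P P (Idn TE P) ?k)"
    unfolding a(1) by (simp add: TE.Cmp_add_left TE.Cmp_add_right)
   also have "... = Idn TE Q" using TE.Idn_Cmp[OF P P k] kk by (simp add: TE_simps(3) Q_def)
   finally have "fac Q n (Idn TE Q)"
    using fac_sandwich[OF a(5) kQ Q(2) P Q(1)] by (simp add: TE_simps(4) Q_def)
   then obtain a' where a': "Poly_Mapping.keys a' \<subseteq> Simp" "frag_of Q - a' : TE.GR"
    using Suc.IH[of Q] Q(1) by blast
   have "(frag_of P - frag_of S - frag_of Q) + (frag_of Q - a') : TE.GR"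
    using TE.GR_cl(2)[OF TE.GR_complement[OF c] a'(2)] .
   thus ?thesis
    using a'(1) a(2) keys_add[of a' "frag_of S"] by (intro exI[of _ "a' + frag_of S"]) (auto simp: algebra_simps)
  qed
 qed
qed

end

section \<open>Products of simple objects\<close>

lemma (in category) pullback_unpaste:
 assumes "pbk f (g ** h) (a ** a') b'" "pbk f g a b" "b ** a' = h ** b'"
  "ar a'" "ar h" "cod a' = dom a" "dom a' = dom b'" "cod h = dom g"
 shows "pbk b h a' b'"
proof -
 note F = pbkD[OF assms(1)] and G = pbkD[OF assms(2)]
 show ?thesis
 proof (rule pullbackI)
  fix c d
  assume *: "ar c" "ar d" "dom c = dom d" "cod c = dom b"
   "cod d = dom h" "b ** c = h ** d"
  have "f ** (a ** c) = g ** (b ** c)" using eq_cmp[OF G(9), of c] * F G by simp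
  also have "... = (g ** h) ** d" using * F G assms by simp
  finally obtain u where u: "u:arr C" "dom u = dom d" "cod u = dom b'"
    "(a ** a') ** u = a ** c" "b' ** u = d"
   using pullback_ex[OF assms(1), of "a ** c" d] * F G assms(5,8) by auto
  have "b ** (a' ** u) = h ** (b' ** u)"
   using eq_cmp[OF assms(3), of u] u F G assms(4-) by simp
  hence "a' ** u = c"
   using pullback_un[OF assms(2), of "a' ** u" c] u * F G assms(4-) by simp
  thus "EX u:arr C. dom u = dom d & cod u = dom b' & a' ** u = c & b' ** u = d"
   using u by blast
 next
  fix u v
  assume *: "ar u" "ar v" "dom u = dom v" "cod u = dom b'" "cod v = dom b'"
   "a' ** u = a' ** v" "b' ** u = b' ** v"
  thus "u = v"
   using pullback_un[OF assms(1), of u v] F G assms(4-) by simp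
 qed (use F G assms in auto)
qed

text \<open>Carrying along an extra coordinate does not change a fibre product: the square is
  obtained by cancelling the cartesian square of a projection.\<close>

lemma (in finitely_complete_category) pullback_pairing:
 assumes ab: "pbk q g1 a b" and g: "ar g2" "dom g2 = dom g1" "cod g2 = y"
 shows "pbk (pg (q ** pr1 C (dom q) y) (pr2 C (dom q) y)) (pg g1 g2) (pg a (g2 ** b)) b"
  and "pbk (pg (pr1 C y (dom q)) (q ** pr2 C y (dom q))) (pg g2 g1) (pg (g2 ** b) a) b"
proof -
 note F = pbkD[OF ab]
 have o: "ob y" "cod g1 : obj C" using g F by auto
 show "pbk (pg (q ** pr1 C (dom q) y) (pr2 C (dom q) y)) (pg g1 g2) (pg a (g2 ** b)) b"
  by (rule pullback_unpaste[OF _ pullback_pr1[of q y, OF _ _ refl refl]]) (use ab F g o in simp_all)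
 show "pbk (pg (pr1 C y (dom q)) (q ** pr2 C y (dom q))) (pg g2 g1) (pg (g2 ** b) a) b"
  by (rule pullback_unpaste[OF _ pullback_pr2[of q y, OF _ _ refl refl]]) (use ab F g o in simp_all)
qed

context exact_malcev_category
begin

text \<open>Goursat's lemma for a relation on three objects, regarded as a relation from the product
  of the last two to the first. When it is not a partial surjection onto the first object, a smaller
  object can take that place.\<close>

lemma small_factor:
 assumes p: "ar p1" "ar p2" "ar p3" "dom p1 = dom p3" "dom p2 = dom p3"
  and mono: "!!u v. ar u ==> ar v ==> dom u = dom v ==> cod u = dom p3 ==> cod v = dom p3 ==>
   p1 ** u = p1 ** v ==> p2 ** u = p2 ** v ==> p3 ** u = p3 ** v ==> u = v"
  and n: "~ (mon (pg p2 p3) & srj p1)"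
 obtains p q g1 g2 g3 a b where "ar p" "dom p = dom q" "cod p = cod p1" "pbk q g1 a b"
  "ar g2" "ar g3" "dom g2 = dom g1" "dom g3 = dom g1" "cod g2 = cod p2" "cod g3 = cod p3"
  "size (cod q) < size (cod p1)" "p ** a = p1" "g2 ** b = p2" "g3 ** b = p3"
proof -
 have m: "mon (pg (pg p2 p3) p1)"
 proof (subst monic_pairing_iff)
  show "ALL u:arr C. ALL v:arr C. dom u = dom v --> cod u = dom (pg p2 p3) --> cod v = dom (pg p2 p3) -->
    pg p2 p3 ** u = pg p2 p3 ** v --> p1 ** u = p1 ** v --> u = v"
  proof (intro ballI impI)
   fix u v assume *: "ar u" "ar v" "dom u = dom v" "cod u = dom (pg p2 p3)" "cod v = dom (pg p2 p3)"
    "pg p2 p3 ** u = pg p2 p3 ** v" and 1: "p1 ** u = p1 ** v"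
   have uv: "cod u = dom p3" "cod v = dom p3" using * p by auto
   have "pg (p2 ** u) (p3 ** u) = pg (p2 ** v) (p3 ** v)" using * p by simp
   from pairing_injD[OF this] have "p2 ** u = p2 ** v" "p3 ** u = p3 ** v" using *(1-3) uv p by simp_all
   thus "u = v" using mono[OF *(1-3) uv 1] by blast
  qed
 qed (use p in auto)
 have a: "pg p2 p3 : arr C" "dom (pg p2 p3) = dom p1" using p by auto
 from a(1) p(1) a(2) m n show thesis
 proof (cases rule: goursat)
  case (sub m k)
  have "pbk (idt C (dom m)) k k (idt C (dom k))" using pullback_sym[OF pullback_trivial[of k "dom m"]] sub by simp
  show thesis
   by (rule that[OF _ _ _ \<open>pbk (idt C (dom m)) k k _\<close>, of m p2 p3]) (use sub p in simp_all)
 next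
  case (quot f s1 s2 a)
  note F = pbkD[OF quot(7)]
  have o: "cod p2 : obj C" "cod p3 : obj C" "cod s1 = pd (cod p2) (cod p3)" "ar f" using p quot by auto
  let ?g2 = "pr1 C (cod p2) (cod p3) ** s1" and ?g3 = "pr2 C (cod p2) (cod p3) ** s1"
  have "?g2 ** a = pr1 C (cod p2) (cod p3) ** pg p2 p3" "?g3 ** a = pr2 C (cod p2) (cod p3) ** pg p2 p3"
   using quot(3-6) F(1-8) o by (simp_all add: quot(8)[symmetric])
  hence g23: "?g2 ** a = p2" "?g3 ** a = p3" using p by simp_all
  show thesis
   by (rule that[OF _ _ _ pullback_sym[OF quot(7)], of "idt C (cod p1)" ?g2 ?g3])
    (use g23 quot(2-5,9) o p in simp_all)
 qed
qed

end

context degree_function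
begin

text \<open>Precomposing a relation on three objects with a span in one tensor factor: the fibre
  product is taken in that coordinate and the other one is carried along.\<close>

lemma tri_cmp:
 assumes ab: "pbk q g1 a b" and p: "ar p" "dom p = dom q" "cod p = x" "cod q = w"
  and g: "ar g2" "ar g3" "dom g2 = dom g1" "dom g3 = dom g1" "cod g2 = y" "cod g3 = z"
 shows "ct (pd x y) (pd w y) z (sp (pg g1 g2) g3) (tn x w y y (sp p q) (idT y)) = sp (pg (p ** a) (g2 ** b)) (g3 ** b)"
  and "ct (pd y x) (pd y w) z (sp (pg g2 g1) g3) (tn y y x w (idT y) (sp p q)) = sp (pg (g2 ** b) (p ** a)) (g3 ** b)"
proof -
 note F = pbkD[OF ab]
 have o: "ob x" "ob y" "ob w" "ob z" "ar q" "ar g1" "cod g1 = w" using p g F by auto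
 have id: "idT y = sp (idt C y) (idt C y)" using o by (simp add: graph_sp)
 note P = pullback_pairing[OF ab g(1,3,5)]
 from Cmp_sp[OF _ _ _ _ g(2) _ P(1), of "prodm p (idt C y)" "pd x y" "pd w y" z]
 show "ct (pd x y) (pd w y) z (sp (pg g1 g2) g3) (tn x w y y (sp p q) (idT y)) = sp (pg (p ** a) (g2 ** b)) (g3 ** b)"
  using TenM_sp[OF p(1) o(5) p(2), of "idt C y" "idt C y" x w y y] o p g F(1-8) id by simp
 from Cmp_sp[OF _ _ _ _ g(2) _ P(2), of "prodm (idt C y) p" "pd y x" "pd y w" z]
 show "ct (pd y x) (pd y w) z (sp (pg g2 g1) g3) (tn y y x w (idT y) (sp p q)) = sp (pg (g2 ** b) (p ** a)) (g3 ** b)"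
  using TenM_sp[OF _ _ _ p(1) o(5) p(2), of "idt C y" "idt C y" y y x w] o p g F(1-8) id by simp
qed

end

section \<open>Relations on three objects\<close>

context degree_function
begin

lemma triple_facts:
 assumes r: "r : Sub (prd3 C x y z)" and o: "ob x" "ob y" "ob z"
 defines "p1 == proj1 C x y z ** rep r" and "p2 == proj2 C x y z ** rep r" and "p3 == proj3 C x y z ** rep r"
 shows "ar p1" "ar p2" "ar p3" "dom p1 = dom (rep r)" "dom p2 = dom (rep r)" "dom p3 = dom (rep r)"
  "cod p1 = x" "cod p2 = y" "cod p3 = z" "pg (pg p1 p2) p3 = rep r" "basis r = sp (pg p1 p2) p3"
  "pr1 C (pd x y) z ** rep r = pg p1 p2" "pr2 C (pd x y) z ** rep r = p3"
proof -
 note R = rep_sub[OF r]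
 let ?m = "pr1 C (pd x y) z ** rep r"
 have m: "?m : arr C" "cod ?m = pd x y" using R o by (auto simp: prd3_def)
 have p: "p1 = pr1 C x y ** ?m" "p2 = pr2 C x y ** ?m" "p3 = pr2 C (pd x y) z ** rep r"
  using R o by (auto simp: p1_def p2_def p3_def proj1_def proj2_def proj3_def prd3_def)
 show m12: "pr1 C (pd x y) z ** rep r = pg p1 p2" using pairing_eta[OF m o(1,2)] p by simp
 show "ar p1" "ar p2" "ar p3" "dom p1 = dom (rep r)" "dom p2 = dom (rep r)" "dom p3 = dom (rep r)"
  "cod p1 = x" "cod p2 = y" "cod p3 = z" unfolding p using m R o by (auto simp: prd3_def)
 show "pr2 C (pd x y) z ** rep r = p3" by (simp add: p)
 show e: "pg (pg p1 p2) p3 = rep r"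
  unfolding m12[symmetric] p(3) by (rule pairing_eta) (use R o in \<open>auto simp: prd3_def\<close>)
 show "basis r = sp (pg p1 p2) p3" unfolding e using bas_monic[OF R(1)] R by simp
qed

lemma Tset_sub: "r : Tset C x y z ==> r : Sub (prd3 C x y z)"
 by (simp add: Tset_def)

lemma Tset_psurj:
 assumes r: "r : Tset C x y z" and o: "ob x" "ob y" "ob z"
 shows "r : psurj (pd x y) z"
 using r triple_facts[OF Tset_sub[OF r] o] by (simp add: Tset_def psurj_def Let_def prd3_def)

lemma bas_triple:
 assumes r: "r : Sub (prd3 C x y z)" and o: "ob x" "ob y" "ob z"
  and h: "ar h1" "ar h2" "ar h3" "dom h1 = dom h3" "dom h2 = dom h3" "cod h1 = x" "cod h2 = y" "cod h3 = z"
  and nz: "sp (pg h1 h2) h3 r ~= 0"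
 obtains s where "srj s" "dom s = dom h3" "cod s = dom (rep r)"
  "(proj1 C x y z ** rep r) ** s = h1" "(proj2 C x y z ** rep r) ** s = h2" "(proj3 C x y z ** rep r) ** s = h3"
proof -
 let ?h = "pg (pg h1 h2) h3"
 let ?p1 = "proj1 C x y z ** rep r" and ?p2 = "proj2 C x y z ** rep r" and ?p3 = "proj3 C x y z ** rep r"
 have ha: "?h : arr C" "dom ?h = dom h3" using h by auto
 have im: "im C ?h = r" using nz by (auto simp: bas_def basis_def split: if_splits)
 define s where "s = surj_part C ?h"
 have s: "ar s" "dom s = dom h3" "cod s = dom (rep r)" "rep r ** s = ?h" "srj s"
  using im_fact[OF ha(1)] ha im by (auto simp: s_def)
 note t = triple_facts[OF r o]
 have "pg (pg (?p1 ** s) (?p2 ** s)) (?p3 ** s) = pg (pg ?p1 ?p2) ?p3 ** s"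
  using t(1-9) s(1-3) by simp
 also have "... = ?h" unfolding t(10) by (rule s(4))
 finally have "pg (pg (?p1 ** s) (?p2 ** s)) (?p3 ** s) = ?h" .
 from pairing_injD[OF this] have 1: "pg (?p1 ** s) (?p2 ** s) = pg h1 h2" "?p3 ** s = h3"
  using t(1-9) s(1-3) h by simp_all
 from pairing_injD[OF 1(1)] have "?p1 ** s = h1" "?p2 ** s = h2" using t(1-9) s(1-3) h by simp_all
 thus thesis using that s 1(2) by blast
qed

text \<open>The analogue of \<open>Jid_psurj\<close> in two variables. If an element of
  \<open>Tset\<close> occurred in a morphism through the product of \<open>w\<close> and
  \<open>w'\<close>, recombination of points would make \<open>x\<close> no larger than
  \<open>w\<close> and \<open>y\<close> no larger than \<open>w'\<close>, against
  \<open>sz\<close>.\<close>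

lemma Tset_small:
 assumes o: "ob x" "ob y" "ob z" "ob w" "ob w'" and f: "f : HT x w" and g: "g : HT y w'"
  and sz: "size w < size x \<or> size w' < size y" and a: "a : Tset C x y z" and u: "u : HT (pd w w') z"
 shows "ct (pd x y) (pd w w') z u (tn x w y w' f g) a = 0"
 using f o(1,4)
proof (induction rule: Hom_T0_induct)
 case (sp p q)
 note 1 = sp(1-5)
 show ?case using g o(2,5)
 proof (induction rule: Hom_T0_induct)
  case (sp p' q')
  note 2 = sp(1-5)
  have o': "pd w w' : obj C" using o by simp
  show ?case using u o' o(3)
  proof (induction rule: Hom_T0_induct)
   case (sp m g3)
   note 3 = sp(1-5)
   obtain alpha beta where ab: "pbk (prodm q q') m alpha beta" using ex_pullback[of "prodm q q'" m] 1 2 3 by auto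
   note F = pbkD[OF ab]
   define alpha1 alpha2 where "alpha1 = pr1 C (dom q) (dom q') ** alpha" and "alpha2 = pr2 C (dom q) (dom q') ** alpha"
   have A: "alpha1 : arr C" "alpha2 : arr C" "dom alpha1 = dom beta" "dom alpha2 = dom beta" "cod alpha1 = dom q" "cod alpha2 = dom q'"
    "ar beta" "cod beta = dom g3"
    using F 1 2 3 by (auto simp: alpha1_def alpha2_def)
   have alpha: "pg alpha1 alpha2 = alpha" unfolding alpha1_def alpha2_def by (rule pairing_eta) (use F 1 2 in auto)
   let ?p1 = "proj1 C x y z ** rep a" and ?p2 = "proj2 C x y z ** rep a" and ?p3 = "proj3 C x y z ** rep a"
   note t = triple_facts[OF Tset_sub[OF a] o(1-3)]
   have a': "srj ?p1" "srj ?p2" "mon (pg ?p2 ?p3)" "mon (pg ?p1 ?p3)"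
    using a by (auto simp: Tset_def Let_def)
   show ?case
   proof (rule ccontr)
    assume n: "~ ?thesis"
    have "ct (pd x y) (pd w w') z (sp m g3) (tn x w y w' (sp p q) (sp p' q')) = sp (prodm p p' ** alpha) (g3 ** beta)"
     using Cmp_sp[OF _ _ _ 3(1,2,3) ab, of "prodm p p'"] TenM_sp[of p q p' q' x w y w'] 1 2 3 by simp
    also have "prodm p p' ** alpha = pg (p ** alpha1) (p' ** alpha2)"
     unfolding alpha[symmetric] using A 1 2 by simp
    finally have nz: "sp (pg (p ** alpha1) (p' ** alpha2)) (g3 ** beta) a ~= 0" using n by simp
    show False
    proof (rule bas_triple[OF Tset_sub[OF a] o(1-3) _ _ _ _ _ _ _ _ nz])
     fix s assume s: "srj s" "dom s = dom (g3 ** beta)" "cod s = dom (rep a)"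
      "?p1 ** s = p ** alpha1" "?p2 ** s = p' ** alpha2" "?p3 ** s = g3 ** beta"
     have ss: "dom s = dom beta" "ar s" using s(1,2) 3 A by auto
     have e: "?p1 ** (s ** c) = p ** (alpha1 ** c)" "?p2 ** (s ** c) = p' ** (alpha2 ** c)" "?p3 ** (s ** c) = g3 ** (beta ** c)"
      if "ar c" "cod c = dom beta" for c
      using eq_cmp[OF s(4), of c] eq_cmp[OF s(5), of c] eq_cmp[OF s(6), of c] t(1-9) s(3) ss A 1 2 3 that by simp_all
     \<comment> \<open>Points with the same images in \<open>w\<close> and in \<open>w'\<close> can
       be recombined: the first coordinate is taken from \<open>c1\<close>, the second from
       \<open>c2\<close>, the third from \<open>c'\<close>.\<close>
     have ex: "EX d. ar d & dom d = dom c' & cod d = dom beta &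
       ?p1 ** (s ** d) = ?p1 ** (s ** c1) & ?p2 ** (s ** d) = ?p2 ** (s ** c2) & ?p3 ** (s ** d) = ?p3 ** (s ** c')"
      if c: "ar c1" "ar c2" "ar c'" "dom c1 = dom c'" "dom c2 = dom c'" "cod c1 = dom beta" "cod c2 = dom beta"
       "cod c' = dom beta" "q ** (alpha1 ** c1) = q ** (alpha1 ** c')" "q' ** (alpha2 ** c2) = q' ** (alpha2 ** c')" for c1 c2 c'
     proof -
      have "prodm q q' ** pg (alpha1 ** c1) (alpha2 ** c2) = prodm q q' ** (alpha ** c')"
       unfolding alpha[symmetric] using c A 1 2 by simp
      also have "... = m ** (beta ** c')" by (rule eq_cmp[OF F(9)]) (use c F(1-8) in simp_all)
      finally obtain d where d: "ar d" "dom d = dom c'" "cod d = dom beta" "alpha ** d = pg (alpha1 ** c1) (alpha2 ** c2)" "beta ** d = beta ** c'"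
       using pullback_ex[OF ab, of "pg (alpha1 ** c1) (alpha2 ** c2)" "beta ** c'"] c A F(1-8) 1 2 by auto
      have "pg (alpha1 ** d) (alpha2 ** d) = pg (alpha1 ** c1) (alpha2 ** c2)"
       using d(1-4) A unfolding alpha[symmetric] by simp
      from pairing_injD[OF this] have "alpha1 ** d = alpha1 ** c1" "alpha2 ** d = alpha2 ** c2" using d c A by simp_all
      thus ?thesis using e[OF d(1,3)] e[OF c(1,6)] e[OF c(2,7)] e[OF c(3,8)] d by auto
     qed
     have "size (cod ?p1) <= size (cod (q ** alpha1))"
     proof (rule size_le_fibre[OF s(1) a'(1) _ a'(3)])
      fix c c' assume c: "ar c" "ar c'" "dom c = dom c'" "cod c = dom s" "cod c' = dom s" "(q ** alpha1) ** c = (q ** alpha1) ** c'"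
      then obtain d where "ar d" "dom d = dom c'" "cod d = dom beta" "?p1 ** (s ** d) = ?p1 ** (s ** c)"
       "?p2 ** (s ** d) = ?p2 ** (s ** c')" "?p3 ** (s ** d) = ?p3 ** (s ** c')"
       using ex[of c c' c'] ss A 1 2 by auto
      thus "EX d. ar d & dom d = dom c' & cod d = dom s & ?p1 ** (s ** d) = ?p1 ** (s ** c) &
        pg ?p2 ?p3 ** (s ** d) = pg ?p2 ?p3 ** (s ** c')"
       using c(2,5) ss t(1-9) s(3) by (intro exI[of _ d]) simp
     qed (use s ss t(1-9) A 1 in simp_all)
     moreover have "size (cod ?p2) <= size (cod (q' ** alpha2))"
     proof (rule size_le_fibre[OF s(1) a'(2) _ a'(4)])
      fix c c' assume c: "ar c" "ar c'" "dom c = dom c'" "cod c = dom s" "cod c' = dom s" "(q' ** alpha2) ** c = (q' ** alpha2) ** c'"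
      then obtain d where "ar d" "dom d = dom c'" "cod d = dom beta" "?p1 ** (s ** d) = ?p1 ** (s ** c')"
       "?p2 ** (s ** d) = ?p2 ** (s ** c)" "?p3 ** (s ** d) = ?p3 ** (s ** c')"
       using ex[of c' c c'] ss A 1 2 by auto
      thus "EX d. ar d & dom d = dom c' & cod d = dom s & ?p2 ** (s ** d) = ?p2 ** (s ** c) &
        pg ?p1 ?p3 ** (s ** d) = pg ?p1 ?p3 ** (s ** c')"
       using c(2,5) ss t(1-9) s(3) by (intro exI[of _ d]) simp
     qed (use s ss t(1-9) A 2 in simp_all)
     ultimately show False using sz t(7,8) A 1 2 by simp
    qed (use 1 2 3 A in simp_all)
   qed
  qed (simp_all only: ct_bilinear Cmp_T0_zero, simp_all add: fun_simps Scl_T0_apply)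
 qed (simp_all only: ct_bilinear Cmp_T0_zero TenM_T0_bilinear TenM_T0_zero, simp_all add: fun_simps Scl_T0_apply)
qed (simp_all only: ct_bilinear Cmp_T0_zero TenM_T0_bilinear TenM_T0_zero, simp_all add: fun_simps Scl_T0_apply)

lemma tn_Cmp:
 assumes "ob x" "ob x'" "ob x''" "ob y" "ob y'" "ob y''"
  "f : HT x x'" "f' : HT x' x''" "g : HT y y'" "g' : HT y' y''"
 shows "ct (pd x y) (pd x' y') (pd x'' y'') (tn x' x'' y' y'' f' g') (tn x x' y y' f g) =
  tn x x'' y y'' (ct x x' x'' f' f) (ct y y' y'' g' g)"
 using T0.TenM_Cmp[of x x' x'' y y' y'' f f' g g'] assms by simp

text \<open>An element of the ideal in one tensor factor is a combination of composites through
  smaller objects, and the other factor passes through its own identity; so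
  \<open>Tset_small\<close> applies termwise.\<close>

lemma Tset_Jid:
 assumes o: "ob x" "ob y" "ob z" and a: "a : Tset C x y z" and u: "u : HT (pd x y) z"
 shows "c : Jid (size x) x x ==> v : HT y y ==> ct (pd x y) (pd x y) z u (tn x x y y c v) a = 0"
  and "v : HT x x ==> c : Jid (size y) y y ==> ct (pd x y) (pd x y) z u (tn x x y y v c) a = 0"
proof -
 have o': "pd x y : obj C" using o by simp
 have *: "ct (pd x y) (pd x y) z u (tn x x y y (ct x w x g f) (ct y w' y g' f')) a = 0"
  if "ob w" "ob w'" "f : HT x w" "g : HT w x" "f' : HT y w'" "g' : HT w' y" "size w < size x \<or> size w' < size y" for w w' f g f' g'
 proof -
  note H = T0_TenM_Hom[OF o(1) that(1) o(2) that(2,3,5)] T0_TenM_Hom[OF that(1) o(1) that(2) o(2) that(4,6)]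
  have w: "pd w w' : obj C" using that by simp
  show ?thesis
   using tn_Cmp[OF o(1) that(1) o(1,2) that(2) o(2) that(3-6)] ct_assoc[OF o' w o' o(3) H u]
    Tset_small[OF o that(1,2,3,5,7) a T0_Cmp_Hom[OF w o' o(3) H(2) u]] by simp
 qed
 have I: "idT x : HT x x" "idT y : HT y y" using o by auto
 show "ct (pd x y) (pd x y) z u (tn x x y y c v) a = 0" if "c : Jid (size x) x x" "v : HT y y"
  using that(1)
 proof (induction rule: Jid_induct)
  case (ct w g f)
  thus ?case using *[OF ct(1) o(2) ct(3,4) that(2) I(2)] T0_Idn_Cmp[of y y v] that(2) o by simp
 qed (simp_all only: ct_bilinear Cmp_T0_zero TenM_T0_bilinear TenM_T0_zero, simp_all add: fun_simps Scl_T0_apply)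
 show "ct (pd x y) (pd x y) z u (tn x x y y v c) a = 0" if "v : HT x x" "c : Jid (size y) y y"
  using that(2)
 proof (induction rule: Jid_induct)
  case (ct w g f)
  thus ?case using *[OF o(1) ct(1) that(1) I(1) ct(3,4)] T0_Idn_Cmp[of x x v] that(1) o by simp
 qed (simp_all only: ct_bilinear Cmp_T0_zero TenM_T0_bilinear TenM_T0_zero, simp_all add: fun_simps Scl_T0_apply)
qed

text \<open>Pulling back along an automorphism moves its inverse to the other leg. Hence
  precomposition with \<open>t\<close> and \<open>u\<close> acts on the relation by
  \<open>t'\<close> and \<open>u'\<close>, whereas postcomposition acts by \<open>h\<close>
  itself.\<close>

lemma act3_Cmp:
 assumes o: "ob x" "ob y" "ob z" and r: "r : Sub (prd3 C x y z)"
  and t: "t : Aut x" "t' : Aut x" "t ** t' = idt C x" "t' ** t = idt C x"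
  and u: "u : Aut y" "u' : Aut y" "u ** u' = idt C y" "u' ** u = idt C y" and h: "h : Aut z"
 shows "ct (pd x y) z z (gr h) (ct (pd x y) (pd x y) z (basis r) (tn x x y y (gr t) (gr u))) = basis (act3 C x y z t' u' h r)"
  and "act3 C x y z t' u' h r : Sub (prd3 C x y z)"
proof -
 define p1 p2 p3 where "p1 = proj1 C x y z ** rep r" and "p2 = proj2 C x y z ** rep r" and "p3 = proj3 C x y z ** rep r"
 note p = triple_facts[OF r o, folded p1_def p2_def p3_def] and R = rep_sub[OF r]
 note T = Aut_arr(1-3)[OF t(1)] Aut_arr(1-3)[OF t(2)] and U = Aut_arr(1-3)[OF u(1)] Aut_arr(1-3)[OF u(2)] and H = Aut_arr(1-3)[OF h]
 have pb: "pbk s k (s' ** k) (idt C (dom k))"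
  if "ar s" "dom s = v" "cod s = v" "ar s'" "dom s' = v" "cod s' = v" "s ** s' = idt C v" "s' ** s = idt C v"
   "ar k" "cod k = v" for s s' k v
 proof (rule pullbackI)
  show "s ** (s' ** k) = k ** idt C (dom k)" using assoc[of k s' s] that by simp
  fix c d assume cd: "ar c" "ar d" "dom c = dom d" "cod c = dom s" "cod d = dom k" "s ** c = k ** d"
  have "s' ** (s ** c) = c" using assoc[of c s s'] that cd(1-5) by simp
  hence "(s' ** k) ** d = c" using that(1-6,9,10) cd by simp
  thus "EX u:arr C. dom u = dom d & cod u = dom (idt C (dom k)) & (s' ** k) ** u = c & idt C (dom k) ** u = d"
   using cd that by (intro bexI[of _ d]) simp_all
 qed (use that in simp_all)
 let ?s = "%a b. pg (a ** pr1 C x y) (b ** pr2 C x y)"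
 have "pbk (?s t u) (pg p1 p2) (?s t' u' ** pg p1 p2) (idt C (dom (pg p1 p2)))"
  by (rule pb[of _ "pd x y"]) (use p(1-9) T U o t u assoc[of "pr1 C x y" t' t] assoc[of "pr1 C x y" t t'] assoc[of "pr2 C x y" u' u] assoc[of "pr2 C x y" u u'] in simp_all)
 from Cmp_sp[OF _ _ _ _ _ _ this, of "?s (idt C x) (idt C y)" p3 "pd x y" "pd x y" z]
 have "ct (pd x y) (pd x y) z (basis r) (tn x x y y (gr t) (gr u)) = sp (pg (t' ** p1) (u' ** p2)) p3"
  using TenM_sp[of "idt C x" t "idt C y" u x x y y] p(1-9,11) T U o by (simp add: graph_sp)
 hence 1: "ct (pd x y) z z (gr h) (ct (pd x y) (pd x y) z (basis r) (tn x x y y (gr t) (gr u))) =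
   sp (pg (t' ** p1) (u' ** p2)) (h ** p3)"
  using ct_gr_sp[of "pg (t' ** p1) (u' ** p2)" p3 "pd x y" z h z] p(1-9) T U H by simp
 let ?m = "pg (pg (t' ** p1) (u' ** p2)) (h ** p3)"
 have act: "act3 C x y z t' u' h r = cls ?m"
  unfolding act3_def using R o T U H by (simp add: p1_def p2_def p3_def proj1_def proj2_def proj3_def prd3_def)
 obtain h' where h': "h' : Aut z" "h' ** h = idt C z" using Aut_inv[OF h] by metis
 let ?v = "pd x y"
 let ?k = "pg (?s t u ** pr1 C ?v z) (h' ** pr2 C ?v z)"
 have "?k ** ?m = pg (pg p1 p2) p3"
  using p(1-9) T U H o Aut_arr(1-3)[OF h'(1)] h'(2) t(3) u(3) assoc[of p1 t' t] assoc[of p2 u' u] assoc[of p3 h h'] by simp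
 hence "mon (?k ** ?m)" unfolding p(10) using R(1) by simp
 hence "mon ?m"
  by (rule monic_cancel) (use p(1-9) T U H o Aut_arr(1-3)[OF h'(1)] in simp_all)
 thus "act3 C x y z t' u' h r : Sub (prd3 C x y z)"
  "ct (pd x y) z z (gr h) (ct (pd x y) (pd x y) z (basis r) (tn x x y y (gr t) (gr u))) = basis (act3 C x y z t' u' h r)"
  unfolding act 1 using bas_monic p(1-9) T U H o by (auto simp: prd3_def intro!: sub_of_subobjs)
qed

end

context envelope
begin

text \<open>For a partial surjection from the product onto \<open>z\<close>, the conditions of
  \<open>Tset\<close> that can fail concern the first or the second object. By
  \<open>small_factor\<close> it then factors through an object smaller than \<open>x\<close> or
  \<open>y\<close>, and \<open>eps x\<close> or \<open>eps y\<close> kills that factor.\<close>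

lemma non_Tset:
 assumes o: "ob x" "ob y" "ob z" and a: "a : psurj (pd x y) z" "a ~: Tset C x y z"
 shows "ct (pd x y) (pd x y) z (basis a) (tn x x y y (eps x) (eps y)) = 0"
proof -
 have as: "a : Sub (prd3 C x y z)" using a psurj_sub by (auto simp: prd3_def)
 let ?p1 = "proj1 C x y z ** rep a" and ?p2 = "proj2 C x y z ** rep a" and ?p3 = "proj3 C x y z ** rep a"
 note p = triple_facts[OF as o]
 have o': "pd x y : obj C" using o by simp
 note ex = ce_facts(6,7)[OF o(1)] and ey = ce_facts(6,7)[OF o(2)]
 have m: "u = v" if uv: "ar u" "ar v" "dom u = dom v" "cod u = dom (rep a)" "cod v = dom (rep a)"
  "?p1 ** u = ?p1 ** v" "?p2 ** u = ?p2 ** v" "?p3 ** u = ?p3 ** v" for u v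
 proof -
  have "pg (pg ?p1 ?p2) ?p3 ** u = pg (pg ?p1 ?p2) ?p3 ** v" using uv p(1-9) by simp
  thus ?thesis using monicD[OF rep_sub(1)[OF as]] uv(1-5) by (simp only: p(10))
 qed
 have *: ?thesis if w: "ob w" "ob w'" and f: "f : HT x w" "g : HT y w'" "G : HT (pd w w') z"
  and b: "basis a = ct (pd x y) (pd w w') z G (tn x w y w' f g)" and k: "ct x x w f (eps x) = 0 \<or> ct y y w' g (eps y) = 0"
  for w w' f g G
  unfolding b using ct_assoc[OF o' o' _ o(3) T0_TenM_Hom[OF o(1,1,2,2) ex(2) ey(2)] T0_TenM_Hom[OF o(1) w(1) o(2) w(2) f(1,2)] f(3)]
   tn_Cmp[OF o(1,1) w(1) o(2,2) w(2) ex(2) f(1) ey(2) f(2)] k w by auto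
 have "~ (mon (pg ?p2 ?p3) & srj ?p1) \<or> ~ (mon (pg ?p1 ?p3) & srj ?p2)"
  using a(1,2) as p(12,13) by (auto simp: Tset_def psurj_def Let_def)
 thus ?thesis
 proof
  assume n: "~ (mon (pg ?p2 ?p3) & srj ?p1)"
  show ?thesis
  proof (rule small_factor[OF p(1-3) _ _ _ n])
   fix q' q g1 g2 g3 alpha beta assume H: "ar q'" "dom q' = dom q" "cod q' = cod ?p1" and ab: "pbk q g1 alpha beta"
    and g: "ar g2" "ar g3" "dom g2 = dom g1" "dom g3 = dom g1" "cod g2 = cod ?p2" "cod g3 = cod ?p3"
    and sz: "size (cod q) < size (cod ?p1)" and e: "q' ** alpha = ?p1" "g2 ** beta = ?p2" "g3 ** beta = ?p3"
   note F = pbkD[OF ab]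
   have f: "sp q' q : HT x (cod q)" using H p F by auto
   show ?thesis
    by (rule *[of "cod q" y "sp q' q" "idT y" "sp (pg g1 g2) g3"])
     (use tri_cmp(1)[OF ab H(1,2), of x "cod q" g2 g3 y z] eps(3)[OF o(1,1) _ Jid_tgt[OF f _ _ o(1)]] H F g p e f sz o in auto)
  qed (use m p in simp_all)
 next
  assume n: "~ (mon (pg ?p1 ?p3) & srj ?p2)"
  show ?thesis
  proof (rule small_factor[OF p(2,1,3) _ _ _ n])
   fix q' q g1 g2 g3 alpha beta assume H: "ar q'" "dom q' = dom q" "cod q' = cod ?p2" and ab: "pbk q g1 alpha beta"
    and g: "ar g2" "ar g3" "dom g2 = dom g1" "dom g3 = dom g1" "cod g2 = cod ?p1" "cod g3 = cod ?p3"
    and sz: "size (cod q) < size (cod ?p2)" and e: "q' ** alpha = ?p2" "g2 ** beta = ?p1" "g3 ** beta = ?p3"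
   note F = pbkD[OF ab]
   have f: "sp q' q : HT y (cod q)" using H p F by auto
   show ?thesis
    by (rule *[of x "cod q" "idT x" "sp q' q" "sp (pg g2 g1) g3"])
     (use tri_cmp(2)[OF ab H(1,2), of y "cod q" g2 g3 x z] eps(3)[OF o(2,2) _ Jid_tgt[OF f _ _ o(2)]] H F g p e f sz o in auto)
  qed (use m p in simp_all)
 qed
qed

text \<open>The tensor product of the two idempotents is the identity minus terms with
  \<open>ce x\<close> or \<open>ce y\<close> in one factor, and those have zero coefficients on
  \<open>Tset\<close>.\<close>

lemma Tset_eps:
 assumes o: "ob x" "ob y" "ob z" and a: "a : Tset C x y z" and u: "u : HT (pd x y) z"
 shows "ct (pd x y) (pd x y) z u (tn x x y y (eps x) (eps y)) a = u a"
proof -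
 note cx = isC_D(1)[OF cid(1)[OF o(1), of "size x"]] and cy = isC_D(1)[OF cid(1)[OF o(2), of "size y"]]
 have "tn x x y y (eps x) (eps y) = tn x x y y (idT x) (idT y) - tn x x y y (idT x) (ce y) - tn x x y y (ce x) (eps y)"
 proof -
  have "tn x x y y (eps x + ce x) (eps y + ce y) = tn x x y y (idT x) (idT y)" by (simp add: eps_def)
  moreover have "tn x x y y (eps x + ce x) (ce y) = tn x x y y (idT x) (ce y)" by (simp add: eps_def)
  ultimately show ?thesis by (simp only: T0.TenM_add_left T0.TenM_add_right) (simp add: algebra_simps)
 qed
 moreover have "tn x x y y (idT x) (idT y) = idT (pd x y)" using T0.TenM_Idn[of x y] o by simp
 ultimately show ?thesis
  using Tset_Jid(2)[OF o a u _ cy, of "idT x"] Tset_Jid(1)[OF o a u cx, of "eps y"] ce_facts(7)[OF o(2)]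
   T0_Cmp_Idn[of "pd x y" z u] o u by (simp add: T0.Cmp_diff_right fun_simps)
qed

text \<open>The trace runs over partial surjections from the product to \<open>z\<close>. Those
  outside \<open>Tset\<close> contribute 0, the others 1 if they are fixed by the action and 0
  otherwise. The trace is therefore the permutation character, with inverses from
  precomposition.\<close>

lemma cx_geps_product:
 assumes o: "ob x" "ob y" "ob z" and t: "t : Aut x" and u: "u : Aut y" and h: "h : Aut z"
 shows "cx z h (pd x y) (tn x x y y (geps x t) (geps y u)) = of_nat (chi_T C x y z (invA x t) (invA y u) h)"
proof -
 interpret X: finite_group_chars "AG x" "IC x" by (rule aut_chars[OF o(1)])
 interpret Y: finite_group_chars "AG y" "IC y" by (rule aut_chars[OF o(2)])
 let ?v = "pd x y"
 let ?G = "tn x x y y (gr t) (gr u)" and ?E = "tn x x y y (eps x) (eps y)"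
 note ex = ce_facts(7)[OF o(1)] and ey = ce_facts(7)[OF o(2)]
 have v: "?v : obj C" using o by simp
 have gt: "gr t : HT x x" "gr u : HT y y" "gr h : HT z z"
  using Aut_arr(1-3)[OF t] Aut_arr(1-3)[OF u] Aut_arr(1-3)[OF h] by auto
 have GE: "?G : HT ?v ?v" "?E : HT ?v ?v" using T0_TenM_Hom o gt ex ey by blast+
 have g: "tn x x y y (geps x t) (geps y u) = ct ?v ?v ?v ?G ?E"
  using tn_Cmp[OF o(1,1,1) o(2,2,2) ex gt(1) ey gt(2)] by (simp add: geps_def)
 have g': "ct ?v ?v ?v ?G ?E = ct ?v ?v ?v ?E ?G"
  using tn_Cmp[OF o(1,1,1) o(2,2,2) ex gt(1) ey gt(2)] tn_Cmp[OF o(1,1,1) o(2,2,2) gt(1) ex gt(2) ey]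
   eps(8)[OF o(1,1) gt(1)] eps(8)[OF o(2,2) gt(2)] by simp
 have c: "ct ?v z z (gr h) (ct ?v ?v z (basis a) (ct ?v ?v ?v ?G ?E)) a =
   (if a : Tset C x y z then if act3 C x y z (invA x t) (invA y u) h a = a then 1 else 0 else 0)" if a: "a : psurj ?v z" for a
 proof -
  have as: "a : Sub (prd3 C x y z)" using a psurj_sub by (simp add: prd3_def)
  have ba: "basis a : HT ?v z" using basis_Hom psurj_sub a by blast
  show ?thesis
  proof (cases "a : Tset C x y z")
   case True
   have A: "ct ?v z z (gr h) (ct ?v ?v z (basis a) ?G) = basis (act3 C x y z (invA x t) (invA y u) h a)"
    "act3 C x y z (invA x t) (invA y u) h a : Sub (prd3 C x y z)"
    using act3_Cmp[OF o as t X.inv_closed[OF t] _ _ u Y.inv_closed[OF u] _ _ h] X.r_inv[OF t] X.l_inv[OF t] Y.r_inv[OF u] Y.l_inv[OF u] by simp_all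
   have "ct ?v z z (gr h) (ct ?v ?v z (basis a) (ct ?v ?v ?v ?G ?E)) = ct ?v ?v z (basis (act3 C x y z (invA x t) (invA y u) h a)) ?E"
    using ct_assoc[OF v v v o(3) GE(2,1) ba] ct_assoc[OF v v o(3,3) GE(2) T0_Cmp_Hom[OF v v o(3) GE(1) ba] gt(3)] A(1) by simp
   thus ?thesis
    using Tset_eps[OF o True basis_Hom[OF A(2)[unfolded prd3_def]]] True by (simp add: basis_def)
  next
   case False
   have "ct ?v ?v z (basis a) (ct ?v ?v ?v ?G ?E) = 0"
    unfolding g' using ct_assoc[OF v v v o(3) GE ba] non_Tset[OF o a False] by simp
   thus ?thesis using False by (simp add: fun_simps)
  qed
 qed
 have "cx z h ?v (tn x x y y (geps x t) (geps y u)) =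
   (SUM a:psurj ?v z. if a : Tset C x y z then if act3 C x y z (invA x t) (invA y u) h a = a then 1 else 0 else 0)"
  unfolding g cx_def using c by (intro sum.cong) auto
 also have "... = (SUM a:{a : Tset C x y z. act3 C x y z (invA x t) (invA y u) h a = a}. 1)"
  by (rule sum.mono_neutral_cong_right) (use Tset_psurj o v in auto)
 finally show ?thesis by (simp add: chi_T_def)
qed

text \<open>By cyclicity, all pairs of diagonal matrix units have the same trace. Summing them
  replaces the primitive idempotents by the central ones, whose coefficients are character values;
  the dimensions of the two representations cancel, and reindexing by inverses gives the
  formula.\<close>

lemma cx_product:
 assumes o: "ob x" "ob y" "ob z" and h: "h : Aut z" and chi: "chi : IC x" and psi: "psi : IC y"
 shows "cx z h (pd x y) (tn x x y y (mu x chi 0 0) (mu y psi 0 0)) = star C x y z chi psi h"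
proof -
 interpret X: finite_group_chars "AG x" "IC x" by (rule aut_chars[OF o(1)])
 interpret Y: finite_group_chars "AG y" "IC y" by (rule aut_chars[OF o(2)])
 let ?v = "pd x y" and ?n = "cdim x chi" and ?m = "cdim y psi"
 let ?t = "%k l. cx z h ?v (tn x x y y (mu x chi k k) (mu y psi l l))"
 have v: "?v : obj C" using o by simp
 note n0 = cdim_pos[OF chi] cdim_pos[OF psi]
 note M = munit_eps(1)[OF o(1)] munit_eps(1)[OF o(2)]
 have eq: "?t k l = ?t 0 0" if kl: "k < ?n" "l < ?m" for k l
 proof -
  have "?t k l = cx z h ?v (ct ?v ?v ?v (tn x x y y (mu x chi k 0) (mu y psi l 0)) (tn x x y y (mu x chi 0 k) (mu y psi 0 l)))"
   using tn_Cmp[OF o(1,1,1) o(2,2,2) M(1) M(1) M(2) M(2)] mu_mult[OF o(1) chi _ _ chi] mu_mult[OF o(2) psi _ _ psi] kl n0 by simp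
  also have "... = cx z h ?v (ct ?v ?v ?v (tn x x y y (mu x chi 0 k) (mu y psi 0 l)) (tn x x y y (mu x chi k 0) (mu y psi l 0)))"
   using cx_cyclic[OF o(3) h v v T0_TenM_Hom[OF o(1,1,2,2) M] T0_TenM_Hom[OF o(1,1,2,2) M]] .
  also have "... = ?t 0 0"
   using tn_Cmp[OF o(1,1,1) o(2,2,2) M(1) M(1) M(2) M(2)] mu_mult[OF o(1) chi _ _ chi] mu_mult[OF o(2) psi _ _ psi] kl n0 by simp
  finally show ?thesis .
 qed
 have "of_nat ?n * of_nat ?m * ?t 0 0 = (SUM k<?n. SUM l<?m. ?t 0 0)" by (simp only: sum_constant card_lessThan mult.assoc)
 also have "... = (SUM k<?n. SUM l<?m. ?t k l)" by (intro sum.cong refl eq[symmetric]) auto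
 also have "... = cx z h ?v (tn x x y y (SUM k<?n. mu x chi k k) (SUM l<?m. mu y psi l l))"
  by (simp add: T0.TenM_sum_left T0.TenM_sum_right cx_sum) (rule sum.swap)
 also have "... = (SUM t:Aut x. SUM u:Aut y. of_nat ?n / oA x * chi (invA x t) * (of_nat ?m / oA y * psi (invA y u)) *
   of_nat (chi_T C x y z (invA x t) (invA y u) h))"
 proof -
  have A: "(SUM k<?n. mu x chi k k) = (SUM t:Aut x. scl (of_nat ?n / oA x * chi (invA x t)) (geps x t))"
   and B: "(SUM k<?m. mu y psi k k) = (SUM t:Aut y. scl (of_nat ?m / oA y * psi (invA y t)) (geps y t))"
   using sum_munit[of x ?n "crep x chi"] sum_munit[of y ?m "crep y psi"] crep[OF chi] crep[OF psi] o by (simp_all add: is_irr_rep_def)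
  show ?thesis
   unfolding A B by (subst sum.swap)
    (auto simp: T0.TenM_sum_left T0.TenM_sum_right TenM_T0_bilinear cx_sum cx_Scl cx_geps_product[OF o _ _ h] sum_distrib_left sum_divide_distrib mult_ac intro!: sum.cong)
 qed
 also have "... = (SUM t:Aut x. SUM u:Aut y. of_nat ?n / oA x * chi t * (of_nat ?m / oA y * psi u) * of_nat (chi_T C x y z t u h))"
  by (subst X.sum_inv, rule sum.cong[OF refl], rule Y.sum_inv)
 also have "... = of_nat ?n * of_nat ?m * star C x y z chi psi h"
  using h by (simp add: star_def sum_distrib_left mult_ac)
 finally show ?thesis using n0 by simp
qed

end

section \<open>The Grothendieck ring of the tensor envelope\<close>

context envelope
begin

definition chf :: "'o => ('o list \<times> (nat => nat => 'm set => 'k) \<Rightarrow>\<^sub>0 int) => 'm => 'k" where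
 "chf z a h = (SUM P:Poly_Mapping.keys a. of_int (poly_mapping.lookup a P) * ch z h P)"

lemma chf_superset:
 "finite A ==> Poly_Mapping.keys a \<subseteq> A ==> chf z a h = (SUM P:A. of_int (poly_mapping.lookup a P) * ch z h P)"
 unfolding chf_def by (rule sum.mono_neutral_left) (auto simp: in_keys_iff)

lemma chf_add: "chf z (a + b) h = chf z a h + chf z b h"
 and chf_diff: "chf z (a - b) h = chf z a h - chf z b h"
 using keys_add[of a b] keys_diff[of a b]
 by (auto simp: chf_superset[of "Poly_Mapping.keys a \<union> Poly_Mapping.keys b"] lookup_add
   lookup_minus distrib_right left_diff_distrib sum.distrib sum_subtractf)

lemma chf_cmul: "chf z (frag_cmul n a) h = of_int n * chf z a h"
 using chf_superset[OF _ keys_cmul[of n a]] by (simp add: chf_def sum_distrib_left mult.assoc)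

lemma chf_0 [simp]: "chf z 0 h = 0"
 and chf_of [simp]: "chf z (frag_of P) h = ch z h P"
 by (simp_all add: chf_def)

lemma chf_sum: "chf z (SUM i:I. f i) h = (SUM i:I. chf z (f i) h)"
 by (induction I rule: infinite_finite_induct) (simp_all add: chf_add)

lemma chf_GR: "ob z ==> r : TE.GR ==> chf z r h = 0"
 by (rotate_tac, induction rule: TE.GR_induct) (simp_all add: chf_diff chf_add ch_complement chf_diff[of z 0, simplified])

lemma chf_omult: "chf z (TE.omult a b) h = (SUM P:Poly_Mapping.keys a. SUM Q:Poly_Mapping.keys b.
  of_int (poly_mapping.lookup a P) * of_int (poly_mapping.lookup b Q) * ch z h (TenO TE P Q))"
 by (simp add: TE.omult_def frag_extend_def chf_sum chf_cmul sum_distrib_left mult.assoc)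

lemma ch_Sobj:
 assumes "x : X" "z : X" "psi : IC x"
 shows "ch z h (Sobj x psi) = (if z = x then psi h else 0)"
 using ch_top0_chi[OF assms(1,2) top0_chi_Sobj] assms by simp

lemma Sobj_inj:
 assumes "z : X" "w : X" "psi : IC z" "phi : IC w" "Sobj z psi = Sobj w phi"
 shows "z = w & psi = phi"
proof -
 have z: "ob z" using assms by simp
 interpret G: finite_group_chars "AG z" "IC z" by (rule aut_chars[OF z])
 have e: "psi h = (if z = w then phi h else 0)" for h
  using ch_Sobj[OF assms(1,1,3), of h] ch_Sobj[OF assms(2,1,4), of h] assms(5) by simp
 have "psi (idt C z) ~= 0" using G.irr_charsE[OF assms(3)] by (metis aut_group_simps(2) of_nat_eq_0_iff less_irrefl)
 hence "z = w" using e by metis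
 thus ?thesis using e by auto
qed

lemma simple_normal_form: "a : carrier TE.FG ==> EX b. Poly_Mapping.keys b \<subseteq> Simp & a - b : TE.GR"
proof (induction a rule: TE.FG_induct)
 case (diff a b)
 then obtain a' b' where *: "Poly_Mapping.keys a' \<subseteq> Simp" "a - a' : TE.GR" "Poly_Mapping.keys b' \<subseteq> Simp" "b - b' : TE.GR" by blast
 thus ?case
  using TE.GR_diff[OF *(2,4)] keys_diff[of a' b'] by (intro exI[of _ "a' - b'"]) (auto simp: algebra_simps)
qed (use simple_class TE.GR_cl(1) in \<open>auto intro: exI[of _ 0]\<close>)

lemma Simp_FG: "Poly_Mapping.keys b \<subseteq> Simp ==> b : carrier TE.FG"
 using Simp_Obj by (auto simp: TE.FG_simps)

text \<open>The simple objects over other elements of \<open>X\<close> have zero character at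
  \<open>z\<close>, so the multiplicities of those over \<open>z\<close> are the coordinates with
  respect to the irreducible characters.\<close>

lemma chf_comb:
 assumes z: "z : X" and b: "Poly_Mapping.keys b \<subseteq> Simp"
 shows "chf z b = finite_group_chars.comb (AG z) (%psi. poly_mapping.lookup b (Sobj z psi))"
proof
 fix h
 have zo: "ob z" using z by simp
 interpret G: finite_group_chars "AG z" "IC z" by (rule aut_chars[OF zo])
 have fin: "finite (IC z)" by (rule G.irr_chars_regular(1))
 have "chf z b h = (SUM P:Sobj z ` IC z \<union> Poly_Mapping.keys b. of_int (poly_mapping.lookup b P) * ch z h P)"
  using fin by (intro chf_superset) auto
 also have "... = (SUM P:Sobj z ` IC z. of_int (poly_mapping.lookup b P) * ch z h P)"
 proof (rule sum.mono_neutral_right)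
  show "ALL P:Sobj z ` IC z \<union> Poly_Mapping.keys b - Sobj z ` IC z. of_int (poly_mapping.lookup b P) * ch z h P = 0"
  proof
   fix P assume P: "P : Sobj z ` IC z \<union> Poly_Mapping.keys b - Sobj z ` IC z"
   then obtain w psi where "w : X" "psi : IC w" "P = Sobj w psi" using b by (auto simp: Simp_def)
   thus "of_int (poly_mapping.lookup b P) * ch z h P = 0" using ch_Sobj[of w z psi h] z P by auto
  qed
 qed (use fin in auto)
 also have "... = (SUM psi:IC z. of_int (poly_mapping.lookup b (Sobj z psi)) * psi h)"
  using Sobj_inj[OF z z] by (subst sum.reindex) (auto simp: inj_on_def ch_Sobj[OF z z])
 finally show "chf z b h = G.comb (%psi. poly_mapping.lookup b (Sobj z psi)) h" by (simp add: G.comb_def)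
qed

lemma Simp_eq:
 assumes b: "Poly_Mapping.keys b \<subseteq> Simp" "Poly_Mapping.keys b' \<subseteq> Simp" and eq: "!!z. z : X ==> chf z b = chf z b'"
 shows "b = b'"
proof (rule poly_mapping_eqI)
 fix P
 show "poly_mapping.lookup b P = poly_mapping.lookup b' P"
 proof (cases "P : Simp")
  case True
  then obtain z psi where z: "z : X" "psi : IC z" "P = Sobj z psi" by (auto simp: Simp_def)
  have zo: "ob z" using z by simp
  interpret G: finite_group_chars "AG z" "IC z" by (rule aut_chars[OF zo])
  show ?thesis using eq[OF z(1)] G.comb_inject[OF _ z(2)] chf_comb[OF z(1)] b unfolding z(3) by metis
 next
  case False
  thus ?thesis using b by (metis in_keys_iff subsetD)
 qed
qed

text \<open>The family of characters of a class, inverse to the isomorphism sought. The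
  representative does not matter, because characters vanish on the relations.\<close>

definition Psi :: "('o list \<times> (nat => nat => 'm set => 'k) \<Rightarrow>\<^sub>0 int) set => 'o => 'm => 'k" where
 "Psi K = (\<lambda>z\<in>X. chf z (SOME a. a : K))"

lemma Psi_gcls: "Psi (TE.gcls a) = (\<lambda>z\<in>X. chf z a)"
proof -
 have "(SOME b. b : TE.gcls a) : TE.gcls a" by (rule someI[of _ a]) (simp add: TE.mem_gcls TE.GR_cl)
 hence "chf z (SOME b. b : TE.gcls a) h = chf z a h" if "z : X" for z h
  using chf_GR[of z "(SOME b. b : TE.gcls a) - a" h] that by (simp add: TE.mem_gcls chf_diff)
 thus ?thesis by (auto simp: Psi_def restrict_def fun_eq_iff)
qed

lemma group_rep: "z : X ==> comm_group (add_monoid (rep_ring (AG z) :: ('m => 'k) ring))"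
 by (rule finite_group_chars.group_rep_ring[OF aut_chars]) simp

lemma carrier_rep_sum: "carrier (rep_sum C X) = {F \<in> \<Pi>\<^sub>E z\<in>X. carrier (rep_ring (AG z)). finite {z \<in> X. F z ~= (%g. 0 :: 'k)}}"
 unfolding rep_sum_def using group_rep comm_group_def
 by (subst carrier_sum_group) (auto simp: rep_ring_def[of "AG _"] comm_group_def)

lemma comb_carrier: "z : X ==> finite_group_chars.comb (AG z) c : carrier (rep_ring (AG z))"
 by (subst finite_group_chars.carrier_rep_ring[OF aut_chars]) auto

lemma chf_carrier:
 assumes "a : carrier TE.FG"
 shows "(\<lambda>z\<in>X. chf z a) : carrier (rep_sum C X)"
proof -
 obtain b where b: "Poly_Mapping.keys b \<subseteq> Simp" "a - b : TE.GR" using simple_normal_form assms by blast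
 have ab: "chf z a = chf z b" if "z : X" for z
  using chf_GR[OF X_obj[OF that] b(2)] by (simp add: chf_diff fun_eq_iff)
 \<comment> \<open>A nonzero character at \<open>z\<close> requires a simple object over
   \<open>z\<close> among the keys, and \<open>z\<close> is recovered from that object; finitely
   many keys leave finitely many \<open>z\<close>.\<close>
 have "{z : X. chf z b ~= (%g. 0)} \<subseteq> (%P. SOME z. z : X & (EX psi:IC z. P = Sobj z psi)) ` Poly_Mapping.keys b"
 proof
  fix z assume "z : {z : X. chf z b ~= (%g. 0)}"
  hence z: "z : X" "chf z b ~= (%g. 0)" by auto
  then obtain h P where P: "P : Poly_Mapping.keys b" "ch z h P ~= 0" by (auto simp: chf_def fun_eq_iff elim!: sum.not_neutral_contains_not_neutral)
  then obtain w psi where w: "w : X" "psi : IC w" "P = Sobj w psi" using b(1) by (auto simp: Simp_def)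
  hence "z = w" using P(2) ch_Sobj z(1) by metis
  hence "(SOME z. z : X & (EX psi:IC z. P = Sobj z psi)) = z"
   using w Sobj_inj by (intro some_equality) blast+
  thus "z : (%P. SOME z. z : X & (EX psi:IC z. P = Sobj z psi)) ` Poly_Mapping.keys b" using P(1) by (intro image_eqI[of _ _ P]) simp_all
 qed
 hence "finite {z : X. chf z b ~= (%g. 0)}" by (rule finite_subset) simp
 moreover have "{z : X. (\<lambda>z\<in>X. chf z a) z ~= (%g. 0)} = {z : X. chf z b ~= (%g. 0)}" using ab by auto
 ultimately show ?thesis
  unfolding carrier_rep_sum using ab comb_carrier chf_comb[OF _ b(1)] by (auto simp: PiE_iff)
qed

text \<open>Each class has a representative supported on simple objects, and linear independence of
  irreducible characters recovers its multiplicities; surjectivity holds because each representation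
  ring is spanned by irreducible characters.\<close>

lemma Psi_iso: "Psi : iso (add_monoid (groth_ring TE)) (rep_sum C X)"
proof (rule isoI)
 show "Psi : hom (add_monoid (groth_ring TE)) (rep_sum C X)"
 proof (rule homI)
  fix K assume "K : carrier (add_monoid (groth_ring TE))"
  then obtain a where a: "a : carrier TE.FG" "K = TE.gcls a" using TE.groth_carrier by auto
  show "Psi K : carrier (rep_sum C X)" using a chf_carrier Psi_gcls by simp
  fix K' assume "K' : carrier (add_monoid (groth_ring TE))"
  then obtain a' where a': "K' = TE.gcls a'" using TE.groth_carrier by auto
  show "Psi (K \<otimes>\<^bsub>add_monoid (groth_ring TE)\<^esub> K') = Psi K \<otimes>\<^bsub>rep_sum C X\<^esub> Psi K'"
   using TE.groth_add[of a a'] by (auto simp: a a' Psi_gcls rep_sum_def rep_ring_def chf_add fun_eq_iff restrict_def)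
 qed
 have "inj_on Psi (carrier (groth_ring TE))"
 proof (rule inj_onI)
  fix K K' assume "K : carrier (groth_ring TE)" "K' : carrier (groth_ring TE)" and eq: "Psi K = Psi K'"
  then obtain a a' where a: "a : carrier TE.FG" "K = TE.gcls a" "a' : carrier TE.FG" "K' = TE.gcls a'" using TE.groth_carrier by auto
  obtain b where b: "Poly_Mapping.keys b \<subseteq> Simp" "(a - a') - b : TE.GR" using simple_normal_form TE.FG_cl(4)[OF a(1,3)] by blast
  have "chf z b = chf z 0" if z: "z : X" for z
  proof
   fix h
   have "chf z a h = chf z a' h" using eq z unfolding a Psi_gcls by (metis restrict_apply')
   thus "chf z b h = chf z 0 h" using chf_GR[OF X_obj[OF z] b(2), of h] by (simp add: chf_diff)
  qed
  hence "b = 0" using Simp_eq[OF b(1)] by simp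
  thus "K = K'" using b(2) by (simp add: a TE.gcls_eq)
 qed
 moreover have "carrier (rep_sum C X) \<subseteq> Psi ` carrier (groth_ring TE)"
 proof
  fix F :: "'o => 'm => 'k" assume F: "F : carrier (rep_sum C X)"
  define Z where "Z = {z : X. F z ~= (%g. 0)}"
  have fin: "finite Z" using F by (simp add: carrier_rep_sum Z_def)
  have "EX c. z : X --> F z = finite_group_chars.comb (AG z) c" for z
  proof (cases "z : X")
   case True
   hence "F z : carrier (rep_ring (AG z))" using F by (auto simp: carrier_rep_sum PiE_iff)
   thus ?thesis unfolding finite_group_chars.carrier_rep_ring[OF aut_chars[OF X_obj[OF True]]] by blast
  qed simp
  then obtain c where c: "!!z. z : X ==> F z = finite_group_chars.comb (AG z) (c z)" by metis
  define a where "a = (SUM z:Z. SUM psi:IC z. frag_cmul (c z psi) (frag_of (Sobj z psi)))"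
  have a: "a : carrier TE.FG"
   unfolding a_def by (intro TE.FG_sum TE.FG_cl(5)) (auto simp: TE.frag_of_FG Z_def intro: Sobj_Obj)
  have "chf w a h = F w h" if w: "w : X" for w h
  proof -
   have "chf w a h = (SUM z:Z. SUM psi:IC z. of_int (c z psi) * ch w h (Sobj z psi))" by (simp add: a_def chf_sum chf_cmul)
   also have "... = (SUM z:Z. if z = w then F w h else 0)"
   proof (intro sum.cong refl)
    fix z assume "z : Z"
    hence z: "z : X" "ob z" by (auto simp: Z_def)
    interpret G: finite_group_chars "AG z" "IC z" by (rule aut_chars[OF z(2)])
    show "(SUM psi:IC z. of_int (c z psi) * ch w h (Sobj z psi)) = (if z = w then F w h else 0)"
     using c[OF z(1)] by (auto simp: ch_Sobj[OF z(1) w] G.comb_def sum.neutral)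
   qed
   also have "... = F w h" using fin w by (auto simp: Z_def)
   finally show ?thesis .
  qed
  hence "Psi (TE.gcls a) = F"
   using F by (auto simp: Psi_gcls carrier_rep_sum PiE_iff extensional_def restrict_def fun_eq_iff)
  thus "F : Psi ` carrier (groth_ring TE)" using a TE.groth_carrier by blast
 qed
 ultimately show "bij_betw Psi (carrier (add_monoid (groth_ring TE))) (carrier (rep_sum C X))"
  using chf_carrier by (auto simp: bij_betw_def TE.groth_carrier Psi_gcls)
qed

section \<open>The product formula\<close>

lemma ch_product:
 assumes "x : X" "y : X" "z : X" "chi : IC x" "psi : IC y"
 shows "ch z h (TenO TE (Sobj x chi) (Sobj y psi)) = star C x y z chi psi h"
proof (cases "h : Aut z")
 case True
 thus ?thesis
  using cx_product[of x y z h chi psi] assms by (simp add: Sobj_def TenO_idem ch_def T0.mtr_def) (simp add: idem_def emb_def T0.mtr_def)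
qed (simp add: ch_def star_def)

lemma chf_product:
 assumes x: "x : X" "y : X" "z : X" and a: "Poly_Mapping.keys a \<subseteq> Simp" "!!w. w : X ==> chf w a = (if w = x then f else (%g. 0))"
  and b: "Poly_Mapping.keys b \<subseteq> Simp" "!!w. w : X ==> chf w b = (if w = y then g else (%g. 0))"
 shows "chf z (TE.omult a b) = star C x y z f g"
proof
 fix h
 \<comment> \<open>A character family concentrated at \<open>x\<close> comes from simple objects
   over \<open>x\<close> only: any other key would give a nonzero coordinate at another element of
   \<open>X\<close>.\<close>
 have K: "Poly_Mapping.keys a \<subseteq> Sobj x ` IC x" if x: "x : X" and a: "Poly_Mapping.keys a \<subseteq> Simp" "!!w. w : X ==> chf w a = (if w = x then f else (%g. 0))" for a x f
 proof
  fix P assume P: "P : Poly_Mapping.keys a"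
  then obtain w psi where w: "w : X" "psi : IC w" "P = Sobj w psi" using a by (auto simp: Simp_def)
  have wo: "ob w" using w by simp
  interpret G: finite_group_chars "AG w" "IC w" by (rule aut_chars[OF wo])
  have "w = x"
  proof (rule ccontr)
   assume "w ~= x"
   hence "G.comb (%psi. poly_mapping.lookup a (Sobj w psi)) = G.comb (%psi. 0)"
    using a(2)[OF w(1)] chf_comb[OF w(1) a(1)] G.comb_zero by simp
   thus False using G.comb_inject[OF _ w(2)] P by (metis in_keys_iff w(3))
  qed
  thus "P : Sobj x ` IC x" using w by blast
 qed
 have xo: "ob x" "ob y" using x by auto
 interpret G: finite_group_chars "AG x" "IC x" by (rule aut_chars[OF xo(1)])
 interpret H: finite_group_chars "AG y" "IC y" by (rule aut_chars[OF xo(2)])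
 note fin = G.irr_chars_regular(1) H.irr_chars_regular(1)
 let ?c = "%chi. of_int (poly_mapping.lookup a (Sobj x chi)) :: 'k" and ?d = "%psi. of_int (poly_mapping.lookup b (Sobj y psi)) :: 'k"
 have fg: "f = (%t. SUM chi:IC x. ?c chi * chi t)" "g = (%u. SUM psi:IC y. ?d psi * psi u)"
  using a(2)[OF x(1)] chf_comb[OF x(1) a(1)] b(2)[OF x(2)] chf_comb[OF x(2) b(1)] by (auto simp: G.comb_def H.comb_def)
 have "chf z (TE.omult a b) h = (SUM P:Sobj x ` IC x. SUM Q:Sobj y ` IC y.
   of_int (poly_mapping.lookup a P) * of_int (poly_mapping.lookup b Q) * ch z h (TenO TE P Q))"
  unfolding chf_omult using fin K[OF x(1) a] K[OF x(2) b]
  by (intro sum.mono_neutral_cong_left) (auto simp: in_keys_iff intro!: sum.mono_neutral_left)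
 also have "... = (SUM chi:IC x. SUM psi:IC y. ?c chi * ?d psi * star C x y z chi psi h)"
  using Sobj_inj[OF x(1,1)] Sobj_inj[OF x(2,2)] by (simp add: sum.reindex inj_on_def ch_product[OF x])
 also have "... = star C x y z f g h"
 proof (cases "h : Aut z")
  case True
  let ?n = "1 / (oA x * oA y)" and ?T = "%t u. of_nat (chi_T C x y z t u h)"
  let ?F = "%chi psi t u. ?n * (?T t u * (?c chi * chi t) * (?d psi * psi u))"
  have "(SUM chi:IC x. SUM psi:IC y. ?c chi * ?d psi * star C x y z chi psi h) = (SUM chi:IC x. SUM psi:IC y. SUM t:Aut x. SUM u:Aut y. ?F chi psi t u)"
   using True by (simp add: star_def sum_distrib_left mult_ac)
  also have "... = (SUM chi:IC x. SUM t:Aut x. SUM psi:IC y. SUM u:Aut y. ?F chi psi t u)" by (rule sum.cong[OF refl], rule sum.swap)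
  also have "... = (SUM t:Aut x. SUM chi:IC x. SUM psi:IC y. SUM u:Aut y. ?F chi psi t u)" by (rule sum.swap)
  also have "... = (SUM t:Aut x. SUM chi:IC x. SUM u:Aut y. SUM psi:IC y. ?F chi psi t u)" by (rule sum.cong[OF refl], rule sum.cong[OF refl], rule sum.swap)
  also have "... = (SUM t:Aut x. SUM u:Aut y. SUM chi:IC x. SUM psi:IC y. ?F chi psi t u)" by (rule sum.cong[OF refl], rule sum.swap)
  also have "... = star C x y z f g h"
   using True by (simp add: star_def fg sum_distrib_left sum_distrib_right mult_ac)
  finally show ?thesis .
 qed (simp add: star_def)
 finally show "chf z (TE.omult a b) h = star C x y z f g h" .
qed

text \<open>Elements of \<open>Tset\<close> are partial surjections from the product onto
  \<open>z\<close>, so the set is empty unless \<open>z\<close> is a subquotient. The finite sum in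
  the product formula therefore loses nothing.\<close>

lemma star_not_subquotient:
 assumes "ob x" "ob y" "ob z" "~ subquotient C z (pd x y)"
 shows "star C x y z f g = (%h. 0)"
proof -
 have "Tset C x y z = {}" using Tset_psurj[OF _ assms(1-3)] psurj_subquotient[of _ "pd x y" z] assms by auto
 thus ?thesis by (simp add: star_def chi_T_def fun_eq_iff)
qed

lemma rep_incl_carrier:
 fixes f :: "'m => 'k"
 assumes "x : X" "f : carrier (rep_ring (AG x))"
 shows "rep_incl X x f : carrier (rep_sum C X)"
proof -
 have "(%g. 0 :: 'k) : carrier (rep_ring (AG z))" if "z : X" for z
  using comb_carrier[OF that, of "%_. 0"] by (simp add: finite_group_chars.comb_def[OF aut_chars[OF X_obj[OF that]]])
 moreover have "finite {z : X. rep_incl X x f z ~= (%g. 0)}"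
  by (rule finite_subset[of _ "{x}"]) (auto simp: rep_incl_def)
 ultimately show ?thesis using assms by (auto simp: carrier_rep_sum rep_incl_def PiE_iff)
qed

theorem groth_tensor_envelope:
 "EX \<Phi>:iso (rep_sum C X) (add_monoid (groth_ring TE)).
  (ALL x:X. ALL chi:irr_chars (AG x).
   (EX S. is_top0_chi C \<delta> x chi S) &
   (ALL S. is_top0_chi C \<delta> x chi S --> simple_object TE S & \<Phi> (rep_incl X x chi) = groth_class TE S)) &
  (ALL x1:X. ALL x2:X. finite {x : X. subquotient C x (pd x1 x2)} &
   (ALL f1:carrier (rep_ring (AG x1)). ALL f2:carrier (rep_ring (AG x2)).
     (ALL x:X. subquotient C x (pd x1 x2) --> star C x1 x2 x f1 f2 : carrier (rep_ring (AG x))) &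
     \<Phi> (rep_incl X x1 f1) \<otimes>\<^bsub>groth_ring TE\<^esub> \<Phi> (rep_incl X x2 f2) =
     (\<Oplus>\<^bsub>groth_ring TE\<^esub> x \<in> {x \<in> X. subquotient C x (pd x1 x2)}. \<Phi> (rep_incl X x (star C x1 x2 x f1 f2)))))"
proof -
 interpret K: comm_group "add_monoid (groth_ring TE)" by (rule TE.comm_group_groth)
 interpret K': abelian_monoid "groth_ring TE" by (rule abelian_monoid.intro) (rule K.comm_monoid_axioms)
 define \<Phi> where "\<Phi> = inv_into (carrier (add_monoid (groth_ring TE))) Psi"
 have iso: "\<Phi> : iso (rep_sum C X) (add_monoid (groth_ring TE))"
  unfolding \<Phi>_def by (rule K.iso_set_sym[OF Psi_iso])
 have \<Phi>: "\<Phi> F = TE.gcls a" if "a : carrier TE.FG" "F = (\<lambda>z\<in>X. chf z a)" for F a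
  unfolding \<Phi>_def that(2) Psi_gcls[symmetric]
  by (rule inv_into_f_f) (use Psi_iso that TE.groth_carrier in \<open>auto simp: iso_def bij_betw_def\<close>)
 have nf: "EX a. Poly_Mapping.keys a \<subseteq> Simp & F = (\<lambda>z\<in>X. chf z a) & \<Phi> F = TE.gcls a" if F: "F : carrier (rep_sum C X)" for F
 proof -
  have "F : Psi ` TE.gcls ` carrier TE.FG"
   using F Psi_iso by (simp add: iso_def bij_betw_def TE.groth_carrier)
  then obtain a where a: "a : carrier TE.FG" "F = Psi (TE.gcls a)" by blast
  obtain b where b: "Poly_Mapping.keys b \<subseteq> Simp" "a - b : TE.GR" using simple_normal_form a by blast
  hence "TE.gcls a = TE.gcls b" using TE.gcls_eq by blast
  thus ?thesis using \<Phi>[OF Simp_FG[OF b(1)] refl] b a by (auto simp: Psi_gcls)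
 qed
 show ?thesis
 proof (intro bexI[OF _ iso] conjI ballI allI impI)
  fix x chi assume x: "x : X" and chi: "chi : IC x"
  show "EX S. is_top0_chi C \<delta> x chi S" using top0_chi_Sobj[OF X_obj[OF x] chi] by blast
  fix S assume S: "is_top0_chi C \<delta> x chi S"
  show "simple_object TE S" using simple_top0_chi x S .
  show "\<Phi> (rep_incl X x chi) = groth_class TE S"
   unfolding TE.groth_class_eq
   by (rule \<Phi>) (use top0_chi_Obj(1)[OF x S] ch_top0_chi[OF x _ S] in \<open>auto simp: rep_incl_def TE.frag_of_FG restrict_def fun_eq_iff\<close>)
 next
  fix x y assume x: "x : X" "y : X"
  let ?J = "{z : X. subquotient C z (pd x y)}"
  show fin: "finite ?J" using finite_subquotients[OF reps, of "pd x y"] x by simp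
  fix f g :: "'m => 'k" assume f: "f : carrier (rep_ring (AG x))" and g: "g : carrier (rep_ring (AG y))"
  obtain a where a: "Poly_Mapping.keys a \<subseteq> Simp" "rep_incl X x f = (\<lambda>z\<in>X. chf z a)" "\<Phi> (rep_incl X x f) = TE.gcls a"
   using nf[OF rep_incl_carrier[OF x(1) f]] by blast
  obtain b where b: "Poly_Mapping.keys b \<subseteq> Simp" "rep_incl X y g = (\<lambda>z\<in>X. chf z b)" "\<Phi> (rep_incl X y g) = TE.gcls b"
   using nf[OF rep_incl_carrier[OF x(2) g]] by blast
  have ch: "chf w a = (if w = x then f else (%g. 0))" "chf w b = (if w = y then g else (%g. 0))" if "w : X" for w
   using fun_cong[OF a(2), of w] fun_cong[OF b(2), of w] that by (auto simp: rep_incl_def)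
  let ?c = "TE.omult a b"
  have c: "?c : carrier TE.FG" using TE.omult_FG Simp_FG a b by blast
  have st: "chf z ?c = star C x y z f g" if "z : X" for z
   using chf_product[OF x that a(1) ch(1) b(1) ch(2)] by simp
  have sc: "star C x y z f g : carrier (rep_ring (AG z))" if "z : X" for z
   using chf_carrier[OF c] st[OF that] that by (auto simp: carrier_rep_sum PiE_iff)
  thus "!!z. z : X ==> subquotient C z (pd x y) ==> star C x y z f g : carrier (rep_ring (AG z))" .
  \<comment> \<open>The finite sum in the Grothendieck ring is followed by a formal combination
    \<open>d\<close> representing it, so that in the end it can be compared with the product through
    characters alone.\<close>
  have "EX d. d : carrier TE.FG & (\<lambda>z\<in>X. chf z d) = (\<lambda>z\<in>X. if z : J then star C x y z f g else (%g. 0)) &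
    (\<Oplus>\<^bsub>groth_ring TE\<^esub> z \<in> J. \<Phi> (rep_incl X z (star C x y z f g))) = TE.gcls d" if "finite J" "J \<subseteq> ?J" for J
   using that
  proof (induction J rule: finite_induct)
   case empty
   have e: "(\<lambda>z\<in>X. chf z 0) = (\<lambda>z\<in>X. if z : {} then star C x y z f g else (%g. 0))" by (auto simp: fun_eq_iff)
   show ?case
    by (rule exI[of _ 0], intro conjI e) (simp_all only: TE.FG_cl(1) TE.groth_zero K'.finsum_empty)
  next
   case (insert w J)
   then obtain d where d: "d : carrier TE.FG" "(\<lambda>z\<in>X. chf z d) = (\<lambda>z\<in>X. if z : J then star C x y z f g else (%g. 0))"
    "(\<Oplus>\<^bsub>groth_ring TE\<^esub> z \<in> J. \<Phi> (rep_incl X z (star C x y z f g))) = TE.gcls d" by blast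
   have w: "w : X" "J \<subseteq> X" using insert by auto
   obtain e where e: "Poly_Mapping.keys e \<subseteq> Simp" "rep_incl X w (star C x y w f g) = (\<lambda>z\<in>X. chf z e)" "\<Phi> (rep_incl X w (star C x y w f g)) = TE.gcls e"
    using nf[OF rep_incl_carrier[OF w(1) sc[OF w(1)]]] by blast
   have ec: "e : carrier TE.FG" using Simp_FG e by blast
   have cl: "\<Phi> (rep_incl X z (star C x y z f g)) : carrier (groth_ring TE)" if "z : X" for z
    using iso rep_incl_carrier[OF that sc[OF that]] by (auto simp: iso_def hom_def)
   have "(\<Oplus>\<^bsub>groth_ring TE\<^esub> z \<in> insert w J. \<Phi> (rep_incl X z (star C x y z f g))) = TE.gcls (e + d)"
    using cl[OF w(1)] cl w by (subst K'.finsum_insert[OF insert(1,2)]) (auto simp only: d(3) e(3) TE.groth_add Pi_iff)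
   moreover have "chf z (e + d) = (if z : insert w J then star C x y z f g else (%g. 0))" if z: "z : X" for z
   proof
    fix h
    have "chf z e = (if z = w then star C x y w f g else (%g. 0))" "chf z d = (if z : J then star C x y z f g else (%g. 0))"
     using fun_cong[OF e(2), of z] fun_cong[OF d(2), of z] z by (auto simp: rep_incl_def)
    thus "chf z (e + d) h = (if z : insert w J then star C x y z f g else (%g. 0)) h"
     using insert(2) by (auto simp: chf_add)
   qed
   ultimately show ?case
    using TE.FG_cl(2)[OF ec d(1)] by (intro exI[of _ "e + d"]) (auto simp: restrict_def fun_eq_iff)
  qed
  then obtain d where d: "d : carrier TE.FG" "(\<lambda>z\<in>X. chf z d) = (\<lambda>z\<in>X. if z : ?J then star C x y z f g else (%g. 0))"
    "(\<Oplus>\<^bsub>groth_ring TE\<^esub> z \<in> ?J. \<Phi> (rep_incl X z (star C x y z f g))) = TE.gcls d" using fin by blast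
  have "chf z d = chf z ?c" if "z : X" for z
   using fun_cong[OF d(2), of z] st[OF that] star_not_subquotient[of x y z f g] that x by auto
  hence "\<Phi> (\<lambda>z\<in>X. chf z ?c) = TE.gcls d" by (intro \<Phi> d(1)) (auto simp: restrict_def fun_eq_iff)
  hence "TE.gcls ?c = TE.gcls d" using \<Phi>[OF c refl] by simp
  thus "\<Phi> (rep_incl X x f) \<otimes>\<^bsub>groth_ring TE\<^esub> \<Phi> (rep_incl X y g) =
    (\<Oplus>\<^bsub>groth_ring TE\<^esub> z \<in> ?J. \<Phi> (rep_incl X z (star C x y z f g)))"
   using TE.groth_mult[OF Simp_FG[OF a(1)] Simp_FG[OF b(1)]] a(3) b(3) d(3) by simp
 qed
qed

end

theorem corollary5p8:
  fixes C :: "('o, 'm) cat"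
    and \<delta> :: "'m \<Rightarrow> 'k::{alg_closed_field, field_char_0}"
    and Ahat :: "'o set"
  assumes "nondegenerate_degree_function C \<delta>"
    and "iso_representatives C Ahat"
  shows "\<exists>\<Phi> \<in> iso (rep_sum C Ahat) (add_monoid (groth_ring (tensor_envelope C \<delta>))).
    (\<forall>x \<in> Ahat. \<forall>\<chi> \<in> irr_chars (aut_group C x).
       (\<exists>S. is_top0_chi C \<delta> x \<chi> S) \<and>
       (\<forall>S. is_top0_chi C \<delta> x \<chi> S \<longrightarrow>
          simple_object (tensor_envelope C \<delta>) S \<and>
          \<Phi> (rep_incl Ahat x \<chi>) = groth_class (tensor_envelope C \<delta>) S)) \<and>
    (\<forall>x1 \<in> Ahat. \<forall>x2 \<in> Ahat.
       finite {x \<in> Ahat. subquotient C x (prd C x1 x2)} \<and>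
       (\<forall>f1 \<in> carrier (rep_ring (aut_group C x1)). \<forall>f2 \<in> carrier (rep_ring (aut_group C x2)).
          (\<forall>x \<in> Ahat. subquotient C x (prd C x1 x2) \<longrightarrow>
             star C x1 x2 x f1 f2 \<in> carrier (rep_ring (aut_group C x))) \<and>
          \<Phi> (rep_incl Ahat x1 f1) \<otimes>\<^bsub>groth_ring (tensor_envelope C \<delta>)\<^esub> \<Phi> (rep_incl Ahat x2 f2) =
          (\<Oplus>\<^bsub>groth_ring (tensor_envelope C \<delta>)\<^esub> x \<in> {x \<in> Ahat. subquotient C x (prd C x1 x2)}.
             \<Phi> (rep_incl Ahat x (star C x1 x2 x f1 f2)))))"
proof -
  interpret nondegenerate_degree_function C \<delta> by fact
  interpret envelope C \<delta> Ahat
    by unfold_locales fact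
  show ?thesis by (rule groth_tensor_envelope)
qed

end
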